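(* Let $(Z_n)_{n\ge 0}$ be the $d$-type branching process with immigration in the stationary ergodic random environment $\omega$ described in the context. Assume: (A1) $E_P(\log^+\|I_0\|_1)<\infty$; (A2) $E_P(\log^+\|M_0\|_1)<\infty$; (A3) $\lim_{n\to\infty} n^{-1}E_P(\log\|M_{n-1}\cdots M_1M_0\|_1)<0$; (B1) $\limsup_{n\to\infty}n^{-1}\log E_P\big(\|M_{n-1,\kappa}\cdots M_{0,\kappa}I_{0,\kappa}\|_\kappa^\kappa\big)<0$ for some $\kappa>2$; (B2) $\limsup_{n\to\infty}n^{-1}\log\alpha(n)<0$. Let $S_n=\sum_{i=0}^{n-1}Z_i$ and $\rho=\sum_{n=0}^\infty E_P(M_n\cdots M_1M_0I_0)$. Then $n^{-1/2}(S_n-n\cdot\rho)$ converges in distribution (under $\mathbb{P}$) to a Gaussian random vector $S_\infty=(S_\infty^{(1)},\dots,S_\infty^{(d)})$ with zero mean. Moreover, if for some $i\in\{1,\dots,d\}$ there is no function $f_i:\Omega\to\mathbb{Z}_+$ such that $P_\omega(Y_0^{(i)}=f_i(\omega))=1$ for $P$-a.e. environment $\omega$, then $\mathbb{E}([S_\infty^{(i)}]^2)>0$ for that $i$.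
   Context: Fix an integer $d\ge 1$. The environment $\omega=(\omega_n)_{n\in\mathbb{Z}}$ is a stationary ergodic sequence of random variables with values in a measurable space $(\mathcal{S},\mathcal{B})$; its law on $(\Omega,\mathcal{F})=(\mathcal{S}^{\mathbb{Z}},\mathcal{B}^{\otimes\mathbb{Z}})$ is $P$, with expectation $E_P$. Let $\mathcal{P}_d$ be the set of probability measures on $\mathbb{Z}_+^d$ ($\mathbb{Z}_+=\mathbb{N}\cup\{0\}$), and let $q,p_1,\dots,p_d:\mathcal{S}\to\mathcal{P}_d$ be measurable. Given $\omega$, under the quenched law $P_\omega$ (expectation $E_\omega$), all of the following random vectors in $\mathbb{Z}_+^d$ are independent: the immigration vectors $X_n=(X_n^{(1)},\dots,X_n^{(d)})$, $n\in\mathbb{Z}_+$, with $X_n$ of law $q_{\omega,n}=q(\omega_{n-1})$; and the offspring vectors $L_{n,m}^{(i)}=(L_{n,m}^{(i,1)},\dots,L_{n,m}^{(i,d)})$, $n\in\mathbb{Z}_+$, $m\in\mathbb{N}$, $1\le i\le d$, with $L_{n,m}^{(i)}$ of law $p^{(i)}_{\omega,n}=p_i(\omega_n)$. The process is defined by $Z_0=\mathbf{0}=(0,\dots,0)$ and $$Z_{n+1}=\sum_{i=1}^d\sum_{m=1}^{Z_n^{(i)}+X_n^{(i)}}L_{n,m}^{(i)},\qquad n\ge 0.$$ The joint (annealed) law is $\mathbb{P}=P\otimes P_\omega$, with expectation $\mathbb{E}$. For $\beta>0$ let $I_{n,\beta}=I_{n,\beta}(\omega)$ be the vector with components $I_{n,\beta}^{(j)}=(E_\omega|X_n^{(j)}|^\beta)^{1/\beta}$,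 and let $M_{n,\beta}=M_{n,\beta}(\omega)$ be the $d\times d$ matrix whose $i$th column is $(M_{n,\beta}^{(i,1)},\dots,M_{n,\beta}^{(i,d)})$, where $M_{n,\beta}^{(i,j)}=(E_\omega|L_{n,1}^{(i,j)}|^\beta)^{1/\beta}$. Put $I_n=I_{n,1}$, $M_n=M_{n,1}$. For $v\in\mathbb{R}^d$, $\|v\|_\beta=(\sum_i|v^{(i)}|^\beta)^{1/\beta}$, and for a $d\times d$ matrix $A$, $\|A\|_\beta$ is the corresponding operator norm. $\log^+x=\max\{0,\log x\}$ and $\log 0=-\infty$. Mixing coefficients: $\alpha(n)=\sup\{|P(A\cap B)-P(A)P(B)|:A\in\mathcal{F}^n,B\in\mathcal{F}_0\}$, where $\mathcal{F}^n=\sigma(\omega_i:i\ge n)$ and $\mathcal{F}_n=\sigma(\omega_i:i<n)$. $Y_n=(Y_n^{(1)},\dots,Y_n^{(d)})$, where $Y_n^{(i)}$ is the total number of descendants of type $i$, over all generations, of all the immigrants that arrived at time $n$ (the immigrants themselves not counted). Explicitly, $Y_n=\sum_{k=n+1}^\infty U_{n,k}$, where $U_{n,k}\in\mathbb{Z}_+^d$ counts by type the descendants present in generation $k$ of the immigrants who arrived at time $n$ ($U_{n,n}=X_n$, and $Z_k=\sum_{n=0}^{k-1}U_{n,k}$). Given $\omega$, the processes $(U_{n,k})_{k\ge n}$, $n\in\mathbb{Z}_+$, are independent Markov chains; given $U_{n,k}=u$, $U_{n,k+1}$ is distributed as $\sum_{i=1}^d\sum_{m=1}^{u^{(i)}}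L_{k,m}^{(i)}$.
   Formalization: In (B1) the expectations E_P(‖M_{n-1,κ}⋯M_{0,κ}I_{0,κ}‖_κ^κ) are additionally required to be finite for every n≥1, for the same κ; with the limsup alone ρ can be infinite. *)

theory Defs
  imports "HOL-Probability.Probability"
begin

section \<open>Extended-real conventions\<close>

text \<open>
  All moments below are expectations of nonnegative quantities, so they are kept in
  \<^typ>\<open>ennreal\<close> and no integrability has to be assumed to give them a meaning.
  Logarithms take the values \<open>log 0 = -\<infinity>\<close> and \<open>log \<infinity> = \<infinity>\<close>.
\<close>

definition elog :: "ennreal \<Rightarrow> ereal" where
  "elog x = (if x = 0 then -\<infinity> else if x = \<infinity> then \<infinity> else ereal (ln (enn2real x)))"

text \<open>Real powers; only used for positive exponents, where \<open>0\<close> and \<open>\<infinity>\<close> are fixed.\<close>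

definition epow :: "ennreal \<Rightarrow> real \<Rightarrow> ennreal" where
  "epow x a = (if x = \<infinity> then \<infinity> else ennreal (enn2real x powr a))"

text \<open>
  Expectation of an extended real random variable as the difference of the integrals of its
  positive and negative parts (\<^const>\<open>e2ennreal\<close> sends negative numbers to \<open>0\<close>).
\<close>

definition ext_expectation :: "'a measure \<Rightarrow> ('a \<Rightarrow> ereal) \<Rightarrow> ereal" where
  "ext_expectation M f =
     enn2ereal (\<integral>\<^sup>+x. e2ennreal (f x) \<partial>M) - enn2ereal (\<integral>\<^sup>+x. e2ennreal (- f x) \<partial>M)"

definition vec_norm :: "real \<Rightarrow> ennreal^'d \<Rightarrow> ennreal" where
  "vec_norm \<beta> v = epow (\<Sum>i\<in>UNIV. epow (v $ i) \<beta>) (1 / \<beta>)"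

definition abs_vec :: "real^'d \<Rightarrow> ennreal^'d" where
  "abs_vec v = (\<chi> i. ennreal \<bar>v $ i\<bar>)"

definition real_mat :: "ennreal^'d^'d \<Rightarrow> real^'d^'d" where
  "real_mat A = (\<chi> i j. enn2real (A $ i $ j))"

text \<open>
  The operator norm of a nonnegative matrix with respect to the \<open>\<beta>\<close>-norm on \<open>\<real>\<^sup>d\<close>; it is
  infinite as soon as some entry is.
\<close>

definition mat_norm :: "real \<Rightarrow> ennreal^'d^'d \<Rightarrow> ennreal" where
  "mat_norm \<beta> A =
     (if \<forall>i j. A $ i $ j < \<infinity>
      then (SUP v\<in>{v :: real^'d. vec_norm \<beta> (abs_vec v) \<le> 1}.
              vec_norm \<beta> (abs_vec (real_mat A *v v)))
      else \<infinity>)"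


section \<open>The environment\<close>

definition shift :: "(int \<Rightarrow> 's) \<Rightarrow> (int \<Rightarrow> 's)" where
  "shift \<omega> = (\<lambda>n. \<omega> (n + 1))"

definition stationary_ergodic :: "'s measure \<Rightarrow> (int \<Rightarrow> 's) measure \<Rightarrow> bool" where
  "stationary_ergodic S P \<longleftrightarrow>
     prob_space P \<and> sets P = sets (Pi\<^sub>M UNIV (\<lambda>_. S)) \<and>
     distr P P shift = P \<and>
     (\<forall>A\<in>sets P. shift -` A \<inter> space P = A \<longrightarrow> measure P A = 0 \<or> measure P A = 1)"

definition env_sigma :: "'s measure \<Rightarrow> (int \<Rightarrow> 's) measure \<Rightarrow> int set \<Rightarrow> (int \<Rightarrow> 's) set set" where
  "env_sigma S P J =
     sigma_sets (space P) {(\<lambda>\<omega>. \<omega> i) -` A \<inter> space P | i A. i \<in> J \<and> A \<in> sets S}"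

definition mixing_coeff :: "'s measure \<Rightarrow> (int \<Rightarrow> 's) measure \<Rightarrow> nat \<Rightarrow> ennreal" where
  "mixing_coeff S P n =
     (SUP A\<in>env_sigma S P {int n..}. SUP B\<in>env_sigma S P {..<0}.
        ennreal \<bar>measure P (A \<inter> B) - measure P A * measure P B\<bar>)"


section \<open>The branching process\<close>

text \<open>
  A realisation of all reproduction and immigration is a function \<open>x\<close> on the slots:
  \<open>x (Imm n)\<close> is the immigration vector \<open>X\<^sub>n\<close>, and \<open>x (Off n m i)\<close> is the offspring vector
  of the \<open>m\<close>-th particle of type \<open>i\<close> in generation \<open>n\<close>.  Particles are numbered from \<open>1\<close>; the
  slots with \<open>m = 0\<close> exist but are never used.
\<close>

datatype 'd slot = Imm nat | Off nat nat 'd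

definition slot_law ::
  "('s \<Rightarrow> (nat^'d) pmf) \<Rightarrow> ('d \<Rightarrow> 's \<Rightarrow> (nat^'d) pmf) \<Rightarrow> (int \<Rightarrow> 's) \<Rightarrow> 'd slot \<Rightarrow> (nat^'d) measure"
where
  "slot_law q p \<omega> k =
     (case k of
        Imm n \<Rightarrow> measure_pmf (q (\<omega> (int n - 1)))
      | Off n m i \<Rightarrow> measure_pmf (p i (\<omega> (int n))))"

definition quenched ::
  "('s \<Rightarrow> (nat^'d) pmf) \<Rightarrow> ('d \<Rightarrow> 's \<Rightarrow> (nat^'d) pmf) \<Rightarrow> (int \<Rightarrow> 's) \<Rightarrow> ('d slot \<Rightarrow> nat^'d) measure"
where
  "quenched q p \<omega> = Pi\<^sub>M UNIV (slot_law q p \<omega>)"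

text \<open>The annealed law is the semidirect product of \<open>P\<close> with the quenched laws.\<close>

definition annealed ::
  "(int \<Rightarrow> 's) measure \<Rightarrow> ('s \<Rightarrow> (nat^'d) pmf) \<Rightarrow> ('d \<Rightarrow> 's \<Rightarrow> (nat^'d) pmf) \<Rightarrow>
     ((int \<Rightarrow> 's) \<times> ('d slot \<Rightarrow> nat^'d)) measure"
where
  "annealed P q p =
     P \<bind> (\<lambda>\<omega>. distr (quenched q p \<omega>)
                  (P \<Otimes>\<^sub>M Pi\<^sub>M UNIV (\<lambda>_. count_space UNIV)) (\<lambda>x. (\<omega>, x)))"

primrec Z :: "('d::finite slot \<Rightarrow> nat^'d) \<Rightarrow> nat \<Rightarrow> nat^'d" where
  "Z x 0 = 0"
| "Z x (Suc n) = (\<Sum>i\<in>UNIV. \<Sum>m = 1..Z x n $ i + x (Imm n) $ i. x (Off n m i))"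

text \<open>
  \<open>U x k n\<close> is the vector \<open>U\<^sub>n\<^sub>,\<^sub>k\<close> counting by type the particles in generation \<open>k\<close> that descend
  from the immigrants who arrived at time \<open>n\<close>.  To realise the families on the same offspring
  variables as \<open>Z\<close>, the particles of each type in generation \<open>k\<close> are numbered by the arrival
  time of their ancestors, earliest first; so the family of arrival time \<open>n\<close> owns the numbers
  between \<open>\<Sum>l<n. U\<^sub>l\<^sub>,\<^sub>k\<close> (exclusive) and \<open>\<Sum>l\<le>n. U\<^sub>l\<^sub>,\<^sub>k\<close> (inclusive).
\<close>

primrec U :: "('d::finite slot \<Rightarrow> nat^'d) \<Rightarrow> nat \<Rightarrow> nat \<Rightarrow> nat^'d" where
  "U x 0 = (\<lambda>n. if n = 0 then x (Imm 0) else 0)"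
| "U x (Suc k) =
     (\<lambda>n. if n \<le> k
          then (\<Sum>i\<in>UNIV. \<Sum>m\<in>{(\<Sum>l<n. U x k l $ i)<..(\<Sum>l\<le>n. U x k l $ i)}. x (Off k m i))
          else if n = Suc k then x (Imm (Suc k)) else 0)"

text \<open>The numbering is exhaustive: the families make up the whole population.\<close>

lemma sum_blocks:
  fixes c :: "nat \<Rightarrow> nat" and g :: "nat \<Rightarrow> 'b::comm_monoid_add"
  shows "(\<Sum>n\<le>k. \<Sum>m\<in>{(\<Sum>l<n. c l)<..(\<Sum>l\<le>n. c l)}. g m) = (\<Sum>m = 1..\<Sum>l\<le>k. c l. g m)"
proof (induction k)
  case 0
  have "{0<..c 0} = {Suc 0..c 0}" by auto
  then show ?case by simp
next
  case (Suc k)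
  have "{1..\<Sum>l\<le>Suc k. c l} =
      {1..\<Sum>l\<le>k. c l} \<union> {(\<Sum>l<Suc k. c l)<..(\<Sum>l\<le>Suc k. c l)}"
    by (auto simp: lessThan_Suc_atMost)
  then show ?case
    using Suc by (simp add: lessThan_Suc_atMost sum.union_disjoint Int_def)
qed

lemma Z_eq_sum_U: "Z x k = (\<Sum>n<k. U x k n)"
proof (induction k)
  case 0
  show ?case by simp
next
  case (Suc k)
  have new: "U x k k = x (Imm k)"
    by (cases k) simp_all
  have pop: "(\<Sum>l\<le>k. U x k l $ i) = Z x k $ i + x (Imm k) $ i" for i
  proof -
    have "(\<Sum>l\<le>k. U x k l $ i) = (\<Sum>l<k. U x k l) $ i + U x k k $ i"
      by (simp add: lessThan_Suc_atMost[symmetric])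
    then show ?thesis using Suc new by simp
  qed
  have "(\<Sum>n<Suc k. U x (Suc k) n) =
      (\<Sum>n\<le>k. \<Sum>i\<in>UNIV. \<Sum>m\<in>{(\<Sum>l<n. U x k l $ i)<..(\<Sum>l\<le>n. U x k l $ i)}. x (Off k m i))"
    by (simp add: lessThan_Suc_atMost)
  also have "\<dots> = (\<Sum>i\<in>UNIV. \<Sum>n\<le>k.
      \<Sum>m\<in>{(\<Sum>l<n. U x k l $ i)<..(\<Sum>l\<le>n. U x k l $ i)}. x (Off k m i))"
    by (rule sum.swap)
  also have "\<dots> = Z x (Suc k)"
    by (simp only: sum_blocks pop Z.simps)
  finally show ?case by simp
qed

text \<open>
  The progeny \<open>Y\<^sub>n = (\<Sum>k>n. U\<^sub>n\<^sub>,\<^sub>k)\<close> is a possibly infinite sum, whence the extended values.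
\<close>

definition Y :: "('d::finite slot \<Rightarrow> nat^'d) \<Rightarrow> nat \<Rightarrow> ennreal^'d" where
  "Y x n = (\<chi> i. \<Sum>k. of_nat (U x (Suc (n + k)) n $ i))"

definition S_sum :: "('d::finite slot \<Rightarrow> nat^'d) \<Rightarrow> nat \<Rightarrow> nat^'d" where
  "S_sum x n = (\<Sum>i<n. Z x i)"


section \<open>Quenched moments\<close>

definition I_vec ::
  "('s \<Rightarrow> (nat^'d) pmf) \<Rightarrow> ('d \<Rightarrow> 's \<Rightarrow> (nat^'d) pmf) \<Rightarrow> real \<Rightarrow> (int \<Rightarrow> 's) \<Rightarrow> nat \<Rightarrow> ennreal^'d"
where
  "I_vec q p \<beta> \<omega> n =
     (\<chi> j. epow (\<integral>\<^sup>+x. ennreal (real (x (Imm n) $ j) powr \<beta>) \<partial>quenched q p \<omega>) (1 / \<beta>))"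

text \<open>Row \<open>j\<close>, column \<open>i\<close>: offspring of type \<open>j\<close> of a particle of type \<open>i\<close>.\<close>

definition M_mat ::
  "('s \<Rightarrow> (nat^'d) pmf) \<Rightarrow> ('d \<Rightarrow> 's \<Rightarrow> (nat^'d) pmf) \<Rightarrow> real \<Rightarrow> (int \<Rightarrow> 's) \<Rightarrow> nat \<Rightarrow> ennreal^'d^'d"
where
  "M_mat q p \<beta> \<omega> n =
     (\<chi> j i. epow (\<integral>\<^sup>+x. ennreal (real (x (Off n 1 i) $ j) powr \<beta>) \<partial>quenched q p \<omega>) (1 / \<beta>))"

text \<open>\<open>M_prod q p \<beta> \<omega> n\<close> is the product of the matrices with indices \<open>n - 1, \<dots>, 1, 0\<close>.\<close>

primrec M_prod ::
  "('s \<Rightarrow> (nat^'d::finite) pmf) \<Rightarrow> ('d \<Rightarrow> 's \<Rightarrow> (nat^'d) pmf) \<Rightarrow> real \<Rightarrow> (int \<Rightarrow> 's) \<Rightarrow> nat \<Rightarrow>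
     ennreal^'d^'d"
where
  "M_prod q p \<beta> \<omega> 0 = mat 1"
| "M_prod q p \<beta> \<omega> (Suc n) = M_mat q p \<beta> \<omega> n ** M_prod q p \<beta> \<omega> n"

definition rho ::
  "(int \<Rightarrow> 's) measure \<Rightarrow> ('s \<Rightarrow> (nat^'d::finite) pmf) \<Rightarrow> ('d \<Rightarrow> 's \<Rightarrow> (nat^'d) pmf) \<Rightarrow> real^'d"
where
  "rho P q p =
     (\<chi> j. enn2real (\<Sum>n. \<integral>\<^sup>+\<omega>. (M_prod q p 1 \<omega> (Suc n) *v I_vec q p 1 \<omega> 0) $ j \<partial>P))"


section \<open>Convergence in distribution and Gaussian laws on \<open>\<real>\<^sup>d\<close>\<close>

definition conv_in_distr ::
  "'a measure \<Rightarrow> (nat \<Rightarrow> 'a \<Rightarrow> 'b::topological_space) \<Rightarrow> 'b measure \<Rightarrow> bool"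
where
  "conv_in_distr M V \<nu> \<longleftrightarrow>
     (\<forall>n. V n \<in> borel_measurable M) \<and>
     (\<forall>f :: 'b \<Rightarrow> real. continuous_on UNIV f \<longrightarrow> bounded (range f) \<longrightarrow>
        (\<lambda>n. \<integral>x. f x \<partial>distr M borel (V n)) \<longlonglongrightarrow> (\<integral>x. f x \<partial>\<nu>))"

text \<open>Degenerate normal laws are allowed, for vectors as well as for their projections.\<close>

definition gaussian_law :: "(real^'d) measure \<Rightarrow> bool" where
  "gaussian_law \<nu> \<longleftrightarrow>
     prob_space \<nu> \<and> sets \<nu> = sets borel \<and>
     (\<forall>u. \<exists>m s. 0 \<le> s \<and>
        distr \<nu> borel (\<lambda>x. u \<bullet> x) =
          (if s = 0 then return borel m
           else density lborel (\<lambda>t. ennreal (normal_density m s t))))"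

end

theory Submission
  imports Defs "HOL-Real_Asymp.Real_Asymp"
begin

text \<open>
  Given the environment, the total progenies \<open>Y\<^sub>n\<close> of the immigrants of the different times are
  independent, and the law of \<open>Y\<^sub>n\<close> is that of \<open>Y\<^sub>0\<close> in the environment shifted by \<open>n\<close>.  Up to a
  boundary term bounded in mean square, \<open>S\<^sub>n\<close> is \<open>Y\<^sub>0 + \<dots> + Y\<^sub>n\<^sub>-\<^sub>1\<close>.  By Minkowski's inequality
  \<open>U\<^sub>0\<^sub>,\<^sub>k\<close> has a \<open>\<kappa>\<close>-th moment which decays exponentially in \<open>k\<close>, so stopping the families after \<open>r\<close>
  generations and truncating the counts at an exponential height makes an error tending to zero in
  mean square.  The truncated progenies form a bounded stationary sequence that inherits the
  mixing of the environment and satisfies a central limit theorem by Bernstein's method; the error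
  of the sums over \<open>n\<close> terms is \<open>o(\<surd>n)\<close> uniformly in \<open>n\<close> as \<open>r\<close> grows, because the covariances are
  summable uniformly in \<open>r\<close>.  Hence every linear functional of \<open>S\<^sub>n\<close> is asymptotically normal.

  The variance of a sum of \<open>n\<close> truncated progenies is at least \<open>n\<close> times their expected quenched
  variance, so a vanishing limit variance forces the quenched variance of \<open>Y\<^sub>0\<close> to vanish.
\<close>

section \<open>A central limit theorem for bounded mixing sequences\<close>

text \<open>The mixing bound for a covariance charges the product of the two sup norms, so it says
  nothing about unbounded progenies, while a fixed height of truncation would leave a fixed error.
  Hence the height \<open>(1 / t) ^ r\<close> grows with the number \<open>r\<close> of generations
  kept. At lag \<open>j\<close> both families are cut at \<open>j div 2\<close> generations: the gap
  left in the environment then outweighs the two heights, and since \<kappa> > 2 the part cut off is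
  geometrically small in mean square. The covariance bounds so obtained are summable in the lag and
  uniform in the level. Independence of the families is hidden by the construction: the particles of
  a family carry numbers that depend on the sizes of the earlier families. It is recovered by
  prescribing all these sizes up to some generation; the events then concern fixed, disjoint sets of
  slots, and the probability is a product of Markov path probabilities. The covariance matrix of the
  limit comes from second moments by polarisation, and the Gaussian law is a linear image of
  independent standard normals.\<close>

definition ndist :: "nat \<Rightarrow> nat \<Rightarrow> nat" where
  "ndist m n = (m - n) + (n - m)"

text \<open>On each side of \<open>m\<close> the distance is injective, so each side contributes at
  most the whole series. One of the two truncated subtractions in \<open>ndist\<close> is always 0,
  which makes it the absolute difference.\<close>

lemma sum_ndist_le:
  fixes \<gamma> :: "nat \<Rightarrow> real"
  assumes "summable (\<lambda>j. \<bar>\<gamma> j\<bar>)" "finite I"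
  shows "(\<Sum>n\<in>I. \<bar>\<gamma> (ndist m n)\<bar>) \<le> 2 * (\<Sum>j. \<bar>\<gamma> j\<bar>)"
proof -
  have le: "(\<Sum>n\<in>K. \<bar>\<gamma> (f n)\<bar>) \<le> (\<Sum>j. \<bar>\<gamma> j\<bar>)" if "finite K" "inj_on f K" for K and f :: "nat \<Rightarrow> nat"
  proof -
    have "(\<Sum>n\<in>K. \<bar>\<gamma> (f n)\<bar>) = (\<Sum>j\<in>f ` K. \<bar>\<gamma> j\<bar>)"
      using that by (simp add: sum.reindex)
    also have "\<dots> \<le> (\<Sum>j. \<bar>\<gamma> j\<bar>)"
      by (rule sum_le_suminf) (use assms that in auto)
    finally show ?thesis .
  qed
  have "(\<Sum>n\<in>I. \<bar>\<gamma> (ndist m n)\<bar>) =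
      (\<Sum>n\<in>I \<inter> {..m}. \<bar>\<gamma> (ndist m n)\<bar>) + (\<Sum>n\<in>I \<inter> {m<..}. \<bar>\<gamma> (ndist m n)\<bar>)"
    using assms by (subst sum.union_disjoint[symmetric]) (auto intro!: sum.cong)
  also have "\<dots> \<le> (\<Sum>j. \<bar>\<gamma> j\<bar>) + (\<Sum>j. \<bar>\<gamma> j\<bar>)"
    by (intro add_mono le) (use assms in \<open>auto simp: inj_on_def ndist_def\<close>)
  finally show ?thesis by simp
qed

text \<open>The bound is linear in the number of indices wherever they lie, as the scattered
  complement of Bernstein's blocks requires.\<close>

lemma double_sum_ndist_le:
  fixes \<gamma> :: "nat \<Rightarrow> real"
  assumes "summable (\<lambda>j. \<bar>\<gamma> j\<bar>)" "finite I"
  shows "(\<Sum>m\<in>I. \<Sum>n\<in>I. \<gamma> (ndist m n)) \<le> real (card I) * (2 * (\<Sum>j. \<bar>\<gamma> j\<bar>))"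
proof -
  have "(\<Sum>m\<in>I. \<Sum>n\<in>I. \<gamma> (ndist m n)) \<le> (\<Sum>m\<in>I. 2 * (\<Sum>j. \<bar>\<gamma> j\<bar>))"
  proof (rule sum_mono)
    fix m
    have "(\<Sum>n\<in>I. \<gamma> (ndist m n)) \<le> (\<Sum>n\<in>I. \<bar>\<gamma> (ndist m n)\<bar>)" by (rule sum_mono) simp
    with sum_ndist_le[OF assms, of m] show "(\<Sum>n\<in>I. \<gamma> (ndist m n)) \<le> 2 * (\<Sum>j. \<bar>\<gamma> j\<bar>)"
      by linarith
  qed
  then show ?thesis by simp
qed

lemma cesaro_mean:
  fixes a :: "nat \<Rightarrow> real"
  assumes "a \<longlonglongrightarrow> l"
  shows "(\<lambda>n. (\<Sum>k<n. a k) / n) \<longlonglongrightarrow> l"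
proof (rule LIMSEQ_I)
  fix e :: real assume e: "0 < e"
  from LIMSEQ_D[OF assms, of "e / 2"] e obtain N where N: "\<And>k. k \<ge> N \<Longrightarrow> \<bar>a k - l\<bar> < e / 2" by auto
  define K where "K = (\<Sum>k<N. \<bar>a k - l\<bar>)"
  have K0: "K \<ge> 0" unfolding K_def by (simp add: sum_nonneg)
  obtain N' where N': "real N' > 2 * K / e" using reals_Archimedean2 by blast
  show "\<exists>no. \<forall>n\<ge>no. norm ((\<Sum>k<n. a k) / n - l) < e"
  proof (intro exI allI impI)
    fix n assume n: "n \<ge> max (Suc N) (Suc N')"
    have "(\<Sum>k<n. a k) / n - l = (\<Sum>k<n. a k - l) / n"
      using n by (simp add: sum_subtractf field_simps)
    also have "\<bar>\<dots>\<bar> \<le> (\<Sum>k<n. \<bar>a k - l\<bar>) / n"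
      by (simp add: divide_right_mono sum_abs)
    also have "(\<Sum>k<n. \<bar>a k - l\<bar>) = K + (\<Sum>k\<in>{N..<n}. \<bar>a k - l\<bar>)"
      unfolding K_def using n by (subst sum.union_disjoint[symmetric]) (auto intro!: sum.cong)
    also have "(\<Sum>k\<in>{N..<n}. \<bar>a k - l\<bar>) \<le> (\<Sum>k\<in>{N..<n}. e / 2)"
      by (rule sum_mono) (use N in \<open>auto intro: less_imp_le\<close>)
    also have "(\<Sum>k\<in>{N..<n}. e / 2) \<le> n * (e / 2)" using e by (simp add: mult_right_mono)
    finally have *: "\<bar>(\<Sum>k<n. a k) / n - l\<bar> \<le> (K + n * (e / 2)) / n"
      by (simp add: divide_right_mono)
    have "2 * K / e < n" using N' n by linarith
    then have "2 * K < n * e" using e by (simp add: pos_divide_less_eq)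
    then have "(K + n * (e / 2)) / n < e" using n by (simp add: field_simps)
    with * show "norm ((\<Sum>k<n. a k) / n - l) < e" by simp
  qed
qed

text \<open>Enlarging the square from \<open>n\<close> to \<open>n + 1\<close> adds a row, a column
  and a corner, together the \<open>n\<close>-th partial sum \<open>a n\<close> of the limit. The
  normalised double sum is therefore a Cesaro mean of \<open>a\<close>.\<close>

lemma double_sum_ndist_lim:
  fixes \<gamma> :: "nat \<Rightarrow> real"
  assumes s: "summable (\<lambda>j. \<bar>\<gamma> j\<bar>)"
  shows "(\<lambda>n. (\<Sum>m<n. \<Sum>k<n. \<gamma> (ndist m k)) / n) \<longlonglongrightarrow> \<gamma> 0 + 2 * (\<Sum>j. \<gamma> (Suc j))"
proof -
  define a where "a n = \<gamma> 0 + 2 * (\<Sum>j<n. \<gamma> (Suc j))" for n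
  have "summable \<gamma>" using s by (rule summable_rabs_cancel)
  then have "summable (\<lambda>j. \<gamma> (Suc j))" by (subst summable_Suc_iff)
  then have "a \<longlonglongrightarrow> \<gamma> 0 + 2 * (\<Sum>j. \<gamma> (Suc j))"
    unfolding a_def by (intro tendsto_intros summable_LIMSEQ)
  then have *: "(\<lambda>n. (\<Sum>k<n. a k) / n) \<longlonglongrightarrow> \<gamma> 0 + 2 * (\<Sum>j. \<gamma> (Suc j))"
    by (rule cesaro_mean)
  have "(\<Sum>m<n. \<Sum>k<n. \<gamma> (ndist m k)) = (\<Sum>k<n. a k)" for n
  proof (induction n)
    case (Suc n)
    have 1: "(\<Sum>k<n. \<gamma> (ndist n k)) = (\<Sum>j<n. \<gamma> (Suc j))"
      by (rule sum.reindex_bij_witness[of _ "\<lambda>j. n - Suc j" "\<lambda>k. n - Suc k"])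
        (auto simp: ndist_def intro!: arg_cong[of _ _ \<gamma>])
    have 2: "(\<Sum>k<n. \<gamma> (ndist k n)) = (\<Sum>j<n. \<gamma> (Suc j))"
      unfolding 1[symmetric] by (simp add: ndist_def add.commute)
    have "(\<Sum>m<Suc n. \<Sum>k<Suc n. \<gamma> (ndist m k)) =
        (\<Sum>m<n. \<Sum>k<n. \<gamma> (ndist m k)) + (\<Sum>m<n. \<gamma> (ndist m n)) + (\<Sum>k<n. \<gamma> (ndist n k)) + \<gamma> (ndist n n)"
      by (simp add: sum.distrib)
    then show ?case using Suc 1 2 by (simp add: a_def ndist_def)
  qed simp
  with * show ?thesis by simp
qed

section \<open>Comparison of characteristic functions\<close>

lemma norm_integral_iexp_le:
  fixes f :: "'a \<Rightarrow> real"
  assumes "prob_space M" "f \<in> borel_measurable M"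
  shows "cmod (\<integral>x. iexp (f x) \<partial>M) \<le> 1"
proof -
  interpret prob_space M by fact
  have "cmod (\<integral>x. iexp (f x) \<partial>M) \<le> (\<integral>x. cmod (iexp (f x)) \<partial>M)"
    by (rule integral_norm_bound)
  also have "\<dots> = 1" by (simp add: prob_space)
  finally show ?thesis .
qed

lemma (in prob_space) integrable_iexp_comp [intro]:
  fixes f :: "'a \<Rightarrow> real"
  assumes [measurable]: "f \<in> borel_measurable M"
  shows "integrable M (\<lambda>x. iexp (f x))"
  by (rule integrable_const_bound[where B=1]) auto

lemma norm_iexp_diff_le: "cmod (iexp a - iexp b) \<le> \<bar>a - b\<bar>"
proof -
  have "iexp a - iexp b = iexp b * (iexp (a - b) - 1)"
    by (simp add: algebra_simps flip: exp_add)
  then show ?thesis using iexp_approx1[of "a - b" 0] by (simp add: norm_mult)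
qed

text \<open>The map \<open>iexp\<close> is Lipschitz with constant 1, and a first absolute moment is
  at most the root of the second moment. Mean-square errors enter the characteristic functions
  through this bound.\<close>

lemma (in prob_space) norm_char_diff_le:
  fixes f g :: "'a \<Rightarrow> real"
  assumes [measurable]: "f \<in> borel_measurable M" "g \<in> borel_measurable M"
    and sq: "integrable M (\<lambda>x. (f x - g x)\<^sup>2)"
  shows "cmod (expectation (\<lambda>x. iexp (f x)) - expectation (\<lambda>x. iexp (g x)))
     \<le> sqrt (expectation (\<lambda>x. (f x - g x)\<^sup>2))"
proof -
  have ab: "integrable M (\<lambda>x. \<bar>f x - g x\<bar>)"
    using square_integrable_imp_integrable[OF _ sq] by auto
  have "expectation (\<lambda>x. iexp (f x)) - expectation (\<lambda>x. iexp (g x)) =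
      expectation (\<lambda>x. iexp (f x) - iexp (g x))"
    by (subst Bochner_Integration.integral_diff) auto
  also have "cmod \<dots> \<le> expectation (\<lambda>x. cmod (iexp (f x) - iexp (g x)))"
    by (rule integral_norm_bound)
  also have "\<dots> \<le> expectation (\<lambda>x. \<bar>f x - g x\<bar>)"
    by (intro integral_mono integrable_norm Bochner_Integration.integrable_diff integrable_iexp_comp)
      (auto intro: ab norm_iexp_diff_le)
  also have "\<dots> \<le> sqrt (expectation (\<lambda>x. (f x - g x)\<^sup>2))"
  proof (rule real_le_rsqrt)
    have "variance (\<lambda>x. \<bar>f x - g x\<bar>) = expectation (\<lambda>x. \<bar>f x - g x\<bar>\<^sup>2) - (expectation (\<lambda>x. \<bar>f x - g x\<bar>))\<^sup>2"
      by (rule variance_eq) (use ab sq in auto)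
    moreover have "variance (\<lambda>x. \<bar>f x - g x\<bar>) \<ge> 0" by simp
    ultimately show "(expectation (\<lambda>x. \<bar>f x - g x\<bar>))\<^sup>2 \<le> expectation (\<lambda>x. (f x - g x)\<^sup>2)" by simp
  qed
  finally show ?thesis .
qed

text \<open>Valid for all nonnegative \<open>x\<close>, so that later no exponent has to be shown
  small. Up to 1 the bound comes from \<open>1 / (1 + x)\<close>; beyond 1 it is crude.\<close>

lemma exp_minus_approx:
  fixes x :: real assumes "x \<ge> 0" shows "\<bar>exp (-x) - (1 - x)\<bar> \<le> x\<^sup>2"
proof (cases "x \<le> 1")
  case True
  have "1 - x \<le> exp (-x)" using exp_ge_add_one_self[of "-x"] by simp
  moreover have "exp (-x) \<le> 1 - x + x\<^sup>2"
    using exp_bound[of "-x"] exp_ge_add_one_self[of x] True assms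
  proof -
    have "exp (-x) = 1 / exp x" by (simp add: exp_minus field_simps)
    also have "\<dots> \<le> 1 / (1 + x)" using exp_ge_add_one_self[of x] assms by (intro divide_left_mono) auto
    also have "\<dots> \<le> 1 - x + x\<^sup>2"
    proof -
      have "(1 - x + x\<^sup>2) * (1 + x) = 1 + x^3" by (simp add: power2_eq_square power3_eq_cube algebra_simps)
      then have "1 \<le> (1 - x + x\<^sup>2) * (1 + x)" using assms by simp
      then show ?thesis using assms by (simp add: pos_divide_le_eq)
    qed
    finally show ?thesis .
  qed
  ultimately show ?thesis by auto
next
  case False
  then have "exp (-x) \<le> 1" "exp (-x) \<ge> 0" "x \<le> x\<^sup>2" using assms by (auto simp: power2_eq_square)
  with exp_ge_add_one_self[of "-x"] False show ?thesis by linarith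
qed

text \<open>Each of the \<open>N\<close> periods consists of a block of length \<open>p\<close> and
  a gap of length \<open>q\<close>. What the blocks leave uncovered is the gaps and the incomplete
  last period.\<close>

lemma blocks:
  fixes n p q N :: nat
  assumes N: "N = n div (p + q)" and pq: "0 < p + q"
  defines "J \<equiv> \<lambda>j. {j * (p + q)..<j * (p + q) + p}"
  shows "(\<Union>j<N. J j) \<subseteq> {..<n}" and "disjoint_family J"
    and "card ({..<n} - (\<Union>j<N. J j)) = n - N * p" and "N * p \<le> n"
proof -
  have sep: "j * (p + q) + p \<le> k * (p + q)" if "j < k" for j k
  proof -
    have "Suc j * (p + q) \<le> k * (p + q)" using that by (intro mult_le_mono1) simp
    then show ?thesis by (simp add: algebra_simps)
  qed
  have Nn: "N * (p + q) \<le> n" using N by simp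
  have sub: "J j \<subseteq> {..<n}" if "j < N" for j
    using sep[OF that] Nn unfolding J_def by auto
  then show A: "(\<Union>j<N. J j) \<subseteq> {..<n}" by blast
  show dis: "disjoint_family J"
    unfolding disjoint_family_on_def
  proof (intro ballI impI)
    fix j k :: nat assume "j \<noteq> k"
    then show "J j \<inter> J k = {}"
      using sep[of j k] sep[of k j] unfolding J_def by (cases "j < k") auto
  qed
  have "card (\<Union>j<N. J j) = (\<Sum>j<N. card (J j))"
    by (rule card_UN_disjoint) (use dis in \<open>auto simp: disjoint_family_on_def J_def\<close>)
  also have "\<dots> = N * p" by (simp add: J_def)
  finally have c: "card (\<Union>j<N. J j) = N * p" .
  show "card ({..<n} - (\<Union>j<N. J j)) = n - N * p"
    by (subst card_Diff_subset) (use A c in \<open>auto simp: J_def\<close>)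
  show "N * p \<le> n" using Nn by (rule order_trans[rotated]) simp
qed

text \<open>The exponent serves two purposes. From \<open>k ^ 16 \<le> n\<close> one has
  \<open>sqrt n \<ge> k ^ 8\<close>, so about \<open>n / k\<^sup>2\<close> cubic Taylor remainders
  of order \<open>(k\<^sup>2 / sqrt n) ^ 3\<close> sum to order \<open>k ^ 4 / sqrt n\<close>, hence
  to order \<open>1 / k ^ 4\<close>. From \<open>n < (k + 1) ^ 16\<close> the number of blocks stays
  polynomial in the gap length \<open>k\<close>, so exponential mixing wins.\<close>

definition root16 :: "nat \<Rightarrow> nat" where
  "root16 n = (GREATEST k. k ^ 16 \<le> n)"

lemma root16: "root16 n ^ 16 \<le> n" "n < (root16 n + 1) ^ 16"
proof -
  have le: "k \<le> n" if "k ^ 16 \<le> n" for k :: nat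
    using that self_le_power[of k 16] by (cases "k = 0") auto
  show "root16 n ^ 16 \<le> n" unfolding root16_def
    by (rule GreatestI_nat[where P="\<lambda>k. k ^ 16 \<le> n" and b=n and k=0]) (use le in auto)
  show "n < (root16 n + 1) ^ 16"
  proof (rule ccontr)
    assume "\<not> ?thesis"
    then have "root16 n + 1 \<le> root16 n" unfolding root16_def
      by (intro Greatest_le_nat[where b=n]) (use le in auto)
    then show False by simp
  qed
qed

lemma filterlim_root16: "filterlim root16 at_top at_top"
  unfolding filterlim_at_top
proof
  fix k
  show "eventually (\<lambda>n. k \<le> root16 n) at_top"
    using eventually_ge_at_top[of "k ^ 16"]
  proof eventually_elim
    case (elim n)
    with root16(2)[of n] have "k ^ 16 < (root16 n + 1) ^ 16" by linarith
    then have "k < root16 n + 1" by (rule power_less_imp_less_base) simp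
    then show ?case by simp
  qed
qed

text \<open>
  The bookkeeping for blocks of length \<open>k\<^sup>2\<close> separated by gaps of length \<open>k\<close>, where \<open>k\<close> is about
  \<open>n\<close> to the power \<open>1/16\<close>.
\<close>

lemma block_count:
  fixes n k N :: nat
  assumes k: "2 \<le> k" "k ^ 16 \<le> n" and N: "N = n div (k\<^sup>2 + k)"
  shows "real (n - N * k\<^sup>2) \<le> 3 / k * n" "k \<le> N" "real N * (real k)\<^sup>2 \<le> n"
    "(1 - 3 / k) * n \<le> real N * (real k)\<^sup>2"
proof -
  have n: "n < N * (k\<^sup>2 + k) + (k\<^sup>2 + k)"
    using N k dividend_less_times_div[of "k\<^sup>2 + k" n] by (simp add: algebra_simps)
  have Nn: "N * (k\<^sup>2 + k) \<le> n" using N by simp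
  \<comment> \<open>One crude comparison with two uses: there are at least \<open>k\<close> periods
    below \<open>n\<close>, and a single period is at most \<open>n / k\<close>.\<close>
  have kk: "k * (k\<^sup>2 + k) \<le> k ^ 16"
  proof -
    have "k * (k\<^sup>2 + k) \<le> k * (k\<^sup>2 + k\<^sup>2)" using k by (intro mult_left_mono add_mono) (auto simp: power2_eq_square)
    also have "\<dots> = 2 * k ^ 3" by (simp add: power2_eq_square power3_eq_cube)
    also have "\<dots> \<le> k * k ^ 3" using k by (intro mult_right_mono) auto
    also have "\<dots> = k ^ 4" by (simp add: power_Suc[symmetric])
    also have "\<dots> \<le> k ^ 16" using k by (intro power_increasing) auto
    finally show ?thesis .
  qed
  show "k \<le> N"
  proof (rule ccontr)
    assume "\<not> k \<le> N"
    then have "(N + 1) * (k\<^sup>2 + k) \<le> k * (k\<^sup>2 + k)" by (intro mult_right_mono) auto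
    then have "n < k ^ 16" using n kk by (simp add: algebra_simps)
    with k show False by simp
  qed
  have kr: "real k \<ge> 2" using k by simp
  have Nk: "real N * k\<^sup>2 + real N * k \<le> n"
    using Nn by (metis of_nat_add of_nat_le_iff of_nat_mult distrib_left)
  then show le: "real N * (real k)\<^sup>2 \<le> n" by (smt (verit) of_nat_0_le_iff mult_nonneg_nonneg of_nat_power)
  have nr: "real n < real N * k\<^sup>2 + real N * k + k\<^sup>2 + k"
    using n by (metis (no_types, lifting) add.assoc distrib_left of_nat_add of_nat_less_iff of_nat_mult)
  have a: "real N * k \<le> n / k"
    using le kr by (simp add: field_simps power2_eq_square)
  have b: "real (k\<^sup>2) + k \<le> 2 / k * n"
  proof -
    have "k * (k\<^sup>2 + k) \<le> n" using kk k by linarith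
    then have "real k * (k\<^sup>2 + k) \<le> n" by (metis of_nat_le_iff of_nat_mult)
    then have "real (k\<^sup>2) + k \<le> n / k" using kr by (simp add: field_simps)
    also have "\<dots> \<le> 2 / k * n" using kr by (simp add: field_simps)
    finally show ?thesis .
  qed
  have c: "3 / k * n = n / k + 2 / k * real n" by (simp add: field_simps)
  show d: "(1 - 3 / k) * n \<le> real N * (real k)\<^sup>2"
    using nr a b c left_diff_distrib[of 1 "3 / real k" "real n"] by simp
  have "N * k\<^sup>2 \<le> n" using le by (metis of_nat_le_iff of_nat_mult of_nat_power)
  then show "real (n - N * k\<^sup>2) \<le> 3 / k * n"
    using d by (simp add: of_nat_diff algebra_simps)
qed

lemma (in prob_space) expectation_sum_square:
  fixes X :: "nat \<Rightarrow> 'a \<Rightarrow> real"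
  assumes int: "\<And>m n. integrable M (\<lambda>x. X m x * X n x)"
    and cov: "\<And>m j. expectation (\<lambda>x. X m x * X (m + j) x) = \<gamma> j" and "finite I"
  shows "expectation (\<lambda>x. (\<Sum>m\<in>I. X m x)\<^sup>2) = (\<Sum>m\<in>I. \<Sum>n\<in>I. \<gamma> (ndist m n))"
    and "integrable M (\<lambda>x. (\<Sum>m\<in>I. X m x)\<^sup>2)"
proof -
  have c: "expectation (\<lambda>x. X m x * X n x) = \<gamma> (ndist m n)" for m n
    using cov[of m "n - m"] cov[of n "m - n"]
    by (cases "m \<le> n") (simp_all add: ndist_def mult.commute)
  show "expectation (\<lambda>x. (\<Sum>m\<in>I. X m x)\<^sup>2) = (\<Sum>m\<in>I. \<Sum>n\<in>I. \<gamma> (ndist m n))"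
    using int by (simp add: power2_eq_square sum_product Bochner_Integration.integral_sum c
        Bochner_Integration.integrable_sum)
  show "integrable M (\<lambda>x. (\<Sum>m\<in>I. X m x)\<^sup>2)"
    using int by (simp add: power2_eq_square sum_product)
qed

text \<open>
  Bernstein's blocks: the blocks are long enough that the gaps are negligible in mean square, and
  short enough that a third order Taylor expansion with the trivial bound on a block suffices.
\<close>

theorem (in prob_space) bounded_clt:
  fixes X :: "nat \<Rightarrow> 'a \<Rightarrow> real"
  assumes meas [measurable]: "\<And>m. X m \<in> borel_measurable M"
    and bd: "\<And>m x. \<bar>X m x\<bar> \<le> B"
    and cent: "\<And>m. expectation (X m) = 0"
    and cov: "\<And>m j. expectation (\<lambda>x. X m x * X (m + j) x) = \<gamma> j"
    and sum\<gamma>: "summable (\<lambda>j. \<bar>\<gamma> j\<bar>)"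
    and stat: "\<And>t a p. expectation (\<lambda>x. iexp (t * (\<Sum>m\<in>{a..<a + p}. X m x))) =
      expectation (\<lambda>x. iexp (t * (\<Sum>m<p. X m x)))"
    and fact: "\<And>t a q I J. finite J \<Longrightarrow> I \<subseteq> {..<a} \<Longrightarrow> J \<subseteq> {a + q..} \<Longrightarrow>
      cmod (expectation (\<lambda>x. iexp (t * ((\<Sum>m\<in>I. X m x) + (\<Sum>m\<in>J. X m x)))) -
        expectation (\<lambda>x. iexp (t * (\<Sum>m\<in>I. X m x))) * expectation (\<lambda>x. iexp (t * (\<Sum>m\<in>J. X m x))))
      \<le> C * \<theta> ^ q"
    and \<theta>: "0 \<le> \<theta>" "\<theta> < 1" and C: "0 \<le> C"
  defines "(\<sigma>::real) \<equiv> \<gamma> 0 + 2 * (\<Sum>j. \<gamma> (Suc j))"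
  shows "(\<lambda>n. expectation (\<lambda>x. iexp (t / sqrt n * (\<Sum>m<n. X m x)))) \<longlonglongrightarrow> of_real (exp (- (t\<^sup>2 * \<sigma> / 2)))"
proof -
  have B0: "B \<ge> 0" using bd[of 0 undefined] by linarith
  have int: "integrable M (\<lambda>x. X m x * X n x)" for m n
    by (rule integrable_const_bound[where B="B * B"])
      (auto simp: abs_mult intro!: mult_mono bd B0)
  have intX: "integrable M (X m)" for m
    by (rule integrable_const_bound[where B=B]) (use bd in auto)
  define G where "G = 2 * (\<Sum>j. \<bar>\<gamma> j\<bar>)"
  have G0: "G \<ge> 0" unfolding G_def using sum\<gamma> by (simp add: suminf_nonneg)
  define v where "v p = (\<Sum>m<p. \<Sum>k<p. \<gamma> (ndist m k))" for p :: nat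
  have v: "expectation (\<lambda>x. (\<Sum>m<p. X m x)\<^sup>2) = v p" for p
    unfolding v_def by (rule expectation_sum_square[OF int cov]) simp
  have vlim: "(\<lambda>p. v p / p) \<longlonglongrightarrow> \<sigma>"
    unfolding v_def \<sigma>_def by (rule double_sum_ndist_lim[OF sum\<gamma>])
  have v0: "v p \<ge> 0" for p unfolding v[symmetric] by simp
  have \<sigma>0: "\<sigma> \<ge> 0"
    by (rule LIMSEQ_le_const[OF vlim]) (use v0 in auto)
  define \<phi> where "\<phi> n = expectation (\<lambda>x. iexp (t / sqrt n * (\<Sum>m<n. X m x)))" for n :: nat
  define L where "L = exp (- (t\<^sup>2 * \<sigma> / 2))"
  define d where "d k = \<bar>v (k\<^sup>2) / k\<^sup>2 - \<sigma>\<bar>" for k :: nat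
  \<comment> \<open>In order: the gaps discarded in mean square; the factorisation over the blocks
    by mixing, once per block; and for a single factor, counted \<open>N\<close> times, the Taylor
    remainder, the deviation of the block variance from its limit, and the replacement of
    \<open>1 - x\<close> by \<open>exp (- x)\<close>.\<close>
  define err where "err k = \<bar>t\<bar> * sqrt (3 * G / k) + (real k + 1) ^ 16 * C * \<theta> ^ k +
      (\<bar>t\<bar> ^ 3 * B ^ 3 / k ^ 4 + t\<^sup>2 / 2 * (d k + \<sigma> * 3 / k) + (t\<^sup>2 * \<sigma> / 2)\<^sup>2 / k)" for k :: nat
  have main: "cmod (\<phi> n - L) \<le> err (root16 n)" if k2: "2 \<le> root16 n" for n
  proof -
    define k where "k = root16 n"
    have k: "2 \<le> k" "k ^ 16 \<le> n" "n < (k + 1) ^ 16" using k2 root16[of n] by (auto simp: k_def)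
    define N where "N = n div (k\<^sup>2 + k)"
    have kr: "real k \<ge> 2" using k by simp
    have "1 \<le> k ^ 16" using k by (intro one_le_power) auto
    with k have n0: "n > 0" by linarith
    note bc = block_count[OF k(1,2) N_def]
    have N0: "N > 0" using bc(2) k by simp
    define J where "J j = {j * (k\<^sup>2 + k)..<j * (k\<^sup>2 + k) + k\<^sup>2}" for j
    have bl: "(\<Union>j<N. J j) \<subseteq> {..<n}" "disjoint_family J" "card ({..<n} - (\<Union>j<N. J j)) = n - N * k\<^sup>2"
      using blocks[OF N_def] k unfolding J_def by auto
    have finJ: "finite (J j)" for j by (simp add: J_def)
    define s where "s = t / sqrt n"
    have s2: "s\<^sup>2 = t\<^sup>2 / n" by (simp add: s_def power_divide)
    define D where "D x = (\<Sum>m\<in>(\<Union>j<N. J j). X m x)" for x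
    have [measurable]: "D \<in> borel_measurable M" by (simp add: D_def[abs_def])
    have Dsum: "(\<Sum>m\<in>(\<Union>j<N'. J j). X m x) = (\<Sum>j<N'. \<Sum>m\<in>J j. X m x)" for N' x
      by (rule sum.UNION_disjoint) (use bl(2) finJ in \<open>auto simp: disjoint_family_on_def\<close>)
    \<comment> \<open>The uncovered indices number at most \<open>3 / k * n\<close>, and the
      variance of a sum is at most linear in the number of indices.\<close>
    have e1: "cmod (\<phi> n - expectation (\<lambda>x. iexp (s * D x))) \<le> \<bar>t\<bar> * sqrt (3 * G / k)"
    proof -
      define R where "R = {..<n} - (\<Union>j<N. J j)"
      have diff: "s * (\<Sum>m<n. X m x) - s * D x = s * (\<Sum>m\<in>R. X m x)" for x
        unfolding R_def D_def using bl(1)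
        by (subst sum_diff) (auto simp: algebra_simps)
      have fR: "finite R" by (simp add: R_def)
      note sq = expectation_sum_square[OF int cov fR]
      have "expectation (\<lambda>x. (s * (\<Sum>m<n. X m x) - s * D x)\<^sup>2) =
          s\<^sup>2 * (\<Sum>m\<in>R. \<Sum>n\<in>R. \<gamma> (ndist m n))"
        by (simp add: diff power_mult_distrib sq(1))
      also have "\<dots> \<le> s\<^sup>2 * (3 / k * n * G)"
      proof (intro mult_left_mono)
        have "(\<Sum>m\<in>R. \<Sum>n\<in>R. \<gamma> (ndist m n)) \<le> card R * G"
          using double_sum_ndist_le[OF sum\<gamma> fR] by (simp add: G_def)
        also have "\<dots> \<le> 3 / k * n * G"
          using bc(1) G0 by (intro mult_right_mono) (auto simp: R_def bl(3))
        finally show "(\<Sum>m\<in>R. \<Sum>n\<in>R. \<gamma> (ndist m n)) \<le> 3 / k * n * G" .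
      qed simp
      also have "\<dots> = \<bar>t\<bar>\<^sup>2 * (3 * G / k)" using n0 by (simp add: s2)
      finally have "sqrt (expectation (\<lambda>x. (s * (\<Sum>m<n. X m x) - s * D x)\<^sup>2)) \<le> sqrt (\<bar>t\<bar>\<^sup>2 * (3 * G / k))"
        by (rule real_sqrt_le_mono)
      moreover have "cmod (\<phi> n - expectation (\<lambda>x. iexp (s * D x))) \<le>
          sqrt (expectation (\<lambda>x. (s * (\<Sum>m<n. X m x) - s * D x)\<^sup>2))"
        unfolding \<phi>_def s_def[symmetric] by (rule norm_char_diff_le)
          (use sq(2) in \<open>auto simp: diff power_mult_distrib\<close>)
      moreover have "sqrt (\<bar>t\<bar>\<^sup>2 * (3 * G / k)) = \<bar>t\<bar> * sqrt (3 * G / k)"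
        by (simp only: real_sqrt_mult real_sqrt_abs abs_abs)
      ultimately show ?thesis by linarith
    qed
    define \<psi> where "\<psi> = expectation (\<lambda>x. iexp (s * (\<Sum>m<k\<^sup>2. X m x)))"
    have \<psi>1: "cmod \<psi> \<le> 1" unfolding \<psi>_def
      by (rule norm_integral_iexp_le) (auto intro: prob_space_axioms)
    have e2: "cmod (expectation (\<lambda>x. iexp (s * (\<Sum>m\<in>(\<Union>j<N'. J j). X m x))) - \<psi> ^ N') \<le> N' * (C * \<theta> ^ k)" for N'
    proof (induction N')
      case 0
      then show ?case by (simp add: prob_space)
    next
      case (Suc N')
      define I where "I = (\<Union>j<N'. J j)"
      define E where "E I = expectation (\<lambda>x. iexp (s * (\<Sum>m\<in>I. X m x)))" for I
      \<comment> \<open>The cut for \<open>fact\<close> is placed \<open>k\<close> before the new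
        block, at the end of the preceding one. For \<open>N' = 0\<close> there is no preceding
        block, and that case is treated separately below.\<close>
      have I: "I \<subseteq> {..<N' * (k\<^sup>2 + k) - k}"
      proof -
        have "j * (k\<^sup>2 + k) + k\<^sup>2 \<le> N' * (k\<^sup>2 + k) - k" if "j < N'" for j
        proof -
          have "Suc j * (k\<^sup>2 + k) \<le> N' * (k\<^sup>2 + k)" using that by (intro mult_le_mono1) simp
          then show ?thesis by simp
        qed
        then show ?thesis by (force simp: I_def J_def)
      qed
      have JN: "J N' \<subseteq> {(N' * (k\<^sup>2 + k) - k) + k..}" if "N' > 0"
        using that by (cases N') (auto simp: J_def)
      have EJ: "E (J N') = \<psi>" unfolding E_def J_def \<psi>_def by (rule stat)
      have disj: "I \<inter> J N' = {}"
      proof -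
        have "J j \<inter> J N' = {}" if "j < N'" for j
          using that by (intro disjoint_family_onD[OF bl(2)]) auto
        then show ?thesis by (auto simp: I_def)
      qed
      have fin: "finite I" by (simp add: I_def finJ)
      have U: "(\<Union>j<Suc N'. J j) = I \<union> J N'" by (auto simp: I_def less_Suc_eq)
      have "cmod (E (I \<union> J N') - E I * \<psi>) \<le> C * \<theta> ^ k"
      proof (cases "N' = 0")
        case True
        then have "I = {}" by (simp add: I_def)
        then show ?thesis using C \<theta> EJ by (simp add: E_def prob_space)
      next
        case False
        then show ?thesis
          using fact[OF finJ I JN, of s] fin disj finJ unfolding EJ[symmetric] unfolding E_def
          by (simp add: sum.union_disjoint)
      qed
      moreover have "cmod (E I * \<psi> - \<psi> ^ N' * \<psi>) \<le> N' * (C * \<theta> ^ k)"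
      proof -
        have "cmod (E I * \<psi> - \<psi> ^ N' * \<psi>) = cmod (E I - \<psi> ^ N') * cmod \<psi>"
          by (simp flip: norm_mult left_diff_distrib)
        also have "\<dots> \<le> cmod (E I - \<psi> ^ N')" using \<psi>1 by (simp add: mult_left_le)
        also have "\<dots> \<le> N' * (C * \<theta> ^ k)" using Suc by (simp add: E_def I_def)
        finally show ?thesis .
      qed
      ultimately have "cmod (E (I \<union> J N') - \<psi> ^ N' * \<psi>) \<le> C * \<theta> ^ k + N' * (C * \<theta> ^ k)"
        by (rule norm_diff_triangle_le)
      then show ?case unfolding U E_def by (simp add: algebra_simps)
    qed
    have e2': "cmod (expectation (\<lambda>x. iexp (s * D x)) - \<psi> ^ N) \<le> (real k + 1) ^ 16 * C * \<theta> ^ k"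
    proof -
      have "N \<le> n" by (simp add: N_def)
      then have "N \<le> (k + 1) ^ 16" using k by linarith
      then have "real N \<le> (real k + 1) ^ 16" by (metis of_nat_1 of_nat_add of_nat_le_iff of_nat_power)
      then have "real N * (C * \<theta> ^ k) \<le> (real k + 1) ^ 16 * (C * \<theta> ^ k)"
        using C \<theta> by (intro mult_right_mono) auto
      with e2[of N] show ?thesis unfolding D_def by (simp add: algebra_simps)
    qed
    \<comment> \<open>The limit \<open>L\<close> is written as an \<open>N\<close>-th power, so that
      the difference of powers is at most \<open>N\<close> times the difference of one
      factor.\<close>
    define w where "w = exp (- (t\<^sup>2 * \<sigma> / (2 * N)))"
    have w: "w ^ N = L" using N0 by (simp add: w_def L_def flip: exp_of_nat_mult)
    have w1: "0 \<le> w" "w \<le> 1" using \<sigma>0 by (auto simp: w_def)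
    have e3: "cmod (\<psi> ^ N - of_real L) \<le> \<bar>t\<bar> ^ 3 * B ^ 3 / k ^ 4 + t\<^sup>2 / 2 * (d k + \<sigma> * 3 / k) + (t\<^sup>2 * \<sigma> / 2)\<^sup>2 / k"
    proof -
      \<comment> \<open>Second order expansion for one block: the linear term has mean zero, and the
        remainder uses only the trivial bound \<open>k\<^sup>2 * B\<close> on the block sum.\<close>
      have t1: "cmod (\<psi> - of_real (1 - s\<^sup>2 * v (k\<^sup>2) / 2)) \<le> (\<bar>s\<bar> * (k\<^sup>2 * B)) ^ 3"
      proof -
        define T where "T x = (\<Sum>m<k\<^sup>2. X m x)" for x
        have [measurable]: "T \<in> borel_measurable M" by (simp add: T_def[abs_def])
        have Tb: "\<bar>T x\<bar> \<le> k\<^sup>2 * B" for x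
        proof -
          have "\<bar>T x\<bar> \<le> (\<Sum>m<k\<^sup>2. \<bar>X m x\<bar>)" unfolding T_def by (rule sum_abs)
          also have "\<dots> \<le> (\<Sum>m<k\<^sup>2. B)" by (intro sum_mono bd)
          finally show ?thesis by simp
        qed
        have T0: "expectation T = 0" unfolding T_def using intX cent by (subst Bochner_Integration.integral_sum) auto
        have intT: "integrable M T" unfolding T_def using intX by simp
        have intT2: "integrable M (\<lambda>x. (T x)\<^sup>2)" unfolding T_def by (rule expectation_sum_square[OF int cov]) simp
        have i1: "integrable M (\<lambda>x. complex_of_real (1 - s\<^sup>2 * (T x)\<^sup>2 / 2))"
          using intT2 by (intro integrable_of_real) auto
        have i2: "integrable M (\<lambda>x. \<i> * complex_of_real (s * T x))"
          using intT by (intro integrable_mult_right integrable_of_real) auto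
        have i3: "integrable M (\<lambda>x. iexp (s * T x))" by (rule integrable_iexp_comp) measurable
        have "expectation (\<lambda>x. complex_of_real (1 - s\<^sup>2 * (T x)\<^sup>2 / 2) + \<i> * of_real (s * T x)) =
            of_real (expectation (\<lambda>x. 1 - s\<^sup>2 * (T x)\<^sup>2 / 2)) + \<i> * of_real (expectation (\<lambda>x. s * T x))"
          unfolding Bochner_Integration.integral_add[OF i1 i2] integral_mult_right_zero integral_complex_of_real ..
        also have "\<dots> = of_real (1 - s\<^sup>2 * v (k\<^sup>2) / 2)"
          using intT intT2 T0 v[of "k\<^sup>2", folded T_def] by (simp add: prob_space)
        finally have m: "expectation (\<lambda>x. complex_of_real (1 - s\<^sup>2 * (T x)\<^sup>2 / 2) + \<i> * of_real (s * T x)) =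
            of_real (1 - s\<^sup>2 * v (k\<^sup>2) / 2)" .
        define Q where "Q x = iexp (s * T x) - (complex_of_real (1 - s\<^sup>2 * (T x)\<^sup>2 / 2) + \<i> * of_real (s * T x))" for x
        have "expectation Q = \<psi> - of_real (1 - s\<^sup>2 * v (k\<^sup>2) / 2)"
          unfolding Q_def Bochner_Integration.integral_diff[OF i3 Bochner_Integration.integrable_add[OF i1 i2]] m
          by (simp only: \<psi>_def T_def)
        then have "cmod (\<psi> - of_real (1 - s\<^sup>2 * v (k\<^sup>2) / 2)) = cmod (expectation Q)" by (simp only:)
        also have "\<dots> \<le> expectation (\<lambda>x. cmod (Q x))"
          by (rule integral_norm_bound)
        also have "\<dots> \<le> expectation (\<lambda>x. (\<bar>s\<bar> * (k\<^sup>2 * B)) ^ 3)"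
        proof (rule integral_mono)
          show "integrable M (\<lambda>x. cmod (Q x))" unfolding Q_def
            by (intro integrable_norm Bochner_Integration.integrable_diff Bochner_Integration.integrable_add
                i1 i2 i3)
          fix x
          have eq: "(\<Sum>k\<le>2. (\<i> * complex_of_real (s * T x)) ^ k / fact k) =
              complex_of_real (1 - s\<^sup>2 * (T x)\<^sup>2 / 2) + \<i> * of_real (s * T x)"
            by (simp add: numeral_2_eq_2 power_mult_distrib)
          have "Suc 2 = 3" by simp
          then have "cmod (Q x) \<le> \<bar>s * T x\<bar> ^ 3 / fact 3"
            unfolding Q_def using iexp_approx1[of "s * T x" 2, unfolded eq] by metis
          also have "\<dots> \<le> \<bar>s * T x\<bar> ^ 3" by (simp add: fact_numeral)
          also have "\<dots> \<le> (\<bar>s\<bar> * (k\<^sup>2 * B)) ^ 3"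
            unfolding abs_mult by (intro power_mono mult_left_mono Tb) auto
          finally show "cmod (Q x) \<le> (\<bar>s\<bar> * (k\<^sup>2 * B)) ^ 3" .
        qed auto
        finally show ?thesis by (simp add: prob_space)
      qed
      have t2: "\<bar>w - (1 - t\<^sup>2 * \<sigma> / (2 * N))\<bar> \<le> (t\<^sup>2 * \<sigma> / (2 * N))\<^sup>2"
        unfolding w_def by (rule exp_minus_approx) (use \<sigma>0 in auto)
      have t3: "N * \<bar>s\<^sup>2 * v (k\<^sup>2) / 2 - t\<^sup>2 * \<sigma> / (2 * N)\<bar> \<le> t\<^sup>2 / 2 * (d k + \<sigma> * 3 / k)"
      proof -
        \<comment> \<open>The proportion of the indices covered by the blocks, between
          \<open>1 - 3 / k\<close> and 1.\<close>
        define r where "r = real N * (real k)\<^sup>2 / n"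
        have r: "0 \<le> r" "r \<le> 1" "1 - 3 / k \<le> r"
          using bc(3,4) n0 by (auto simp: r_def field_simps)
        have k0: "real (k\<^sup>2) \<noteq> 0" using kr by simp
        have "N * \<bar>s\<^sup>2 * v (k\<^sup>2) / 2 - t\<^sup>2 * \<sigma> / (2 * N)\<bar> = \<bar>N * (s\<^sup>2 * v (k\<^sup>2) / 2 - t\<^sup>2 * \<sigma> / (2 * N))\<bar>"
          by (simp add: abs_mult)
        also have "N * (s\<^sup>2 * v (k\<^sup>2) / 2 - t\<^sup>2 * \<sigma> / (2 * N)) = t\<^sup>2 / 2 * (r * (v (k\<^sup>2) / k\<^sup>2) - \<sigma>)"
          using N0 n0 k0 by (simp add: s2 r_def field_simps)
        also have "\<bar>\<dots>\<bar> = t\<^sup>2 / 2 * \<bar>r * (v (k\<^sup>2) / k\<^sup>2) - \<sigma>\<bar>" by (simp add: abs_mult)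
        also have "\<dots> \<le> t\<^sup>2 / 2 * (d k + \<sigma> * 3 / k)"
        proof (rule mult_left_mono)
          have "r * (v (k\<^sup>2) / k\<^sup>2) - \<sigma> = r * (v (k\<^sup>2) / k\<^sup>2 - \<sigma>) - (1 - r) * \<sigma>" by (simp add: algebra_simps)
          also have "\<bar>\<dots>\<bar> \<le> \<bar>r * (v (k\<^sup>2) / k\<^sup>2 - \<sigma>)\<bar> + \<bar>(1 - r) * \<sigma>\<bar>" by (rule abs_triangle_ineq4)
          also have "\<dots> = r * d k + (1 - r) * \<sigma>" using r \<sigma>0 by (simp add: abs_mult d_def)
          also have "\<dots> \<le> 1 * d k + 3 / k * \<sigma>"
            using r \<sigma>0 by (intro add_mono mult_right_mono) (auto simp: d_def)
          finally show "\<bar>r * (v (k\<^sup>2) / k\<^sup>2) - \<sigma>\<bar> \<le> d k + \<sigma> * 3 / k" by (simp add: mult.commute)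
        qed simp
        finally show ?thesis .
      qed
      have t4: "N * (\<bar>s\<bar> * (k\<^sup>2 * B)) ^ 3 \<le> \<bar>t\<bar> ^ 3 * B ^ 3 / k ^ 4"
      proof -
        have sn: "real k ^ 8 \<le> sqrt n"
        proof (rule real_le_rsqrt)
          have "real (k ^ 16) \<le> n" using k(2) by linarith
          then show "(real k ^ 8)\<^sup>2 \<le> n" by (simp flip: power_mult)
        qed
        have "N * (\<bar>s\<bar> * (k\<^sup>2 * B)) ^ 3 = (N * k\<^sup>2) * (\<bar>t\<bar> ^ 3 * B ^ 3 * k ^ 4) / sqrt n ^ 3"
          by (simp add: s_def abs_divide power_divide power_mult_distrib field_simps flip: power_add power_mult)
        also have "\<dots> \<le> n * (\<bar>t\<bar> ^ 3 * B ^ 3 * k ^ 4) / sqrt n ^ 3"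
          using bc(3) B0 by (intro divide_right_mono mult_right_mono) auto
        also have "\<dots> = (\<bar>t\<bar> ^ 3 * B ^ 3 * k ^ 4) / sqrt n"
          using n0 by (simp add: power3_eq_cube field_simps)
        also have "\<dots> \<le> (\<bar>t\<bar> ^ 3 * B ^ 3 * k ^ 4) / real k ^ 8"
          using sn kr B0 n0 by (intro divide_left_mono) auto
        also have "\<dots> = \<bar>t\<bar> ^ 3 * B ^ 3 / k ^ 4"
          using kr by (simp add: field_simps flip: power_add)
        finally show ?thesis .
      qed
      have t5: "N * (t\<^sup>2 * \<sigma> / (2 * N))\<^sup>2 \<le> (t\<^sup>2 * \<sigma> / 2)\<^sup>2 / k"
      proof -
        have "N * (t\<^sup>2 * \<sigma> / (2 * N))\<^sup>2 = (t\<^sup>2 * \<sigma> / 2)\<^sup>2 / N"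
          using N0 by (simp add: power2_eq_square field_simps)
        also have "\<dots> \<le> (t\<^sup>2 * \<sigma> / 2)\<^sup>2 / k"
          using bc(2) kr by (intro divide_left_mono) auto
        finally show ?thesis .
      qed
      have "cmod (\<psi> ^ N - of_real L) = cmod (\<psi> ^ N - of_real w ^ N)" by (simp flip: w)
      also have "\<dots> \<le> N * cmod (\<psi> - of_real w)"
        by (rule norm_power_diff) (use \<psi>1 w1 in auto)
      finally have a: "cmod (\<psi> ^ N - of_real L) \<le> N * cmod (\<psi> - of_real w)" .
      have "cmod (of_real (1 - s\<^sup>2 * v (k\<^sup>2) / 2) - of_real w) = \<bar>(1 - s\<^sup>2 * v (k\<^sup>2) / 2) - w\<bar>"
        by (simp only: flip: of_real_diff) (rule norm_of_real)
      also have "\<dots> \<le> \<bar>s\<^sup>2 * v (k\<^sup>2) / 2 - t\<^sup>2 * \<sigma> / (2 * N)\<bar> + (t\<^sup>2 * \<sigma> / (2 * N))\<^sup>2"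
        using t2 by linarith
      finally have "cmod (\<psi> - of_real w) \<le> (\<bar>s\<bar> * (k\<^sup>2 * B)) ^ 3 +
          (\<bar>s\<^sup>2 * v (k\<^sup>2) / 2 - t\<^sup>2 * \<sigma> / (2 * N)\<bar> + (t\<^sup>2 * \<sigma> / (2 * N))\<^sup>2)"
        by (rule norm_diff_triangle_le[OF t1])
      then have "cmod (\<psi> ^ N - of_real L) \<le> N * ((\<bar>s\<bar> * (k\<^sup>2 * B)) ^ 3 +
          (\<bar>s\<^sup>2 * v (k\<^sup>2) / 2 - t\<^sup>2 * \<sigma> / (2 * N)\<bar> + (t\<^sup>2 * \<sigma> / (2 * N))\<^sup>2))"
        by (intro order_trans[OF a] mult_left_mono) auto
      then show ?thesis using t3 t4 t5 unfolding distrib_left by linarith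
    qed
    show ?thesis
      using norm_diff_triangle_le[OF norm_diff_triangle_le[OF e1 e2'] e3]
      unfolding err_def k_def[symmetric] by simp
  qed
  have "err \<longlonglongrightarrow> 0"
  proof -
    have sq: "filterlim (\<lambda>k::nat. k\<^sup>2) at_top at_top"
      by (rule filterlim_subseq) (simp add: strict_mono_def power_strict_mono)
    have "(\<lambda>k. v (k\<^sup>2) / (k\<^sup>2)) \<longlonglongrightarrow> \<sigma>" by (rule filterlim_compose[OF vlim sq])
    then have "(\<lambda>k. v (k\<^sup>2) / (k\<^sup>2) - \<sigma>) \<longlonglongrightarrow> 0" by (simp add: LIM_zero)
    then have d: "d \<longlonglongrightarrow> 0" unfolding d_def by (simp add: tendsto_rabs_zero)
    have th: "(\<lambda>k. (real k + 1) ^ 16 * C * \<theta> ^ k) \<longlonglongrightarrow> 0"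
    proof (cases "\<theta> = 0")
      case True
      then show ?thesis by (intro tendsto_eventually eventually_sequentiallyI[of 1]) auto
    next
      case False
      then have "\<theta> > 0" using \<theta> by simp
      then have "(\<lambda>k. real k ^ 16 * \<theta> ^ k) \<longlonglongrightarrow> 0" using \<theta>(2) by real_asymp
      then have "(\<lambda>k. C / \<theta> * (real (Suc k) ^ 16 * \<theta> ^ Suc k)) \<longlonglongrightarrow> C / \<theta> * 0"
        by (intro tendsto_mult_left LIMSEQ_Suc)
      then show ?thesis using \<open>\<theta> > 0\<close> by (simp add: ac_simps)
    qed
    have r: "(\<lambda>k::nat. 3 * G / k) \<longlonglongrightarrow> 0" by real_asymp
    have r: "(\<lambda>k::nat. sqrt (3 * G / k)) \<longlonglongrightarrow> sqrt 0" by (rule tendsto_real_sqrt[OF r])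
    have u: "(\<lambda>k::nat. \<bar>t\<bar> ^ 3 * B ^ 3 / real (k ^ 4)) \<longlonglongrightarrow> 0" by real_asymp
    have u': "(\<lambda>k::nat. \<sigma> * 3 / k) \<longlonglongrightarrow> 0" by real_asymp
    have u'': "(\<lambda>k::nat. (t\<^sup>2 * \<sigma> / 2)\<^sup>2 / k) \<longlonglongrightarrow> 0" by real_asymp
    have "err \<longlonglongrightarrow> \<bar>t\<bar> * sqrt 0 + 0 + (0 + t\<^sup>2 / 2 * (0 + 0) + 0)"
      unfolding err_def by (intro tendsto_add tendsto_mult_left r th u u' u'' d)
    then show ?thesis by simp
  qed
  then have "(\<lambda>n. err (root16 n)) \<longlonglongrightarrow> 0" by (rule filterlim_compose[OF _ filterlim_root16])
  then have "(\<lambda>n. \<phi> n - of_real L) \<longlonglongrightarrow> 0"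
  proof (rule Lim_null_comparison[rotated])
    show "eventually (\<lambda>n. cmod (\<phi> n - of_real L) \<le> err (root16 n)) sequentially"
      using filterlim_root16[unfolded filterlim_at_top, rule_format, of 2]
      by eventually_elim (rule main)
  qed
  then show ?thesis unfolding \<phi>_def L_def by (simp add: LIM_zero_iff)
qed

section \<open>Convergence in distribution from characteristic functions\<close>

text \<open>Finite combinations of characters, whose expectations are combinations of values of the
  characteristic function. Products of characters are characters, which makes the class an
  algebra.\<close>

inductive trig_poly :: "((real^'d) \<Rightarrow> complex) \<Rightarrow> bool" where
  mono: "trig_poly (\<lambda>x. c * iexp (u \<bullet> x))"
| add: "trig_poly f \<Longrightarrow> trig_poly g \<Longrightarrow> trig_poly (\<lambda>x. f x + g x)"

lemma trig_poly_const: "trig_poly (\<lambda>x. c)"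
  using trig_poly.mono[of c 0] by simp

lemma trig_poly_mult_mono:
  fixes f :: "real^'d \<Rightarrow> complex"
  assumes "trig_poly f"
  shows "trig_poly (\<lambda>x. (c * iexp (u \<bullet> x)) * f x)"
  using assms
proof (induction rule: trig_poly.induct)
  case (mono c' u')
  have eq: "(c * iexp (u \<bullet> x)) * (c' * iexp (u' \<bullet> x)) = (c * c') * iexp ((u + u') \<bullet> x)" for x :: "real^'d"
    by (simp add: inner_add_left distrib_left exp_add)
  show ?case unfolding eq by (rule trig_poly.mono)
next
  case (add f g)
  then show ?case using trig_poly.add by (simp add: distrib_left)
qed

lemma trig_poly_mult: "trig_poly f \<Longrightarrow> trig_poly g \<Longrightarrow> trig_poly (\<lambda>x. f x * g x)"
proof (induction rule: trig_poly.induct)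
  case (mono c u)
  then show ?case by (rule trig_poly_mult_mono)
next
  case (add f f')
  then show ?case using trig_poly.add[of "\<lambda>x. f x * g x" "\<lambda>x. f' x * g x"] by (simp add: distrib_right)
qed

lemma trig_poly_sum: "finite I \<Longrightarrow> (\<And>i. i \<in> I \<Longrightarrow> trig_poly (f i)) \<Longrightarrow> trig_poly (\<lambda>x. \<Sum>i\<in>I. f i x)"
  by (induction I rule: finite_induct) (auto intro: trig_poly_const trig_poly.add)

lemma trig_poly_cos_sin:
  "trig_poly (\<lambda>x. complex_of_real (cos (u \<bullet> x)))" "trig_poly (\<lambda>x. complex_of_real (sin (u \<bullet> x)))"
proof -
  have eq: "complex_of_real (cos (u \<bullet> x)) = 1 / 2 * iexp (u \<bullet> x) + 1 / 2 * iexp ((-u) \<bullet> x)" for x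
    by (simp add: cos_exp_eq add_divide_distrib flip: cos_of_real)
  show "trig_poly (\<lambda>x. complex_of_real (cos (u \<bullet> x)))"
    unfolding eq by (intro trig_poly.intros)
  have eq': "complex_of_real (sin (u \<bullet> x)) = 1 / (2 * \<i>) * iexp (u \<bullet> x) + (- 1 / (2 * \<i>)) * iexp ((-u) \<bullet> x)" for x
    by (simp add: sin_exp_eq field_simps flip: sin_of_real)
  show "trig_poly (\<lambda>x. complex_of_real (sin (u \<bullet> x)))"
    unfolding eq' by (intro trig_poly.intros)
qed

text \<open>The coordinatewise covering of a torus with period \<open>2 * L\<close>: the cube of
  half side \<open>L\<close> is mapped onto a compact torus, opposite faces being glued.\<close>

definition torus_map :: "real \<Rightarrow> real^'d \<Rightarrow> complex^'d" where
  "torus_map L x = (\<chi> i. cis (pi * x $ i / L))"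

text \<open>A real linear functional of the torus point combines the real and imaginary parts of its
  coordinates, which are cosines and sines of linear forms in \<open>x\<close>. Polynomials follow
  because trigonometric polynomials form an algebra.\<close>

lemma trig_poly_torus:
  fixes h :: "complex^'d \<Rightarrow> real"
  assumes "real_polynomial_function h"
  shows "trig_poly (\<lambda>x. complex_of_real (h (torus_map L x)))"
  using assms
proof (induction rule: real_polynomial_function.induct)
  case (linear l)
  have expand: "l z = (\<Sum>b\<in>Basis. (z \<bullet> b) * l b)" for z
  proof -
    have lin: "linear l" using linear by (rule bounded_linear.linear)
    have "l z = l (\<Sum>b\<in>Basis. (z \<bullet> b) *\<^sub>R b)" by (simp only: euclidean_representation)
    also have "\<dots> = (\<Sum>b\<in>Basis. l ((z \<bullet> b) *\<^sub>R b))" by (rule linear_sum[OF lin])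
    also have "\<dots> = (\<Sum>b\<in>Basis. (z \<bullet> b) * l b)" by (simp add: linear_scale[OF lin])
    finally show ?thesis .
  qed
  have *: "(\<lambda>x. complex_of_real (l (torus_map L x))) =
      (\<lambda>x. \<Sum>b\<in>Basis. complex_of_real (torus_map L x \<bullet> b) * complex_of_real (l b))"
    by (rule ext, subst expand) (simp only: of_real_sum of_real_mult)
  have "trig_poly (\<lambda>x. complex_of_real (torus_map L x \<bullet> b))" if "b \<in> Basis" for b :: "complex^'d"
  proof -
    from that obtain i c where b: "b = axis i c" "c \<in> Basis"
      by (auto simp: Basis_vec_def)
    then have "c = 1 \<or> c = \<i>" by (auto simp: Basis_complex_def)
    moreover have "pi * x $ i / L = (axis i (pi / L)) \<bullet> x" for x :: "real^'d"
      by (simp add: inner_axis' mult.commute)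
    ultimately show ?thesis using b trig_poly_cos_sin[of "axis i (pi / L)"]
      by (auto simp: torus_map_def inner_axis inner_complex_def)
  qed
  then show ?case unfolding * by (intro trig_poly_sum trig_poly_mult trig_poly_const) auto
next
  case (const c)
  show ?case by (rule trig_poly_const)
next
  case (add f g)
  show ?case using trig_poly.add[OF add.IH] by simp
next
  case (mult f g)
  show ?case using trig_poly_mult[OF mult.IH] by simp
qed

text \<open>Points with equal images differ by multiples of \<open>2 * L\<close> in each coordinate,
  which inside the cube is possible only between opposite faces. A function that vanishes on the
  faces is therefore well defined on the torus.\<close>

lemma torus_map_inj:
  fixes x y :: "real^'d"
  assumes L: "L > 0" and eq: "torus_map L x = torus_map L y"
    and x: "\<And>i. \<bar>x $ i\<bar> \<le> L" and y: "\<And>i. \<bar>y $ i\<bar> \<le> L"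
  shows "x = y \<or> (\<exists>i. \<bar>x $ i\<bar> = L) \<and> (\<exists>i. \<bar>y $ i\<bar> = L)"
proof (cases "x = y")
  case False
  then obtain i where i: "x $ i \<noteq> y $ i" by (auto simp: vec_eq_iff)
  have "cis (pi * x $ i / L) = cis (pi * y $ i / L)" using eq by (simp add: torus_map_def vec_eq_iff)
  then have "sin (pi * x $ i / L) = sin (pi * y $ i / L) \<and> cos (pi * x $ i / L) = cos (pi * y $ i / L)"
    by (auto simp: complex_eq_iff)
  then obtain n :: int where n: "pi * x $ i / L = pi * y $ i / L + 2 * pi * of_int n"
    using sin_cos_eq_iff by blast
  have "pi * x $ i / L = pi * (y $ i / L + 2 * of_int n)" using n by (simp add: algebra_simps)
  then have "x $ i / L = y $ i / L + 2 * of_int n"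
    by (metis mult_left_cancel pi_neq_zero times_divide_eq_right)
  then have d: "x $ i = y $ i + 2 * of_int n * L" using L by (simp add: field_simps)
  have n0: "n \<noteq> 0" using d i by auto
  have "\<bar>2 * of_int n * L\<bar> \<le> 2 * L" using d x[of i] y[of i] by linarith
  then have "\<bar>real_of_int n\<bar> \<le> 1" using L by (simp add: abs_mult)
  then have "n = 1 \<or> n = -1" using n0 by linarith
  then have "x $ i = L \<and> y $ i = - L \<or> x $ i = - L \<and> y $ i = L"
    using d x[of i] y[of i] by auto
  then have "\<bar>x $ i\<bar> = L" "\<bar>y $ i\<bar> = L" using L by auto
  then show ?thesis by blast
qed simp

text \<open>Reduction of each coordinate modulo \<open>2 * L\<close>. For functions of the torus
  point it carries a bound on the cube over to the whole space.\<close>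

lemma torus_map_surj:
  fixes x :: "real^'d"
  assumes L: "L > 0"
  shows "\<exists>y. (\<forall>i. \<bar>y $ i\<bar> \<le> L) \<and> torus_map L y = torus_map L x"
proof -
  define n where "n i = \<lfloor>(x $ i + L) / (2 * L)\<rfloor>" for i
  define y :: "real^'d" where "y = (\<chi> i. x $ i - 2 * L * of_int (n i))"
  have "\<bar>y $ i\<bar> \<le> L" for i
  proof -
    have "of_int (n i) \<le> (x $ i + L) / (2 * L)" "(x $ i + L) / (2 * L) < of_int (n i) + 1"
      unfolding n_def by linarith+
    then have "of_int (n i) * (2 * L) \<le> x $ i + L" "x $ i + L < (of_int (n i) + 1) * (2 * L)"
      using L by (simp_all add: field_simps)
    then show ?thesis by (simp add: y_def algebra_simps abs_le_iff)
  qed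
  moreover have "cis (pi * y $ i / L) = cis (pi * x $ i / L)" for i
  proof -
    have "pi * y $ i / L = pi * x $ i / L + 2 * pi * of_int (- n i)"
      using L by (simp add: y_def field_simps)
    then show ?thesis
      using sin_cos_eq_iff[of "pi * y $ i / L" "pi * x $ i / L"] by (metis complex_eq_iff cis.sel)
  qed
  ultimately show ?thesis unfolding torus_map_def by (intro exI[of _ y]) simp
qed

text \<open>A function vanishing on the faces of the cube descends to the torus, where
  Stone-Weierstrass applies. The approximant is periodic: it is close to \<open>\<phi>\<close> only
  in the cube, but its bound \<open>B + e\<close> holds everywhere.\<close>

lemma trig_approximation:
  fixes \<phi> :: "real^'d \<Rightarrow> real"
  assumes cont: "continuous_on UNIV \<phi>" and L: "L > 0" and e: "e > 0"
    and bd: "\<And>x. \<bar>\<phi> x\<bar> \<le> B"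
    and zero: "\<And>x i. \<bar>x $ i\<bar> = L \<Longrightarrow> \<phi> x = 0"
  obtains g :: "real^'d \<Rightarrow> real" where "trig_poly (\<lambda>x. of_real (g x))"
    "\<And>x. (\<And>i. \<bar>x $ i\<bar> \<le> L) \<Longrightarrow> \<bar>\<phi> x - g x\<bar> < e" "\<And>x. \<bar>g x\<bar> \<le> B + e"
proof -
  define K where "K = {x :: real^'d. \<forall>i. \<bar>x $ i\<bar> \<le> L}"
  have Kbox: "K = cbox (\<chi> i. -L) (\<chi> i. L)"
    by (auto simp: K_def mem_box_cart abs_le_iff)
      (metis minus_le_iff)+
  have K: "compact K" unfolding Kbox by (rule compact_cbox)
  have ce: "continuous_on A (torus_map L)" for A :: "(real^'d) set"
    unfolding torus_map_def[abs_def] by (intro continuous_on_vec_lambda continuous_intros) (use L in auto)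
  define T where "T = torus_map L ` K"
  have T: "compact T" unfolding T_def by (rule compact_continuous_image[OF ce K])
  define F where "F z = \<phi> (SOME x. x \<in> K \<and> torus_map L x = z)" for z
  have F: "F (torus_map L x) = \<phi> x" if x: "x \<in> K" for x
  proof -
    define y where "y = (SOME y. y \<in> K \<and> torus_map L y = torus_map L x)"
    have y: "y \<in> K \<and> torus_map L y = torus_map L x"
      unfolding y_def by (rule someI[of _ x]) (use x in simp)
    have "\<phi> y = \<phi> x"
      using torus_map_inj[OF L, of y x] x y zero unfolding K_def by (metis mem_Collect_eq)
    then show ?thesis by (simp add: F_def y_def)
  qed
  \<comment> \<open>By closed preimages: the preimage of a closed set under \<open>F\<close> is the
    image under \<open>torus_map L\<close> of a compact subset of the cube.\<close>
  have "continuous_on T F"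
    unfolding continuous_on_closed_vimage[OF compact_imp_closed[OF T]]
  proof (intro allI impI)
    fix C :: "real set" assume C: "closed C"
    have "F -` C \<inter> T = torus_map L ` (\<phi> -` C \<inter> K)"
      unfolding T_def using F by auto
    moreover have "closed (\<phi> -` C)" using cont C by (simp add: continuous_closed_vimage continuous_on_eq_continuous_at)
    then have "compact (\<phi> -` C \<inter> K)" using K by (simp add: closed_Int_compact)
    then have "compact (torus_map L ` (\<phi> -` C \<inter> K))" by (rule compact_continuous_image[OF ce])
    ultimately show "closed (F -` C \<inter> T)" by (simp add: compact_imp_closed)
  qed
  then obtain h where h: "real_polynomial_function h" "\<And>z. z \<in> T \<Longrightarrow> \<bar>F z - h z\<bar> < e"
    using Stone_Weierstrass_real_polynomial_function[OF T _ e] by metis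
  define g where "g x = h (torus_map L x)" for x
  have near: "\<bar>\<phi> x - g x\<bar> < e" if "x \<in> K" for x
    using h(2)[of "torus_map L x"] that F[OF that] by (simp add: g_def T_def)
  show ?thesis
  proof (rule that[of g])
    show "trig_poly (\<lambda>x. of_real (g x))" unfolding g_def by (rule trig_poly_torus[OF h(1)])
    show "\<bar>\<phi> x - g x\<bar> < e" if "\<And>i. \<bar>x $ i\<bar> \<le> L" for x using near[of x] that by (simp add: K_def)
    show "\<bar>g x\<bar> \<le> B + e" for x
    proof -
      obtain y where y: "\<forall>i. \<bar>y $ i\<bar> \<le> L" "torus_map L y = torus_map L x"
        using torus_map_surj[OF L, of x] by auto
      then have "g x = g y" by (simp add: g_def)
      moreover have "\<bar>\<phi> y - g y\<bar> < e" using near y by (simp add: K_def)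
      ultimately show ?thesis using bd[of y] by linarith
    qed
  qed
qed

section \<open>From characteristic functions to bounded continuous test functions\<close>

lemma trig_poly_integral_tendsto:
  fixes V :: "nat \<Rightarrow> 'a \<Rightarrow> real^'d"
  assumes M: "prob_space M" and N: "prob_space N" "sets N = sets borel"
    and V [measurable]: "\<And>n. V n \<in> borel_measurable M"
    and ch: "\<And>u. (\<lambda>n. \<integral>x. iexp (u \<bullet> V n x) \<partial>M) \<longlonglongrightarrow> (\<integral>x. iexp (u \<bullet> x) \<partial>N)"
    and g: "trig_poly g"
  shows "(\<lambda>n. \<integral>x. g (V n x) \<partial>M) \<longlonglongrightarrow> (\<integral>x. g x \<partial>N) \<and>
    (\<forall>n. integrable M (\<lambda>x. g (V n x))) \<and> integrable N g"
  using g
proof (induction rule: trig_poly.induct)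
  case (mono c u)
  interpret M: prob_space M by fact
  interpret N: prob_space N by fact
  have [measurable]: "(\<lambda>x. iexp (u \<bullet> x)) \<in> borel_measurable N"
    using N(2) by (simp cong: measurable_cong_sets)
  have "integrable M (\<lambda>x. iexp (u \<bullet> V n x))" for n
    by (rule M.integrable_const_bound[where B=1]) auto
  moreover have "integrable N (\<lambda>x. iexp (u \<bullet> x))"
    by (rule N.integrable_const_bound[where B=1]) auto
  ultimately show ?case using tendsto_mult_left[OF ch[of u], of c] by simp
next
  case (add f g)
  then show ?case by (simp add: tendsto_add)
qed

text \<open>A test function, cut off outside a large ball, is replaced by a trigonometric
  polynomial. The common second moment bound takes the place of tightness: where the approximation
  fails, the error is bounded by a small multiple of \<open>(norm x)\<^sup>2\<close>.\<close>

theorem cramer_wold_conv: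
  fixes V :: "nat \<Rightarrow> 'a \<Rightarrow> real^'d"
  assumes M: "prob_space M" and N: "prob_space N" "sets N = sets borel"
    and V [measurable]: "\<And>n. V n \<in> borel_measurable M"
    and ch: "\<And>u. (\<lambda>n. \<integral>x. iexp (u \<bullet> V n x) \<partial>M) \<longlonglongrightarrow> (\<integral>x. iexp (u \<bullet> x) \<partial>N)"
    and sqM: "\<And>n. integrable M (\<lambda>x. (norm (V n x))\<^sup>2)" "\<And>n. (\<integral>x. (norm (V n x))\<^sup>2 \<partial>M) \<le> C"
    and sqN: "integrable N (\<lambda>x. (norm x)\<^sup>2)" "(\<integral>x. (norm x)\<^sup>2 \<partial>N) \<le> C"
  shows "conv_in_distr M V N"
  unfolding conv_in_distr_def
proof (intro conjI allI impI V)
  fix f :: "real^'d \<Rightarrow> real"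
  assume f: "continuous_on UNIV f" and bf: "bounded (range f)"
  interpret M: prob_space M by fact
  interpret N: prob_space N by fact
  obtain B where B: "\<And>x. \<bar>f x\<bar> \<le> B" using bf by (auto simp: bounded_iff)
  have B0: "B \<ge> 0" using B[of 0] by linarith
  have C0: "C \<ge> 0" using sqN(2) by (rule order_trans[rotated]) simp
  have fm [measurable]: "f \<in> borel_measurable borel" by (rule borel_measurable_continuous_onI[OF f])
  have fN [measurable]: "f \<in> borel_measurable N" using N(2) by (simp cong: measurable_cong_sets)
  have if1: "integrable M (\<lambda>x. f (V n x))" for n
    by (rule M.integrable_const_bound[where B=B]) (use B in auto)
  have if2: "integrable N f"
    by (rule N.integrable_const_bound[where B=B]) (use B in auto)
  have "(\<lambda>n. \<integral>x. f (V n x) \<partial>M) \<longlonglongrightarrow> (\<integral>x. f x \<partial>N)"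
  proof (rule LIMSEQ_I)
    fix r :: real assume r: "0 < r"
    define e where "e = min 1 (r / 8)"
    have e: "0 < e" "e \<le> 1" "8 * e \<le> r" using r by (auto simp: e_def)
    \<comment> \<open>Chosen so that \<open>c * C \<le> e\<close> for the constant
      \<open>c = (2 * B + 1) * (4 / L\<^sup>2)\<close> defined further down; the summand 1 keeps
      \<open>L\<close> positive when \<open>C = 0\<close>.\<close>
    define L where "L = sqrt ((8 * B + 4) * C / e) + 1"
    have L1: "L \<ge> 1" "(8 * B + 4) * C / e \<le> L\<^sup>2"
    proof -
      have "0 \<le> (8 * B + 4) * C / e" using B0 C0 e by simp
      then show "L \<ge> 1" by (simp add: L_def)
      have "(8 * B + 4) * C / e = (sqrt ((8 * B + 4) * C / e))\<^sup>2" using B0 C0 e by simp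
      also have "\<dots> \<le> L\<^sup>2" unfolding L_def using B0 C0 e by (intro power_mono) auto
      finally show "(8 * B + 4) * C / e \<le> L\<^sup>2" .
    qed
    define k where "k x = max 0 (min 1 (2 - 2 * norm x / L))" for x :: "real^'d"
    have k01: "0 \<le> k x" "k x \<le> 1" for x by (auto simp: k_def)
    have k1: "k x = 1" if "norm x \<le> L / 2" for x
      using that L1 by (simp add: k_def field_simps)
    have k0: "k x = 0" if "norm x \<ge> L" for x
      using that L1 by (simp add: k_def field_simps)
    have "continuous_on UNIV k" unfolding k_def[abs_def] by (intro continuous_intros)(use L1 in auto)
    then have cont: "continuous_on UNIV (\<lambda>x. f x * k x)" by (intro continuous_intros f)
    have bk: "\<bar>f x * k x\<bar> \<le> B" for x
      using mult_mono[OF B[of x] k01(2)[of x]] B0 k01[of x] by (simp add: abs_mult)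
    obtain g where g: "trig_poly (\<lambda>x. complex_of_real (g x))"
      "\<And>x. (\<And>i. \<bar>x $ i\<bar> \<le> L) \<Longrightarrow> \<bar>f x * k x - g x\<bar> < e" "\<And>x. \<bar>g x\<bar> \<le> B + e"
    proof (rule trig_approximation[OF cont _ e(1) bk])
      show "0 < L" using L1 by simp
      show "f x * k x = 0" if "\<bar>x $ i\<bar> = L" for x i
        using k0[of x] component_le_norm_cart[of x i] that by simp
    qed blast
    define c where "c = (2 * B + 1) * (4 / L\<^sup>2)"
    have near: "\<bar>f x - g x\<bar> \<le> e + c * (norm x)\<^sup>2" for x
    proof (cases "norm x \<le> L / 2")
      case True
      have "\<bar>x $ i\<bar> \<le> L" for i
        using component_le_norm_cart[of x i] True L1 by linarith
      then have "\<bar>f x - g x\<bar> < e" using g(2)[of x] k1[OF True] by simp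
      moreover have "0 \<le> c * (norm x)\<^sup>2" using B0 by (simp add: c_def)
      ultimately show ?thesis by linarith
    next
      case False
      then have "(L / 2)\<^sup>2 \<le> (norm x)\<^sup>2" using L1 by (intro power_mono) auto
      then have "1 \<le> 4 / L\<^sup>2 * (norm x)\<^sup>2" using L1 by (simp add: field_simps power2_eq_square)
      then have "(2 * B + 1) * 1 \<le> (2 * B + 1) * (4 / L\<^sup>2 * (norm x)\<^sup>2)"
        using B0 by (intro mult_left_mono) auto
      then have "2 * B + 1 \<le> c * (norm x)\<^sup>2" by (simp only: c_def mult.assoc mult_1_right)
      moreover have "\<bar>f x - g x\<bar> \<le> 2 * B + 1 + e" using B[of x] g(3)[of x] e by linarith
      ultimately show ?thesis by linarith
    qed
    have cC: "c * C \<le> e"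
    proof -
      have "(8 * B + 4) * C \<le> e * L\<^sup>2" using L1(2) e(1) by (simp add: field_simps)
      then show ?thesis using L1 by (simp add: c_def field_simps)
    qed
    have c0: "c \<ge> 0" using B0 by (simp add: c_def)
    note tp = trig_poly_integral_tendsto[OF M N V ch g(1)]
    have ig1: "integrable M (\<lambda>x. g (V n x))" for n
    proof -
      have "integrable M (\<lambda>x. Re (complex_of_real (g (V n x))))" using tp by (intro integrable_Re) blast
      then show ?thesis by simp
    qed
    have ig2: "integrable N g"
    proof -
      have "integrable N (\<lambda>x. Re (complex_of_real (g x)))" using tp by (intro integrable_Re) blast
      then show ?thesis by simp
    qed
    have d1: "\<bar>(\<integral>x. f (V n x) \<partial>M) - (\<integral>x. g (V n x) \<partial>M)\<bar> \<le> 2 * e" for n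
    proof -
      have "\<bar>(\<integral>x. f (V n x) \<partial>M) - (\<integral>x. g (V n x) \<partial>M)\<bar> = \<bar>\<integral>x. f (V n x) - g (V n x) \<partial>M\<bar>"
        using if1 ig1 by simp
      also have "\<dots> \<le> (\<integral>x. \<bar>f (V n x) - g (V n x)\<bar> \<partial>M)" by (rule integral_abs_bound)
      also have "\<dots> \<le> (\<integral>x. e + c * (norm (V n x))\<^sup>2 \<partial>M)"
        by (intro integral_mono near) (use if1 ig1 sqM in auto)
      also have "\<dots> = e + c * (\<integral>x. (norm (V n x))\<^sup>2 \<partial>M)" using sqM(1) by (simp add: M.prob_space)
      also have "\<dots> \<le> e + c * C" using sqM(2)[of n] c0 by (simp add: mult_left_mono)
      finally show ?thesis using cC by linarith
    qed
    have d2: "\<bar>(\<integral>x. f x \<partial>N) - (\<integral>x. g x \<partial>N)\<bar> \<le> 2 * e"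
    proof -
      have "\<bar>(\<integral>x. f x \<partial>N) - (\<integral>x. g x \<partial>N)\<bar> = \<bar>\<integral>x. f x - g x \<partial>N\<bar>"
        using if2 ig2 by simp
      also have "\<dots> \<le> (\<integral>x. \<bar>f x - g x\<bar> \<partial>N)" by (rule integral_abs_bound)
      also have "\<dots> \<le> (\<integral>x. e + c * (norm x)\<^sup>2 \<partial>N)"
        by (intro integral_mono near) (use if2 ig2 sqN in auto)
      also have "\<dots> = e + c * (\<integral>x. (norm x)\<^sup>2 \<partial>N)" using sqN(1) by (simp add: N.prob_space)
      also have "\<dots> \<le> e + c * C" using sqN(2) c0 by (simp add: mult_left_mono)
      finally show ?thesis using cC by linarith
    qed
    have "(\<lambda>n. Re (\<integral>x. complex_of_real (g (V n x)) \<partial>M)) \<longlonglongrightarrow> Re (\<integral>x. complex_of_real (g x) \<partial>N)"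
      using tp by (intro tendsto_Re) blast
    then have "(\<lambda>n. \<integral>x. g (V n x) \<partial>M) \<longlonglongrightarrow> (\<integral>x. g x \<partial>N)" by simp
    from LIMSEQ_D[OF this e(1)] obtain n0 where
      n0: "\<And>n. n \<ge> n0 \<Longrightarrow> \<bar>(\<integral>x. g (V n x) \<partial>M) - (\<integral>x. g x \<partial>N)\<bar> < e" by auto
    show "\<exists>no. \<forall>n\<ge>no. norm ((\<integral>x. f (V n x) \<partial>M) - (\<integral>x. f x \<partial>N)) < r"
    proof (intro exI allI impI)
      fix n assume "n \<ge> n0"
      from n0[OF this] d1[of n] d2 e show "norm ((\<integral>x. f (V n x) \<partial>M) - (\<integral>x. f x \<partial>N)) < r"
        by simp
    qed
  qed
  then show "(\<lambda>n. \<integral>x. f x \<partial>distr M borel (V n)) \<longlonglongrightarrow> (\<integral>x. f x \<partial>N)"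
    by (simp add: integral_distr)
qed

section \<open>Gaussian laws with a given covariance\<close>

definition qform :: "('d::finite \<Rightarrow> 'd \<Rightarrow> real) \<Rightarrow> ('d \<Rightarrow> real) \<Rightarrow> real" where
  "qform K u = (\<Sum>i\<in>UNIV. \<Sum>j\<in>UNIV. u i * u j * K i j)"

text \<open>The argument is \<open>x\<close> times the \<open>i\<close>-th plus \<open>y\<close>
  times the \<open>l\<close>-th unit vector. The case \<open>i = l\<close> is included and yields
  the diagonal entries.\<close>

lemma qform_two:
  fixes K :: "'d::finite \<Rightarrow> 'd \<Rightarrow> real"
  assumes "\<And>i j. K i j = K j i"
  shows "qform K (\<lambda>k. (if k = i then x else 0) + (if k = l then y else 0)) =
    x\<^sup>2 * K i i + 2 * x * y * K i l + y\<^sup>2 * K l l"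
proof -
  have "qform K (\<lambda>k. (if k = i then x else 0) + (if k = l then y else 0)) =
    x * x * K i i + x * y * K i l + (y * x * K l i + y * y * K l l)"
    unfolding qform_def
    by (simp add: distrib_right distrib_left sum.distrib if_distrib[of "\<lambda>z. z * _"] if_distrib[of "\<lambda>z. _ * z"]
        sum.delta cong: if_cong)
  then show ?thesis using assms[of l i] by (simp add: power2_eq_square)
qed

text \<open>Symmetric Gaussian elimination: subtracting the rank one form through a nonzero diagonal
  entry \<open>K l l\<close> preserves positivity and clears that entry, while zero diagonal entries
  stay zero. The induction is on the number of nonzero diagonal entries.\<close>

lemma psd_decomposition:
  fixes K :: "'d::finite \<Rightarrow> 'd \<Rightarrow> real"
  assumes "\<And>i j. K i j = K j i" "\<And>u. qform K u \<ge> 0"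
  shows "\<exists>(r::nat) a. \<forall>i j. K i j = (\<Sum>k<r. a k i * a k j)"
  using assms
proof (induction "card {i. K i i \<noteq> 0}" arbitrary: K rule: less_induct)
  case (less K)
  note sym = less.prems(1) and psd = less.prems(2)
  have two: "x\<^sup>2 * K i i + 2 * x * y * K i l + y\<^sup>2 * K l l \<ge> 0" for i l x y
    using psd[of "\<lambda>k. (if k = i then x else 0) + (if k = l then y else 0)"] qform_two[of K, OF sym] by simp
  \<comment> \<open>With \<open>K i i = 0\<close> the form is affine in the coefficient
    \<open>x\<close>, hence bounded below only if the mixed entry vanishes; the contradiction is
    taken at the \<open>x\<close> where the value would be -1.\<close>
  have zero: "K i l = 0" if i: "K i i = 0" for i l
  proof (rule ccontr)
    assume n: "K i l \<noteq> 0"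
    have "2 * x * K i l + K l l \<ge> 0" for x using two[of x i 1 l] i by simp
    from this[of "(- 1 - K l l) / (2 * K i l)"] n show False by (simp add: field_simps)
  qed
  show ?case
  proof (cases "\<exists>l. K l l \<noteq> 0")
    case False
    then have "K i j = 0" for i j using zero by simp
    then show ?thesis by (intro exI[of _ 0] exI[of _ "\<lambda>_ _. 0"]) simp
  next
    case True
    then obtain l where l: "K l l \<noteq> 0" by blast
    with two[of 1 l 0 l] have lpos: "K l l > 0" by simp
    define K' where "K' i j = K i j - K i l * K l j / K l l" for i j
    have sym': "K' i j = K' j i" for i j
      unfolding K'_def using sym[of i j] sym[of i l] sym[of j l] by simp
    have psd': "qform K' u \<ge> 0" for u
    proof -
      \<comment> \<open>Subtracting \<open>t\<close> times the \<open>l\<close>-th unit vector from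
        \<open>u\<close> minimises the form along that axis, and the minimum is the value of the
        reduced form \<open>K'\<close> at \<open>u\<close>.\<close>
      define t where "t = (\<Sum>j\<in>UNIV. u j * K l j) / K l l"
      have t: "(\<Sum>j\<in>UNIV. u j * K l j) = t * K l l" using l by (simp add: t_def)
      have t': "(\<Sum>j\<in>UNIV. u j * K j l) = t * K l l"
        unfolding t[symmetric] by (rule sum.cong[OF refl], rule arg_cong[OF sym])
      define \<delta> where "\<delta> k = (if k = l then t else 0)" for k
      have \<delta>: "(\<Sum>j\<in>UNIV. \<delta> j * g j) = t * g l" for g :: "'d \<Rightarrow> real"
      proof -
        have "\<delta> j * g j = (if j = l then t * g l else 0)" for j by (simp add: \<delta>_def)
        then show ?thesis by simp
      qed
      have pull: "(\<Sum>i\<in>UNIV. \<Sum>j\<in>UNIV. a i * b j * K i j) = (\<Sum>i\<in>UNIV. a i * (\<Sum>j\<in>UNIV. b j * K i j))" for a b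
        by (simp only: sum_distrib_left mult.assoc)
      have 1: "(\<Sum>i\<in>UNIV. \<Sum>j\<in>UNIV. u i * \<delta> j * K i j) = t * (t * K l l)"
        unfolding pull \<delta> mult.left_commute[of "u _" t] sum_distrib_left[symmetric] t' ..
      have 2: "(\<Sum>i\<in>UNIV. \<Sum>j\<in>UNIV. \<delta> i * u j * K i j) = t * (t * K l l)"
        unfolding pull \<delta> t ..
      have 3: "(\<Sum>i\<in>UNIV. \<Sum>j\<in>UNIV. \<delta> i * \<delta> j * K i j) = t * (t * K l l)"
        unfolding pull \<delta> ..
      have 4: "(\<Sum>i\<in>UNIV. \<Sum>j\<in>UNIV. u i * u j * (K i l * K l j / K l l)) = t * (t * K l l)"
      proof -
        have "(\<Sum>i\<in>UNIV. \<Sum>j\<in>UNIV. u i * u j * (K i l * K l j / K l l)) =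
            (\<Sum>i\<in>UNIV. u i * K i l) * (\<Sum>j\<in>UNIV. u j * K l j) / K l l"
          unfolding sum_product sum_divide_distrib by (intro sum.cong refl) simp
        then show ?thesis using l by (simp only: t t') simp
      qed
      have "qform K (\<lambda>k. u k - \<delta> k) = qform K u - t * (t * K l l)"
        unfolding qform_def left_diff_distrib right_diff_distrib sum_subtractf 1 2 3 by simp
      also have "\<dots> = qform K' u"
        unfolding qform_def K'_def right_diff_distrib sum_subtractf 4 ..
      finally show ?thesis using psd[of "\<lambda>k. u k - \<delta> k"] by simp
    qed
    have "{i. K' i i \<noteq> 0} \<subset> {i. K i i \<noteq> 0}"
    proof
      show "{i. K' i i \<noteq> 0} \<subseteq> {i. K i i \<noteq> 0}" using zero by (auto simp: K'_def)
      have "K' l l = 0" using l by (simp add: K'_def)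
      with l show "{i. K' i i \<noteq> 0} \<noteq> {i. K i i \<noteq> 0}" by auto
    qed
    then have "card {i. K' i i \<noteq> 0} < card {i. K i i \<noteq> 0}" by (intro psubset_card_mono) auto
    from less.hyps[OF this sym' psd'] obtain r :: nat and a
      where ra: "\<And>i j. K' i j = (\<Sum>k<r. a k i * a k j)" by blast
    define b where "b k i = (if k = r then K i l / sqrt (K l l) else a k i)" for k i
    have "K i j = (\<Sum>k<Suc r. b k i * b k j)" for i j
    proof -
      have "(\<Sum>k<Suc r. b k i * b k j) = (\<Sum>k<r. a k i * a k j) + K i l * K j l / K l l"
        using lpos by (simp add: b_def)
      also have "\<dots> = K i j" using sym[of j l] by (simp add: ra[symmetric] K'_def)
      finally show ?thesis by simp
    qed
    then show ?thesis by blast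
  qed
qed

text \<open>The degenerate case \<open>s = 0\<close> is carried along, so that projections of a
  Gaussian vector onto null directions are treated together with the others.\<close>

lemma normal_law_moments:
  fixes s :: real
  assumes s: "s \<ge> 0"
  defines "N \<equiv> (if s = 0 then return borel 0 else density lborel (\<lambda>t. ennreal (normal_density 0 s t)))"
  shows "prob_space N" "sets N = sets borel" "(\<integral>t. t \<partial>N) = 0" "(\<integral>t. t\<^sup>2 \<partial>N) = s\<^sup>2"
    "integrable N (\<lambda>t. t\<^sup>2)" "char N t = exp (- (t\<^sup>2 * s\<^sup>2 / 2))"
proof -
  have "prob_space N \<and> sets N = sets borel \<and> (\<integral>t. t \<partial>N) = 0 \<and> (\<integral>t. t\<^sup>2 \<partial>N) = s\<^sup>2 \<and>
    integrable N (\<lambda>t. t\<^sup>2) \<and> char N t = exp (- (t\<^sup>2 * s\<^sup>2 / 2))"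
  proof (cases "s = 0")
    case True
    have 1: "prob_space (return borel (0::real))" by (rule prob_space_return) simp
    have 2: "integrable (return borel (0::real)) (\<lambda>t. t\<^sup>2)"
      by (intro integrableI_bounded) (auto simp: nn_integral_return)
    show ?thesis using True 1 2 by (simp add: N_def integral_return char_def)
  next
    case False
    with s have s: "s > 0" by simp
    have N: "N = density lborel (\<lambda>t. ennreal (normal_density 0 s t))" using False by (simp add: N_def)
    have a1: "(\<integral>t. t \<partial>N) = 0"
      unfolding N using integral_normal_moment_nz_1[OF s, of 0] by (subst integral_density) auto
    have a2: "(\<integral>t. t\<^sup>2 \<partial>N) = s\<^sup>2"
      unfolding N using integral_normal_moment_even[OF s, of 0 1]
      by (subst integral_density) (auto simp: fact_numeral)
    have a3: "integrable N (\<lambda>t. t\<^sup>2)"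
      unfolding N using integrable_normal_moment[OF s, of 0 2]
      by (subst integrable_density) auto
    have a4: "prob_space N" unfolding N by (rule prob_space_normal_density[OF s])
    have N': "N = distr std_normal_distribution borel (\<lambda>x. s * x)"
    proof -
      have d: "distributed std_normal_distribution lborel (\<lambda>x. x) (std_normal_density)"
        unfolding distributed_def by (auto simp: distr_id2)
      interpret prob_space std_normal_distribution by (rule prob_space_normal_density) simp
      have "distributed std_normal_distribution lborel (\<lambda>x. 0 + s * x) (normal_density (0 + s * 0) (\<bar>s\<bar> * 1))"
        by (rule normal_density_affine[OF d]) (use s in auto)
      then show ?thesis using s unfolding N distributed_def by (auto cong: distr_cong)
    qed
    have a5: "char N t = exp (- (t\<^sup>2 * s\<^sup>2 / 2))"
    proof -
      have "char N t = (\<integral>x. iexp (t * (s * x)) \<partial>std_normal_distribution)"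
        unfolding N' char_def by (subst integral_distr) auto
      also have "\<dots> = char std_normal_distribution (t * s)" by (simp add: char_def mult.assoc)
      also have "\<dots> = exp (- (t\<^sup>2 * s\<^sup>2 / 2))"
        by (simp add: char_std_normal_distribution power_mult_distrib)
      finally show ?thesis .
    qed
    show ?thesis using a1 a2 a3 a4 a5 by (simp add: N)
  qed
  then show "prob_space N" "sets N = sets borel" "(\<integral>t. t \<partial>N) = 0" "(\<integral>t. t\<^sup>2 \<partial>N) = s\<^sup>2"
    "integrable N (\<lambda>t. t\<^sup>2)" "char N t = exp (- (t\<^sup>2 * s\<^sup>2 / 2))" by blast+
qed

text \<open>The law of a combination of the vectors \<open>v k\<close> with independent standard
  normal coefficients. A projection has the characteristic function of a centred normal law,
  possibly degenerate, and is that law by uniqueness.\<close>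

theorem gaussian_law_exists:
  fixes K :: "'d::finite \<Rightarrow> 'd \<Rightarrow> real"
  assumes sym: "\<And>i j. K i j = K j i" and psd: "\<And>u. qform K u \<ge> 0"
  obtains N :: "(real^'d) measure" where "gaussian_law N"
    "\<And>i. (\<integral>x. x $ i \<partial>N) = 0" "\<And>i. (\<integral>x. (x $ i)\<^sup>2 \<partial>N) = K i i"
    "integrable N (\<lambda>x. (norm x)\<^sup>2)"
    "\<And>u. (\<integral>x. iexp (u \<bullet> x) \<partial>N) = exp (- (qform K (($) u) / 2))"
proof -
  obtain r :: nat and a where a: "\<And>i j. K i j = (\<Sum>k<r. a k i * a k j)"
    using psd_decomposition[OF sym psd] by blast
  define v :: "nat \<Rightarrow> real^'d" where "v k = (\<chi> i. a k i)" for k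
  define G :: "(nat \<Rightarrow> real) measure" where "G = Pi\<^sub>M {..<r} (\<lambda>_. std_normal_distribution)"
  define h where "h g = (\<Sum>k<r. g k *\<^sub>R v k)" for g
  have pn: "prob_space std_normal_distribution" by (rule prob_space_normal_density) simp
  interpret PG: product_prob_space "\<lambda>_. std_normal_distribution" "{..<r}"
    by (intro product_prob_spaceI pn)
  interpret prob_space G unfolding G_def by (rule PG.prob_space_axioms)
  have gm [measurable]: "(\<lambda>g. g k) \<in> borel_measurable G" if "k < r" for k
  proof -
    have "(\<lambda>g. g k) \<in> measurable G std_normal_distribution"
      unfolding G_def using that by (intro measurable_component_singleton) auto
    then show ?thesis by simp
  qed
  have hm [measurable]: "h \<in> borel_measurable G"
    unfolding h_def by (intro borel_measurable_sum borel_measurable_scaleR gm) auto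
  define N where "N = distr G borel h"
  have N: "prob_space N" "sets N = sets borel"
    unfolding N_def by (auto intro: prob_space_distr hm)
  interpret N: prob_space N by fact
  have meas: "f \<in> borel_measurable N \<longleftrightarrow> f \<in> borel_measurable borel" for f :: "real^'d \<Rightarrow> 'b::topological_space"
    using N(2) by (simp cong: measurable_cong_sets)
  have Q: "qform K (($) u) = (\<Sum>k<r. (u \<bullet> v k)\<^sup>2)" for u
  proof -
    have "qform K (($) u) = (\<Sum>i\<in>UNIV. \<Sum>j\<in>UNIV. \<Sum>k<r. (u $ i * a k i) * (u $ j * a k j))"
      by (simp add: qform_def a sum_distrib_left mult_ac)
    also have "\<dots> = (\<Sum>i\<in>UNIV. \<Sum>k<r. \<Sum>j\<in>UNIV. (u $ i * a k i) * (u $ j * a k j))"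
      by (intro sum.cong refl sum.swap)
    also have "\<dots> = (\<Sum>k<r. \<Sum>i\<in>UNIV. \<Sum>j\<in>UNIV. (u $ i * a k i) * (u $ j * a k j))"
      by (rule sum.swap)
    also have "\<dots> = (\<Sum>k<r. (u \<bullet> v k)\<^sup>2)"
      by (simp add: power2_eq_square v_def inner_vec_def sum_product)
    finally show ?thesis .
  qed
  have ch: "(\<integral>x. iexp (u \<bullet> x) \<partial>N) = exp (- (qform K (($) u) / 2))" for u
  proof -
    have "(\<integral>x. iexp (u \<bullet> x) \<partial>N) = (\<integral>g. iexp (u \<bullet> h g) \<partial>G)"
      unfolding N_def by (subst integral_distr) auto
    also have "\<dots> = (\<integral>g. (\<Prod>k<r. iexp (u \<bullet> v k * g k)) \<partial>G)"
      by (intro Bochner_Integration.integral_cong refl)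
        (simp add: h_def inner_sum_right sum_distrib_left mult.commute flip: exp_sum)
    also have "\<dots> = (\<Prod>k<r. \<integral>x. iexp (u \<bullet> v k * x) \<partial>std_normal_distribution)"
      unfolding G_def
    proof (rule PG.product_integral_prod)
      fix k
      show "integrable std_normal_distribution (\<lambda>x. iexp (u \<bullet> v k * x))"
        by (rule finite_measure.integrable_const_bound[where B=1])
          (use pn in \<open>auto intro: prob_space.finite_measure\<close>)
    qed simp
    also have "\<dots> = (\<Prod>k<r. complex_of_real (exp (- ((u \<bullet> v k)\<^sup>2 / 2))))"
      using char_std_normal_distribution by (simp add: char_def fun_eq_iff)
    also have "\<dots> = complex_of_real (exp (\<Sum>k<r. - ((u \<bullet> v k)\<^sup>2 / 2)))"
      by (simp add: exp_sum)
    also have "(\<Sum>k<r. - ((u \<bullet> v k)\<^sup>2 / 2)) = - (qform K (($) u) / 2)"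
      by (simp add: Q sum_negf sum_divide_distrib)
    finally show ?thesis .
  qed
  define s where "s u = sqrt (qform K (($) u))" for u
  have s: "s u \<ge> 0" "(s u)\<^sup>2 = qform K (($) u)" for u
    using psd by (auto simp: s_def)
  have proj: "distr N borel (\<lambda>x. u \<bullet> x) = (if s u = 0 then return borel 0
      else density lborel (\<lambda>t. ennreal (normal_density 0 (s u) t)))" (is "_ = ?N") for u
  proof (rule Levy_uniqueness)
    have [measurable]: "(\<lambda>x. u \<bullet> x) \<in> borel_measurable N" unfolding meas by simp
    show "real_distribution (distr N borel (\<lambda>x. u \<bullet> x))"
      by (rule N.real_distribution_distr) measurable
    show "real_distribution ?N"
      using normal_law_moments(1,2)[OF s(1)[of u]] unfolding real_distribution_def real_distribution_axioms_def
      by (auto dest: sets_eq_imp_space_eq)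
    show "char (distr N borel (\<lambda>x. u \<bullet> x)) = char ?N"
    proof
      fix t
      have "char (distr N borel (\<lambda>x. u \<bullet> x)) t = (\<integral>x. iexp ((t *\<^sub>R u) \<bullet> x) \<partial>N)"
        unfolding char_def by (subst integral_distr) auto
      also have "\<dots> = exp (- (t\<^sup>2 * (s u)\<^sup>2 / 2))"
        unfolding ch s(2) by (simp add: qform_def sum_distrib_left power2_eq_square mult_ac)
      also have "\<dots> = char ?N t" by (rule normal_law_moments(6)[OF s(1), symmetric])
      finally show "char (distr N borel (\<lambda>x. u \<bullet> x)) t = char ?N t" .
    qed
  qed
  have coord: "x $ i = axis i 1 \<bullet> x" for x :: "real^'d" and i by (simp add: inner_axis')
  have Kii: "qform K (($) (axis i 1)) = K i i" for i
  proof -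
    have "(($) (axis i 1)) = (\<lambda>k. (if k = i then 1 else 0) + (if k = i then 0 else 0::real))"
      by (auto simp: axis_def)
    then show ?thesis using qform_two[of K, OF sym, of i 1 i 0] by simp
  qed
  have cm [measurable]: "(\<lambda>x. axis i 1 \<bullet> x) \<in> borel_measurable N" for i :: 'd unfolding meas by simp
  note nl = normal_law_moments[OF s(1), folded proj]
  show ?thesis
  proof (rule that[of N])
    show "gaussian_law N" unfolding gaussian_law_def using N proj s(1) by blast
    show "(\<integral>x. x $ i \<partial>N) = 0" for i
      using nl(3)[of "axis i 1"] unfolding coord by (subst (asm) integral_distr) auto
    show "(\<integral>x. (x $ i)\<^sup>2 \<partial>N) = K i i" for i
      using nl(4)[of "axis i 1"] unfolding coord by (subst (asm) integral_distr) (auto simp: s(2) Kii)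
    have "integrable N (\<lambda>x. (x $ i)\<^sup>2)" for i
      using nl(5)[of "axis i 1"] unfolding coord by (subst (asm) integrable_distr_eq) auto
    then have "integrable N (\<lambda>x. \<Sum>i\<in>UNIV. (x $ i)\<^sup>2)" by simp
    then show "integrable N (\<lambda>x. (norm x)\<^sup>2)"
      by (simp add: norm_vec_def L2_set_def sum_nonneg)
    show "(\<integral>x. iexp (u \<bullet> x) \<partial>N) = exp (- (qform K (($) u) / 2))" for u by (rule ch)
  qed
qed

section \<open>Independence of the families\<close>

text \<open>The target is countable and all its subsets are measurable, so it suffices to split over
  the values of the first summand.\<close>

lemma measurable_count_add:
  fixes f g :: "'a \<Rightarrow> 'b::{countable, plus}"
  assumes "f \<in> measurable M (count_space UNIV)" "g \<in> measurable M (count_space UNIV)"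
  shows "(\<lambda>x. f x + g x) \<in> measurable M (count_space UNIV)"
proof (rule measurable_compose_countable[OF _ assms(1)])
  fix i
  show "(\<lambda>x. i + g x) \<in> measurable M (count_space UNIV)"
    using assms(2) by measurable
qed

lemma measurable_count_sum:
  fixes f :: "'i \<Rightarrow> 'a \<Rightarrow> 'b::{countable, comm_monoid_add}"
  assumes "\<And>i. i \<in> I \<Longrightarrow> f i \<in> measurable M (count_space UNIV)"
  shows "(\<lambda>x. \<Sum>i\<in>I. f i x) \<in> measurable M (count_space UNIV)"
  using assms by (induction I rule: infinite_finite_induct) (auto intro: measurable_count_add)

lemma measurable_count_map:
  fixes f :: "'i \<Rightarrow> 'a \<Rightarrow> 'b::countable"
  assumes "\<And>i. i \<in> set is \<Longrightarrow> f i \<in> measurable M (count_space UNIV)"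
  shows "(\<lambda>x. map (\<lambda>i. f i x) is) \<in> measurable M (count_space UNIV)"
  using assms
proof (induction "is")
  case (Cons i js)
  have tail: "(\<lambda>x. map (\<lambda>i. f i x) js) \<in> measurable M (count_space UNIV)"
    by (rule Cons.IH) (use Cons.prems in auto)
  have "(\<lambda>x. f i x # map (\<lambda>i. f i x) js) \<in> measurable M (count_space UNIV)"
  proof (rule measurable_compose_countable[where g="f i"])
    fix y
    show "(\<lambda>x. y # map (\<lambda>i. f i x) js) \<in> measurable M (count_space UNIV)"
      using tail by (rule measurable_compose) simp
  qed (use Cons.prems in auto)
  then show ?case by simp
qed simp

text \<open>\<open>slot_law\<close> again, but typed as \<open>pmf\<close>: that each factor is a
  probability measure in which every set is measurable is then part of the type.\<close>

definition slot_pmf ::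
  "('s \<Rightarrow> (nat^'d) pmf) \<Rightarrow> ('d \<Rightarrow> 's \<Rightarrow> (nat^'d) pmf) \<Rightarrow> (int \<Rightarrow> 's) \<Rightarrow> 'd slot \<Rightarrow> (nat^'d) pmf"
where
  "slot_pmf q p \<omega> k = (case k of Imm n \<Rightarrow> q (\<omega> (int n - 1)) | Off n m i \<Rightarrow> p i (\<omega> (int n)))"

abbreviation slot_space :: "('d slot \<Rightarrow> nat^'d) measure" where
  "slot_space \<equiv> Pi\<^sub>M UNIV (\<lambda>_. count_space UNIV)"

lemma quenched_eq: "quenched q p \<omega> = Pi\<^sub>M UNIV (\<lambda>k. measure_pmf (slot_pmf q p \<omega> k))"
  unfolding quenched_def slot_law_def[abs_def] slot_pmf_def
  by (intro PiM_cong refl) (simp split: slot.split)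

lemma sets_quenched [measurable_cong]: "sets (quenched q p \<omega>) = sets slot_space"
  unfolding quenched_eq by (intro sets_PiM_cong) auto

lemma space_quenched [simp]: "space (quenched q p \<omega>) = UNIV"
  unfolding quenched_eq by (auto simp: space_PiM)

lemma prob_space_quenched: "prob_space (quenched q p \<omega>)"
  unfolding quenched_eq by (intro prob_space_PiM measure_pmf.prob_space_axioms)

lemma indep_vars_PiM_coordinates:
  assumes "\<And>k. prob_space (M k)"
  shows "prob_space.indep_vars (Pi\<^sub>M UNIV M) M (\<lambda>k x. x k) UNIV"
proof -
  interpret product_prob_space M UNIV by (rule product_prob_spaceI) (rule assms)
  have "distr (Pi\<^sub>M UNIV M) (Pi\<^sub>M UNIV M) (\<lambda>x. \<lambda>k\<in>UNIV. x k) = Pi\<^sub>M UNIV M"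
    by (simp add: restrict_def distr_id2)
  also have "\<dots> = Pi\<^sub>M UNIV (\<lambda>k. distr (Pi\<^sub>M UNIV M) (M k) (\<lambda>x. x k))"
    by (simp add: PiM_component)
  finally show ?thesis
    by (subst indep_vars_iff_distr_eq_PiM) auto
qed

lemma measurable_slot [measurable]: "(\<lambda>x. x k) \<in> measurable slot_space (count_space UNIV)"
  by (rule measurable_component_singleton) simp

text \<open>The generation step, with the numbering read off from a prescribed array \<open>u\<close>.\<close>

definition block_sum :: "(nat \<Rightarrow> nat \<Rightarrow> nat^'d::finite) \<Rightarrow> nat \<Rightarrow> nat \<Rightarrow> ('d slot \<Rightarrow> nat^'d) \<Rightarrow> nat^'d" where
  "block_sum u k n x = (\<Sum>i\<in>UNIV. \<Sum>m\<in>{(\<Sum>l<n. u k l $ i)<..(\<Sum>l\<le>n. u k l $ i)}. x (Off k m i))"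

lemma U_diag: "U x n n = x (Imm n)"
  by (cases n) simp_all

lemma U_Suc: "n \<le> k \<Longrightarrow> U x (Suc k) n = block_sum (U x) k n x"
  by (simp add: block_sum_def)

lemma block_sum_cong: "(\<And>l. l \<le> n \<Longrightarrow> u k l = u' k l) \<Longrightarrow> block_sum u k n x = block_sum u' k n x"
  unfolding block_sum_def
  by (intro sum.cong refl arg_cong2[where f="\<lambda>a b. {a<..b}"]) auto

lemma measurable_block_sum:
  assumes "\<And>m i. (\<lambda>x. x (Off k m i)) \<in> measurable M (count_space UNIV)"
  shows "block_sum u k n \<in> measurable M (count_space UNIV)"
  unfolding block_sum_def[abs_def] by (intro measurable_count_sum assms)

lemma measurable_U [measurable]: "(\<lambda>x. U x k n) \<in> measurable slot_space (count_space UNIV)"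
proof (induction k arbitrary: n)
  case 0
  then show ?case by (cases "n = 0") simp_all
next
  case (Suc k)
  show ?case
  proof (cases "n \<le> k")
    case True
    \<comment> \<open>The block boundaries depend on the families \<open>0\<close> to
      \<open>n\<close> of generation \<open>k\<close>. They are packed into one list, a value of a
      countable type, over which the composition can be split.\<close>
    have eq: "U x (Suc k) n = block_sum (\<lambda>_ l. map (\<lambda>l. U x k l) [0..<Suc n] ! l) k n x" for x :: "'a slot \<Rightarrow> nat^'a"
      unfolding U_Suc[OF True] by (rule block_sum_cong) (simp del: upt_Suc)
    show ?thesis unfolding eq
      by (rule measurable_compose_countable[where f="\<lambda>us. block_sum (\<lambda>_ l. us ! l) k n" and g="\<lambda>x. map (\<lambda>l. U x k l) [0..<Suc n]"])
        (intro measurable_block_sum measurable_slot measurable_count_map Suc)+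
  next
    case False
    then show ?thesis by (cases "n = Suc k") simp_all
  qed
qed

text \<open>The count that family \<open>n\<close> has in generation \<open>k\<close> when the
  numbering is fixed by \<open>u\<close> instead of by the process. Unlike \<open>U\<close> it reads
  a deterministic set of slots, \<open>cell_slots u n k\<close>.\<close>

definition cell :: "(nat \<Rightarrow> nat \<Rightarrow> nat^'d::finite) \<Rightarrow> nat \<Rightarrow> nat \<Rightarrow> ('d slot \<Rightarrow> nat^'d) \<Rightarrow> nat^'d" where
  "cell u n k x = (if k = n then x (Imm n) else block_sum u (k - 1) n x)"

definition cell_slots :: "(nat \<Rightarrow> nat \<Rightarrow> nat^'d::finite) \<Rightarrow> nat \<Rightarrow> nat \<Rightarrow> 'd slot set" where
  "cell_slots u n k = (if k = n then {Imm n}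
     else {Off (k - 1) m i | m i. (\<Sum>l<n. u (k - 1) l $ i) < m \<and> m \<le> (\<Sum>l\<le>n. u (k - 1) l $ i)})"

lemma U_eq_cell:
  assumes "n \<le> k" "\<And>l. l \<le> n \<Longrightarrow> n < k \<Longrightarrow> U x (k - 1) l = u (k - 1) l"
  shows "U x k n = cell u n k x"
proof (cases "k = n")
  case True
  then show ?thesis by (simp add: cell_def U_diag)
next
  case False
  then obtain k' where k: "k = Suc k'" "n \<le> k'" using assms(1) by (cases k) auto
  then show ?thesis
    using assms(2) False by (simp add: cell_def U_Suc del: U.simps) (rule block_sum_cong, simp)
qed

text \<open>On this event the random block boundaries are those of \<open>u\<close>, so the event
  becomes one about cells. The array contains every family up to \<open>n0\<close> and runs to a
  common generation \<open>N\<close>, because the boundaries of family \<open>n\<close> involve all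
  families \<open>l \<le> n\<close> one generation earlier.\<close>

lemma U_event:
  "(\<forall>n\<le>n0. \<forall>k\<in>{n..N}. U x k n = u k n) \<longleftrightarrow> (\<forall>n\<le>n0. \<forall>k\<in>{n..N}. cell u n k x = u k n)"
proof
  assume L: "\<forall>n\<le>n0. \<forall>k\<in>{n..N}. U x k n = u k n"
  show "\<forall>n\<le>n0. \<forall>k\<in>{n..N}. cell u n k x = u k n"
  proof (intro allI impI ballI)
    fix n k assume nk: "n \<le> n0" "k \<in> {n..N}"
    then have "U x k n = cell u n k x"
    proof (intro U_eq_cell)
      fix l assume "l \<le> n" "n < k"
      with nk have "l \<le> n0" "k - 1 \<in> {l..N}" by auto
      with L show "U x (k - 1) l = u (k - 1) l" by blast
    qed simp
    with nk L show "cell u n k x = u k n" by metis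
  qed
next
  assume R: "\<forall>n\<le>n0. \<forall>k\<in>{n..N}. cell u n k x = u k n"
  have "\<forall>n\<le>n0. n \<le> k \<longrightarrow> k \<le> N \<longrightarrow> U x k n = u k n" for k
  proof (induction k)
    case 0
    then show ?case using R[rule_format, of 0 0] by (auto simp: cell_def)
  next
    case (Suc k)
    show ?case
    proof (intro allI impI)
      fix n assume n: "n \<le> n0" "n \<le> Suc k" "Suc k \<le> N"
      have "U x (Suc k) n = cell u n (Suc k) x"
        by (rule U_eq_cell) (use n Suc in \<open>auto\<close>)
      also have "\<dots> = u (Suc k) n" using R n by simp
      finally show "U x (Suc k) n = u (Suc k) n" .
    qed
  qed
  then show "\<forall>n\<le>n0. \<forall>k\<in>{n..N}. U x k n = u k n" by auto
qed

text \<open>Within a generation the blocks of successive families are consecutive intervals of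
  numbers, and offspring slots of different generations differ in their first index.\<close>

lemma disjoint_cell_slots:
  "disjoint_family_on (\<lambda>(n, k). cell_slots u n k) {(n, k). n \<le> k}"
proof -
  have mono: "(\<Sum>l\<le>n. (c l :: nat)) \<le> (\<Sum>l<n'. c l)" if "n < n'" for n n' :: nat and c
    using that by (intro sum_mono2) auto
  have blk: "n = n'" if "(\<Sum>l<n. c l) < m" "m \<le> (\<Sum>l\<le>n. c l)" "(\<Sum>l<n'. c l) < m" "m \<le> (\<Sum>l\<le>n'. c l)" for n n' m :: nat and c
    using mono[of n n' c] mono[of n' n c] that by (cases n n' rule: linorder_cases) auto
  show ?thesis
    unfolding disjoint_family_on_def
    by (auto simp: cell_slots_def split: if_splits intro: blk)
qed

lemma cell_restrict: "cell u n k (restrict x (cell_slots u n k)) = cell u n k x"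
  unfolding cell_def cell_slots_def block_sum_def
  by (auto intro!: sum.cong)

text \<open>The transition probability of the population from \<open>v\<close> to \<open>w\<close>,
  realised on a product over exactly the particles of \<open>v\<close>, hence without reference to
  the numbering of \<open>U\<close>.\<close>

definition offspring_prob :: "('d::finite \<Rightarrow> 's \<Rightarrow> (nat^'d) pmf) \<Rightarrow> 's \<Rightarrow> nat^'d \<Rightarrow> nat^'d \<Rightarrow> real" where
  "offspring_prob p s v w = (let K = (SIGMA i:UNIV. {1..v $ i}); M = Pi\<^sub>M K (\<lambda>(i, m). measure_pmf (p i s))
     in measure M {g \<in> space M. (\<Sum>i\<in>UNIV. \<Sum>m\<in>{1..v $ i}. g (i, m)) = w})"

text \<open>Only the length of a block matters: within a generation the law of an offspring slot
  does not depend on the particle number, so the block can be translated by \<open>c i\<close> to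
  start at 1.\<close>

lemma prob_block_sum:
  fixes p :: "'d::finite \<Rightarrow> 's \<Rightarrow> (nat^'d) pmf"
  shows "measure (quenched q p \<omega>) {x. block_sum u k n x = w} = offspring_prob p (\<omega> (int k)) (u k n) w"
proof -
  define c where "c i = (\<Sum>l<n. u k l $ i)" for i
  define K where "K = (SIGMA i:(UNIV::'d set). {1..u k n $ i})"
  define f where "f = (\<lambda>(i, m). Off k (c i + m) i :: 'd slot)"
  define M where "M = Pi\<^sub>M K (\<lambda>(i, m). measure_pmf (p i (\<omega> (int k))))"
  define T where "T g = (\<Sum>i\<in>UNIV. \<Sum>m\<in>{1..u k n $ i}. g (i, m))" for g :: "'d \<times> nat \<Rightarrow> nat^'d"
  have inj: "inj_on f K" by (auto simp: f_def inj_on_def)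
  have f_pmf: "slot_pmf q p \<omega> (f j) = (case j of (i, m) \<Rightarrow> p i (\<omega> (int k)))" for j
    by (simp add: f_def slot_pmf_def split: prod.split)
  have M: "M = Pi\<^sub>M K (\<lambda>j. measure_pmf (slot_pmf q p \<omega> (f j)))"
    unfolding M_def by (intro PiM_cong refl) (simp add: f_pmf split: prod.split)
  have d: "distr (quenched q p \<omega>) M (\<lambda>x. \<lambda>j\<in>K. x (f j)) = M"
    unfolding M quenched_eq by (rule distr_PiM_reindex) (use inj measure_pmf.prob_space_axioms in auto)
  have T [measurable]: "T \<in> measurable M (count_space UNIV)"
    unfolding T_def
  proof (intro measurable_count_sum)
    fix i m assume "m \<in> {1..u k n $ i}"
    then have "(\<lambda>g. g (i, m)) \<in> measurable M (measure_pmf (slot_pmf q p \<omega> (f (i, m))))"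
      unfolding M by (intro measurable_component_singleton) (auto simp: K_def)
    then show "(\<lambda>g. g (i, m)) \<in> measurable M (count_space UNIV)"
      by (simp cong: measurable_cong_sets)
  qed
  have eq: "block_sum u k n x = T (\<lambda>j\<in>K. x (f j))" for x
    unfolding block_sum_def T_def
  proof (rule sum.cong[OF refl])
    fix i
    have "(\<Sum>l\<le>n. u k l $ i) = c i + u k n $ i" by (simp add: c_def lessThan_Suc_atMost[symmetric])
    then have "(\<Sum>m\<in>{(\<Sum>l<n. u k l $ i)<..(\<Sum>l\<le>n. u k l $ i)}. x (Off k m i)) =
        (\<Sum>m\<in>{c i<..c i + u k n $ i}. x (Off k m i))" by (simp add: c_def)
    also have "\<dots> = (\<Sum>m\<in>{1..u k n $ i}. x (Off k (c i + m) i))"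
      by (rule sum.reindex_bij_witness[of _ "\<lambda>m. c i + m" "\<lambda>m. m - c i"]) auto
    also have "\<dots> = (\<Sum>m\<in>{1..u k n $ i}. (\<lambda>j\<in>K. x (f j)) (i, m))"
      by (intro sum.cong refl) (auto simp: K_def f_def)
    finally show "(\<Sum>m\<in>{(\<Sum>l<n. u k l $ i)<..(\<Sum>l\<le>n. u k l $ i)}. x (Off k m i)) =
        (\<Sum>m\<in>{1..u k n $ i}. (\<lambda>j\<in>K. x (f j)) (i, m))" .
  qed
  have mr: "(\<lambda>x. \<lambda>j\<in>K. x (f j)) \<in> measurable (quenched q p \<omega>) M"
    unfolding M quenched_eq by (rule measurable_restrict) (rule measurable_component_singleton, simp)
  have sp: "(\<lambda>j\<in>K. x (f j)) \<in> space M" for x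
    using measurable_space[OF mr, of x] by simp
  have "offspring_prob p (\<omega> (int k)) (u k n) w = measure M {g \<in> space M. T g = w}"
    by (simp add: offspring_prob_def Let_def M_def K_def T_def)
  also have "\<dots> = measure (distr (quenched q p \<omega>) M (\<lambda>x. \<lambda>j\<in>K. x (f j))) {g \<in> space M. T g = w}"
    by (simp only: d)
  also have "\<dots> = measure (quenched q p \<omega>) {x. block_sum u k n x = w}"
    by (subst measure_distr[OF mr]) (auto simp: eq sp intro!: arg_cong[where f="measure _"])
  finally show ?thesis by simp
qed

text \<open>Cells read pairwise disjoint slots and are independent. A diagonal cell contributes the
  immigration law, any other one a transition from the preceding generation of its own family only;
  this makes the product split by families.\<close>

lemma prob_U_array:
  fixes p :: "'d::finite \<Rightarrow> 's \<Rightarrow> (nat^'d) pmf"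
  assumes "n0 \<le> N"
  shows "measure (quenched q p \<omega>) {x. \<forall>n\<le>n0. \<forall>k\<in>{n..N}. U x k n = u k n} =
    (\<Prod>n\<le>n0. \<Prod>k\<in>{n..N}. if k = n then pmf (q (\<omega> (int n - 1))) (u n n)
       else offspring_prob p (\<omega> (int k - 1)) (u (k - 1) n) (u k n))"
proof -
  interpret prob_space "quenched q p \<omega>" by (rule prob_space_quenched)
  define I where "I = (SIGMA n:{..n0}. {n..N})"
  define X where "X = (\<lambda>(n, k). cell u n k)"
  have I: "finite I" "(0, 0) \<in> I" using assms by (auto simp: I_def)
  define PM where "PM k = measure_pmf (slot_pmf q p \<omega> k)" for k
  have co: "indep_vars PM (\<lambda>k x. x k) UNIV"
    unfolding quenched_eq PM_def by (rule indep_vars_PiM_coordinates) (rule measure_pmf.prob_space_axioms)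
  have "indep_vars (\<lambda>j. Pi\<^sub>M ((\<lambda>(n, k). cell_slots u n k) j) PM)
      (\<lambda>j x. restrict x ((\<lambda>(n, k). cell_slots u n k) j)) I"
    by (rule indep_vars_restrict[OF co])
      (auto intro!: disjoint_family_on_mono[OF _ disjoint_cell_slots] simp: I_def)
  then have "indep_vars (\<lambda>_. count_space UNIV) (\<lambda>j x. X j (restrict x ((\<lambda>(n, k). cell_slots u n k) j))) I"
  proof (rule indep_vars_compose2)
    fix j assume "j \<in> I"
    obtain n k where j: "j = (n, k)" by (cases j)
    have comp: "(\<lambda>x. x l) \<in> measurable (Pi\<^sub>M (cell_slots u n k) PM) (count_space UNIV)" if "l \<in> cell_slots u n k" for l
    proof -
      have "(\<lambda>x. x l) \<in> measurable (Pi\<^sub>M (cell_slots u n k) PM) (PM l)"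
        using that by (rule measurable_component_singleton)
      moreover have "sets (PM l) = sets (count_space UNIV)" by (simp add: PM_def)
      ultimately show ?thesis using measurable_cong_sets by blast
    qed
    have "cell u n k \<in> measurable (Pi\<^sub>M (cell_slots u n k) PM) (count_space UNIV)"
    proof (cases "k = n")
      case True
      then have eq: "cell u n k = (\<lambda>x. x (Imm n))" by (simp add: cell_def fun_eq_iff)
      show ?thesis unfolding eq by (rule comp) (use True in \<open>simp add: cell_slots_def\<close>)
    next
      case False
      then have eq: "cell u n k = block_sum u (k - 1) n" by (simp add: cell_def fun_eq_iff)
      show ?thesis unfolding eq block_sum_def[abs_def]
        by (intro measurable_count_sum comp) (use False in \<open>auto simp: cell_slots_def\<close>)
    qed
    then show "X j \<in> measurable (Pi\<^sub>M ((\<lambda>(n, k). cell_slots u n k) j) PM) (count_space UNIV)"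
      by (simp add: j X_def)
  qed
  moreover have "X j (restrict x ((\<lambda>(n, k). cell_slots u n k) j)) = X j x" for j x
    by (cases j) (simp add: X_def cell_restrict)
  ultimately have ind: "indep_vars (\<lambda>_. count_space UNIV) X I" by simp
  have "{x. \<forall>n\<le>n0. \<forall>k\<in>{n..N}. U x k n = u k n} = (\<Inter>j\<in>I. X j -` {u (snd j) (fst j)} \<inter> space (quenched q p \<omega>))"
    unfolding U_event by (auto simp: I_def X_def)
  then have "measure (quenched q p \<omega>) {x. \<forall>n\<le>n0. \<forall>k\<in>{n..N}. U x k n = u k n} =
      (\<Prod>j\<in>I. prob (X j -` {u (snd j) (fst j)} \<inter> space (quenched q p \<omega>)))"
    using I by (simp only:) (rule indep_varsD[OF ind], auto)
  also have "\<dots> = (\<Prod>j\<in>I. case j of (n, k) \<Rightarrow> if k = n then pmf (q (\<omega> (int n - 1))) (u n n)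
       else offspring_prob p (\<omega> (int k - 1)) (u (k - 1) n) (u k n))"
  proof (rule prod.cong[OF refl])
    fix j assume "j \<in> I"
    then obtain n k where j: "j = (n, k)" "n \<le> k" by (auto simp: I_def)
    have "prob {x. cell u n k x = u k n} = (if k = n then pmf (q (\<omega> (int n - 1))) (u n n)
       else offspring_prob p (\<omega> (int k - 1)) (u (k - 1) n) (u k n))"
    proof (cases "k = n")
      case True
      have mc: "(\<lambda>x. x (Imm n)) \<in> measurable (quenched q p \<omega>) (PM (Imm n))"
        unfolding quenched_eq PM_def by (rule measurable_component_singleton) simp
      have "prob {x. cell u n k x = u k n} = measure (distr (quenched q p \<omega>) (PM (Imm n)) (\<lambda>x. x (Imm n))) {u k n}"
        by (subst measure_distr[OF mc]) (auto simp: True cell_def vimage_def PM_def)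
      also have "\<dots> = measure (PM (Imm n)) {u k n}"
        unfolding quenched_eq PM_def by (subst distr_PiM_component) (auto intro: measure_pmf.prob_space_axioms)
      also have "\<dots> = pmf (q (\<omega> (int n - 1))) (u n n)"
        using True by (simp add: PM_def slot_pmf_def pmf.rep_eq)
      finally show ?thesis using True by simp
    next
      case False
      then have "int (k - 1) = int k - 1" using j by auto
      then show ?thesis using False prob_block_sum[of q p \<omega> u "k - 1" n "u k n"] by (simp add: cell_def)
    qed
    then show "prob (X j -` {u (snd j) (fst j)} \<inter> space (quenched q p \<omega>)) =
      (case j of (n, k) \<Rightarrow> if k = n then pmf (q (\<omega> (int n - 1))) (u n n)
       else offspring_prob p (\<omega> (int k - 1)) (u (k - 1) n) (u k n))"
      by (simp add: j X_def vimage_def)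
  qed
  finally show ?thesis unfolding I_def by (subst (asm) prod.Sigma[symmetric]) auto
qed

section \<open>Families seen from their arrival times\<close>

definition shift_by :: "int \<Rightarrow> (int \<Rightarrow> 's) \<Rightarrow> int \<Rightarrow> 's" where
  "shift_by m \<omega> = (\<lambda>j. \<omega> (j + m))"

text \<open>The Markov path probability of the family founded at time 0. Immigration reads site -1
  and the step into generation \<open>j\<close> reads site \<open>j - 1\<close>, so a path of
  \<open>r\<close> steps sees the sites from -1 to \<open>r - 1\<close>.\<close>

definition path_prob ::
  "('s \<Rightarrow> (nat^'d::finite) pmf) \<Rightarrow> ('d \<Rightarrow> 's \<Rightarrow> (nat^'d) pmf) \<Rightarrow> (int \<Rightarrow> 's) \<Rightarrow> nat \<Rightarrow> (nat \<Rightarrow> nat^'d) \<Rightarrow> real"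
where
  "path_prob q p \<omega> r a = (\<Prod>j\<le>r. if j = 0 then pmf (q (\<omega> (-1))) (a 0)
     else offspring_prob p (\<omega> (int j - 1)) (a (j - 1)) (a j))"

lemma prob_U_path_prob:
  fixes p :: "'d::finite \<Rightarrow> 's \<Rightarrow> (nat^'d) pmf"
  assumes "n0 \<le> N"
  shows "measure (quenched q p \<omega>) {x. \<forall>n\<le>n0. \<forall>k\<in>{n..N}. U x k n = u k n} =
    (\<Prod>n\<le>n0. path_prob q p (shift_by (int n) \<omega>) (N - n) (\<lambda>j. u (n + j) n))"
  unfolding prob_U_array[OF assms]
proof (rule prod.cong[OF refl])
  fix n assume "n \<in> {..n0}"
  then have n: "n \<le> N" using assms by auto
  show "(\<Prod>k\<in>{n..N}. if k = n then pmf (q (\<omega> (int n - 1))) (u n n)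
      else offspring_prob p (\<omega> (int k - 1)) (u (k - 1) n) (u k n)) =
    path_prob q p (shift_by (int n) \<omega>) (N - n) (\<lambda>j. u (n + j) n)"
    unfolding path_prob_def
    by (rule prod.reindex_bij_witness[of _ "\<lambda>j. n + j" "\<lambda>k. k - n"])
      (use n in \<open>auto simp: shift_by_def algebra_simps of_nat_diff\<close>)
qed

lemma prob_U_zero:
  fixes p :: "'d::finite \<Rightarrow> 's \<Rightarrow> (nat^'d) pmf"
  shows "measure (quenched q p \<omega>) {x. \<forall>k\<le>r. U x k 0 = a k} = path_prob q p \<omega> r a"
proof -
  have "{x. \<forall>k\<le>r. U x k 0 = a k} = {x. \<forall>n\<le>0. \<forall>k\<in>{n..r}. U x k n = (\<lambda>k n. a k) k n}" by auto
  then show ?thesis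
    using prob_U_path_prob[of 0 r q p \<omega> "\<lambda>k n. a k"] by (simp add: shift_by_def)
qed

text \<open>The arrival and the \<open>r\<close> generations after it, packed as a list: a single
  random value in a countable type, to which arbitrary functions can be applied measurably.\<close>

definition fam :: "('d::finite slot \<Rightarrow> nat^'d) \<Rightarrow> nat \<Rightarrow> nat \<Rightarrow> (nat^'d) list" where
  "fam x n r = map (\<lambda>k. U x (n + k) n) [0..<Suc r]"

lemma length_fam [simp]: "length (fam x n r) = Suc r"
  by (simp add: fam_def)

lemma fam_nth: "k \<le> r \<Longrightarrow> fam x n r ! k = U x (n + k) n"
  by (simp add: fam_def del: upt_Suc)

lemma take_fam: "r \<le> r' \<Longrightarrow> take (Suc r) (fam x n r') = fam x n r"
  by (simp add: fam_def take_map del: upt_Suc)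

lemma measurable_fam [measurable]: "(\<lambda>x. fam x n r) \<in> measurable slot_space (count_space UNIV)"
  unfolding fam_def by (intro measurable_count_map measurable_U)

lemma measurable_quenched_iff: "measurable (quenched q p \<omega>) M = measurable slot_space M"
  by (rule measurable_cong_sets) (auto simp: sets_quenched)

lemma prob_fam_zero:
  fixes p :: "'d::finite \<Rightarrow> 's \<Rightarrow> (nat^'d) pmf"
  shows "measure (quenched q p \<omega>) {x. fam x 0 r = as} =
    (if length as = Suc r then path_prob q p \<omega> r ((!) as) else 0)"
proof (cases "length as = Suc r")
  case True
  have "fam x 0 r = as \<longleftrightarrow> (\<forall>k\<le>r. U x k 0 = as ! k)" for x
    using True by (auto simp: list_eq_iff_nth_eq fam_nth less_Suc_eq_le)
  then show ?thesis using True prob_U_zero[of q p \<omega> r "(!) as"] by simp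
next
  case False
  then have "fam x 0 r \<noteq> as" for x by auto
  then show ?thesis using False by simp
qed

text \<open>All families are followed to a common generation \<open>N\<close>, as the numbering
  demands, so their histories cover different numbers \<open>N - n\<close> of generations. A list of
  the wrong length has probability zero on both sides.\<close>

lemma prob_families:
  fixes p :: "'d::finite \<Rightarrow> 's \<Rightarrow> (nat^'d) pmf"
  assumes "n0 \<le> N"
  shows "measure (quenched q p \<omega>) {x. \<forall>n\<le>n0. fam x n (N - n) = as n} =
    (\<Prod>n\<le>n0. measure (quenched q p (shift_by (int n) \<omega>)) {x. fam x 0 (N - n) = as n})"
proof (cases "\<forall>n\<le>n0. length (as n) = Suc (N - n)")
  case True
  have "(\<forall>n\<le>n0. fam x n (N - n) = as n) \<longleftrightarrow> (\<forall>n\<le>n0. \<forall>k\<in>{n..N}. U x k n = as n ! (k - n))" for x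
  proof -
    have "fam x n (N - n) = as n \<longleftrightarrow> (\<forall>k\<in>{n..N}. U x k n = as n ! (k - n))" if n: "n \<le> n0" for n
    proof -
      have "fam x n (N - n) = as n \<longleftrightarrow> (\<forall>j\<le>N - n. U x (n + j) n = as n ! j)"
        using True n by (auto simp: list_eq_iff_nth_eq fam_nth less_Suc_eq_le)
      also have "\<dots> \<longleftrightarrow> (\<forall>k\<in>{n..N}. U x k n = as n ! (k - n))"
      proof safe
        fix k assume "\<forall>j\<le>N - n. U x (n + j) n = as n ! j" "k \<in> {n..N}"
        then show "U x k n = as n ! (k - n)" by (auto dest!: spec[of _ "k - n"])
      next
        fix j assume *: "\<forall>k\<in>{n..N}. U x k n = as n ! (k - n)" "j \<le> N - n"
        with assms n have "n + j \<in> {n..N}" by auto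
        with * show "U x (n + j) n = as n ! j" by fastforce
      qed
      finally show ?thesis .
    qed
    then show ?thesis by blast
  qed
  then show ?thesis
    using prob_U_path_prob[OF assms, of q p \<omega> "\<lambda>k n. as n ! (k - n)"] True
    by (simp add: prob_fam_zero)
next
  case False
  then obtain n where n: "n \<le> n0" "length (as n) \<noteq> Suc (N - n)" by blast
  then have "fam x n (N - n) \<noteq> as n" for x using length_fam by metis
  with n have e: "{x. \<forall>n\<le>n0. fam x n (N - n) = as n} = {}" by auto
  have "(\<Prod>n\<le>n0. measure (quenched q p (shift_by (int n) \<omega>)) {x. fam x 0 (N - n) = as n}) = 0"
    using n by (intro prod_zero) (auto intro!: bexI[of _ n] simp: prob_fam_zero)
  then show ?thesis by (simp add: e)
qed

text \<open>A finite product of countable discrete spaces is countable, so it suffices to compare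
  the two measures on singletons.\<close>

lemma distr_families:
  fixes p :: "'d::finite \<Rightarrow> 's \<Rightarrow> (nat^'d) pmf"
  assumes "n0 \<le> N"
  shows "distr (quenched q p \<omega>) (Pi\<^sub>M {..n0} (\<lambda>_. count_space UNIV)) (\<lambda>x. \<lambda>n\<in>{..n0}. fam x n (N - n)) =
    Pi\<^sub>M {..n0} (\<lambda>n. distr (quenched q p (shift_by (int n) \<omega>)) (count_space UNIV) (\<lambda>x. fam x 0 (N - n)))"
    (is "?D = Pi\<^sub>M _ ?M")
proof -
  interpret Q: prob_space "quenched q p \<omega>" by (rule prob_space_quenched)
  have m0: "(\<lambda>x. fam x n r) \<in> measurable (quenched q p \<omega>') (count_space UNIV)" for n r \<omega>'
    unfolding measurable_quenched_iff by (rule measurable_fam)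
  have pM: "prob_space (?M n)" for n
    by (intro prob_space.prob_space_distr prob_space_quenched m0)
  interpret M: product_prob_space ?M "{..n0}" by (rule product_prob_spaceI) (rule pM)
  have mr: "(\<lambda>x. \<lambda>n\<in>{..n0}. fam x n (N - n)) \<in> measurable (quenched q p \<omega>) (Pi\<^sub>M {..n0} (\<lambda>_. count_space UNIV))"
    by (intro measurable_restrict m0)
  let ?A = "Pi\<^sub>E {..n0} (\<lambda>_. UNIV :: (nat^'d) list set)"
  have sing: "{a} = Pi\<^sub>E {..n0} (\<lambda>n. {a n})" if "a \<in> ?A" for a
    using that by (intro PiE_singleton[symmetric]) (auto simp: PiE_def)
  show ?thesis
  proof (rule measure_eqI_countable')
    show "space ?D = ?A" by (simp add: space_PiM)
    show "space (Pi\<^sub>M {..n0} ?M) = ?A" by (simp add: space_PiM)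
    show "countable ?A" by (rule countable_PiE) auto
    show "{a} \<in> sets ?D" if "a \<in> ?A" for a
      unfolding sing[OF that] sets_distr by (rule sets_PiM_I_finite) auto
    show "{a} \<in> sets (Pi\<^sub>M {..n0} ?M)" if "a \<in> ?A" for a
      unfolding sing[OF that] by (rule sets_PiM_I_finite) auto
    show "emeasure ?D {a} = emeasure (Pi\<^sub>M {..n0} ?M) {a}" if a: "a \<in> ?A" for a
    proof -
      have "{a} \<in> sets (Pi\<^sub>M {..n0} (\<lambda>_. count_space UNIV))"
        unfolding sing[OF a] by (rule sets_PiM_I_finite) auto
      then have "emeasure ?D {a} = emeasure (quenched q p \<omega>)
          ((\<lambda>x. \<lambda>n\<in>{..n0}. fam x n (N - n)) -` {a} \<inter> space (quenched q p \<omega>))"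
        by (rule emeasure_distr[OF mr])
      also have "(\<lambda>x. \<lambda>n\<in>{..n0}. fam x n (N - n)) -` {a} \<inter> space (quenched q p \<omega>) =
          {x. \<forall>n\<le>n0. fam x n (N - n) = a n}"
      proof -
        have "(\<lambda>n\<in>{..n0}. fam x n (N - n)) = a \<longleftrightarrow> (\<forall>n\<le>n0. fam x n (N - n) = a n)" for x
          using a by (auto simp: fun_eq_iff PiE_def extensional_def restrict_def)
        then show ?thesis by auto
      qed
      also have "emeasure (quenched q p \<omega>) \<dots> = ennreal (\<Prod>n\<le>n0. measure (?M n) {a n})"
        unfolding Q.emeasure_eq_measure prob_families[OF assms]
        by (intro arg_cong[where f=ennreal] prod.cong refl)
          (simp add: measure_distr[OF m0] vimage_def)
      also have "\<dots> = (\<Prod>n\<le>n0. emeasure (?M n) {a n})"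
        by (simp add: prod_ennreal[symmetric] finite_measure.emeasure_eq_measure[OF prob_space.finite_measure[OF pM]])
      also have "\<dots> = emeasure (Pi\<^sub>M {..n0} ?M) {a}"
        unfolding sing[OF a] by (rule M.emeasure_PiM[symmetric]) auto
      finally show ?thesis .
    qed
  qed
qed

text \<open>Under the quenched law the families are independent, and the family of the immigrants of time
  \<open>n\<close> is distributed like the first family in the environment seen from time \<open>n\<close>.\<close>

theorem integral_prod_families:
  fixes p :: "'d::finite \<Rightarrow> 's \<Rightarrow> (nat^'d) pmf"
    and H :: "nat \<Rightarrow> (nat^'d) list \<Rightarrow> 'b::{real_normed_field, banach, second_countable_topology}"
  assumes I: "finite I" and bd: "\<And>n as. n \<in> I \<Longrightarrow> norm (H n as) \<le> B n"
  shows "(\<integral>x. (\<Prod>n\<in>I. H n (fam x n r)) \<partial>quenched q p \<omega>) =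
    (\<Prod>n\<in>I. \<integral>x. H n (fam x 0 r) \<partial>quenched q p (shift_by (int n) \<omega>))"
proof -
  obtain n0 where n0: "I \<subseteq> {..n0}" using I by (meson finite_nat_set_iff_bounded_le atMost_iff subsetI)
  \<comment> \<open>With \<open>n0 + r\<close> generations every family is followed for at least
    \<open>r\<close> of them; \<open>G\<close> discards the excess and is 1 outside
    \<open>I\<close>.\<close>
  define N where "N = n0 + r"
  have N: "n0 \<le> N" by (simp add: N_def)
  define G where "G n as = (if n \<in> I then H n (take (Suc r) as) else 1)" for n as
  have m0: "(\<lambda>x. fam x n r) \<in> measurable (quenched q p \<omega>') (count_space UNIV)" for n r \<omega>'
    unfolding measurable_quenched_iff by (rule measurable_fam)
  let ?M = "\<lambda>n. distr (quenched q p (shift_by (int n) \<omega>)) (count_space UNIV) (\<lambda>x. fam x 0 (N - n))"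
  have pM: "prob_space (?M n)" for n
    by (intro prob_space.prob_space_distr prob_space_quenched m0)
  interpret M: product_prob_space ?M "{..n0}" by (rule product_prob_spaceI) (rule pM)
  have mr: "(\<lambda>x. \<lambda>n\<in>{..n0}. fam x n (N - n)) \<in> measurable (quenched q p \<omega>) (Pi\<^sub>M {..n0} (\<lambda>_. count_space UNIV))"
    by (intro measurable_restrict m0)
  have G: "G n (fam x n' (N - n)) = (if n \<in> I then H n (fam x n' r) else 1)" if "n \<le> n0" for n n' x
    using that by (simp add: G_def take_fam N_def)
  have "(\<integral>x. (\<Prod>n\<in>I. H n (fam x n r)) \<partial>quenched q p \<omega>) =
      (\<integral>x. (\<Prod>n\<le>n0. G n (fam x n (N - n))) \<partial>quenched q p \<omega>)"
  proof (intro Bochner_Integration.integral_cong refl)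
    fix x
    have "(\<Prod>n\<le>n0. G n (fam x n (N - n))) = (\<Prod>n\<le>n0. if n \<in> I then H n (fam x n r) else 1)"
      by (intro prod.cong refl) (simp add: G)
    also have "\<dots> = (\<Prod>n\<in>I. H n (fam x n r))"
      using n0 by (simp add: prod.If_cases Int_absorb1)
    finally show "(\<Prod>n\<in>I. H n (fam x n r)) = (\<Prod>n\<le>n0. G n (fam x n (N - n)))" ..
  qed
  also have "\<dots> = (\<integral>g. (\<Prod>n\<le>n0. G n (g n)) \<partial>distr (quenched q p \<omega>) (Pi\<^sub>M {..n0} (\<lambda>_. count_space UNIV)) (\<lambda>x. \<lambda>n\<in>{..n0}. fam x n (N - n)))"
  proof (subst integral_distr[OF mr])
    show "(\<lambda>g. \<Prod>n\<le>n0. G n (g n)) \<in> borel_measurable (Pi\<^sub>M {..n0} (\<lambda>_. count_space UNIV))"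
    proof (rule borel_measurable_prod)
      fix n assume "n \<in> {..n0}"
      then have "(\<lambda>g. g n) \<in> measurable (Pi\<^sub>M {..n0} (\<lambda>_. count_space UNIV)) (count_space UNIV)"
        by (rule measurable_component_singleton)
      then show "(\<lambda>g. G n (g n)) \<in> borel_measurable (Pi\<^sub>M {..n0} (\<lambda>_. count_space UNIV))"
        by (rule measurable_compose) simp
    qed
  qed (intro Bochner_Integration.integral_cong refl prod.cong; simp)
  also have "\<dots> = (\<Prod>n\<le>n0. integral\<^sup>L (?M n) (G n))"
    unfolding distr_families[OF N]
  proof (rule M.product_integral_prod)
    fix n
    show "integrable (?M n) (G n)"
    proof (rule finite_measure.integrable_const_bound[OF prob_space.finite_measure[OF pM]])
      show "AE as in ?M n. norm (G n as) \<le> max 1 (B n)"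
        using bd[of n] by (auto simp: G_def le_max_iff_disj)
    qed simp
  qed simp
  also have "\<dots> = (\<Prod>n\<le>n0. if n \<in> I then (\<integral>x. H n (fam x 0 r) \<partial>quenched q p (shift_by (int n) \<omega>)) else 1)"
  proof (rule prod.cong[OF refl])
    fix n assume n: "n \<in> {..n0}"
    interpret p: prob_space "quenched q p (shift_by (int n) \<omega>)" by (rule prob_space_quenched)
    show "integral\<^sup>L (?M n) (G n) = (if n \<in> I then (\<integral>x. H n (fam x 0 r) \<partial>quenched q p (shift_by (int n) \<omega>)) else 1)"
      using n by (subst integral_distr[OF m0]) (simp_all add: G p.prob_space[simplified])
  qed
  also have "\<dots> = (\<Prod>n\<in>I. \<integral>x. H n (fam x 0 r) \<partial>quenched q p (shift_by (int n) \<omega>))"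
    using n0 by (simp add: prod.If_cases Int_absorb1)
  finally show ?thesis .
qed

text \<open>The law of a history is given by \<open>path_prob\<close>, which reads only these sites.
  This finite range is what passes the mixing of the environment on to families followed for
  \<open>r\<close> generations.\<close>

lemma integral_fam_cong:
  fixes p :: "'d::finite \<Rightarrow> 's \<Rightarrow> (nat^'d) pmf"
    and H :: "(nat^'d) list \<Rightarrow> 'b::{real_normed_field, banach, second_countable_topology}"
  assumes "\<And>j. - 1 \<le> j \<Longrightarrow> j < int r \<Longrightarrow> \<omega> j = \<omega>' j"
  shows "(\<integral>x. H (fam x 0 r) \<partial>quenched q p \<omega>) = (\<integral>x. H (fam x 0 r) \<partial>quenched q p \<omega>')"
proof -
  have m0: "(\<lambda>x. fam x 0 r) \<in> measurable (quenched q p \<omega>') (count_space UNIV)" for \<omega>'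
    unfolding measurable_quenched_iff by (rule measurable_fam)
  have pp: "path_prob q p \<omega> r a = path_prob q p \<omega>' r a" for a
    unfolding path_prob_def by (intro prod.cong refl if_cong) (auto simp: assms)
  have "distr (quenched q p \<omega>) (count_space UNIV) (\<lambda>x. fam x 0 r) =
      distr (quenched q p \<omega>') (count_space UNIV) (\<lambda>x. fam x 0 r)"
  proof (rule measure_eqI_countable[where A=UNIV])
    fix as :: "(nat^'d) list"
    have "emeasure (distr (quenched q p \<omega>) (count_space UNIV) (\<lambda>x. fam x 0 r)) {as} =
        ennreal (measure (quenched q p \<omega>) {x. fam x 0 r = as})" for \<omega>
      using prob_space.finite_measure[OF prob_space_quenched, of q p \<omega>]
      by (subst emeasure_distr[OF m0]) (auto simp: vimage_def finite_measure.emeasure_eq_measure)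
    then show "emeasure (distr (quenched q p \<omega>) (count_space UNIV) (\<lambda>x. fam x 0 r)) {as} =
        emeasure (distr (quenched q p \<omega>') (count_space UNIV) (\<lambda>x. fam x 0 r)) {as}"
      by (simp add: prob_fam_zero pp)
  qed auto
  then have "integral\<^sup>L (distr (quenched q p \<omega>) (count_space UNIV) (\<lambda>x. fam x 0 r)) H =
      integral\<^sup>L (distr (quenched q p \<omega>') (count_space UNIV) (\<lambda>x. fam x 0 r)) H" by simp
  then show ?thesis by (simp add: integral_distr[OF m0])
qed

section \<open>Moments of the families\<close>

lemma epow_0 [simp]: "epow 0 a = 0"
  by (simp add: epow_def)

lemma epow_top [simp]: "epow \<top> a = \<top>"
  by (simp add: epow_def)

lemma epow_ennreal: "0 \<le> x \<Longrightarrow> epow (ennreal x) a = ennreal (x powr a)"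
  by (simp add: epow_def)

lemma epow_one [simp]: "epow x 1 = x"
  by (cases x) (auto simp: epow_ennreal powr_one)

lemma epow_1 [simp]: "epow 1 a = 1"
  using epow_ennreal[of 1 a] by simp

lemma epow_mono: "0 \<le> a \<Longrightarrow> x \<le> y \<Longrightarrow> epow x a \<le> epow y a"
  by (cases x; cases y) (auto simp: epow_ennreal top_unique intro!: ennreal_leI powr_mono2)

lemma epow_eq_0_iff: "epow x a = 0 \<longleftrightarrow> x = 0"
  by (cases x) (auto simp: epow_ennreal ennreal_eq_0_iff)

lemma epow_mult: "epow (x * y) a = epow x a * epow y a"
proof (cases "x = \<top> \<or> y = \<top>")
  case True
  then show ?thesis
    by (auto simp: ennreal_mult_top ennreal_top_mult epow_eq_0_iff)
next
  case False
  then obtain x' y' where "x = ennreal x'" "0 \<le> x'" "y = ennreal y'" "0 \<le> y'"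
    by (cases x; cases y) auto
  then show ?thesis by (simp add: epow_ennreal ennreal_mult[symmetric] powr_mult)
qed

lemma epow_epow: "epow (epow x a) b = epow x (a * b)"
  by (cases x) (auto simp: epow_ennreal powr_powr)

lemma epow_two: "epow x 2 = x\<^sup>2"
  by (cases x) (auto simp: epow_ennreal ennreal_power powr_numeral power2_eq_square ennreal_top_mult ennreal_mult)

lemma borel_measurable_epow [measurable]: "(\<lambda>x. epow x a) \<in> borel_measurable borel"
  unfolding epow_def[abs_def] by measurable

lemma borel_measurable_epow' [measurable]:
  "f \<in> borel_measurable M \<Longrightarrow> (\<lambda>x. epow (f x) a) \<in> borel_measurable M"
  by (rule measurable_compose[OF _ borel_measurable_epow])

lemma convex_powr:
  fixes x y l a :: real
  assumes "0 \<le> x" "0 \<le> y" "0 \<le> l" "l \<le> 1" "1 \<le> a"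
  shows "(l * x + (1 - l) * y) powr a \<le> l * x powr a + (1 - l) * y powr a"
proof -
  \<comment> \<open>Serves the boundary, where one of the two points is 0; the convexity of the
    power is quoted only for positive points.\<close>
  have small: "c powr a \<le> c" if "0 \<le> c" "c \<le> 1" for c :: real
  proof (cases "c = 0")
    case False
    then have "c powr a \<le> c powr 1" using that assms(5) by (intro powr_mono') auto
    then show ?thesis using False that by simp
  qed simp
  consider "x = 0" | "y = 0" | "x > 0" "y > 0" using assms by linarith
  then show ?thesis
  proof cases
    case 1
    have "((1 - l) * y) powr a = (1 - l) powr a * y powr a" using assms by (simp add: powr_mult)
    also have "\<dots> \<le> (1 - l) * y powr a" using assms by (intro mult_right_mono small) auto
    finally show ?thesis using 1 by simp
  next
    case 2
    have "(l * x) powr a = l powr a * x powr a" using assms by (simp add: powr_mult)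
    also have "\<dots> \<le> l * x powr a" using assms by (intro mult_right_mono small) auto
    finally show ?thesis using 2 by simp
  next
    case 3
    then show ?thesis using convex_onD[OF powr_convex[OF assms(5)], of "1 - l" x y] assms by auto
  qed
qed

lemma epow_convex:
  fixes l :: real
  assumes "0 < l" "l < 1" "1 \<le> a"
  shows "epow (ennreal l * x + ennreal (1 - l) * y) a \<le> ennreal l * epow x a + ennreal (1 - l) * epow y a"
proof (cases "x = \<top> \<or> y = \<top>")
  case True
  then show ?thesis using assms by (auto simp: ennreal_mult_top)
next
  case False
  then obtain x' y' where xy: "x = ennreal x'" "0 \<le> x'" "y = ennreal y'" "0 \<le> y'"
    by (cases x; cases y) auto
  have e1: "ennreal l * x + ennreal (1 - l) * y = ennreal (l * x' + (1 - l) * y')"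
    using xy assms by (simp add: ennreal_mult[symmetric] ennreal_plus[symmetric] del: ennreal_plus)
  have e2: "ennreal l * epow x a + ennreal (1 - l) * epow y a = ennreal (l * x' powr a + (1 - l) * y' powr a)"
    using xy assms by (simp add: epow_ennreal ennreal_mult[symmetric] ennreal_plus[symmetric] del: ennreal_plus)
  have "0 \<le> l * x' + (1 - l) * y'" using xy assms by simp
  then show ?thesis unfolding e1 e2 using convex_powr[of x' y' l a] assms xy
    by (subst epow_ennreal) (auto intro!: ennreal_leI simp del: ennreal_plus)
qed

text \<open>The \<open>L^a\<close> norm of a nonnegative function, allowed to be infinite.
  Minkowski's inequality then holds without finite moments, and quenched moments may well be
  infinite in some environments.\<close>

definition nrm :: "real \<Rightarrow> 'a measure \<Rightarrow> ('a \<Rightarrow> ennreal) \<Rightarrow> ennreal" where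
  "nrm a M f = epow (\<integral>\<^sup>+x. epow (f x) a \<partial>M) (1 / a)"

lemma epow_nrm: "a > 0 \<Longrightarrow> epow (nrm a M f) a = (\<integral>\<^sup>+x. epow (f x) a \<partial>M)"
  by (simp add: nrm_def epow_epow)

lemma nrm_one: "nrm 1 M f = (\<integral>\<^sup>+x. f x \<partial>M)"
  by (simp add: nrm_def)

lemma nrm_le_iff: "a > 0 \<Longrightarrow> nrm a M f \<le> c \<longleftrightarrow> (\<integral>\<^sup>+x. epow (f x) a \<partial>M) \<le> epow c a"
proof
  assume a: "a > 0" and "nrm a M f \<le> c"
  then have "epow (nrm a M f) a \<le> epow c a" by (intro epow_mono) auto
  then show "(\<integral>\<^sup>+x. epow (f x) a \<partial>M) \<le> epow c a" using a by (simp add: epow_nrm)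
next
  assume a: "a > 0" and "(\<integral>\<^sup>+x. epow (f x) a \<partial>M) \<le> epow c a"
  then have "nrm a M f \<le> epow (epow c a) (1 / a)" unfolding nrm_def by (intro epow_mono) auto
  then show "nrm a M f \<le> c" using a by (simp add: epow_epow)
qed

lemma nrm_cmult:
  assumes "a > 0" "f \<in> borel_measurable M"
  shows "nrm a M (\<lambda>x. c * f x) = c * nrm a M f"
  unfolding nrm_def epow_mult using assms
  by (subst nn_integral_cmult) (auto simp: epow_mult epow_epow)

text \<open>Minkowski's inequality from convexity: \<open>f + g\<close> is \<open>A + B\<close>
  times a convex combination of the normalised functions, with weights proportional to their norms
  \<open>A\<close> and \<open>B\<close>. A vanishing norm means a function that is null almost
  everywhere and is treated apart, as is an infinite one.\<close>

lemma nrm_add: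
  assumes a: "a \<ge> 1" and [measurable]: "f \<in> borel_measurable M" "g \<in> borel_measurable M"
  shows "nrm a M (\<lambda>x. f x + g x) \<le> nrm a M f + nrm a M g"
proof -
  define A where "A = nrm a M f"
  define B where "B = nrm a M g"
  have a0: "a > 0" using a by simp
  have null: "nrm a M (\<lambda>x. f x + g x) = nrm a M g"
    if "nrm a M f = 0" and [measurable]: "f \<in> borel_measurable M" for f g
  proof -
    have "(\<integral>\<^sup>+x. epow (f x) a \<partial>M) = 0" using that a0 by (simp add: nrm_def epow_eq_0_iff)
    then have "AE x in M. f x = 0" by (subst (asm) nn_integral_0_iff_AE) (auto simp: epow_eq_0_iff)
    then show ?thesis unfolding nrm_def
      by (intro arg_cong2[where f=epow] nn_integral_cong_AE) auto
  qed
  consider "A = \<top> \<or> B = \<top>" | "A = 0" | "B = 0" | "A \<noteq> \<top>" "B \<noteq> \<top>" "A \<noteq> 0" "B \<noteq> 0" by blast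
  then show ?thesis
  proof cases
    case 1
    then show ?thesis by (auto simp: A_def B_def)
  next
    case 2
    then show ?thesis using null[of f g] by (simp add: A_def)
  next
    case 3
    then show ?thesis using null[of g f] by (simp add: B_def add.commute)
  next
    case 4
    then obtain A' B' where AB: "A = ennreal A'" "B = ennreal B'" "A' > 0" "B' > 0"
      by (cases A; cases B) (auto simp: less_le)
    define l where "l = A' / (A' + B')"
    have l: "0 < l" "l < 1" "1 - l = B' / (A' + B')" using AB by (auto simp: l_def field_simps)
    define c where "c = ennreal (A' + B')"
    have c: "A + B = c" using AB by (simp add: c_def)
    have dec: "f x + g x = c * (ennreal l * (f x * ennreal (1 / A')) + ennreal (1 - l) * (g x * ennreal (1 / B')))" for x
    proof -
      have "c * ennreal l * ennreal (1 / A') = 1" "c * ennreal (1 - l) * ennreal (1 / B') = 1"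
        unfolding c_def l(3) unfolding l_def using AB by (simp_all add: ennreal_mult[symmetric] del: ennreal_plus)
      then show ?thesis by (simp add: distrib_left mult_ac) (metis mult.assoc mult.commute mult_1_right)
    qed
    have one: "(\<integral>\<^sup>+x. epow (h x * ennreal (1 / C)) a \<partial>M) = 1"
      if "nrm a M h = ennreal C" "C > 0" and [measurable]: "h \<in> borel_measurable M" for h C
    proof -
      have "nrm a M (\<lambda>x. ennreal (1 / C) * h x) = ennreal (1 / C) * ennreal C"
        using nrm_cmult[OF a0 that(3)] that(1) by simp
      also have "\<dots> = 1" using that(2) by (simp add: ennreal_mult[symmetric])
      finally have "epow (nrm a M (\<lambda>x. ennreal (1 / C) * h x)) a = 1" by simp
      then show ?thesis using a0 by (simp add: epow_nrm mult.commute)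
    qed
    have "(\<integral>\<^sup>+x. epow (f x + g x) a \<partial>M) \<le>
      (\<integral>\<^sup>+x. epow c a * (ennreal l * epow (f x * ennreal (1 / A')) a + ennreal (1 - l) * epow (g x * ennreal (1 / B')) a) \<partial>M)"
      unfolding dec epow_mult[of c]
      by (intro nn_integral_mono mult_left_mono epow_convex) (use l a in auto)
    also have "\<dots> = epow c a * (ennreal l * (\<integral>\<^sup>+x. epow (f x * ennreal (1 / A')) a \<partial>M) +
        ennreal (1 - l) * (\<integral>\<^sup>+x. epow (g x * ennreal (1 / B')) a \<partial>M))"
      by (simp add: nn_integral_cmult nn_integral_add)
    also have "\<dots> = epow c a * (ennreal l + ennreal (1 - l))"
      using one[of f A'] one[of g B'] AB by (simp add: A_def B_def)
    also have "\<dots> = epow c a" using l(1,2) by (simp add: ennreal_plus[symmetric] del: ennreal_plus)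
    finally show ?thesis unfolding A_def[symmetric] B_def[symmetric] c using a0 by (simp add: nrm_le_iff)
  qed
qed

lemma nrm_0 [simp]: "nrm a M (\<lambda>x. 0) = 0"
  by (simp add: nrm_def)

lemma nrm_sum:
  assumes "a \<ge> 1" "\<And>i. i \<in> I \<Longrightarrow> f i \<in> borel_measurable M"
  shows "nrm a M (\<lambda>x. \<Sum>i\<in>I. f i x) \<le> (\<Sum>i\<in>I. nrm a M (f i))"
  using assms(2)
proof (induction I rule: infinite_finite_induct)
  case (insert i I)
  then have "nrm a M (\<lambda>x. f i x + (\<Sum>i\<in>I. f i x)) \<le> nrm a M (f i) + nrm a M (\<lambda>x. \<Sum>i\<in>I. f i x)"
    by (intro nrm_add assms(1)) auto
  also have "\<dots> \<le> nrm a M (f i) + (\<Sum>i\<in>I. nrm a M (f i))"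
    using insert by (intro add_left_mono) auto
  finally show ?case using insert by simp
qed auto

section \<open>Generation recursion for the moments\<close>

lemma nn_integral_slot:
  "(\<integral>\<^sup>+x. f (x s) \<partial>quenched q p \<omega>) = (\<integral>\<^sup>+y. f y \<partial>measure_pmf (slot_pmf q p \<omega> s))"
proof -
  have m: "(\<lambda>x. x s) \<in> measurable (quenched q p \<omega>) (measure_pmf (slot_pmf q p \<omega> s))"
    unfolding quenched_eq by (rule measurable_component_singleton) simp
  have "distr (quenched q p \<omega>) (measure_pmf (slot_pmf q p \<omega> s)) (\<lambda>x. x s) = measure_pmf (slot_pmf q p \<omega> s)"
    unfolding quenched_eq by (rule distr_PiM_component) (auto intro: measure_pmf.prob_space_axioms)
  then have "(\<integral>\<^sup>+y. f y \<partial>measure_pmf (slot_pmf q p \<omega> s)) =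
      (\<integral>\<^sup>+y. f y \<partial>distr (quenched q p \<omega>) (measure_pmf (slot_pmf q p \<omega> s)) (\<lambda>x. x s))" by simp
  also have "\<dots> = (\<integral>\<^sup>+x. f (x s) \<partial>quenched q p \<omega>)"
    by (rule nn_integral_distr[OF m]) simp
  finally show ?thesis ..
qed

lemma epow_of_nat: "epow (of_nat n) a = ennreal (real n powr a)"
  by (simp add: epow_ennreal ennreal_of_nat_eq_real_of_nat)

lemma I_vec_eq_nrm: "I_vec q p a \<omega> n $ j = nrm a (quenched q p \<omega>) (\<lambda>x. of_nat (x (Imm n) $ j))"
  by (simp add: I_vec_def nrm_def epow_of_nat)

lemma M_mat_eq_nrm:
  "M_mat q p a \<omega> k $ j $ i = nrm a (quenched q p \<omega>) (\<lambda>x. of_nat (x (Off k m i) $ j))"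
  unfolding M_mat_def nrm_def epow_of_nat
  using nn_integral_slot[where f="\<lambda>y. ennreal (real (y $ j) powr a)" and s="Off k m i" and q=q and p=p and \<omega>=\<omega>]
    nn_integral_slot[where f="\<lambda>y. ennreal (real (y $ j) powr a)" and s="Off k 1 i" and q=q and p=p and \<omega>=\<omega>]
  by (simp add: slot_pmf_def)

text \<open>The first family owns the lowest numbers, so its block starts at 1 and is determined by
  its own size \<open>v\<close> alone; no other family enters its recursion.\<close>

definition next_gen :: "nat \<Rightarrow> nat^'d::finite \<Rightarrow> ('d slot \<Rightarrow> nat^'d) \<Rightarrow> nat^'d" where
  "next_gen k v x = (\<Sum>i\<in>UNIV. \<Sum>m\<in>{0<..v $ i}. x (Off k m i))"

lemma U_Suc_zero: "U x (Suc k) 0 = next_gen k (U x k 0) x"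
  by (simp add: next_gen_def)

definition past_slots :: "nat \<Rightarrow> 'd slot set" where
  "past_slots k = insert (Imm 0) {Off l m i | l m i. l < k}"

definition gen_slots :: "nat \<Rightarrow> 'd slot set" where
  "gen_slots k = {Off k m i | m i. True}"

lemma next_gen_cong: "(\<And>s. s \<in> gen_slots k \<Longrightarrow> x s = y s) \<Longrightarrow> next_gen k v x = next_gen k v y"
  unfolding next_gen_def gen_slots_def by (intro sum.cong refl) auto

lemma U_cong: "(\<And>s. s \<in> past_slots k \<Longrightarrow> x s = y s) \<Longrightarrow> U x k 0 = U y k 0"
proof (induction k)
  case 0
  then show ?case by (simp add: past_slots_def)
next
  case (Suc k)
  have "U x k 0 = U y k 0" by (rule Suc.IH) (use Suc.prems in \<open>auto simp: past_slots_def\<close>)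
  moreover have "next_gen k v x = next_gen k v y" for v
    by (rule next_gen_cong) (use Suc.prems in \<open>auto simp: past_slots_def gen_slots_def\<close>)
  ultimately show ?case by (simp only: U_Suc_zero)
qed

text \<open>Generations up to \<open>k\<close> of the first family and the offspring in generation
  \<open>k\<close> read the disjoint sets \<open>past_slots k\<close> and
  \<open>gen_slots k\<close>. By independence the offspring may be replaced by those of a second,
  independent configuration \<open>y\<close>.\<close>

lemma nn_integral_U_Suc:
  fixes p :: "'d::finite \<Rightarrow> 's \<Rightarrow> (nat^'d) pmf" and g :: "nat^'d \<Rightarrow> ennreal"
  shows "(\<integral>\<^sup>+x. g (U x (Suc k) 0) \<partial>quenched q p \<omega>) =
    (\<integral>\<^sup>+x. (\<integral>\<^sup>+y. g (next_gen k (U x k 0) y) \<partial>quenched q p \<omega>) \<partial>quenched q p \<omega>)"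
proof -
  define Q where "Q = quenched q p \<omega>"
  interpret Q: prob_space Q unfolding Q_def by (rule prob_space_quenched)
  define PM where "PM k = measure_pmf (slot_pmf q p \<omega> k)" for k
  define A :: "'d slot set" where "A = past_slots k"
  define B :: "'d slot set" where "B = gen_slots k"
  \<comment> \<open>\<open>U\<close> is defined on full configurations only; the slots outside
    \<open>A\<close> are filled with 0 and do not influence the first family up to generation
    \<open>k\<close>.\<close>
  define ext where "ext z = (\<lambda>s\<in>UNIV. if s \<in> A then z s else (0 :: nat^'d))" for z
  have co: "Q.indep_vars PM (\<lambda>k x. x k) UNIV"
    unfolding quenched_eq PM_def Q_def by (rule indep_vars_PiM_coordinates) (rule measure_pmf.prob_space_axioms)
  have comp: "(\<lambda>x. x l) \<in> measurable (Pi\<^sub>M C PM) (count_space UNIV)" if "l \<in> C" for l C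
  proof -
    have "(\<lambda>x. x l) \<in> measurable (Pi\<^sub>M C PM) (PM l)"
      using that by (rule measurable_component_singleton)
    moreover have "sets (PM l) = sets (count_space UNIV)" by (simp add: PM_def)
    ultimately show ?thesis using measurable_cong_sets by blast
  qed
  have ind: "Q.indep_var (Pi\<^sub>M A PM) (\<lambda>x. restrict x A) (Pi\<^sub>M B PM) (\<lambda>x. restrict x B)"
    by (rule Q.indep_var_restrict[OF co]) (auto simp: A_def B_def past_slots_def gen_slots_def)
  have ext: "ext \<in> measurable (Pi\<^sub>M A PM) slot_space"
    unfolding ext_def
  proof (rule measurable_restrict)
    fix s
    show "(\<lambda>z. if s \<in> A then z s else 0) \<in> measurable (Pi\<^sub>M A PM) (count_space UNIV)"
      using comp[of s A] by (cases "s \<in> A") auto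
  qed
  have Um: "(\<lambda>z. U (ext z) k 0) \<in> measurable (Pi\<^sub>M A PM) (count_space UNIV)"
    by (rule measurable_compose[OF ext measurable_U])
  have e: "U (ext (restrict x A)) k 0 = U x k 0" for x
    by (rule U_cong) (simp add: ext_def A_def)
  have nB: "next_gen k v (restrict x B) = next_gen k v x" for v x
    by (rule next_gen_cong) (simp add: B_def)
  define h where "h = (\<lambda>(z, z'). g (next_gen k (U (ext z) k 0) z'))"
  have ng: "next_gen k v \<in> measurable (Pi\<^sub>M B PM) (count_space UNIV)" for v
    unfolding next_gen_def[abs_def] by (intro measurable_count_sum comp) (auto simp: B_def gen_slots_def)
  have "(\<lambda>w. next_gen k (U (ext (fst w)) k 0) (snd w)) \<in> measurable (Pi\<^sub>M A PM \<Otimes>\<^sub>M Pi\<^sub>M B PM) (count_space UNIV)"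
    by (rule measurable_compose_countable[where f="\<lambda>v w. next_gen k v (snd w)" and g="\<lambda>w. U (ext (fst w)) k 0"])
      (rule measurable_compose[OF measurable_snd ng] measurable_compose[OF measurable_fst Um])+
  then have "(\<lambda>w. g (next_gen k (U (ext (fst w)) k 0) (snd w))) \<in> borel_measurable (Pi\<^sub>M A PM \<Otimes>\<^sub>M Pi\<^sub>M B PM)"
    by (rule measurable_compose) simp
  then have h [measurable]: "h \<in> borel_measurable (Pi\<^sub>M A PM \<Otimes>\<^sub>M Pi\<^sub>M B PM)"
    by (simp add: h_def case_prod_beta)
  have rvX: "(\<lambda>x. restrict x A) \<in> measurable Q (Pi\<^sub>M A PM)"
    and rvY: "(\<lambda>x. restrict x B) \<in> measurable Q (Pi\<^sub>M B PM)"
    and de: "distr Q (Pi\<^sub>M A PM) (\<lambda>x. restrict x A) \<Otimes>\<^sub>M distr Q (Pi\<^sub>M B PM) (\<lambda>x. restrict x B) =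
      distr Q (Pi\<^sub>M A PM \<Otimes>\<^sub>M Pi\<^sub>M B PM) (\<lambda>x. (restrict x A, restrict x B))"
    using ind unfolding Q.indep_var_distribution_eq by auto
  interpret Y: prob_space "distr Q (Pi\<^sub>M B PM) (\<lambda>x. restrict x B)"
    by (rule Q.prob_space_distr[OF rvY])
  have "(\<integral>\<^sup>+x. g (U x (Suc k) 0) \<partial>Q) = (\<integral>\<^sup>+x. h (restrict x A, restrict x B) \<partial>Q)"
    by (simp only: U_Suc_zero h_def prod.case nB e)
  also have "\<dots> = (\<integral>\<^sup>+z. h z \<partial>distr Q (Pi\<^sub>M A PM \<Otimes>\<^sub>M Pi\<^sub>M B PM) (\<lambda>x. (restrict x A, restrict x B)))"
    by (rule nn_integral_distr[symmetric]) (use rvX rvY in auto)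
  also have "\<dots> = (\<integral>\<^sup>+v. (\<integral>\<^sup>+y. h (v, y) \<partial>distr Q (Pi\<^sub>M B PM) (\<lambda>x. restrict x B)) \<partial>distr Q (Pi\<^sub>M A PM) (\<lambda>x. restrict x A))"
    unfolding de[symmetric] by (rule Y.nn_integral_fst[symmetric]) (simp cong: measurable_cong_sets)
  also have "\<dots> = (\<integral>\<^sup>+x. (\<integral>\<^sup>+y. h (restrict x A, y) \<partial>distr Q (Pi\<^sub>M B PM) (\<lambda>x. restrict x B)) \<partial>Q)"
    by (rule nn_integral_distr[OF rvX]) simp
  also have "\<dots> = (\<integral>\<^sup>+x. (\<integral>\<^sup>+y. h (restrict x A, restrict y B) \<partial>Q) \<partial>Q)"
  proof (intro nn_integral_cong nn_integral_distr[OF rvY])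
    fix x assume "x \<in> space Q"
    then have "restrict x A \<in> space (Pi\<^sub>M A PM)" using measurable_space[OF rvX] by blast
    then show "(\<lambda>y. h (restrict x A, y)) \<in> borel_measurable (distr Q (Pi\<^sub>M B PM) (\<lambda>x. restrict x B))"
      by simp
  qed
  finally show ?thesis by (simp only: h_def prod.case nB e Q_def)
qed

lemma measurable_quenched_count:
  fixes g :: "'b \<Rightarrow> ennreal"
  assumes "f \<in> measurable slot_space (count_space UNIV)"
  shows "(\<lambda>x. g (f x)) \<in> borel_measurable (quenched q p \<omega>)"
proof -
  have "(\<lambda>x. g (f x)) \<in> borel_measurable slot_space"
    by (rule measurable_compose[OF assms]) simp
  then show ?thesis by (simp cong: measurable_cong_sets add: sets_quenched)
qed

text \<open>Minkowski's inequality over single particles: all particles of a type have the same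
  offspring norm, hence the factor \<open>v $ i\<close>.\<close>

lemma nrm_next_gen_le:
  fixes p :: "'d::finite \<Rightarrow> 's \<Rightarrow> (nat^'d) pmf"
  assumes a: "a \<ge> 1"
  shows "nrm a (quenched q p \<omega>) (\<lambda>y. of_nat (next_gen k v y $ j)) \<le>
    (\<Sum>i\<in>UNIV. M_mat q p a \<omega> k $ j $ i * of_nat (v $ i))"
proof -
  have m: "(\<lambda>y. of_nat (y (Off k m i) $ j) :: ennreal) \<in> borel_measurable (quenched q p \<omega>)" for m i
    by (rule measurable_quenched_count[where g="\<lambda>w. of_nat (w $ j)"]) (rule measurable_slot)
  have "nrm a (quenched q p \<omega>) (\<lambda>y. of_nat (next_gen k v y $ j)) =
      nrm a (quenched q p \<omega>) (\<lambda>y. \<Sum>i\<in>UNIV. \<Sum>m\<in>{0<..v $ i}. of_nat (y (Off k m i) $ j))"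
    by (simp add: next_gen_def)
  also have "\<dots> \<le> (\<Sum>i\<in>UNIV. nrm a (quenched q p \<omega>) (\<lambda>y. \<Sum>m\<in>{0<..v $ i}. of_nat (y (Off k m i) $ j)))"
    by (rule nrm_sum[OF a]) (intro borel_measurable_sum m)
  also have "\<dots> \<le> (\<Sum>i\<in>UNIV. \<Sum>m\<in>{0<..v $ i}. nrm a (quenched q p \<omega>) (\<lambda>y. of_nat (y (Off k m i) $ j)))"
    by (intro sum_mono nrm_sum[OF a] m)
  also have "\<dots> = (\<Sum>i\<in>UNIV. M_mat q p a \<omega> k $ j $ i * of_nat (v $ i))"
    by (intro sum.cong refl) (simp add: M_mat_eq_nrm[symmetric] mult.commute)
  finally show ?thesis .
qed

lemma nn_integral_next_gen:
  fixes p :: "'d::finite \<Rightarrow> 's \<Rightarrow> (nat^'d) pmf"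
  shows "(\<integral>\<^sup>+y. of_nat (next_gen k v y $ j) \<partial>quenched q p \<omega>) =
    (\<Sum>i\<in>UNIV. M_mat q p 1 \<omega> k $ j $ i * of_nat (v $ i))"
proof -
  have m: "(\<lambda>y. of_nat (y (Off k m i) $ j) :: ennreal) \<in> borel_measurable (quenched q p \<omega>)" for m i
    by (rule measurable_quenched_count[where g="\<lambda>w. of_nat (w $ j)"]) (rule measurable_slot)
  have "(\<integral>\<^sup>+y. of_nat (next_gen k v y $ j) \<partial>quenched q p \<omega>) =
      (\<integral>\<^sup>+y. (\<Sum>i\<in>UNIV. \<Sum>m\<in>{0<..v $ i}. of_nat (y (Off k m i) $ j)) \<partial>quenched q p \<omega>)"
    by (simp add: next_gen_def)
  also have "\<dots> = (\<Sum>i\<in>UNIV. \<Sum>m\<in>{0<..v $ i}. \<integral>\<^sup>+y. of_nat (y (Off k m i) $ j) \<partial>quenched q p \<omega>)"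
    using m by (simp add: nn_integral_sum borel_measurable_sum)
  also have "\<dots> = (\<Sum>i\<in>UNIV. M_mat q p 1 \<omega> k $ j $ i * of_nat (v $ i))"
    by (intro sum.cong refl) (simp add: M_mat_eq_nrm[of q p 1 \<omega> k j _ m for m, unfolded nrm_one, symmetric] mult.commute)
  finally show ?thesis .
qed

text \<open>Minkowski's inequality twice: over the particles given the population, and then over the
  types of the random population. The resulting recursion is multiplication by the matrix of
  offspring norms.\<close>

lemma nrm_U_le:
  fixes p :: "'d::finite \<Rightarrow> 's \<Rightarrow> (nat^'d) pmf"
  assumes a: "a \<ge> 1"
  shows "nrm a (quenched q p \<omega>) (\<lambda>x. of_nat (U x k 0 $ j)) \<le> (M_prod q p a \<omega> k *v I_vec q p a \<omega> 0) $ j"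
proof (induction k arbitrary: j)
  case 0
  then show ?case by (simp add: I_vec_eq_nrm matrix_vector_mul_lid)
next
  case (Suc k)
  have a0: "a > 0" using a by simp
  have m: "(\<lambda>x. of_nat (U x k 0 $ i) :: ennreal) \<in> borel_measurable (quenched q p \<omega>)" for i
    by (rule measurable_quenched_count[where g="\<lambda>w. of_nat (w $ i)"]) (rule measurable_U)
  have "(\<integral>\<^sup>+x. epow (of_nat (U x (Suc k) 0 $ j)) a \<partial>quenched q p \<omega>) =
    (\<integral>\<^sup>+x. (\<integral>\<^sup>+y. epow (of_nat (next_gen k (U x k 0) y $ j)) a \<partial>quenched q p \<omega>) \<partial>quenched q p \<omega>)"
    by (rule nn_integral_U_Suc)
  also have "\<dots> \<le> (\<integral>\<^sup>+x. epow (\<Sum>i\<in>UNIV. M_mat q p a \<omega> k $ j $ i * of_nat (U x k 0 $ i)) a \<partial>quenched q p \<omega>)"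
    by (intro nn_integral_mono) (simp add: nrm_le_iff[OF a0, symmetric] nrm_next_gen_le[OF a])
  finally have "nrm a (quenched q p \<omega>) (\<lambda>x. of_nat (U x (Suc k) 0 $ j)) \<le>
      nrm a (quenched q p \<omega>) (\<lambda>x. \<Sum>i\<in>UNIV. M_mat q p a \<omega> k $ j $ i * of_nat (U x k 0 $ i))"
    by (simp add: nrm_le_iff[OF a0] epow_nrm[OF a0] del: U.simps)
  also have "\<dots> \<le> (\<Sum>i\<in>UNIV. nrm a (quenched q p \<omega>) (\<lambda>x. M_mat q p a \<omega> k $ j $ i * of_nat (U x k 0 $ i)))"
    by (rule nrm_sum[OF a]) (use m in auto)
  also have "\<dots> = (\<Sum>i\<in>UNIV. M_mat q p a \<omega> k $ j $ i * nrm a (quenched q p \<omega>) (\<lambda>x. of_nat (U x k 0 $ i)))"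
    by (simp add: nrm_cmult[OF a0 m])
  also have "\<dots> \<le> (\<Sum>i\<in>UNIV. M_mat q p a \<omega> k $ j $ i * (M_prod q p a \<omega> k *v I_vec q p a \<omega> 0) $ i)"
    by (intro sum_mono mult_left_mono Suc) auto
  also have "\<dots> = (M_mat q p a \<omega> k *v (M_prod q p a \<omega> k *v I_vec q p a \<omega> 0)) $ j"
    by (simp add: matrix_vector_mult_def)
  also have "\<dots> = (M_prod q p a \<omega> (Suc k) *v I_vec q p a \<omega> 0) $ j"
    by (simp add: matrix_vector_mul_assoc)
  finally show ?case .
qed

text \<open>For exponent 1 the inequalities of the preceding bound become equalities. This
  identifies the terms of \<open>rho\<close> as the mean sizes of the generations after the
  immigrants.\<close>

lemma nn_integral_U:
  fixes p :: "'d::finite \<Rightarrow> 's \<Rightarrow> (nat^'d) pmf"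
  shows "(\<integral>\<^sup>+x. of_nat (U x k 0 $ j) \<partial>quenched q p \<omega>) = (M_prod q p 1 \<omega> k *v I_vec q p 1 \<omega> 0) $ j"
proof (induction k arbitrary: j)
  case 0
  then show ?case by (simp add: I_vec_eq_nrm nrm_one matrix_vector_mul_lid)
next
  case (Suc k)
  have m: "(\<lambda>x. of_nat (U x k 0 $ i) :: ennreal) \<in> borel_measurable (quenched q p \<omega>)" for i
    by (rule measurable_quenched_count[where g="\<lambda>w. of_nat (w $ i)"]) (rule measurable_U)
  have "(\<integral>\<^sup>+x. of_nat (U x (Suc k) 0 $ j) \<partial>quenched q p \<omega>) =
    (\<integral>\<^sup>+x. (\<integral>\<^sup>+y. of_nat (next_gen k (U x k 0) y $ j) \<partial>quenched q p \<omega>) \<partial>quenched q p \<omega>)"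
    by (rule nn_integral_U_Suc)
  also have "\<dots> = (\<integral>\<^sup>+x. (\<Sum>i\<in>UNIV. M_mat q p 1 \<omega> k $ j $ i * of_nat (U x k 0 $ i)) \<partial>quenched q p \<omega>)"
    by (simp only: nn_integral_next_gen)
  also have "\<dots> = (\<Sum>i\<in>UNIV. M_mat q p 1 \<omega> k $ j $ i * (M_prod q p 1 \<omega> k *v I_vec q p 1 \<omega> 0) $ i)"
    using m by (simp add: nn_integral_sum nn_integral_cmult Suc)
  also have "\<dots> = (M_mat q p 1 \<omega> k *v (M_prod q p 1 \<omega> k *v I_vec q p 1 \<omega> 0)) $ j"
    by (simp add: matrix_vector_mult_def)
  also have "\<dots> = (M_prod q p 1 \<omega> (Suc k) *v I_vec q p 1 \<omega> 0) $ j"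
    by (simp add: matrix_vector_mul_assoc)
  finally show ?case .
qed

section \<open>Stationarity and mixing of the environment\<close>

locale branching_environment =
  fixes S :: "'s measure" and P :: "(int \<Rightarrow> 's) measure"
    and q :: "'s \<Rightarrow> (nat^'d::finite) pmf" and p :: "'d \<Rightarrow> 's \<Rightarrow> (nat^'d) pmf"
  assumes env: "stationary_ergodic S P"
    and q_meas: "(\<lambda>s. measure_pmf (q s)) \<in> measurable S (subprob_algebra (count_space UNIV))"
    and p_meas: "\<And>i. (\<lambda>s. measure_pmf (p i s)) \<in> measurable S (subprob_algebra (count_space UNIV))"
begin

lemma prob_space_P: "prob_space P"
  and sets_P [measurable_cong]: "sets P = sets (Pi\<^sub>M UNIV (\<lambda>_. S))"
  and distr_shift: "distr P P shift = P"
  using env by (auto simp: stationary_ergodic_def)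

sublocale EP: prob_space P by (rule prob_space_P)

lemma space_P: "space P = Pi\<^sub>E UNIV (\<lambda>_. space S)"
  using sets_eq_imp_space_eq[OF sets_P] by (simp add: space_PiM)

lemma measurable_coordinate [measurable]: "(\<lambda>\<omega>. \<omega> j) \<in> measurable P S"
  by (subst measurable_cong_sets[OF sets_P refl]) (rule measurable_component_singleton, simp)

lemma measurable_slot_pmf: "(\<lambda>\<omega>. measure_pmf (slot_pmf q p \<omega> s)) \<in> measurable P (subprob_algebra (count_space UNIV))"
proof (cases s)
  case (Imm n)
  then show ?thesis
    unfolding slot_pmf_def by simp (rule measurable_compose[OF measurable_coordinate q_meas])
next
  case (Off n m i)
  then show ?thesis
    unfolding slot_pmf_def by simp (rule measurable_compose[OF measurable_coordinate p_meas])
qed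

text \<open>On a cylinder the quenched law is a finite product of probabilities of single slots,
  each measurable in the environment; the cylinders generate and are stable under
  intersection.\<close>

lemma measurable_quenched [measurable]: "quenched q p \<in> measurable P (subprob_algebra slot_space)"
proof (rule measurable_prob_algebraD, rule measurable_prob_algebra_generated)
  show "sets slot_space = sigma_sets (Pi\<^sub>E UNIV (\<lambda>_. space (count_space UNIV))) (prod_algebra UNIV (\<lambda>_. count_space UNIV))"
    by (rule sets_PiM)
  show "Int_stable (prod_algebra UNIV (\<lambda>_. count_space UNIV))" by (rule Int_stable_prod_algebra)
  show "prod_algebra UNIV (\<lambda>_. count_space UNIV) \<subseteq> Pow (Pi\<^sub>E UNIV (\<lambda>_. space (count_space UNIV)))"
    by (rule prod_algebra_sets_into_space)
  show "prob_space (quenched q p a)" for a by (rule prob_space_quenched)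
  show "sets (quenched q p a) = sets slot_space" for a by (rule sets_quenched)
  fix A :: "('d slot \<Rightarrow> nat^'d) set"
  assume "A \<in> prod_algebra UNIV (\<lambda>_. count_space UNIV)"
  then obtain J E where A: "A = prod_emb UNIV (\<lambda>_. count_space UNIV) J (Pi\<^sub>E J E)" "finite J"
    by (rule prod_algebraE)
  have "emeasure (quenched q p \<omega>) A = (\<Prod>j\<in>J. emeasure (measure_pmf (slot_pmf q p \<omega> j)) (E j))" for \<omega>
  proof -
    interpret product_prob_space "\<lambda>k. measure_pmf (slot_pmf q p \<omega> k)" UNIV
      by (rule product_prob_spaceI) (rule measure_pmf.prob_space_axioms)
    have "A = prod_emb UNIV (\<lambda>k. measure_pmf (slot_pmf q p \<omega> k)) J (Pi\<^sub>E J E)"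
      by (simp add: A prod_emb_def)
    then show ?thesis unfolding quenched_eq by (simp add: emeasure_PiM_emb A(2))
  qed
  moreover have "(\<lambda>\<omega>. \<Prod>j\<in>J. emeasure (measure_pmf (slot_pmf q p \<omega> j)) (E j)) \<in> borel_measurable P"
    by (intro borel_measurable_prod_ennreal)
      (rule measurable_compose[OF measurable_slot_pmf measurable_emeasure_subprob_algebra], simp)
  ultimately show "(\<lambda>\<omega>. emeasure (quenched q p \<omega>) A) \<in> borel_measurable P" by simp
qed

lemma measurable_shift_by [measurable]: "shift_by m \<in> measurable P P"
proof -
  have "(\<lambda>\<omega> j. \<omega> (j + m)) \<in> measurable P (Pi\<^sub>M UNIV (\<lambda>_. S))"
    by (rule measurable_abs_UNIV) (rule measurable_coordinate)
  then show ?thesis unfolding shift_by_def[abs_def] by (subst measurable_cong_sets[OF refl sets_P])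
qed

text \<open>Iteration gives the forward shifts; a backward shift inverts a forward one and so
  preserves the law as well.\<close>

lemma distr_shift_by: "distr P P (shift_by m) = P"
proof -
  have nat: "distr P P (shift_by (int n)) = P" for n
  proof (induction n)
    case 0
    have "shift_by 0 = (\<lambda>\<omega>::int \<Rightarrow> 's. \<omega>)" by (simp add: shift_by_def fun_eq_iff)
    then show ?case by (simp add: distr_id2)
  next
    case (Suc n)
    have s: "shift = (shift_by 1 :: (int \<Rightarrow> 's) \<Rightarrow> _)" by (simp add: fun_eq_iff shift_def shift_by_def)
    have c: "shift_by 1 \<circ> shift_by (int n) = (shift_by (int (Suc n)) :: (int \<Rightarrow> 's) \<Rightarrow> _)"
      by (simp add: fun_eq_iff shift_by_def algebra_simps)
    have "distr P P (shift_by (int (Suc n))) = distr (distr P P (shift_by (int n))) P (shift_by 1)"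
      by (subst distr_distr) (simp_all add: c)
    then show ?case using Suc distr_shift by (simp add: s)
  qed
  have c: "shift_by (- int n) \<circ> shift_by (int n) = (id :: (int \<Rightarrow> 's) \<Rightarrow> _)" for n
    by (simp add: fun_eq_iff shift_by_def)
  have "distr P P (shift_by (- int n)) = P" for n
  proof -
    have "distr P P (shift_by (- int n)) = distr (distr P P (shift_by (int n))) P (shift_by (- int n))"
      by (simp add: nat)
    also have "\<dots> = P" by (subst distr_distr) (simp_all add: c id_def distr_id2)
    finally show ?thesis .
  qed
  then show ?thesis using nat by (cases m rule: int_cases2) auto
qed

lemma nn_integral_shift_by:
  assumes "f \<in> borel_measurable P"
  shows "(\<integral>\<^sup>+\<omega>. f (shift_by m \<omega>) \<partial>P) = (\<integral>\<^sup>+\<omega>. f \<omega> \<partial>P)"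
proof -
  have "(\<integral>\<^sup>+\<omega>. f \<omega> \<partial>distr P P (shift_by m)) = (\<integral>\<^sup>+\<omega>. f (shift_by m \<omega>) \<partial>P)"
    by (rule nn_integral_distr[OF measurable_shift_by]) (use assms in simp)
  then show ?thesis by (simp add: distr_shift_by)
qed

lemma integral_shift_by:
  fixes f :: "_ \<Rightarrow> 'b::{banach, second_countable_topology}"
  assumes "f \<in> borel_measurable P"
  shows "(\<integral>\<omega>. f (shift_by m \<omega>) \<partial>P) = (\<integral>\<omega>. f \<omega> \<partial>P)"
  using integral_distr[OF measurable_shift_by assms, of m] by (simp add: distr_shift_by)

text \<open>The annealed law of the slots alone; it carries all the processes.\<close>

definition slots :: "('d slot \<Rightarrow> nat^'d) measure" where
  "slots = P \<bind> quenched q p"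

lemma sets_slots [measurable_cong]: "sets slots = sets slot_space"
  unfolding slots_def by (rule sets_bind) (use EP.not_empty sets_quenched in auto)

lemma space_slots [simp]: "space slots = UNIV"
  using sets_eq_imp_space_eq[OF sets_slots] by (simp add: space_PiM)

lemma prob_space_slots: "prob_space slots"
  unfolding slots_def
  by (rule EP.prob_space_bind[OF _ measurable_quenched]) (simp add: prob_space_quenched)

sublocale A: prob_space slots by (rule prob_space_slots)

lemma measurable_slots_iff: "measurable slots M = measurable slot_space M"
  by (rule measurable_cong_sets) (auto simp: sets_slots)

lemma nn_integral_slots:
  assumes "f \<in> borel_measurable slot_space"
  shows "(\<integral>\<^sup>+x. f x \<partial>slots) = (\<integral>\<^sup>+\<omega>. (\<integral>\<^sup>+x. f x \<partial>quenched q p \<omega>) \<partial>P)"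
  unfolding slots_def by (rule nn_integral_bind[OF assms measurable_quenched])

lemma measurable_nn_integral_quenched:
  assumes "f \<in> borel_measurable slot_space"
  shows "(\<lambda>\<omega>. \<integral>\<^sup>+x. f x \<partial>quenched q p \<omega>) \<in> borel_measurable P"
  by (rule measurable_compose[OF measurable_quenched nn_integral_measurable_subprob_algebra[OF assms]])

lemma measurable_integral_quenched:
  fixes f :: "_ \<Rightarrow> 'b::{banach, second_countable_topology}"
  assumes "f \<in> borel_measurable slot_space"
  shows "(\<lambda>\<omega>. \<integral>x. f x \<partial>quenched q p \<omega>) \<in> borel_measurable P"
  by (rule measurable_compose[OF measurable_quenched integral_measurable_subprob_algebra[OF assms]])

lemma integral_slots_real:
  fixes f :: "_ \<Rightarrow> real"
  assumes "f \<in> borel_measurable slot_space" "\<And>x. \<bar>f x\<bar> \<le> B"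
  shows "(\<integral>x. f x \<partial>slots) = (\<integral>\<omega>. (\<integral>x. f x \<partial>quenched q p \<omega>) \<partial>P)"
  unfolding slots_def
proof (rule integral_bind[OF assms(1) assms(2) measurable_quenched])
  show "finite_measure P" by (rule EP.finite_measure_axioms)
  show "AE \<omega> in P. emeasure (quenched q p \<omega>) (space (quenched q p \<omega>)) \<le> ennreal 1"
    by (intro AE_I2) (simp add: prob_space.emeasure_space_1[OF prob_space_quenched, simplified])
qed

lemma quenched_bounded:
  fixes f :: "_ \<Rightarrow> 'b::{banach, second_countable_topology}"
  assumes "f \<in> borel_measurable slot_space" "\<And>x. norm (f x) \<le> B"
  shows "integrable (quenched q p \<omega>) f" "norm (\<integral>x. f x \<partial>quenched q p \<omega>) \<le> B"
proof -
  interpret Q: prob_space "quenched q p \<omega>" by (rule prob_space_quenched)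
  have [measurable]: "f \<in> borel_measurable (quenched q p \<omega>)" using assms(1) by (simp add: measurable_quenched_iff)
  show i: "integrable (quenched q p \<omega>) f"
    by (rule Q.integrable_const_bound[where B=B]) (use assms(2) in auto)
  have "norm (\<integral>x. f x \<partial>quenched q p \<omega>) \<le> (\<integral>x. norm (f x) \<partial>quenched q p \<omega>)" by (rule integral_norm_bound)
  also have "\<dots> \<le> (\<integral>x. B \<partial>quenched q p \<omega>)" by (intro integral_mono integrable_norm i assms(2)) simp
  finally show "norm (\<integral>x. f x \<partial>quenched q p \<omega>) \<le> B" by (simp add: Q.prob_space[simplified])
qed

lemma integral_slots_complex:
  fixes f :: "_ \<Rightarrow> complex"
  assumes [measurable]: "f \<in> borel_measurable slot_space" and bd: "\<And>x. cmod (f x) \<le> B"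
  shows "(\<integral>x. f x \<partial>slots) = (\<integral>\<omega>. (\<integral>x. f x \<partial>quenched q p \<omega>) \<partial>P)"
proof -
  have fA [measurable]: "f \<in> borel_measurable slots" by (simp add: measurable_slots_iff)
  have iA: "integrable slots f" by (rule A.integrable_const_bound[where B=B]) (use bd in auto)
  note iQ = quenched_bounded[OF assms]
  have iP: "integrable P (\<lambda>\<omega>. \<integral>x. f x \<partial>quenched q p \<omega>)"
    by (rule EP.integrable_const_bound[where B=B]) (use iQ(2) measurable_integral_quenched[OF assms(1)] in auto)
  have b: "\<bar>Re (f x)\<bar> \<le> B" "\<bar>Im (f x)\<bar> \<le> B" for x
    using bd[of x] abs_Re_le_cmod[of "f x"] abs_Im_le_cmod[of "f x"] by linarith+
  show ?thesis
  proof (rule complex_eqI)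
    have "Re (\<integral>x. f x \<partial>slots) = (\<integral>\<omega>. (\<integral>x. Re (f x) \<partial>quenched q p \<omega>) \<partial>P)"
      using iA integral_slots_real[of "\<lambda>x. Re (f x)" B] b by simp
    then show "Re (\<integral>x. f x \<partial>slots) = Re (\<integral>\<omega>. (\<integral>x. f x \<partial>quenched q p \<omega>) \<partial>P)"
      using iP iQ(1) by simp
    have "Im (\<integral>x. f x \<partial>slots) = (\<integral>\<omega>. (\<integral>x. Im (f x) \<partial>quenched q p \<omega>) \<partial>P)"
      using iA integral_slots_real[of "\<lambda>x. Im (f x)" B] b by simp
    then show "Im (\<integral>x. f x \<partial>slots) = Im (\<integral>\<omega>. (\<integral>x. f x \<partial>quenched q p \<omega>) \<partial>P)"
      using iP iQ(1) by simp
  qed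
qed

text \<open>The processes are functions of the slots alone, so their expectations under the annealed
  law can be computed under its marginal \<open>slots\<close>.\<close>

lemma
  shows distr_annealed: "distr (annealed P q p) slot_space snd = slots"
    and measurable_annealed: "measurable (annealed P q p) N = measurable (P \<Otimes>\<^sub>M slot_space) N"
    and prob_space_annealed: "prob_space (annealed P q p)"
proof -
  let ?K = "\<lambda>\<omega>. distr (quenched q p \<omega>) (P \<Otimes>\<^sub>M slot_space) (\<lambda>x. (\<omega>, x))"
  have K: "?K \<in> measurable P (subprob_algebra (P \<Otimes>\<^sub>M slot_space))"
    by (rule measurable_distr2[OF _ measurable_quenched]) simp
  have pair: "(\<lambda>x. (\<omega>, x)) \<in> measurable (quenched q p \<omega>) (P \<Otimes>\<^sub>M slot_space)" if "\<omega> \<in> space P" for \<omega>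
    unfolding measurable_quenched_iff using that by measurable
  have "distr (annealed P q p) slot_space snd = P \<bind> (\<lambda>\<omega>. distr (?K \<omega>) slot_space snd)"
    unfolding annealed_def by (rule distr_bind[OF K EP.not_empty]) simp
  also have "\<dots> = P \<bind> quenched q p"
  proof (rule bind_cong[OF refl])
    fix \<omega> assume w: "\<omega> \<in> space P"
    show "distr (?K \<omega>) slot_space snd = quenched q p \<omega>"
      by (subst distr_distr[OF _ pair[OF w]]) (simp_all add: comp_def distr_id2 sets_quenched)
  qed
  finally show "distr (annealed P q p) slot_space snd = slots" by (simp add: slots_def)
  have "sets (annealed P q p) = sets (P \<Otimes>\<^sub>M slot_space)"
    unfolding annealed_def by (rule sets_bind) (use EP.not_empty in auto)
  then show "measurable (annealed P q p) N = measurable (P \<Otimes>\<^sub>M slot_space) N"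
    by (rule measurable_cong_sets) simp
  show "prob_space (annealed P q p)"
    unfolding annealed_def
    by (rule EP.prob_space_bind[OF _ K]) (auto intro!: AE_I2 prob_space.prob_space_distr prob_space_quenched pair)
qed

section \<open>Families under the annealed law\<close>

lemma fam_measurable_comp:
  fixes H :: "(nat^'d) list \<Rightarrow> 'b::topological_space"
  shows "(\<lambda>x. H (fam x n r)) \<in> borel_measurable slot_space"
  by (rule measurable_compose[OF measurable_fam]) simp

lemma distr_fam:
  "distr (quenched q p \<omega>) (count_space UNIV) (\<lambda>x. fam x n r) =
    distr (quenched q p (shift_by (int n) \<omega>)) (count_space UNIV) (\<lambda>x. fam x 0 r)"
proof (rule measure_eqI_countable[where A=UNIV])
  fix as :: "(nat^'d) list"
  have m0: "(\<lambda>x. fam x n r) \<in> measurable (quenched q p \<omega>') (count_space UNIV)" for n \<omega>'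
    unfolding measurable_quenched_iff by (rule measurable_fam)
  define H where "H = (indicator {as} :: _ \<Rightarrow> real)"
  have "(\<integral>x. H (fam x n r) \<partial>quenched q p \<omega>) = (\<integral>x. H (fam x 0 r) \<partial>quenched q p (shift_by (int n) \<omega>))"
    using integral_prod_families[where I="{n}" and H="\<lambda>_. H" and B="\<lambda>_. 1" and r=r and q=q and p=p and \<omega>=\<omega>] by (simp add: H_def)
  moreover have "(\<integral>x. H (fam x n r) \<partial>quenched q p \<omega>') = measure (quenched q p \<omega>') ((\<lambda>x. fam x n r) -` {as})" for n \<omega>'
  proof -
    have "(\<integral>x. H (fam x n r) \<partial>quenched q p \<omega>') = (\<integral>x. indicator ((\<lambda>x. fam x n r) -` {as}) x \<partial>quenched q p \<omega>')"
      by (intro Bochner_Integration.integral_cong refl) (simp add: H_def indicator_def)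
    then show ?thesis by simp
  qed
  moreover have "emeasure (distr (quenched q p \<omega>') (count_space UNIV) (\<lambda>x. fam x n r)) {as} =
      ennreal (measure (quenched q p \<omega>') ((\<lambda>x. fam x n r) -` {as}))" for n \<omega>'
    using prob_space.finite_measure[OF prob_space_quenched, of q p \<omega>']
    by (subst emeasure_distr[OF m0]) (auto simp: finite_measure.emeasure_eq_measure)
  ultimately show "emeasure (distr (quenched q p \<omega>) (count_space UNIV) (\<lambda>x. fam x n r)) {as} =
      emeasure (distr (quenched q p (shift_by (int n) \<omega>)) (count_space UNIV) (\<lambda>x. fam x 0 r)) {as}"
    by simp
qed auto

lemma nn_integral_fam_quenched:
  fixes f :: "(nat^'d) list \<Rightarrow> ennreal"
  shows "(\<integral>\<^sup>+x. f (fam x n r) \<partial>quenched q p \<omega>) = (\<integral>\<^sup>+x. f (fam x 0 r) \<partial>quenched q p (shift_by (int n) \<omega>))"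
proof -
  have m0: "(\<lambda>x. fam x n r) \<in> measurable (quenched q p \<omega>') (count_space UNIV)" for n \<omega>'
    unfolding measurable_quenched_iff by (rule measurable_fam)
  have "(\<integral>\<^sup>+x. f (fam x n r) \<partial>quenched q p \<omega>) = (\<integral>\<^sup>+a. f a \<partial>distr (quenched q p \<omega>) (count_space UNIV) (\<lambda>x. fam x n r))"
    by (rule nn_integral_distr[OF m0, symmetric]) simp
  also have "\<dots> = (\<integral>\<^sup>+x. f (fam x 0 r) \<partial>quenched q p (shift_by (int n) \<omega>))"
    unfolding distr_fam[where \<omega>=\<omega> and n=n and r=r] by (rule nn_integral_distr[OF m0]) simp
  finally show ?thesis .
qed

lemma nn_integral_fam:
  fixes f :: "(nat^'d) list \<Rightarrow> ennreal"
  shows "(\<integral>\<^sup>+x. f (fam x n r) \<partial>slots) = (\<integral>\<^sup>+\<omega>. (\<integral>\<^sup>+x. f (fam x 0 r) \<partial>quenched q p \<omega>) \<partial>P)"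
  unfolding nn_integral_slots[OF fam_measurable_comp] nn_integral_fam_quenched[where f=f and n=n and r=r]
  by (rule nn_integral_shift_by) (rule measurable_nn_integral_quenched[OF fam_measurable_comp])

lemma integral_prod_fam_real:
  fixes H :: "nat \<Rightarrow> (nat^'d) list \<Rightarrow> real"
  assumes "finite I" "\<And>n as. n \<in> I \<Longrightarrow> \<bar>H n as\<bar> \<le> B n"
  shows "(\<integral>x. (\<Prod>n\<in>I. H n (fam x n r)) \<partial>slots) =
    (\<integral>\<omega>. (\<Prod>n\<in>I. \<integral>x. H n (fam x 0 r) \<partial>quenched q p (shift_by (int n) \<omega>)) \<partial>P)"
proof (subst integral_slots_real)
  show "(\<lambda>x. \<Prod>n\<in>I. H n (fam x n r)) \<in> borel_measurable slot_space"
    by (intro borel_measurable_prod fam_measurable_comp)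
  show "\<bar>\<Prod>n\<in>I. H n (fam x n r)\<bar> \<le> (\<Prod>n\<in>I. B n)" for x
    unfolding abs_prod by (intro prod_mono) (use assms(2) in auto)
qed (use assms in \<open>simp add: integral_prod_families[where I=I and H=H and B=B]\<close>)

lemma integral_prod_fam_complex:
  fixes H :: "nat \<Rightarrow> (nat^'d) list \<Rightarrow> complex"
  assumes "finite I" "\<And>n as. n \<in> I \<Longrightarrow> cmod (H n as) \<le> B n"
  shows "(\<integral>x. (\<Prod>n\<in>I. H n (fam x n r)) \<partial>slots) =
    (\<integral>\<omega>. (\<Prod>n\<in>I. \<integral>x. H n (fam x 0 r) \<partial>quenched q p (shift_by (int n) \<omega>)) \<partial>P)"
proof (subst integral_slots_complex)
  show "(\<lambda>x. \<Prod>n\<in>I. H n (fam x n r)) \<in> borel_measurable slot_space"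
    by (intro borel_measurable_prod fam_measurable_comp)
  show "cmod (\<Prod>n\<in>I. H n (fam x n r)) \<le> (\<Prod>n\<in>I. B n)" for x
    unfolding prod_norm[symmetric] by (intro prod_mono) (use assms(2) in auto)
qed (use assms in \<open>simp add: integral_prod_families[where I=I and H=H and B=B]\<close>)

end

text \<open>A level strictly between the upper limit and 0 gives a rate that holds from some index
  on; the finitely many earlier terms are finite and are absorbed into \<open>C\<close>. Index 0 is
  left out, where the quotient is a division by 0.\<close>

lemma limsup_elog_imp_exp_decay:
  fixes a :: "nat \<Rightarrow> ennreal"
  assumes ls: "limsup (\<lambda>n. elog (a n) / ereal (real n)) < 0" and fin: "\<And>n. n \<ge> 1 \<Longrightarrow> a n < \<infinity>"
  obtains C \<theta> :: real where "0 < C" "0 < \<theta>" "\<theta> < 1" "\<And>n. n \<ge> 1 \<Longrightarrow> a n \<le> ennreal (C * \<theta> ^ n)"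
proof -
  obtain c where c: "limsup (\<lambda>n. elog (a n) / ereal (real n)) < ereal c" "ereal c < 0"
    using ereal_dense2[OF ls] by blast
  have c0: "c < 0" using c(2) by simp
  define \<theta> where "\<theta> = exp c"
  have \<theta>: "0 < \<theta>" "\<theta> < 1" using c0 by (auto simp: \<theta>_def)
  have "eventually (\<lambda>n. elog (a n) / ereal (real n) < ereal c) sequentially"
    by (rule Limsup_lessD[OF c(1)])
  then obtain N where N: "\<And>n. n \<ge> N \<Longrightarrow> elog (a n) / ereal (real n) < ereal c"
    by (auto simp: eventually_sequentially)
  have big: "a n \<le> ennreal (\<theta> ^ n)" if n: "n \<ge> N" "n \<ge> 1" for n
  proof (cases "a n = 0")
    case False
    obtain y where y: "a n = ennreal y" "y \<ge> 0" using fin[OF n(2)] by (cases "a n") auto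
    with False have y0: "y > 0" by (auto simp: less_le)
    have "elog (a n) = ereal (ln y)" using y y0 by (simp add: elog_def)
    then have "ln y / real n < c" using N[OF n(1)] n(2) by simp
    then have "ln y < c * real n" using n(2) by (simp add: pos_divide_less_eq)
    then have "y < exp (c * real n)" using y0 by (metis exp_less_cancel_iff exp_ln)
    also have "exp (c * real n) = \<theta> ^ n" by (simp add: \<theta>_def exp_of_nat_mult[symmetric] mult.commute)
    finally show ?thesis using y by (simp add: ennreal_leI)
  qed simp
  define C where "C = 1 + (\<Sum>n<N. enn2real (a n) / \<theta> ^ n)"
  have C1: "C \<ge> 1" unfolding C_def using \<theta> by (simp add: sum_nonneg)
  have "a n \<le> ennreal (C * \<theta> ^ n)" if n: "n \<ge> 1" for n
  proof (cases "n \<ge> N")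
    case True
    have "\<theta> ^ n \<le> C * \<theta> ^ n" using C1 \<theta> by simp
    then show ?thesis using big[OF True n] by (meson ennreal_leI order_trans)
  next
    case False
    then have "enn2real (a n) / \<theta> ^ n \<le> (\<Sum>n<N. enn2real (a n) / \<theta> ^ n)"
      using \<theta> by (intro member_le_sum) auto
    then have "enn2real (a n) / \<theta> ^ n \<le> C" by (simp add: C_def)
    then have "enn2real (a n) \<le> C * \<theta> ^ n" using \<theta> by (simp add: pos_divide_le_eq)
    then show ?thesis using fin[OF n] by (metis ennreal_enn2real ennreal_leI infinity_ennreal_def)
  qed
  with that[of C \<theta>] C1 \<theta> show ?thesis by simp
qed

text \<open>On the unit interval this is \<open>y\<close> rounded down to a multiple of
  \<open>1 / K\<close>, written as an average of indicators of upper level sets. Covariances of such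
  functions are averages of covariances of events.\<close>

definition staircase :: "nat \<Rightarrow> real \<Rightarrow> real" where
  "staircase K y = (\<Sum>j = 1..K. if real j \<le> real K * y then 1 else 0) / K"

lemma staircase:
  assumes "K > 0" "0 \<le> y" "y \<le> 1"
  shows "\<bar>y - staircase K y\<bar> \<le> 1 / K" "0 \<le> staircase K y" "staircase K y \<le> 1"
proof -
  define n where "n = nat \<lfloor>real K * y\<rfloor>"
  have Ky: "0 \<le> real K * y" "real K * y \<le> K" using assms by (auto simp: mult_left_le)
  have n: "real n \<le> real K * y" "real K * y < n + 1" using Ky unfolding n_def by linarith+
  have nK: "n \<le> K" using n(1) Ky(2) by linarith
  have "{j \<in> {1..K}. real j \<le> real K * y} = {1..n}"
    using n nK by auto
  then have "(\<Sum>j = 1..K. if real j \<le> real K * y then 1 else 0 :: real) = n"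
    by (simp add: sum.If_cases Int_def)
  then have s: "staircase K y = n / K" by (simp add: staircase_def)
  have "\<bar>real K * y - n\<bar> \<le> 1" using n by linarith
  moreover have "y - staircase K y = (real K * y - n) / K" using assms by (simp add: s field_simps)
  ultimately show "\<bar>y - staircase K y\<bar> \<le> 1 / K" using assms by (simp add: divide_right_mono)
  show "0 \<le> staircase K y" "staircase K y \<le> 1" using nK assms by (auto simp: s)
qed

lemma sigma_generated_by:
  assumes "X \<subseteq> Pow \<Omega>"
  shows "sets (sigma \<Omega> X) = sigma_sets \<Omega> X" "space (sigma \<Omega> X) = \<Omega>"
  using assms by (auto simp: sets_measure_of space_measure_of_conv)

context branching_environment
begin

text \<open>Stated through the values of \<open>G\<close>, which can be read off from formulas;
  measurability with respect to the coordinates in \<open>J\<close> is derived in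
  \<open>depends_on_sets\<close>.\<close>

definition depends_on :: "int set \<Rightarrow> ((int \<Rightarrow> 's) \<Rightarrow> 'b::topological_space) \<Rightarrow> bool" where
  "depends_on J G \<longleftrightarrow> G \<in> borel_measurable P \<and>
     (\<forall>\<omega>\<in>space P. \<forall>\<omega>'\<in>space P. (\<forall>j\<in>J. \<omega> j = \<omega>' j) \<longrightarrow> G \<omega> = G \<omega>')"

text \<open>The coordinates outside \<open>J\<close> are frozen at those of a fixed environment.
  This does not change \<open>G\<close> on \<open>space P\<close>, and the freezing map is
  measurable from the \<sigma>-algebra of the coordinates in \<open>J\<close>.\<close>

lemma depends_on_sets:
  fixes G :: "(int \<Rightarrow> 's) \<Rightarrow> 'b::topological_space"
  assumes G: "depends_on J G" and T: "T \<in> sets borel"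
  shows "{\<omega> \<in> space P. G \<omega> \<in> T} \<in> env_sigma S P J"
proof -
  define gen where "gen = {(\<lambda>\<omega>. \<omega> i) -` A \<inter> space P | i A. i \<in> J \<and> A \<in> sets S}"
  define PJ where "PJ = sigma (space P) gen"
  have gen: "gen \<subseteq> Pow (space P)" by (auto simp: gen_def)
  have PJ: "sets PJ = env_sigma S P J" "space PJ = space P"
    unfolding PJ_def env_sigma_def gen_def[symmetric] using sigma_generated_by[OF gen] by auto
  obtain \<omega>0 where w0: "\<omega>0 \<in> space P" using EP.not_empty by blast
  define pr where "pr \<omega> = (\<lambda>j. if j \<in> J then \<omega> j else \<omega>0 j)" for \<omega>
  have in_S: "\<omega> j \<in> space S" if "\<omega> \<in> space P" for \<omega> j using that by (auto simp: space_P)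
  have "(\<lambda>\<omega>. pr \<omega> j) \<in> measurable PJ S" for j
  proof (cases "j \<in> J")
    case True
    have "(\<lambda>\<omega>. \<omega> j) \<in> measurable PJ S"
    proof (rule measurableI)
      fix A assume "A \<in> sets S"
      then have "(\<lambda>\<omega>. \<omega> j) -` A \<inter> space P \<in> gen" using True by (auto simp: gen_def)
      then show "(\<lambda>\<omega>. \<omega> j) -` A \<inter> space PJ \<in> sets PJ"
        unfolding PJ(2) unfolding PJ_def using sigma_generated_by(1)[OF gen] by auto
    qed (use in_S PJ in auto)
    then show ?thesis using True by (simp add: pr_def)
  next
    case False
    then show ?thesis using in_S[OF w0] by (simp add: pr_def)
  qed
  then have "(\<lambda>\<omega> j. pr \<omega> j) \<in> measurable PJ (Pi\<^sub>M UNIV (\<lambda>_. S))" by (rule measurable_abs_UNIV)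
  then have pr: "pr \<in> measurable PJ P" by (subst measurable_cong_sets[OF refl sets_P])
  have Geq: "G (pr \<omega>) = G \<omega>" if "\<omega> \<in> space P" for \<omega>
  proof -
    have "pr \<omega> \<in> space P" using measurable_space[OF pr] that PJ by auto
    moreover have "\<forall>j\<in>J. pr \<omega> j = \<omega> j" by (simp add: pr_def)
    ultimately show ?thesis using G that unfolding depends_on_def by blast
  qed
  have "(\<lambda>\<omega>. G (pr \<omega>)) \<in> borel_measurable PJ"
    using G by (intro measurable_compose[OF pr]) (auto simp: depends_on_def)
  then have "(\<lambda>\<omega>. G (pr \<omega>)) -` T \<inter> space PJ \<in> sets PJ" using T by (rule measurable_sets)
  moreover have "(\<lambda>\<omega>. G (pr \<omega>)) -` T \<inter> space PJ = {\<omega> \<in> space P. G \<omega> \<in> T}"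
    using Geq PJ by auto
  ultimately show ?thesis using PJ by simp
qed

lemma depends_on_mono: "depends_on J G \<Longrightarrow> J \<subseteq> J' \<Longrightarrow> depends_on J' G"
  unfolding depends_on_def by blast

lemma depends_on_compose:
  assumes "depends_on J G" "f \<in> borel_measurable borel"
  shows "depends_on J (\<lambda>\<omega>. f (G \<omega>))"
  using assms measurable_compose[of G P borel f borel] unfolding depends_on_def by metis

lemma depends_on_shift_by:
  assumes "depends_on J G"
  shows "depends_on ((\<lambda>j. j + m) ` J) (\<lambda>\<omega>. G (shift_by m \<omega>))"
  unfolding depends_on_def
proof (intro conjI ballI impI)
  show "(\<lambda>\<omega>. G (shift_by m \<omega>)) \<in> borel_measurable P"
    using assms by (intro measurable_compose[OF measurable_shift_by]) (simp add: depends_on_def)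
  fix \<omega> \<omega>' assume w: "\<omega> \<in> space P" "\<omega>' \<in> space P" "\<forall>j\<in>(\<lambda>j. j + m) ` J. \<omega> j = \<omega>' j"
  have "shift_by m \<omega> \<in> space P" "shift_by m \<omega>' \<in> space P"
    using w measurable_space[OF measurable_shift_by] by auto
  moreover have "\<forall>j\<in>J. shift_by m \<omega> j = shift_by m \<omega>' j" using w by (auto simp: shift_by_def)
  ultimately show "G (shift_by m \<omega>) = G (shift_by m \<omega>')" using assms unfolding depends_on_def by blast
qed

lemma depends_on_prod:
  fixes G :: "'i \<Rightarrow> (int \<Rightarrow> 's) \<Rightarrow> 'b::{real_normed_field, second_countable_topology}"
  assumes "\<And>i. i \<in> I \<Longrightarrow> depends_on J (G i)"
  shows "depends_on J (\<lambda>\<omega>. \<Prod>i\<in>I. G i \<omega>)"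
  unfolding depends_on_def
proof (intro conjI ballI impI)
  show "(\<lambda>\<omega>. \<Prod>i\<in>I. G i \<omega>) \<in> borel_measurable P"
    using assms by (intro borel_measurable_prod) (auto simp: depends_on_def)
  fix \<omega> \<omega>' assume "\<omega> \<in> space P" "\<omega>' \<in> space P" "\<forall>j\<in>J. \<omega> j = \<omega>' j"
  then have "G i \<omega> = G i \<omega>'" if "i \<in> I" for i
    using assms[OF that] unfolding depends_on_def by blast
  then show "(\<Prod>i\<in>I. G i \<omega>) = (\<Prod>i\<in>I. G i \<omega>')" by (intro prod.cong refl) auto
qed

section \<open>Covariance inequalities for the mixing coefficient\<close>

lemma mixing_coeff_le_1: "mixing_coeff S P n \<le> 1"
  unfolding mixing_coeff_def
proof (intro SUP_least)
  fix A B
  have "measure P (A \<inter> B) \<le> 1" "measure P A * measure P B \<le> 1" by (auto intro: mult_le_one)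
  moreover have "0 \<le> measure P (A \<inter> B)" "0 \<le> measure P A * measure P B" by auto
  ultimately have "\<bar>measure P (A \<inter> B) - measure P A * measure P B\<bar> \<le> 1" by linarith
  then show "ennreal \<bar>measure P (A \<inter> B) - measure P A * measure P B\<bar> \<le> 1"
    using ennreal_leI by fastforce
qed

text \<open>Both functions are replaced by staircases with \<open>K\<close> steps. The covariance of
  the staircases averages \<open>K\<^sup>2\<close> covariances of events, each at most \<alpha>; the
  replacement costs at most \<open>4 / K\<close>.\<close>

lemma covariance_unit_interval:
  fixes G H :: "(int \<Rightarrow> 's) \<Rightarrow> real"
  assumes G: "depends_on {..<0} G" and H: "depends_on {int n..} H"
    and G01: "\<And>\<omega>. 0 \<le> G \<omega>" "\<And>\<omega>. G \<omega> \<le> 1" and H01: "\<And>\<omega>. 0 \<le> H \<omega>" "\<And>\<omega>. H \<omega> \<le> 1"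
    and \<alpha>: "mixing_coeff S P n \<le> ennreal \<alpha>" "0 \<le> \<alpha>"
  shows "\<bar>(\<integral>\<omega>. G \<omega> * H \<omega> \<partial>P) - (\<integral>\<omega>. G \<omega> \<partial>P) * (\<integral>\<omega>. H \<omega> \<partial>P)\<bar> \<le> \<alpha>"
proof (rule field_le_epsilon)
  fix e :: real assume e: "0 < e"
  obtain K where K: "K > 0" "4 / real K < e"
  proof -
    obtain K where "4 / e < real K" using reals_Archimedean2 by blast
    then have "4 < e * K" using e by (simp add: pos_divide_less_eq mult.commute)
    moreover then have "K > 0" using e by (cases K) auto
    ultimately show ?thesis using that[of K] by (simp add: pos_divide_less_eq)
  qed
  have [measurable]: "G \<in> borel_measurable P" "H \<in> borel_measurable P"
    using G H by (auto simp: depends_on_def)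
  define A where "A j = {\<omega> \<in> space P. real j \<le> real K * G \<omega>}" for j
  define B where "B j = {\<omega> \<in> space P. real j \<le> real K * H \<omega>}" for j
  have As: "A j \<in> env_sigma S P {..<0}" for j
  proof -
    have "A j = {\<omega> \<in> space P. G \<omega> \<in> {real j / K..}}" using K by (auto simp: A_def pos_divide_le_eq mult.commute)
    then show ?thesis using depends_on_sets[OF G, of "{real j / K..}"] by simp
  qed
  have Bs: "B j \<in> env_sigma S P {int n..}" for j
  proof -
    have "B j = {\<omega> \<in> space P. H \<omega> \<in> {real j / K..}}" using K by (auto simp: B_def pos_divide_le_eq mult.commute)
    then show ?thesis using depends_on_sets[OF H, of "{real j / K..}"] by simp
  qed
  have [measurable]: "A j \<in> sets P" "B j \<in> sets P" for j by (auto simp: A_def B_def)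
  have AB: "\<bar>measure P (A j \<inter> B l) - measure P (A j) * measure P (B l)\<bar> \<le> \<alpha>" for j l
  proof -
    have "ennreal \<bar>measure P (B l \<inter> A j) - measure P (B l) * measure P (A j)\<bar> \<le> mixing_coeff S P n"
      unfolding mixing_coeff_def by (rule SUP_upper2[OF Bs[of l]], rule SUP_upper2[OF As[of j]], rule order_refl)
    also have "\<dots> \<le> ennreal \<alpha>" by fact
    finally show ?thesis using \<alpha>(2) by (simp add: Int_commute mult.commute)
  qed
  define GK where "GK \<omega> = staircase K (G \<omega>)" for \<omega>
  define HK where "HK \<omega> = staircase K (H \<omega>)" for \<omega>
  note sG = staircase[OF K(1) G01(1) G01(2), folded GK_def]
  note sH = staircase[OF K(1) H01(1) H01(2), folded HK_def]
  have GK: "GK \<omega> = (\<Sum>j = 1..K. indicator (A j) \<omega>) / K" if "\<omega> \<in> space P" for \<omega>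
    using that unfolding GK_def staircase_def A_def by (intro arg_cong2[where f="(/)"] sum.cong) auto
  have HK: "HK \<omega> = (\<Sum>j = 1..K. indicator (B j) \<omega>) / K" if "\<omega> \<in> space P" for \<omega>
    using that unfolding HK_def staircase_def B_def by (intro arg_cong2[where f="(/)"] sum.cong) auto
  have [measurable]: "GK \<in> borel_measurable P" "HK \<in> borel_measurable P"
    unfolding GK_def[abs_def] HK_def[abs_def] staircase_def by measurable
  have int: "integrable P F" if "F \<in> borel_measurable P" "\<And>\<omega>. \<bar>F \<omega>\<bar> \<le> 1" for F :: "_ \<Rightarrow> real"
    by (rule EP.integrable_const_bound[where B=1]) (use that in auto)
  have prod1: "\<bar>x * y\<bar> \<le> 1" if "0 \<le> x" "x \<le> 1" "0 \<le> y" "y \<le> 1" for x y :: real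
    using that by (simp add: abs_mult mult_le_one)
  have ints: "integrable P G" "integrable P H" "integrable P GK" "integrable P HK"
    "integrable P (\<lambda>\<omega>. G \<omega> * H \<omega>)" "integrable P (\<lambda>\<omega>. GK \<omega> * HK \<omega>)"
    by (intro int prod1; use G01 H01 sG sH in \<open>force intro: borel_measurable_times\<close>)+
  have near: "\<bar>(\<integral>\<omega>. F \<omega> \<partial>P) - (\<integral>\<omega>. F' \<omega> \<partial>P)\<bar> \<le> c"
    if "integrable P F" "integrable P F'" "\<And>\<omega>. \<bar>F \<omega> - F' \<omega>\<bar> \<le> c" for F F' :: "_ \<Rightarrow> real" and c
  proof -
    have "\<bar>(\<integral>\<omega>. F \<omega> \<partial>P) - (\<integral>\<omega>. F' \<omega> \<partial>P)\<bar> = \<bar>\<integral>\<omega>. F \<omega> - F' \<omega> \<partial>P\<bar>" using that by simp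
    also have "\<dots> \<le> (\<integral>\<omega>. \<bar>F \<omega> - F' \<omega>\<bar> \<partial>P)" by (rule integral_abs_bound)
    also have "\<dots> \<le> (\<integral>\<omega>. c \<partial>P)" by (intro integral_mono that) (use that in auto)
    finally show ?thesis by (simp add: EP.prob_space)
  qed
  have nG: "\<bar>(\<integral>\<omega>. G \<omega> \<partial>P) - (\<integral>\<omega>. GK \<omega> \<partial>P)\<bar> \<le> 1 / K" by (rule near) (use ints sG in auto)
  have nH: "\<bar>(\<integral>\<omega>. H \<omega> \<partial>P) - (\<integral>\<omega>. HK \<omega> \<partial>P)\<bar> \<le> 1 / K" by (rule near) (use ints sH in auto)
  have diff: "\<bar>x * y - x' * y'\<bar> \<le> c + c"
    if "\<bar>x - x'\<bar> \<le> c" "\<bar>y - y'\<bar> \<le> c" "0 \<le> x'" "x' \<le> 1" "0 \<le> y" "y \<le> 1" for x y x' y' c :: real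
  proof -
    have "x * y - x' * y' = (x - x') * y + x' * (y - y')" by (simp add: algebra_simps)
    also have "\<bar>\<dots>\<bar> \<le> \<bar>x - x'\<bar> * y + x' * \<bar>y - y'\<bar>"
      using that by (intro order_trans[OF abs_triangle_ineq]) (simp add: abs_mult)
    also have "\<dots> \<le> c * 1 + 1 * c" using that by (intro add_mono mult_mono) auto
    finally show ?thesis by simp
  qed
  have nGH: "\<bar>(\<integral>\<omega>. G \<omega> * H \<omega> \<partial>P) - (\<integral>\<omega>. GK \<omega> * HK \<omega> \<partial>P)\<bar> \<le> 1 / K + 1 / K"
    by (rule near[OF ints(5,6)], rule diff) (rule sG sH H01)+
  have bnd: "0 \<le> (\<integral>\<omega>. GK \<omega> \<partial>P)" "(\<integral>\<omega>. GK \<omega> \<partial>P) \<le> 1" "0 \<le> (\<integral>\<omega>. H \<omega> \<partial>P)" "(\<integral>\<omega>. H \<omega> \<partial>P) \<le> 1"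
    using ints sG H01 EP.integral_le_const[of GK 1] EP.integral_le_const[of H 1]
    by (auto intro!: integral_nonneg)
  have nP: "\<bar>(\<integral>\<omega>. G \<omega> \<partial>P) * (\<integral>\<omega>. H \<omega> \<partial>P) - (\<integral>\<omega>. GK \<omega> \<partial>P) * (\<integral>\<omega>. HK \<omega> \<partial>P)\<bar> \<le> 1 / K + 1 / K"
    by (rule diff[OF nG nH]) (use bnd in auto)
  have eG: "(\<integral>\<omega>. GK \<omega> \<partial>P) = (\<Sum>j = 1..K. measure P (A j)) / K"
  proof -
    have "(\<integral>\<omega>. GK \<omega> \<partial>P) = (\<integral>\<omega>. (\<Sum>j = 1..K. indicator (A j) \<omega>) / K \<partial>P)"
      by (intro Bochner_Integration.integral_cong refl GK)
    then show ?thesis by (simp add: Bochner_Integration.integral_sum EP.emeasure_eq_measure)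
  qed
  have eH: "(\<integral>\<omega>. HK \<omega> \<partial>P) = (\<Sum>j = 1..K. measure P (B j)) / K"
  proof -
    have "(\<integral>\<omega>. HK \<omega> \<partial>P) = (\<integral>\<omega>. (\<Sum>j = 1..K. indicator (B j) \<omega>) / K \<partial>P)"
      by (intro Bochner_Integration.integral_cong refl HK)
    then show ?thesis by (simp add: Bochner_Integration.integral_sum EP.emeasure_eq_measure)
  qed
  have eGH: "(\<integral>\<omega>. GK \<omega> * HK \<omega> \<partial>P) = (\<Sum>j = 1..K. \<Sum>l = 1..K. measure P (A j \<inter> B l)) / K\<^sup>2"
  proof -
    have "(\<integral>\<omega>. GK \<omega> * HK \<omega> \<partial>P) = (\<integral>\<omega>. (\<Sum>j = 1..K. \<Sum>l = 1..K. indicator (A j \<inter> B l) \<omega>) / K\<^sup>2 \<partial>P)"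
      by (intro Bochner_Integration.integral_cong refl)
        (simp add: GK HK sum_product indicator_inter_arith power2_eq_square)
    then show ?thesis by (simp add: Bochner_Integration.integral_sum EP.emeasure_eq_measure)
  qed
  have "\<bar>(\<integral>\<omega>. GK \<omega> * HK \<omega> \<partial>P) - (\<integral>\<omega>. GK \<omega> \<partial>P) * (\<integral>\<omega>. HK \<omega> \<partial>P)\<bar> =
      \<bar>\<Sum>j = 1..K. \<Sum>l = 1..K. measure P (A j \<inter> B l) - measure P (A j) * measure P (B l)\<bar> / K\<^sup>2"
    unfolding eG eH eGH by (simp add: sum_product sum_subtractf power2_eq_square diff_divide_distrib[symmetric])
  also have "\<dots> \<le> (\<Sum>j = 1..K. \<Sum>l = 1..K. \<alpha>) / K\<^sup>2"
    by (intro divide_right_mono order_trans[OF sum_abs] sum_mono AB) auto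
  also have "\<dots> = \<alpha>" using K by (simp add: power2_eq_square)
  finally have "\<bar>(\<integral>\<omega>. GK \<omega> * HK \<omega> \<partial>P) - (\<integral>\<omega>. GK \<omega> \<partial>P) * (\<integral>\<omega>. HK \<omega> \<partial>P)\<bar> \<le> \<alpha>" .
  moreover have "1 / K + 1 / K + (1 / K + 1 / K) = 4 / real K" by simp
  ultimately show "\<bar>(\<integral>\<omega>. G \<omega> * H \<omega> \<partial>P) - (\<integral>\<omega>. G \<omega> \<partial>P) * (\<integral>\<omega>. H \<omega> \<partial>P)\<bar> \<le> \<alpha> + e"
    using nGH nP K(2) by linarith
qed

text \<open>Stationarity moves the cut from \<open>a\<close> to 0, and affine maps carry the ranges
  of width \<open>2 * b\<close> and \<open>2 * c\<close> to the unit interval; undoing them produces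
  the factor \<open>4 * b * c\<close>.\<close>

lemma covariance_real:
  fixes G H :: "(int \<Rightarrow> 's) \<Rightarrow> real"
  assumes G: "depends_on {..<a} G" and H: "depends_on {a + int n..} H"
    and bG: "\<And>\<omega>. \<bar>G \<omega>\<bar> \<le> b" and bH: "\<And>\<omega>. \<bar>H \<omega>\<bar> \<le> c" and bc: "b > 0" "c > 0"
    and \<alpha>: "mixing_coeff S P n \<le> ennreal \<alpha>" "0 \<le> \<alpha>"
  shows "\<bar>(\<integral>\<omega>. G \<omega> * H \<omega> \<partial>P) - (\<integral>\<omega>. G \<omega> \<partial>P) * (\<integral>\<omega>. H \<omega> \<partial>P)\<bar> \<le> 4 * b * c * \<alpha>"
proof -
  have [measurable]: "G \<in> borel_measurable P" "H \<in> borel_measurable P"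
    using G H by (auto simp: depends_on_def)
  define G' where "G' \<omega> = (G (shift_by (- a) \<omega>) / b + 1) / 2" for \<omega>
  define H' where "H' \<omega> = (H (shift_by (- a) \<omega>) / c + 1) / 2" for \<omega>
  have G': "depends_on {..<0} G'"
    unfolding G'_def
    by (rule depends_on_compose[where f="\<lambda>y. (y / b + 1) / 2", OF depends_on_mono[OF depends_on_shift_by[OF G]]]) auto
  have H': "depends_on {int n..} H'"
    unfolding H'_def
    by (rule depends_on_compose[where f="\<lambda>y. (y / c + 1) / 2", OF depends_on_mono[OF depends_on_shift_by[OF H]]]) auto
  have unit: "0 \<le> (y / b + 1) / 2" "(y / b + 1) / 2 \<le> 1" if "\<bar>y\<bar> \<le> b" "b > 0" for y b :: real
  proof -
    have "- 1 \<le> y / b" "y / b \<le> 1" using that by (auto simp: field_simps abs_le_iff)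
    then show "0 \<le> (y / b + 1) / 2" "(y / b + 1) / 2 \<le> 1" by auto
  qed
  have *: "\<bar>(\<integral>\<omega>. G' \<omega> * H' \<omega> \<partial>P) - (\<integral>\<omega>. G' \<omega> \<partial>P) * (\<integral>\<omega>. H' \<omega> \<partial>P)\<bar> \<le> \<alpha>"
    by (rule covariance_unit_interval[OF G' H' _ _ _ _ \<alpha>]; unfold G'_def H'_def)
      (rule unit(1)[OF bG bc(1)] unit(2)[OF bG bc(1)] unit(1)[OF bH bc(2)] unit(2)[OF bH bc(2)])+
  have iG: "integrable P G" by (rule EP.integrable_const_bound[where B=b]) (use bG in auto)
  have iH: "integrable P H" by (rule EP.integrable_const_bound[where B=c]) (use bH in auto)
  have iGH: "integrable P (\<lambda>\<omega>. G \<omega> * H \<omega>)"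
    by (rule EP.integrable_const_bound[where B="b * c"]) (use bG bH bc in \<open>auto simp: abs_mult intro!: mult_mono AE_I2\<close>)
  define x y z where "x = (\<integral>\<omega>. G \<omega> \<partial>P)" and "y = (\<integral>\<omega>. H \<omega> \<partial>P)" and "z = (\<integral>\<omega>. G \<omega> * H \<omega> \<partial>P)"
  have "(\<integral>\<omega>. G' \<omega> \<partial>P) = (\<integral>\<omega>. (G \<omega> / b + 1) / 2 \<partial>P)"
    unfolding G'_def by (rule integral_shift_by[of "\<lambda>\<omega>. (G \<omega> / b + 1) / 2"]) measurable
  also have "\<dots> = (x / b + 1) / 2" using iG by (simp add: x_def EP.prob_space)
  finally have 1: "(\<integral>\<omega>. G' \<omega> \<partial>P) = (x / b + 1) / 2" .
  have "(\<integral>\<omega>. H' \<omega> \<partial>P) = (\<integral>\<omega>. (H \<omega> / c + 1) / 2 \<partial>P)"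
    unfolding H'_def by (rule integral_shift_by[of "\<lambda>\<omega>. (H \<omega> / c + 1) / 2"]) measurable
  also have "\<dots> = (y / c + 1) / 2" using iH by (simp add: y_def EP.prob_space)
  finally have 2: "(\<integral>\<omega>. H' \<omega> \<partial>P) = (y / c + 1) / 2" .
  have "(\<integral>\<omega>. G' \<omega> * H' \<omega> \<partial>P) = (\<integral>\<omega>. (G \<omega> / b + 1) / 2 * ((H \<omega> / c + 1) / 2) \<partial>P)"
    unfolding G'_def H'_def by (rule integral_shift_by[of "\<lambda>\<omega>. (G \<omega> / b + 1) / 2 * ((H \<omega> / c + 1) / 2)"]) measurable
  also have "\<dots> = (\<integral>\<omega>. (1 / (4 * b * c)) * (G \<omega> * H \<omega>) + (1 / (4 * b)) * G \<omega> + (1 / (4 * c)) * H \<omega> + 1 / 4 \<partial>P)"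
    using bc by (intro Bochner_Integration.integral_cong refl) (simp add: field_simps)
  also have "\<dots> = (1 / (4 * b * c)) * z + (1 / (4 * b)) * x + (1 / (4 * c)) * y + 1 / 4"
    using iG iH iGH by (simp add: x_def y_def z_def EP.prob_space)
  finally have 3: "(\<integral>\<omega>. G' \<omega> * H' \<omega> \<partial>P) = (1 / (4 * b * c)) * z + (1 / (4 * b)) * x + (1 / (4 * c)) * y + 1 / 4" .
  have "z - x * y = 4 * b * c * ((\<integral>\<omega>. G' \<omega> * H' \<omega> \<partial>P) - (\<integral>\<omega>. G' \<omega> \<partial>P) * (\<integral>\<omega>. H' \<omega> \<partial>P))"
    unfolding 1 2 3 using bc by (simp add: field_simps)
  then have "\<bar>z - x * y\<bar> = 4 * b * c * \<bar>(\<integral>\<omega>. G' \<omega> * H' \<omega> \<partial>P) - (\<integral>\<omega>. G' \<omega> \<partial>P) * (\<integral>\<omega>. H' \<omega> \<partial>P)\<bar>"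
    using bc by (simp add: abs_mult)
  also have "\<dots> \<le> 4 * b * c * \<alpha>" using * bc by (intro mult_left_mono) auto
  finally show ?thesis by (simp add: x_def y_def z_def)
qed

text \<open>Four covariances of real and imaginary parts, each at most
  \<open>4 * \<alpha>\<close>.\<close>

lemma covariance_complex:
  fixes G H :: "(int \<Rightarrow> 's) \<Rightarrow> complex"
  assumes G: "depends_on {..<a} G" and H: "depends_on {a + int n..} H"
    and bG: "\<And>\<omega>. cmod (G \<omega>) \<le> 1" and bH: "\<And>\<omega>. cmod (H \<omega>) \<le> 1"
    and \<alpha>: "mixing_coeff S P n \<le> ennreal \<alpha>" "0 \<le> \<alpha>"
  shows "cmod ((\<integral>\<omega>. G \<omega> * H \<omega> \<partial>P) - (\<integral>\<omega>. G \<omega> \<partial>P) * (\<integral>\<omega>. H \<omega> \<partial>P)) \<le> 16 * \<alpha>"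
proof -
  have [measurable]: "G \<in> borel_measurable P" "H \<in> borel_measurable P"
    using G H by (auto simp: depends_on_def)
  note dG = depends_on_compose[OF G, of Re] depends_on_compose[OF G, of Im]
  note dH = depends_on_compose[OF H, of Re] depends_on_compose[OF H, of Im]
  have b: "\<bar>Re (G \<omega>)\<bar> \<le> 1" "\<bar>Im (G \<omega>)\<bar> \<le> 1" "\<bar>Re (H \<omega>)\<bar> \<le> 1" "\<bar>Im (H \<omega>)\<bar> \<le> 1" for \<omega>
    using bG[of \<omega>] bH[of \<omega>] abs_Re_le_cmod abs_Im_le_cmod order_trans by blast+
  have iG: "integrable P G" by (rule EP.integrable_const_bound[where B=1]) (use bG in auto)
  have iH: "integrable P H" by (rule EP.integrable_const_bound[where B=1]) (use bH in auto)
  have iGH: "integrable P (\<lambda>\<omega>. G \<omega> * H \<omega>)"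
    by (rule EP.integrable_const_bound[where B=1]) (use bG bH in \<open>auto simp: norm_mult intro!: mult_le_one AE_I2\<close>)
  define c where "c g h = (\<integral>\<omega>. g (G \<omega>) * h (H \<omega>) \<partial>P) - (\<integral>\<omega>. g (G \<omega>) \<partial>P) * (\<integral>\<omega>. h (H \<omega>) \<partial>P)" for g h :: "complex \<Rightarrow> real"
  have cb: "\<bar>c Re Re\<bar> \<le> 4 * \<alpha>" "\<bar>c Re Im\<bar> \<le> 4 * \<alpha>" "\<bar>c Im Re\<bar> \<le> 4 * \<alpha>" "\<bar>c Im Im\<bar> \<le> 4 * \<alpha>"
    unfolding c_def
    using covariance_real[OF dG(1) dH(1) b(1) b(3) _ _ \<alpha>] covariance_real[OF dG(1) dH(2) b(1) b(4) _ _ \<alpha>]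
      covariance_real[OF dG(2) dH(1) b(2) b(3) _ _ \<alpha>] covariance_real[OF dG(2) dH(2) b(2) b(4) _ _ \<alpha>]
    by auto
  have ip: "integrable P (\<lambda>\<omega>. Re (G \<omega>) * Re (H \<omega>))" "integrable P (\<lambda>\<omega>. Re (G \<omega>) * Im (H \<omega>))"
    "integrable P (\<lambda>\<omega>. Im (G \<omega>) * Re (H \<omega>))" "integrable P (\<lambda>\<omega>. Im (G \<omega>) * Im (H \<omega>))"
    by (rule EP.integrable_const_bound[where B=1]; use b in \<open>auto simp: abs_mult intro!: mult_le_one AE_I2\<close>)+
  let ?D = "(\<integral>\<omega>. G \<omega> * H \<omega> \<partial>P) - (\<integral>\<omega>. G \<omega> \<partial>P) * (\<integral>\<omega>. H \<omega> \<partial>P)"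
  have "Re (\<integral>\<omega>. G \<omega> * H \<omega> \<partial>P) = (\<integral>\<omega>. Re (G \<omega>) * Re (H \<omega>) - Im (G \<omega>) * Im (H \<omega>) \<partial>P)"
    using iGH by (subst integral_Re[symmetric]) simp_all
  then have R: "Re ?D = c Re Re - c Im Im"
    using iG iH ip by (simp add: c_def)
  have "Im (\<integral>\<omega>. G \<omega> * H \<omega> \<partial>P) = (\<integral>\<omega>. Re (G \<omega>) * Im (H \<omega>) + Im (G \<omega>) * Re (H \<omega>) \<partial>P)"
    using iGH by (subst integral_Im[symmetric]) simp_all
  then have I: "Im ?D = c Re Im + c Im Re"
    using iG iH ip by (simp add: c_def)
  have "cmod ?D \<le> \<bar>Re ?D\<bar> + \<bar>Im ?D\<bar>" by (rule cmod_le)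
  then show ?thesis unfolding R I using cb by linarith
qed

end

section \<open>Truncated progenies\<close>

text \<open>
  The rate is written as a fourth power because the progenies are truncated at the height
  \<open>(1 / t) ^ r\<close> after \<open>r\<close> generations: at lag \<open>j \<ge> 2 * r\<close> the mixing bound for the gap \<open>j - r\<close> then beats
  the product of two such heights by a factor \<open>t ^ j\<close>.
\<close>

locale mixing_branching = branching_environment S P q p
  for S :: "'s measure" and P :: "(int \<Rightarrow> 's) measure"
    and q :: "'s \<Rightarrow> (nat^'d::finite) pmf" and p :: "'d \<Rightarrow> 's \<Rightarrow> (nat^'d) pmf" +
  fixes \<kappa> c\<^sub>0 t :: real
  assumes \<kappa>: "\<kappa> > 2" and c\<^sub>0: "c\<^sub>0 > 0" and t: "0 < t" "t < 1"
    and moment: "\<And>k. k \<ge> 1 \<Longrightarrow>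
      (\<integral>\<^sup>+\<omega>. epow (vec_norm \<kappa> (M_prod q p \<kappa> \<omega> k *v I_vec q p \<kappa> \<omega> 0)) \<kappa> \<partial>P) \<le> ennreal (c\<^sub>0 * (t ^ 4) ^ k)"
    and mixing: "\<And>n. mixing_coeff S P n \<le> ennreal (c\<^sub>0 * (t ^ 4) ^ n)"
begin

text \<open>Stationarity moves the arrival time to 0, and one coordinate of the bound
  \<open>nrm_U_le\<close> is dominated by the \<kappa>-norm of the vector, whose moment is
  controlled by the locale.\<close>

lemma moment_U:
  assumes "k \<ge> 1"
  shows "(\<integral>\<^sup>+x. epow (of_nat (U x (m + k) m $ j)) \<kappa> \<partial>slots) \<le> ennreal (c\<^sub>0 * (t ^ 4) ^ k)"
proof -
  have "(\<integral>\<^sup>+x. epow (of_nat (U x (m + k) m $ j)) \<kappa> \<partial>slots) =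
      (\<integral>\<^sup>+x. (\<lambda>as. epow (of_nat (as ! k $ j)) \<kappa>) (fam x m k) \<partial>slots)"
    by (simp add: fam_nth)
  also have "\<dots> = (\<integral>\<^sup>+\<omega>. (\<integral>\<^sup>+x. (\<lambda>as. epow (of_nat (as ! k $ j)) \<kappa>) (fam x 0 k) \<partial>quenched q p \<omega>) \<partial>P)"
    by (rule nn_integral_fam)
  also have "\<dots> = (\<integral>\<^sup>+\<omega>. epow (nrm \<kappa> (quenched q p \<omega>) (\<lambda>x. of_nat (U x k 0 $ j))) \<kappa> \<partial>P)"
    using \<kappa> by (simp add: fam_nth epow_nrm)
  also have "\<dots> \<le> (\<integral>\<^sup>+\<omega>. epow (vec_norm \<kappa> (M_prod q p \<kappa> \<omega> k *v I_vec q p \<kappa> \<omega> 0)) \<kappa> \<partial>P)"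
  proof (intro nn_integral_mono)
    fix \<omega>
    let ?v = "M_prod q p \<kappa> \<omega> k *v I_vec q p \<kappa> \<omega> 0"
    have "epow (nrm \<kappa> (quenched q p \<omega>) (\<lambda>x. of_nat (U x k 0 $ j))) \<kappa> \<le> epow (?v $ j) \<kappa>"
      using \<kappa> by (intro epow_mono nrm_U_le) auto
    also have "\<dots> \<le> (\<Sum>i\<in>UNIV. epow (?v $ i) \<kappa>)" by (intro member_le_sum) auto
    also have "\<dots> = epow (vec_norm \<kappa> ?v) \<kappa>" using \<kappa> by (simp add: vec_norm_def epow_epow)
    finally show "epow (nrm \<kappa> (quenched q p \<omega>) (\<lambda>x. of_nat (U x k 0 $ j))) \<kappa> \<le> epow (vec_norm \<kappa> ?v) \<kappa>" .
  qed
  also have "\<dots> \<le> ennreal (c\<^sub>0 * (t ^ 4) ^ k)" by (rule moment[OF assms])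
  finally show ?thesis .
qed

text \<open>The \<kappa>-th root of the rate of the moments, hence the rate of the
  \<open>L^\<kappa>\<close> norms.\<close>

definition \<tau> :: real where "\<tau> = (t ^ 4) powr (1 / \<kappa>)"

lemma \<tau>: "0 < \<tau>" "\<tau> < 1"
proof -
  show "0 < \<tau>" using t by (simp add: \<tau>_def)
  have "t ^ 4 < 1 ^ 4" using t by (intro power_strict_mono) auto
  then have "(t ^ 4) powr (1 / \<kappa>) < 1 powr (1 / \<kappa>)" using t \<kappa> by (intro powr_less_mono2) auto
  then show "\<tau> < 1" by (simp add: \<tau>_def)
qed

definition c\<^sub>1 :: real where "c\<^sub>1 = c\<^sub>0 powr (1 / \<kappa>)"

lemma c\<^sub>1: "c\<^sub>1 > 0"
  using c\<^sub>0 by (simp add: c\<^sub>1_def)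

lemma measurable_U_slots:
  fixes g :: "nat \<Rightarrow> 'b::topological_space"
  shows "(\<lambda>x. g (U x k m $ j)) \<in> borel_measurable slots"
  unfolding measurable_slots_iff
  by (rule measurable_compose[where g="\<lambda>v. g (v $ j)", OF measurable_U]) simp

lemma nrm_U:
  assumes "k \<ge> 1"
  shows "nrm \<kappa> slots (\<lambda>x. of_nat (U x (m + k) m $ j)) \<le> ennreal (c\<^sub>1 * \<tau> ^ k)"
proof -
  have "(c\<^sub>1 * \<tau> ^ k) powr \<kappa> = c\<^sub>0 * (t ^ 4) ^ k"
  proof -
    have "(c\<^sub>1 * \<tau> ^ k) powr \<kappa> = c\<^sub>1 powr \<kappa> * (\<tau> ^ k) powr \<kappa>" using c\<^sub>1 \<tau> by (simp add: powr_mult)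
    also have "c\<^sub>1 powr \<kappa> = c\<^sub>0" using c\<^sub>0 \<kappa> by (simp add: c\<^sub>1_def powr_powr)
    also have "(\<tau> ^ k) powr \<kappa> = (\<tau> powr \<kappa>) ^ k" using \<tau> by (simp add: powr_power powr_realpow[symmetric] powr_powr mult.commute)
    also have "\<tau> powr \<kappa> = t ^ 4" using t \<kappa> by (simp add: \<tau>_def powr_powr)
    finally show ?thesis .
  qed
  then show ?thesis
    using moment_U[OF assms, of m j] \<kappa> c\<^sub>1 \<tau> by (simp add: nrm_le_iff epow_ennreal)
qed

text \<open>Counts are integers, so the second moment is below the \<open>\<kappa>\<close>-th.\<close>

lemma nrm2_U:
  assumes "k \<ge> 1"
  shows "nrm 2 slots (\<lambda>x. of_nat (U x (m + k) m $ j)) \<le> ennreal (sqrt c\<^sub>0 * (t\<^sup>2) ^ k)"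
proof -
  have "epow (of_nat n) 2 \<le> epow (of_nat n) \<kappa>" for n :: nat
    unfolding epow_of_nat using \<kappa> by (cases "n = 0") (auto intro!: ennreal_leI powr_mono simp del: powr_numeral)
  then have "(\<integral>\<^sup>+x. epow (of_nat (U x (m + k) m $ j)) 2 \<partial>slots) \<le> (\<integral>\<^sup>+x. epow (of_nat (U x (m + k) m $ j)) \<kappa> \<partial>slots)"
    by (intro nn_integral_mono) auto
  also have "\<dots> \<le> ennreal (c\<^sub>0 * (t ^ 4) ^ k)" by (rule moment_U[OF assms])
  also have "c\<^sub>0 * (t ^ 4) ^ k = (sqrt c\<^sub>0 * (t\<^sup>2) ^ k)\<^sup>2"
    using c\<^sub>0 by (simp add: power_mult_distrib flip: power_mult)
  also have "ennreal \<dots> = epow (ennreal (sqrt c\<^sub>0 * (t\<^sup>2) ^ k)) 2"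
    using c\<^sub>0 t by (simp add: epow_two ennreal_power)
  finally show ?thesis by (simp add: nrm_le_iff)
qed

definition W :: "nat \<Rightarrow> 'd \<Rightarrow> nat \<Rightarrow> ('d slot \<Rightarrow> nat^'d) \<Rightarrow> nat" where
  "W r j m x = (\<Sum>k = 1..r. U x (m + k) m $ j)"

definition V :: "nat \<Rightarrow> 'd \<Rightarrow> nat \<Rightarrow> ('d slot \<Rightarrow> nat^'d) \<Rightarrow> real" where
  "V r j m x = min ((1 / t) ^ r) (real (W r j m x))"

lemma V_bounds: "0 \<le> V r j m x" "V r j m x \<le> (1 / t) ^ r" "\<bar>V r j m x\<bar> \<le> (1 / t) ^ r" "V r j m x \<le> real (W r j m x)"
  using t by (auto simp: V_def)

lemma W_mono: "r \<le> s \<Longrightarrow> W r j m x \<le> W s j m x"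
  unfolding W_def by (intro sum_mono2) auto

text \<open>Cap and count both grow with \<open>r\<close>. This makes differences of levels
  nonnegative and, in the degenerate case, the quenched means monotone.\<close>

lemma V_mono: "r \<le> s \<Longrightarrow> V r j m x \<le> V s j m x"
  unfolding V_def using t W_mono[of r s j m x]
  by (intro min.mono power_increasing) (auto simp: field_simps)

lemma measurable_W [measurable]:
  fixes g :: "nat \<Rightarrow> 'b::topological_space"
  shows "(\<lambda>x. g (W r j m x)) \<in> borel_measurable slots"
proof -
  have "(\<lambda>x. (\<Sum>k = 1..r. U x (m + k) m) $ j) \<in> measurable slot_space (count_space UNIV)"
    by (rule measurable_compose[where g="\<lambda>v. v $ j", OF measurable_count_sum[OF measurable_U]]) simp
  then have "W r j m \<in> measurable slot_space (count_space UNIV)"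
    by (simp add: W_def[abs_def])
  then show ?thesis unfolding measurable_slots_iff by (rule measurable_compose) simp
qed

lemma measurable_V [measurable]: "V r j m \<in> borel_measurable slots"
  unfolding V_def[abs_def] by (rule measurable_W)

lemma geometric_ennreal_sum:
  assumes "0 \<le> c" "0 < z" "z < 1"
  shows "(\<Sum>k\<in>{r<..s}. ennreal (c * z ^ k)) \<le> ennreal (c / (1 - z) * z ^ r)"
proof -
  have "(\<Sum>k\<in>{r<..s}. c * z ^ k) \<le> c / (1 - z) * z ^ r"
  proof -
    have "(\<Sum>k\<in>{r<..s}. c * z ^ k) \<le> (\<Sum>k\<in>{r..<r + Suc s}. c * z ^ k)"
      using assms by (intro sum_mono2) auto
    also have "\<dots> = c * z ^ r * (\<Sum>k<Suc s. z ^ k)"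
      unfolding sum_distrib_left
      by (rule sum.reindex_bij_witness[of _ "\<lambda>k. r + k" "\<lambda>k. k - r"]) (auto simp: power_add[symmetric])
    also have "\<dots> \<le> c * z ^ r * (1 / (1 - z))"
    proof (intro mult_left_mono)
      have "(\<Sum>k<Suc s. z ^ k) = (1 - z ^ Suc s) / (1 - z)" using assms by (subst sum_gp_strict) auto
      also have "\<dots> \<le> 1 / (1 - z)" using assms by (intro divide_right_mono) auto
      finally show "(\<Sum>k<Suc s. z ^ k) \<le> 1 / (1 - z)" .
    qed (use assms in auto)
    finally show ?thesis by (simp add: mult_ac)
  qed
  then show ?thesis using assms by (subst sum_ennreal) (auto intro: ennreal_leI)
qed

definition c\<^sub>2 :: real where "c\<^sub>2 = c\<^sub>1 / (1 - \<tau>)"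
definition c\<^sub>3 :: real where "c\<^sub>3 = sqrt c\<^sub>0 / (1 - t\<^sup>2)"

lemma c23: "c\<^sub>2 > 0" "c\<^sub>3 > 0"
  using c\<^sub>1 \<tau> c\<^sub>0 t by (auto simp: c\<^sub>2_def c\<^sub>3_def power_less_one_iff)

lemma nrm_W: "nrm \<kappa> slots (\<lambda>x. of_nat (W r j m x)) \<le> ennreal c\<^sub>2"
proof -
  have "nrm \<kappa> slots (\<lambda>x. of_nat (W r j m x)) = nrm \<kappa> slots (\<lambda>x. \<Sum>k\<in>{0<..r}. of_nat (U x (m + k) m $ j))"
    by (simp add: W_def atLeastSucAtMost_greaterThanAtMost[symmetric])
  also have "\<dots> \<le> (\<Sum>k\<in>{0<..r}. nrm \<kappa> slots (\<lambda>x. of_nat (U x (m + k) m $ j)))"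
    using \<kappa> by (intro nrm_sum measurable_U_slots) auto
  also have "\<dots> \<le> (\<Sum>k\<in>{0<..r}. ennreal (c\<^sub>1 * \<tau> ^ k))"
    by (intro sum_mono nrm_U) auto
  also have "\<dots> \<le> ennreal (c\<^sub>1 / (1 - \<tau>) * \<tau> ^ 0)"
    by (rule geometric_ennreal_sum) (use c\<^sub>1 \<tau> in auto)
  finally show ?thesis by (simp add: c\<^sub>2_def)
qed

lemma nrm2_W_diff:
  assumes "r \<le> s"
  shows "nrm 2 slots (\<lambda>x. of_nat (W s j m x - W r j m x)) \<le> ennreal (c\<^sub>3 * (t\<^sup>2) ^ r)"
proof -
  have "W s j m x - W r j m x = (\<Sum>k\<in>{r<..s}. U x (m + k) m $ j)" for x
  proof -
    have "{1..s} = {1..r} \<union> {r<..s}" using assms by auto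
    then have "W s j m x = W r j m x + (\<Sum>k\<in>{r<..s}. U x (m + k) m $ j)"
      unfolding W_def by (simp add: sum.union_disjoint Int_def)
    then show ?thesis by simp
  qed
  then have "nrm 2 slots (\<lambda>x. of_nat (W s j m x - W r j m x)) = nrm 2 slots (\<lambda>x. \<Sum>k\<in>{r<..s}. of_nat (U x (m + k) m $ j))"
    by simp
  also have "\<dots> \<le> (\<Sum>k\<in>{r<..s}. nrm 2 slots (\<lambda>x. of_nat (U x (m + k) m $ j)))"
    by (intro nrm_sum measurable_U_slots) auto
  also have "\<dots> \<le> (\<Sum>k\<in>{r<..s}. ennreal (sqrt c\<^sub>0 * (t\<^sup>2) ^ k))"
    by (intro sum_mono nrm2_U) auto
  also have "\<dots> \<le> ennreal (sqrt c\<^sub>0 / (1 - t\<^sup>2) * (t\<^sup>2) ^ r)"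
    by (rule geometric_ennreal_sum) (use c\<^sub>0 t in \<open>auto simp: power_less_one_iff\<close>)
  finally show ?thesis by (simp add: c\<^sub>3_def)
qed

text \<open>The slower of two rates. Generations after \<open>r\<close> contribute a mean square of
  order \<open>(t ^ 4) ^ r\<close>. Counts above the cap \<open>l = (1 / t) ^ r\<close> contribute
  at most a \<kappa>-th moment times \<open>l powr (2 - \<kappa>)\<close>, and the latter factor
  equals \<open>(t powr (\<kappa> - 2)) ^ r\<close>.\<close>

definition \<rho>' :: real where "\<rho>' = max (t ^ 4) (t powr (\<kappa> - 2))"
definition c\<^sub>4 :: real where "c\<^sub>4 = 2 * c\<^sub>3\<^sup>2 + 2 * c\<^sub>2 powr \<kappa>"
definition err :: "nat \<Rightarrow> real" where "err r = c\<^sub>4 * \<rho>' ^ r"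

lemma \<rho>': "0 < \<rho>'" "\<rho>' < 1"
  using t \<kappa> powr_less_mono2[of "\<kappa> - 2" t 1] by (auto simp: \<rho>'_def power_less_one_iff less_max_iff_disj)

lemma c\<^sub>4: "c\<^sub>4 > 0"
  using c23 by (simp add: c\<^sub>4_def add_pos_nonneg)

lemma err_pos: "err r > 0"
  using c\<^sub>4 \<rho>' by (simp add: err_def)

lemma err_tendsto_0: "err \<longlonglongrightarrow> 0"
  unfolding err_def using \<rho>' by (intro tendsto_mult_right_zero LIMSEQ_power_zero) auto

text \<open>The bound on \<open>f\<close> is the one satisfied by differences of truncated counts.\<close>

lemma truncation_error:
  fixes f :: "_ \<Rightarrow> real"
  assumes rs: "r \<le> s" and f [measurable]: "f \<in> borel_measurable slots"
    and le: "\<And>x. \<bar>f x\<bar> \<le> real (W s j m x - W r j m x) + (if real (W r j m x) > (1 / t) ^ r then real (W r j m x) else 0)"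
  shows "integrable slots (\<lambda>x. (f x)\<^sup>2)" "(\<integral>x. (f x)\<^sup>2 \<partial>slots) \<le> err r"
proof -
  define l where "l = (1 / t) ^ r"
  have l: "l > 0" using t by (simp add: l_def)
  have pw: "ennreal ((f x)\<^sup>2) \<le> 2 * epow (of_nat (W s j m x - W r j m x)) 2 +
      ennreal (2 * l powr (2 - \<kappa>)) * epow (of_nat (W r j m x)) \<kappa>" for x
  proof -
    define a where "a = real (W s j m x - W r j m x)"
    define w where "w = real (W r j m x)"
    define b where "b = (if w > l then w else 0)"
    \<comment> \<open>As \<kappa> > 2, the exponent \<open>2 - \<kappa>\<close> is negative: above
      the level \<open>l\<close> a square is at most \<open>l powr (2 - \<kappa>)\<close> times the
      \<kappa>-th power.\<close>
    have b: "b\<^sup>2 \<le> l powr (2 - \<kappa>) * w powr \<kappa>"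
    proof (cases "w > l")
      case True
      then have "w powr (2 - \<kappa>) \<le> l powr (2 - \<kappa>)" using l \<kappa> by (intro powr_mono2') auto
      then have "w powr (2 - \<kappa>) * w powr \<kappa> \<le> l powr (2 - \<kappa>) * w powr \<kappa>" by (intro mult_right_mono) auto
      moreover have "w powr (2 - \<kappa>) * w powr \<kappa> = w\<^sup>2"
        using True l by (simp add: powr_add[symmetric] powr_numeral)
      ultimately show ?thesis using True by (simp add: b_def)
    qed (simp add: b_def)
    have "\<bar>f x\<bar> \<le> a + b" using le[of x] by (simp only: a_def b_def w_def l_def)
    then have "(f x)\<^sup>2 \<le> (a + b)\<^sup>2" by (metis abs_ge_zero power2_abs power_mono)
    also have "\<dots> \<le> 2 * a\<^sup>2 + 2 * b\<^sup>2" using sum_squares_bound[of a b] by (simp add: power2_sum)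
    also have "\<dots> \<le> 2 * a\<^sup>2 + 2 * l powr (2 - \<kappa>) * w powr \<kappa>" using b by simp
    finally have "ennreal ((f x)\<^sup>2) \<le> ennreal (2 * a\<^sup>2 + 2 * l powr (2 - \<kappa>) * w powr \<kappa>)" by (rule ennreal_leI)
    also have "\<dots> = 2 * epow (of_nat (W s j m x - W r j m x)) 2 + ennreal (2 * l powr (2 - \<kappa>)) * epow (of_nat (W r j m x)) \<kappa>"
      unfolding epow_of_nat a_def[symmetric] w_def[symmetric]
      by (simp add: ennreal_plus ennreal_mult powr_numeral a_def)
    finally show ?thesis .
  qed
  have lin: "(\<integral>\<^sup>+x. 2 * F x + c * G x \<partial>slots) = 2 * (\<integral>\<^sup>+x. F x \<partial>slots) + c * (\<integral>\<^sup>+x. G x \<partial>slots)"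
    if [measurable]: "F \<in> borel_measurable slots" "G \<in> borel_measurable slots" for F G and c :: ennreal
    by (simp add: nn_integral_add nn_integral_cmult)
  have "(\<integral>\<^sup>+x. ennreal ((f x)\<^sup>2) \<partial>slots) \<le> (\<integral>\<^sup>+x. 2 * epow (of_nat (W s j m x - W r j m x)) 2 +
      ennreal (2 * l powr (2 - \<kappa>)) * epow (of_nat (W r j m x)) \<kappa> \<partial>slots)"
    by (intro nn_integral_mono pw)
  also have "\<dots> = 2 * (\<integral>\<^sup>+x. epow (of_nat (W s j m x - W r j m x)) 2 \<partial>slots) +
      ennreal (2 * l powr (2 - \<kappa>)) * (\<integral>\<^sup>+x. epow (of_nat (W r j m x)) \<kappa> \<partial>slots)"
  proof (rule lin)
    have "(\<lambda>x. ennreal (real (W s j m x) - real (W r j m x))) \<in> borel_measurable slots"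
      by (intro measurable_compose[OF _ measurable_ennreal] borel_measurable_diff measurable_W)
    moreover have "ennreal (real (W s j m x) - real (W r j m x)) = of_nat (W s j m x - W r j m x)" for x
      using W_mono[OF rs, of j m x] by (simp only: ennreal_of_nat_eq_real_of_nat of_nat_diff)
    ultimately show "(\<lambda>x. epow (of_nat (W s j m x - W r j m x)) 2) \<in> borel_measurable slots"
      by (intro borel_measurable_epow') (simp only:)
    show "(\<lambda>x. epow (of_nat (W r j m x)) \<kappa>) \<in> borel_measurable slots" by (rule measurable_W)
  qed
  also have "\<dots> \<le> 2 * epow (ennreal (c\<^sub>3 * (t\<^sup>2) ^ r)) 2 + ennreal (2 * l powr (2 - \<kappa>)) * epow (ennreal c\<^sub>2) \<kappa>"
    using nrm2_W_diff[OF rs, of j m] nrm_W[of r j m] \<kappa>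
    by (intro add_mono mult_left_mono) (auto simp: nrm_le_iff)
  also have "\<dots> = ennreal (2 * (c\<^sub>3 * (t\<^sup>2) ^ r)\<^sup>2 + 2 * l powr (2 - \<kappa>) * c\<^sub>2 powr \<kappa>)"
  proof -
    have e: "epow (ennreal (c\<^sub>3 * (t\<^sup>2) ^ r)) 2 = ennreal ((c\<^sub>3 * (t\<^sup>2) ^ r)\<^sup>2)"
      using c23 t by (subst epow_ennreal) (auto simp: powr_numeral)
    have e': "epow (ennreal c\<^sub>2) \<kappa> = ennreal (c\<^sub>2 powr \<kappa>)" using c23 by (subst epow_ennreal) auto
    have "(2::ennreal) = ennreal 2" by simp
    then show ?thesis unfolding e e' by (simp only: ennreal_mult[symmetric] ennreal_plus[symmetric] zero_le_power2
        powr_ge_zero mult_nonneg_nonneg zero_le_numeral)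
  qed
  also have "\<dots> \<le> ennreal (err r)"
  proof (rule ennreal_leI)
    have 1: "((t\<^sup>2) ^ r)\<^sup>2 \<le> \<rho>' ^ r"
    proof -
      have "((t\<^sup>2) ^ r)\<^sup>2 = (t ^ 4) ^ r" by (simp flip: power_mult)
      also have "\<dots> \<le> \<rho>' ^ r" using t by (intro power_mono) (auto simp: \<rho>'_def)
      finally show ?thesis .
    qed
    have 2: "l powr (2 - \<kappa>) \<le> \<rho>' ^ r"
    proof -
      have "l powr (2 - \<kappa>) = (t powr (\<kappa> - 2)) ^ r"
      proof -
        have "l = t powr (- real r)"
          using t by (simp add: l_def powr_minus powr_realpow power_one_over inverse_eq_divide)
        then have "l powr (2 - \<kappa>) = t powr ((\<kappa> - 2) * real r)" by (simp add: powr_powr algebra_simps)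
        also have "\<dots> = (t powr (\<kappa> - 2)) ^ r" using t by (simp add: powr_realpow[symmetric] powr_powr)
        finally show ?thesis .
      qed
      also have "\<dots> \<le> \<rho>' ^ r" using t by (intro power_mono) (auto simp: \<rho>'_def)
      finally show ?thesis .
    qed
    have "2 * (c\<^sub>3 * (t\<^sup>2) ^ r)\<^sup>2 + 2 * l powr (2 - \<kappa>) * c\<^sub>2 powr \<kappa> = 2 * c\<^sub>3\<^sup>2 * ((t\<^sup>2) ^ r)\<^sup>2 + 2 * c\<^sub>2 powr \<kappa> * l powr (2 - \<kappa>)"
      by (simp add: power_mult_distrib)
    also have "\<dots> \<le> 2 * c\<^sub>3\<^sup>2 * \<rho>' ^ r + 2 * c\<^sub>2 powr \<kappa> * \<rho>' ^ r"
      using 1 2 by (intro add_mono mult_left_mono) auto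
    also have "\<dots> = err r" by (simp add: err_def c\<^sub>4_def algebra_simps)
    finally show "2 * (c\<^sub>3 * (t\<^sup>2) ^ r)\<^sup>2 + 2 * l powr (2 - \<kappa>) * c\<^sub>2 powr \<kappa> \<le> err r" .
  qed
  finally have fin: "(\<integral>\<^sup>+x. ennreal ((f x)\<^sup>2) \<partial>slots) \<le> ennreal (err r)" .
  show i: "integrable slots (\<lambda>x. (f x)\<^sup>2)"
    by (intro integrableI_bounded) (use fin in \<open>auto simp: less_top[symmetric] top_unique\<close>)
  have "ennreal (\<integral>x. (f x)\<^sup>2 \<partial>slots) \<le> ennreal (err r)"
    using fin by (subst nn_integral_eq_integral[OF i, symmetric]) auto
  then show "(\<integral>x. (f x)\<^sup>2 \<partial>slots) \<le> err r" using err_pos[of r] by simp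
qed

text \<open>If the count at level \<open>r\<close> is within its cap, the difference is at most the
  increment of the count. Otherwise it is at most the full count at level \<open>s\<close>, which is
  that increment plus the count at level \<open>r\<close>.\<close>

lemma V_diff:
  assumes "r \<le> s"
  shows "integrable slots (\<lambda>x. (V s j m x - V r j m x)\<^sup>2)" "(\<integral>x. (V s j m x - V r j m x)\<^sup>2 \<partial>slots) \<le> err r"
proof -
  have "\<bar>V s j m x - V r j m x\<bar> \<le> real (W s j m x - W r j m x) + (if real (W r j m x) > (1 / t) ^ r then real (W r j m x) else 0)" for x
    using W_mono[OF assms, of j m x] V_mono[OF assms, of j m x] V_bounds(1)[of r j m x] V_bounds(4)[of s j m x]
    by (auto simp: of_nat_diff V_def[of r])
  then show "integrable slots (\<lambda>x. (V s j m x - V r j m x)\<^sup>2)" "(\<integral>x. (V s j m x - V r j m x)\<^sup>2 \<partial>slots) \<le> err r"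
    using truncation_error[OF assms, where f="\<lambda>x. V s j m x - V r j m x" and j=j and m=m] by simp_all
qed

text \<open>With \<open>s = r\<close> only the cut in height remains.\<close>

lemma W_V_diff:
  "integrable slots (\<lambda>x. (real (W r j m x) - V r j m x)\<^sup>2)" "(\<integral>x. (real (W r j m x) - V r j m x)\<^sup>2 \<partial>slots) \<le> err r"
proof -
  have m: "(\<lambda>x. real (W r j m x) - V r j m x) \<in> borel_measurable slots"
    by (intro borel_measurable_diff measurable_V measurable_W)
  have "\<bar>real (W r j m x) - V r j m x\<bar> \<le> real (W r j m x - W r j m x) + (if real (W r j m x) > (1 / t) ^ r then real (W r j m x) else 0)" for x
    using t by (auto simp: V_def)
  then show "integrable slots (\<lambda>x. (real (W r j m x) - V r j m x)\<^sup>2)" "(\<integral>x. (real (W r j m x) - V r j m x)\<^sup>2 \<partial>slots) \<le> err r"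
    using truncation_error[OF order_refl m, where j=j and m=m and r=r] by simp_all
qed

text \<open>At level 0 the count is 0, so the error bound becomes a second moment bound common to
  all levels.\<close>

lemma V_square: "integrable slots (\<lambda>x. (V r j m x)\<^sup>2)" "(\<integral>x. (V r j m x)\<^sup>2 \<partial>slots) \<le> err 0"
proof -
  have "\<bar>V r j m x\<bar> \<le> real (W r j m x - W 0 j m x) + (if real (W 0 j m x) > (1 / t) ^ 0 then real (W 0 j m x) else 0)" for x
    using V_bounds(1)[of r j m x] V_bounds(4)[of r j m x] by (simp add: W_def)
  then show "integrable slots (\<lambda>x. (V r j m x)\<^sup>2)" "(\<integral>x. (V r j m x)\<^sup>2 \<partial>slots) \<le> err 0"
    using truncation_error[where r=0 and s=r and f="V r j m" and j=j and m=m] by simp_all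
qed

end

section \<open>Covariances\<close>

definition sq_int :: "'a measure \<Rightarrow> ('a \<Rightarrow> real) \<Rightarrow> bool" where
  "sq_int M f \<longleftrightarrow> f \<in> borel_measurable M \<and> integrable M (\<lambda>x. (f x)\<^sup>2)"

definition l2 :: "'a measure \<Rightarrow> ('a \<Rightarrow> real) \<Rightarrow> real" where
  "l2 M f = sqrt (\<integral>x. (f x)\<^sup>2 \<partial>M)"

definition cov :: "'a measure \<Rightarrow> ('a \<Rightarrow> real) \<Rightarrow> ('a \<Rightarrow> real) \<Rightarrow> real" where
  "cov M f g = (\<integral>x. f x * g x \<partial>M) - (\<integral>x. f x \<partial>M) * (\<integral>x. g x \<partial>M)"

lemma l2_nonneg [simp]: "0 \<le> l2 M f"
  by (simp add: l2_def)

lemma l2_square: "(l2 M f)\<^sup>2 = (\<integral>x. (f x)\<^sup>2 \<partial>M)"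
  by (simp add: l2_def)

lemma l2_le_sqrt: "(\<integral>x. (f x)\<^sup>2 \<partial>M) \<le> e \<Longrightarrow> l2 M f \<le> sqrt e"
  by (simp add: l2_def)

lemma sq_int_mult:
  assumes "sq_int M f" "sq_int M g"
  shows "integrable M (\<lambda>x. f x * g x)"
proof (rule Bochner_Integration.integrable_bound[where f="\<lambda>x. (f x)\<^sup>2 + (g x)\<^sup>2"])
  show "AE x in M. norm (f x * g x) \<le> norm ((f x)\<^sup>2 + (g x)\<^sup>2)"
  proof (rule AE_I2)
    fix x
    have "0 \<le> (\<bar>f x\<bar> - \<bar>g x\<bar>)\<^sup>2" by simp
    then have "2 * (\<bar>f x\<bar> * \<bar>g x\<bar>) \<le> (f x)\<^sup>2 + (g x)\<^sup>2" by (simp add: power2_diff)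
    moreover have "0 \<le> \<bar>f x\<bar> * \<bar>g x\<bar>" by simp
    ultimately have "\<bar>f x\<bar> * \<bar>g x\<bar> \<le> (f x)\<^sup>2 + (g x)\<^sup>2" by linarith
    then show "norm (f x * g x) \<le> norm ((f x)\<^sup>2 + (g x)\<^sup>2)" by (simp add: abs_mult)
  qed
qed (use assms in \<open>auto simp: sq_int_def\<close>)

lemma sq_int_add:
  assumes "sq_int M f" "sq_int M g"
  shows "sq_int M (\<lambda>x. f x + g x)"
  using assms sq_int_mult[OF assms] unfolding sq_int_def
  by (auto simp: power2_sum mult.assoc intro!: borel_measurable_add Bochner_Integration.integrable_add)

lemma sq_int_cmult: "sq_int M f \<Longrightarrow> sq_int M (\<lambda>x. c * f x)"
  by (auto simp: sq_int_def power_mult_distrib intro!: borel_measurable_times)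

lemma sq_int_diff: "sq_int M f \<Longrightarrow> sq_int M g \<Longrightarrow> sq_int M (\<lambda>x. f x - g x)"
  using sq_int_add[OF _ sq_int_cmult[of M g "-1"]] by simp

lemma sq_int_sum: "(\<And>i. i \<in> I \<Longrightarrow> sq_int M (f i)) \<Longrightarrow> sq_int M (\<lambda>x. \<Sum>i\<in>I. f i x)"
  by (induction I rule: infinite_finite_induct) (auto intro: sq_int_add simp: sq_int_def[of M "\<lambda>x. 0"])

text \<open>The Cauchy-Schwarz inequality: the quadratic
  \<open>y\<^sup>2 * A + 2 * y * E + B\<close> is the integral of a square. For \<open>A = 0\<close>
  it is affine, which forces \<open>E = 0\<close>; otherwise it is evaluated at its minimum.\<close>

lemma abs_integral_mult_le:
  assumes f: "sq_int M f" and g: "sq_int M g"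
  shows "\<bar>\<integral>x. f x * g x \<partial>M\<bar> \<le> l2 M f * l2 M g"
proof -
  define A B E where "A = (\<integral>x. (f x)\<^sup>2 \<partial>M)" and "B = (\<integral>x. (g x)\<^sup>2 \<partial>M)" and "E = (\<integral>x. f x * g x \<partial>M)"
  have A0: "A \<ge> 0" by (simp add: A_def)
  have q: "0 \<le> y\<^sup>2 * A + 2 * y * E + B" for y
  proof -
    have "0 \<le> (\<integral>x. (y * f x + g x)\<^sup>2 \<partial>M)" by simp
    also have "\<dots> = (\<integral>x. y\<^sup>2 * (f x)\<^sup>2 + 2 * y * (f x * g x) + (g x)\<^sup>2 \<partial>M)"
      by (intro Bochner_Integration.integral_cong refl) (simp add: power2_sum power_mult_distrib)
    also have "\<dots> = y\<^sup>2 * A + 2 * y * E + B"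
      using f g sq_int_mult[OF f g] by (simp add: A_def B_def E_def sq_int_def)
    finally show ?thesis .
  qed
  have "E\<^sup>2 \<le> A * B"
  proof (cases "A = 0")
    case True
    have "E = 0"
    proof (rule ccontr)
      assume "E \<noteq> 0"
      then show False using q[of "(- B - 1) / (2 * E)"] True by (simp add: field_simps)
    qed
    then show ?thesis using True by simp
  next
    case False
    then have "A > 0" using A0 by simp
    then show ?thesis using q[of "- E / A"] by (simp add: field_simps power2_eq_square)
  qed
  then have "sqrt (E\<^sup>2) \<le> sqrt (A * B)" by (rule real_sqrt_le_mono)
  then show ?thesis by (simp add: l2_def A_def B_def E_def real_sqrt_mult)
qed

lemma l2_add:
  assumes f: "sq_int M f" and g: "sq_int M g"
  shows "l2 M (\<lambda>x. f x + g x) \<le> l2 M f + l2 M g"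
proof -
  have "(\<integral>x. (f x + g x)\<^sup>2 \<partial>M) = (l2 M f)\<^sup>2 + (l2 M g)\<^sup>2 + 2 * (\<integral>x. f x * g x \<partial>M)"
    using f g sq_int_mult[OF f g] by (simp add: l2_square power2_sum sq_int_def mult.assoc)
  also have "\<dots> \<le> (l2 M f)\<^sup>2 + (l2 M g)\<^sup>2 + 2 * (l2 M f * l2 M g)"
    using abs_integral_mult_le[OF f g] by linarith
  also have "\<dots> = (l2 M f + l2 M g)\<^sup>2" by (simp add: power2_sum)
  finally show ?thesis by (simp add: l2_def[of M "\<lambda>x. f x + g x"] real_le_lsqrt)
qed

lemma l2_cmult: "l2 M (\<lambda>x. c * f x) = \<bar>c\<bar> * l2 M f"
  by (simp add: l2_def power_mult_distrib real_sqrt_mult)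

lemma l2_minus_commute: "l2 M (\<lambda>x. f x - g x) = l2 M (\<lambda>x. g x - f x)"
  by (simp add: l2_def power2_commute)

lemma l2_sum:
  "(\<And>i. i \<in> I \<Longrightarrow> sq_int M (f i)) \<Longrightarrow> l2 M (\<lambda>x. \<Sum>i\<in>I. f i x) \<le> (\<Sum>i\<in>I. l2 M (f i))"
proof (induction I rule: infinite_finite_induct)
  case (insert i I)
  have "l2 M (\<lambda>x. f i x + (\<Sum>i\<in>I. f i x)) \<le> l2 M (f i) + l2 M (\<lambda>x. \<Sum>i\<in>I. f i x)"
    using insert by (intro l2_add sq_int_sum) auto
  also have "\<dots> \<le> l2 M (f i) + (\<Sum>i\<in>I. l2 M (f i))" using insert by (intro add_left_mono) auto
  finally show ?case using insert by simp
qed (auto simp: l2_def)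

lemma l2_triangle:
  assumes "sq_int M f" "sq_int M g"
  shows "\<bar>l2 M f - l2 M g\<bar> \<le> l2 M (\<lambda>x. f x - g x)"
proof -
  have "l2 M (\<lambda>x. (f x - g x) + g x) \<le> l2 M (\<lambda>x. f x - g x) + l2 M g"
    by (intro l2_add sq_int_diff assms)
  moreover have "l2 M (\<lambda>x. (g x - f x) + f x) \<le> l2 M (\<lambda>x. g x - f x) + l2 M f"
    by (intro l2_add sq_int_diff assms)
  ultimately show ?thesis by (simp add: l2_minus_commute[of M g f])
qed

lemma l2_triangle3:
  assumes "sq_int M f" "sq_int M g" "sq_int M h"
  shows "l2 M (\<lambda>x. f x - h x) \<le> l2 M (\<lambda>x. f x - g x) + l2 M (\<lambda>x. g x - h x)"
  using l2_add[OF sq_int_diff[OF assms(1,2)] sq_int_diff[OF assms(2,3)]] by simp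

section \<open>Covariances under a probability measure\<close>

context prob_space
begin

lemma sq_int_integrable: "sq_int M f \<Longrightarrow> integrable M f"
  unfolding sq_int_def using square_integrable_imp_integrable by blast

lemma sq_int_const [simp]: "sq_int M (\<lambda>x. c)"
  by (simp add: sq_int_def)

lemma sq_int_bounded:
  assumes "f \<in> borel_measurable M" "\<And>x. \<bar>f x\<bar> \<le> B"
  shows "sq_int M f"
  unfolding sq_int_def
proof
  have "(f x)\<^sup>2 \<le> B\<^sup>2" for x using assms(2)[of x] by (metis abs_ge_zero power2_abs power_mono)
  then show "integrable M (\<lambda>x. (f x)\<^sup>2)"
    using assms(1) by (intro integrable_const_bound[where B="B\<^sup>2"]) auto
qed fact

lemma l2_const: "l2 M (\<lambda>x. c) = \<bar>c\<bar>"
  by (simp add: l2_def prob_space)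

lemma abs_expectation_le_l2: "sq_int M f \<Longrightarrow> \<bar>expectation f\<bar> \<le> l2 M f"
  using abs_integral_mult_le[of M f "\<lambda>x. 1"] by (simp add: l2_const)

lemma l2_centered_le:
  assumes "sq_int M f"
  shows "l2 M (\<lambda>x. f x - expectation f) \<le> l2 M f"
proof -
  have "variance f = expectation (\<lambda>x. (f x)\<^sup>2) - (expectation f)\<^sup>2"
    using assms sq_int_integrable[OF assms] by (intro variance_eq) (auto simp: sq_int_def)
  then show ?thesis by (simp add: l2_def)
qed

lemma cov_eq_centered:
  assumes f: "sq_int M f" and g: "sq_int M g"
  shows "cov M f g = expectation (\<lambda>x. (f x - expectation f) * (g x - expectation g))"
proof -
  note i = sq_int_mult[OF f g] sq_int_integrable[OF f] sq_int_integrable[OF g]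
  have "expectation (\<lambda>x. (f x - expectation f) * (g x - expectation g)) =
      expectation (\<lambda>x. f x * g x - expectation g * f x - expectation f * g x + expectation f * expectation g)"
    by (intro Bochner_Integration.integral_cong refl) (simp add: algebra_simps)
  also have "\<dots> = cov M f g" using i by (simp add: cov_def prob_space)
  finally show ?thesis ..
qed

lemma abs_cov_le:
  assumes f: "sq_int M f" and g: "sq_int M g"
  shows "\<bar>cov M f g\<bar> \<le> l2 M f * l2 M g"
proof -
  have "\<bar>cov M f g\<bar> \<le> l2 M (\<lambda>x. f x - expectation f) * l2 M (\<lambda>x. g x - expectation g)"
    unfolding cov_eq_centered[OF f g] by (intro abs_integral_mult_le sq_int_diff f g) auto
  also have "\<dots> \<le> l2 M f * l2 M g" by (intro mult_mono l2_centered_le f g) auto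
  finally show ?thesis .
qed

lemma cov_diff_left:
  assumes "sq_int M f" "sq_int M f'" "sq_int M g"
  shows "cov M (\<lambda>x. f x - f' x) g = cov M f g - cov M f' g"
  using sq_int_mult[OF assms(1,3)] sq_int_mult[OF assms(2,3)] sq_int_integrable assms
  by (simp add: cov_def left_diff_distrib)

lemma cov_commute: "cov M f g = cov M g f"
  by (simp add: cov_def mult.commute)

lemma cov_diff_right:
  assumes "sq_int M f" "sq_int M g" "sq_int M g'"
  shows "cov M f (\<lambda>x. g x - g' x) = cov M f g - cov M f g'"
  using cov_diff_left[of g g' f] assms by (simp add: cov_commute[of f])

text \<open>One argument is exchanged at a time, with Cauchy-Schwarz for each difference. It carries
  a covariance bound from shorter truncations to longer ones.\<close>

lemma cov_replace:
  assumes "sq_int M f" "sq_int M f'" "sq_int M g" "sq_int M g'"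
  shows "\<bar>cov M f g\<bar> \<le> \<bar>cov M f' g'\<bar> + l2 M (\<lambda>x. f x - f' x) * l2 M g + l2 M f' * l2 M (\<lambda>x. g x - g' x)"
proof -
  have "cov M f g = cov M f' g' + cov M (\<lambda>x. f x - f' x) g + cov M f' (\<lambda>x. g x - g' x)"
    using assms by (simp add: cov_diff_left cov_diff_right)
  moreover have "\<bar>cov M (\<lambda>x. f x - f' x) g\<bar> \<le> l2 M (\<lambda>x. f x - f' x) * l2 M g"
    by (intro abs_cov_le sq_int_diff assms)
  moreover have "\<bar>cov M f' (\<lambda>x. g x - g' x)\<bar> \<le> l2 M f' * l2 M (\<lambda>x. g x - g' x)"
    by (intro abs_cov_le sq_int_diff assms)
  ultimately show ?thesis by linarith
qed

lemma cov_sum_sum: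
  assumes f: "\<And>i. i \<in> I \<Longrightarrow> sq_int M (f i)" and g: "\<And>j. j \<in> J \<Longrightarrow> sq_int M (g j)"
  shows "cov M (\<lambda>x. \<Sum>i\<in>I. f i x) (\<lambda>x. \<Sum>j\<in>J. g j x) = (\<Sum>i\<in>I. \<Sum>j\<in>J. cov M (f i) (g j))"
  using sq_int_mult[OF f g] sq_int_integrable[OF f] sq_int_integrable[OF g]
  by (simp add: cov_def sum_product sum_subtractf)

lemma l2_centered_sum_square:
  assumes "\<And>i. i \<in> I \<Longrightarrow> sq_int M (f i)"
  shows "(l2 M (\<lambda>x. \<Sum>i\<in>I. (f i x - expectation (f i))))\<^sup>2 = (\<Sum>i\<in>I. \<Sum>j\<in>I. cov M (f i) (f j))"
proof -
  have s: "sq_int M (\<lambda>x. \<Sum>i\<in>I. f i x)" by (intro sq_int_sum assms)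
  have c: "(\<Sum>i\<in>I. (f i x - expectation (f i))) = (\<Sum>i\<in>I. f i x) - expectation (\<lambda>x. \<Sum>i\<in>I. f i x)" for x
    using sq_int_integrable[OF assms] by (simp add: sum_subtractf)
  have "(l2 M (\<lambda>x. \<Sum>i\<in>I. (f i x - expectation (f i))))\<^sup>2 =
      expectation (\<lambda>x. ((\<Sum>i\<in>I. f i x) - expectation (\<lambda>x. \<Sum>i\<in>I. f i x))\<^sup>2)"
    by (simp only: l2_square c)
  also have "\<dots> = cov M (\<lambda>x. \<Sum>i\<in>I. f i x) (\<lambda>x. \<Sum>i\<in>I. f i x)"
    by (simp only: cov_eq_centered[OF s s] power2_eq_square)
  also have "\<dots> = (\<Sum>i\<in>I. \<Sum>j\<in>I. cov M (f i) (f j))"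
    by (rule cov_sum_sum) (use assms in auto)
  finally show ?thesis .
qed

end

section \<open>Central limit theorem for truncated progenies\<close>

context branching_environment
begin

text \<open>The window of the first family, sites -1 to \<open>r - 1\<close>, moved by the arrival
  time \<open>m\<close>.\<close>

lemma depends_on_quenched_mean:
  fixes \<xi> :: "(nat^'d) list \<Rightarrow> 'b::{real_normed_field, banach, second_countable_topology}"
  shows "depends_on {int m - 1..<int m + int r} (\<lambda>\<omega>. \<integral>x. \<xi> (fam x 0 r) \<partial>quenched q p (shift_by (int m) \<omega>))"
proof -
  have "depends_on {-1..<int r} (\<lambda>\<omega>. \<integral>x. \<xi> (fam x 0 r) \<partial>quenched q p \<omega>)"
    unfolding depends_on_def
  proof (intro conjI ballI impI)
    show "(\<lambda>\<omega>. \<integral>x. \<xi> (fam x 0 r) \<partial>quenched q p \<omega>) \<in> borel_measurable P"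
      by (rule measurable_integral_quenched[OF fam_measurable_comp])
    fix \<omega> \<omega>' :: "int \<Rightarrow> 's" assume "\<forall>j\<in>{-1..<int r}. \<omega> j = \<omega>' j"
    then show "(\<integral>x. \<xi> (fam x 0 r) \<partial>quenched q p \<omega>) = (\<integral>x. \<xi> (fam x 0 r) \<partial>quenched q p \<omega>')"
      by (intro integral_fam_cong) auto
  qed
  then show ?thesis by (rule depends_on_mono[OF depends_on_shift_by]) auto
qed

lemma measurable_fam_slots [measurable]:
  fixes \<xi> :: "(nat^'d) list \<Rightarrow> 'b::topological_space"
  shows "(\<lambda>x. \<xi> (fam x m r)) \<in> borel_measurable slots"
  unfolding measurable_slots_iff by (rule fam_measurable_comp)

lemma expectation_fam:
  fixes \<xi> :: "(nat^'d) list \<Rightarrow> real"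
  assumes "\<And>as. \<bar>\<xi> as\<bar> \<le> B"
  shows "(\<integral>x. \<xi> (fam x m r) \<partial>slots) = (\<integral>\<omega>. (\<integral>x. \<xi> (fam x 0 r) \<partial>quenched q p \<omega>) \<partial>P)"
proof -
  have "(\<integral>x. \<xi> (fam x m r) \<partial>slots) = (\<integral>\<omega>. (\<integral>x. \<xi> (fam x 0 r) \<partial>quenched q p (shift_by (int m) \<omega>)) \<partial>P)"
    using integral_prod_fam_real[where I="{m}" and H="\<lambda>_. \<xi>" and B="\<lambda>_. B" and r=r] assms by simp
  also have "\<dots> = (\<integral>\<omega>. (\<integral>x. \<xi> (fam x 0 r) \<partial>quenched q p \<omega>) \<partial>P)"
    by (rule integral_shift_by) (rule measurable_integral_quenched[OF fam_measurable_comp])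
  finally show ?thesis .
qed

lemma expectation_fam_pair:
  fixes \<xi> \<xi>' :: "(nat^'d) list \<Rightarrow> real"
  assumes "\<And>as. \<bar>\<xi> as\<bar> \<le> B" "\<And>as. \<bar>\<xi>' as\<bar> \<le> B'" and "m \<noteq> m'"
  shows "(\<integral>x. \<xi> (fam x m r) * \<xi>' (fam x m' r) \<partial>slots) =
    (\<integral>\<omega>. (\<integral>x. \<xi> (fam x 0 r) \<partial>quenched q p (shift_by (int m) \<omega>)) *
      (\<integral>x. \<xi>' (fam x 0 r) \<partial>quenched q p (shift_by (int m') \<omega>)) \<partial>P)"
  using integral_prod_fam_real[where I="{m, m'}" and H="\<lambda>n. if n = m then \<xi> else \<xi>'"
      and B="\<lambda>n. if n = m then B else B'" and r=r] assms by simp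

text \<open>Lag 0 is separate: one family is then multiplied with itself, and the factorisation into
  quenched means is available for distinct arrival times only. For a positive lag the two quenched
  means move together under the stationary shift.\<close>

lemma expectation_fam_pair_shift:
  fixes \<xi> :: "(nat^'d) list \<Rightarrow> real"
  assumes \<xi>: "\<And>as. \<bar>\<xi> as\<bar> \<le> B"
  shows "(\<integral>x. \<xi> (fam x m r) * \<xi> (fam x (m + j) r) \<partial>slots) = (\<integral>x. \<xi> (fam x 0 r) * \<xi> (fam x j r) \<partial>slots)"
proof (cases "j = 0")
  case True
  have "\<bar>\<xi> as * \<xi> as\<bar> \<le> B * B" for as
    using mult_mono[OF \<xi>[of as] \<xi>[of as]] order_trans[OF abs_ge_zero \<xi>[of as]] by (simp add: abs_mult)
  then show ?thesis
    using True expectation_fam[of "\<lambda>as. \<xi> as * \<xi> as" "B * B"] by simp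
next
  case False
  let ?h = "\<lambda>\<omega>. \<integral>x. \<xi> (fam x 0 r) \<partial>quenched q p \<omega>"
  have h [measurable]: "?h \<in> borel_measurable P" by (rule measurable_integral_quenched[OF fam_measurable_comp])
  have s: "shift_by (int (m + j)) \<omega> = shift_by (int j) (shift_by (int m) \<omega>)" for \<omega> :: "int \<Rightarrow> 's"
    by (simp add: shift_by_def fun_eq_iff algebra_simps)
  have s0: "shift_by (int 0) \<omega> = \<omega>" for \<omega> :: "int \<Rightarrow> 's" by (simp add: shift_by_def)
  have "(\<integral>x. \<xi> (fam x m r) * \<xi> (fam x (m + j) r) \<partial>slots) = (\<integral>\<omega>. ?h (shift_by (int m) \<omega>) * ?h (shift_by (int j) (shift_by (int m) \<omega>)) \<partial>P)"
    using expectation_fam_pair[of \<xi> B \<xi> B, OF \<xi> \<xi>, where m=m and m'="m + j" and r=r] False by (simp only: s)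
  also have "\<dots> = (\<integral>\<omega>. ?h \<omega> * ?h (shift_by (int j) \<omega>) \<partial>P)"
    by (rule integral_shift_by[of "\<lambda>\<omega>. ?h \<omega> * ?h (shift_by (int j) \<omega>)"])
      (intro borel_measurable_times h measurable_compose[OF measurable_shift_by h])
  also have "\<dots> = (\<integral>x. \<xi> (fam x 0 r) * \<xi> (fam x j r) \<partial>slots)"
    using expectation_fam_pair[of \<xi> B \<xi> B, OF \<xi> \<xi>, where m=0 and m'=j and r=r] False by (simp only: s0)
  finally show ?thesis .
qed

lemma char_fam:
  fixes \<xi> :: "(nat^'d) list \<Rightarrow> real"
  assumes "finite I"
  shows "(\<integral>x. iexp (y * (\<Sum>m\<in>I. \<xi> (fam x m r))) \<partial>slots) =
    (\<integral>\<omega>. (\<Prod>m\<in>I. \<integral>x. iexp (y * \<xi> (fam x 0 r)) \<partial>quenched q p (shift_by (int m) \<omega>)) \<partial>P)"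
proof -
  have "iexp (y * (\<Sum>m\<in>I. \<xi> (fam x m r))) = (\<Prod>m\<in>I. iexp (y * \<xi> (fam x m r)))" for x
    using assms by (simp add: sum_distrib_left exp_sum)
  then show ?thesis
    using integral_prod_fam_complex[where I=I and H="\<lambda>_ as. iexp (y * \<xi> as)" and B="\<lambda>_. 1" and r=r] assms by simp
qed

lemma char_fam_shift:
  fixes \<xi> :: "(nat^'d) list \<Rightarrow> real"
  shows "(\<integral>x. iexp (y * (\<Sum>m\<in>{a..<a + l}. \<xi> (fam x m r))) \<partial>slots) =
    (\<integral>x. iexp (y * (\<Sum>m<l. \<xi> (fam x m r))) \<partial>slots)"
proof -
  let ?h = "\<lambda>\<omega>. \<integral>x. iexp (y * \<xi> (fam x 0 r)) \<partial>quenched q p \<omega>"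
  have h: "?h \<in> borel_measurable P" by (rule measurable_integral_quenched[OF fam_measurable_comp])
  have s: "shift_by (int (a + m)) \<omega> = shift_by (int m) (shift_by (int a) \<omega>)" for \<omega> :: "int \<Rightarrow> 's" and m
    by (simp add: shift_by_def fun_eq_iff algebra_simps)
  have "(\<integral>x. iexp (y * (\<Sum>m\<in>{a..<a + l}. \<xi> (fam x m r))) \<partial>slots) =
      (\<integral>\<omega>. (\<Prod>m\<in>{a..<a + l}. ?h (shift_by (int m) \<omega>)) \<partial>P)"
    by (rule char_fam) simp
  also have "\<dots> = (\<integral>\<omega>. (\<Prod>m<l. ?h (shift_by (int m) (shift_by (int a) \<omega>))) \<partial>P)"
    unfolding s[symmetric]
    by (intro Bochner_Integration.integral_cong refl prod.reindex_bij_witness[of _ "\<lambda>m. a + m" "\<lambda>m. m - a"]) auto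
  also have "\<dots> = (\<integral>\<omega>. (\<Prod>m<l. ?h (shift_by (int m) \<omega>)) \<partial>P)"
    by (rule integral_shift_by[of "\<lambda>\<omega>. \<Prod>m<l. ?h (shift_by (int m) \<omega>)"])
      (intro borel_measurable_prod measurable_compose[OF measurable_shift_by h])
  also have "\<dots> = (\<integral>x. iexp (y * (\<Sum>m<l. \<xi> (fam x m r))) \<partial>slots)"
    by (rule char_fam[symmetric]) simp
  finally show ?thesis .
qed

end

context mixing_branching
begin

text \<open>Histories of \<open>r\<close> generations widen the windows, so \<open>r + 1\<close> of
  the \<open>n\<close> sites between the two groups are lost. A gap shorter than this is covered by
  the trivial bound 2, for which the constant is large enough.\<close>

lemma char_fam_mixing:
  fixes \<xi> :: "(nat^'d) list \<Rightarrow> real"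
  assumes J: "finite J" "I \<subseteq> {..<a}" "J \<subseteq> {a + n..}"
  shows "cmod ((\<integral>x. iexp (y * ((\<Sum>m\<in>I. \<xi> (fam x m r)) + (\<Sum>m\<in>J. \<xi> (fam x m r)))) \<partial>slots) -
      (\<integral>x. iexp (y * (\<Sum>m\<in>I. \<xi> (fam x m r))) \<partial>slots) * (\<integral>x. iexp (y * (\<Sum>m\<in>J. \<xi> (fam x m r))) \<partial>slots))
    \<le> (16 * c\<^sub>0 + 2) / (t ^ 4) ^ (r + 1) * (t ^ 4) ^ n" (is "cmod (?IJ - ?I * ?J) \<le> _")
proof (cases "n \<ge> r + 1")
  case True
  let ?h = "\<lambda>\<omega>. \<integral>x. iexp (y * \<xi> (fam x 0 r)) \<partial>quenched q p \<omega>"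
  have I: "finite I" using J(2) finite_subset by blast
  have disj: "I \<inter> J = {}" using J by fastforce
  define G where "G \<omega> = (\<Prod>m\<in>I. ?h (shift_by (int m) \<omega>))" for \<omega>
  define H where "H \<omega> = (\<Prod>m\<in>J. ?h (shift_by (int m) \<omega>))" for \<omega>
  have h1: "cmod (?h \<omega>) \<le> 1" for \<omega>
    by (rule quenched_bounded(2)[OF fam_measurable_comp]) simp
  have b: "cmod (\<Prod>m\<in>K. ?h (shift_by (int m) \<omega>)) \<le> 1" for K \<omega>
    unfolding prod_norm[symmetric] by (rule prod_le_1) (use h1 in auto)
  have G: "depends_on {..<int a + int r} G"
    unfolding G_def
  proof (rule depends_on_prod)
    fix m assume "m \<in> I"
    then have "m < a" using J(2) by auto
    then show "depends_on {..<int a + int r} (\<lambda>\<omega>. ?h (shift_by (int m) \<omega>))"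
      by (intro depends_on_mono[OF depends_on_quenched_mean]) auto
  qed
  have H: "depends_on {int a + int r + int (n - r - 1)..} H"
    unfolding H_def
  proof (rule depends_on_prod)
    fix m assume "m \<in> J"
    then have "a + n \<le> m" using J(3) by auto
    then show "depends_on {int a + int r + int (n - r - 1)..} (\<lambda>\<omega>. ?h (shift_by (int m) \<omega>))"
      using True by (intro depends_on_mono[OF depends_on_quenched_mean]) auto
  qed
  have "?IJ = (\<integral>x. iexp (y * (\<Sum>m\<in>I \<union> J. \<xi> (fam x m r))) \<partial>slots)"
    using I J(1) disj by (simp add: sum.union_disjoint)
  also have "\<dots> = (\<integral>\<omega>. (\<Prod>m\<in>I \<union> J. ?h (shift_by (int m) \<omega>)) \<partial>P)" by (rule char_fam) (use I J in auto)
  also have "\<dots> = (\<integral>\<omega>. G \<omega> * H \<omega> \<partial>P)"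
    using I J(1) disj by (simp add: prod.union_disjoint G_def H_def)
  finally have 1: "?IJ = (\<integral>\<omega>. G \<omega> * H \<omega> \<partial>P)" .
  have 2: "?I = (\<integral>\<omega>. G \<omega> \<partial>P)" unfolding G_def by (rule char_fam[OF I])
  have 3: "?J = (\<integral>\<omega>. H \<omega> \<partial>P)" unfolding H_def by (rule char_fam[OF J(1)])
  have "cmod (?IJ - ?I * ?J) \<le> 16 * (c\<^sub>0 * (t ^ 4) ^ (n - r - 1))"
    unfolding 1 2 3 by (rule covariance_complex[OF G H _ _ mixing]) (use b c\<^sub>0 t in \<open>auto simp: G_def H_def\<close>)
  also have "(t ^ 4) ^ (n - r - 1) = (t ^ 4) ^ n / (t ^ 4) ^ (r + 1)"
    using t True by (simp add: power_diff)
  also have "16 * (c\<^sub>0 * \<dots>) \<le> (16 * c\<^sub>0 + 2) / (t ^ 4) ^ (r + 1) * (t ^ 4) ^ n"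
    using t by (simp add: field_simps)
  finally show ?thesis .
next
  case False
  have le1: "cmod (\<integral>x. iexp (y * (\<Sum>m\<in>K. \<xi> (fam x m r))) \<partial>slots) \<le> 1" for K
    by (rule norm_integral_iexp_le) (auto intro: A.prob_space_axioms)
  have le1': "cmod ?IJ \<le> 1"
    by (rule norm_integral_iexp_le) (auto intro: A.prob_space_axioms)
  have "cmod (?IJ - ?I * ?J) \<le> cmod ?IJ + cmod ?I * cmod ?J"
    using norm_triangle_ineq4[of ?IJ "?I * ?J"] by (simp add: norm_mult)
  also have "\<dots> \<le> 1 + 1 * 1" by (intro add_mono mult_mono le1 le1') auto
  also have "\<dots> \<le> (16 * c\<^sub>0 + 2) * ((t ^ 4) ^ n / (t ^ 4) ^ (r + 1))"
  proof -
    have "(t ^ 4) ^ (r + 1) \<le> (t ^ 4) ^ n"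
      using False t by (intro power_decreasing) (auto simp: power_le_one)
    then have "1 \<le> (t ^ 4) ^ n / (t ^ 4) ^ (r + 1)" using t by (simp add: field_simps)
    then have "(16 * c\<^sub>0 + 2) * 1 \<le> (16 * c\<^sub>0 + 2) * ((t ^ 4) ^ n / (t ^ 4) ^ (r + 1))"
      using c\<^sub>0 by (intro mult_left_mono) auto
    moreover have "1 + 1 * 1 \<le> (16 * c\<^sub>0 + 2) * 1" using c\<^sub>0 by simp
    ultimately show ?thesis by (rule order_trans[rotated])
  qed
  finally show ?thesis by simp
qed

lemma clt_fam:
  fixes \<xi> :: "(nat^'d) list \<Rightarrow> real"
  assumes \<xi>: "\<And>as. \<bar>\<xi> as\<bar> \<le> B" and mean: "(\<integral>x. \<xi> (fam x 0 r) \<partial>slots) = 0"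
    and sm: "summable (\<lambda>j. \<bar>\<integral>x. \<xi> (fam x 0 r) * \<xi> (fam x j r) \<partial>slots\<bar>)"
  obtains \<sigma> where "(\<lambda>n. (l2 slots (\<lambda>x. \<Sum>m<n. \<xi> (fam x m r)))\<^sup>2 / n) \<longlonglongrightarrow> \<sigma>"
    "\<And>y. (\<lambda>n. \<integral>x. iexp (y / sqrt n * (\<Sum>m<n. \<xi> (fam x m r))) \<partial>slots) \<longlonglongrightarrow> of_real (exp (- (y\<^sup>2 * \<sigma> / 2)))"
proof -
  define \<gamma> where "\<gamma> j = (\<integral>x. \<xi> (fam x 0 r) * \<xi> (fam x j r) \<partial>slots)" for j
  define \<sigma> where "\<sigma> = \<gamma> 0 + 2 * (\<Sum>j. \<gamma> (Suc j))"
  have cov: "(\<integral>x. \<xi> (fam x m r) * \<xi> (fam x (m + j) r) \<partial>slots) = \<gamma> j" for m j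
    unfolding \<gamma>_def by (rule expectation_fam_pair_shift[OF \<xi>])
  have sq: "sq_int slots (\<lambda>x. \<xi> (fam x m r))" for m
    by (rule A.sq_int_bounded[where B=B]) (use \<xi> in auto)
  show ?thesis
  proof (rule that[of \<sigma>])
    have "(l2 slots (\<lambda>x. \<Sum>m<n. \<xi> (fam x m r)))\<^sup>2 = (\<Sum>m<n. \<Sum>k<n. \<gamma> (ndist m k))" for n
      unfolding l2_square by (rule A.expectation_sum_square(1)[OF sq_int_mult[OF sq sq] cov]) simp
    then show "(\<lambda>n. (l2 slots (\<lambda>x. \<Sum>m<n. \<xi> (fam x m r)))\<^sup>2 / n) \<longlonglongrightarrow> \<sigma>"
      using double_sum_ndist_lim[of \<gamma>] sm by (simp add: \<gamma>_def \<sigma>_def)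
    show "(\<lambda>n. \<integral>x. iexp (y / sqrt n * (\<Sum>m<n. \<xi> (fam x m r))) \<partial>slots) \<longlonglongrightarrow> of_real (exp (- (y\<^sup>2 * \<sigma> / 2)))" for y
      unfolding \<sigma>_def
    proof (rule A.bounded_clt[where X="\<lambda>m x. \<xi> (fam x m r)" and B=B and \<theta>="t ^ 4"
          and C="(16 * c\<^sub>0 + 2) / (t ^ 4) ^ (r + 1)"])
      show "(\<integral>x. \<xi> (fam x m r) \<partial>slots) = 0" for m
        using mean expectation_fam[of \<xi> B, OF \<xi>, where m=m and r=r] expectation_fam[of \<xi> B, OF \<xi>, where m=0 and r=r] by simp
      show "summable (\<lambda>j. \<bar>\<gamma> j\<bar>)" using sm by (simp add: \<gamma>_def)
      show "t ^ 4 < 1" using t by (simp add: power_less_one_iff)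
    qed (use \<xi> cov char_fam_shift char_fam_mixing t c\<^sub>0 in auto)
  qed
qed

text \<open>\<open>V\<close> as a function of a history, so that the results on \<open>fam\<close>
  apply. Entry 0, the immigrants themselves, is skipped, and entries beyond \<open>r\<close> are
  ignored.\<close>

definition vf :: "nat \<Rightarrow> 'd \<Rightarrow> (nat^'d) list \<Rightarrow> real" where
  "vf r j as = min ((1 / t) ^ r) (\<Sum>k = 1..r. real (as ! k $ j))"

lemma vf_bound: "\<bar>vf r j as\<bar> \<le> (1 / t) ^ r"
  using t by (auto simp: vf_def sum_nonneg abs_le_iff min_def intro: order_trans[of _ 0])

lemma V_eq_vf: "r \<le> R \<Longrightarrow> V r j m x = vf r j (fam x m R)"
  by (simp add: V_def W_def vf_def fam_nth)

definition qmean :: "nat \<Rightarrow> 'd \<Rightarrow> (int \<Rightarrow> 's) \<Rightarrow> real" where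
  "qmean r j \<omega> = (\<integral>x. V r j 0 x \<partial>quenched q p \<omega>)"

lemma qmean_eq: "r \<le> R \<Longrightarrow> (\<integral>x. vf r j (fam x 0 R) \<partial>quenched q p \<omega>) = qmean r j \<omega>"
  by (simp add: qmean_def V_eq_vf)

lemma measurable_V_slot [measurable]: "V r j m \<in> borel_measurable slot_space"
  using measurable_V by (simp add: measurable_slots_iff)

lemma measurable_qmean [measurable]: "qmean r j \<in> borel_measurable P"
  unfolding qmean_def[abs_def] by (rule measurable_integral_quenched[OF measurable_V_slot])

lemma qmean_bound: "\<bar>qmean r j \<omega>\<bar> \<le> (1 / t) ^ r"
  unfolding qmean_def real_norm_def[symmetric]
  by (rule quenched_bounded(2)[OF measurable_V_slot]) (simp add: V_bounds)

lemma depends_on_qmean: "depends_on {int m - 1..<int m + int r} (\<lambda>\<omega>. qmean r j (shift_by (int m) \<omega>))"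
  using depends_on_quenched_mean[of m r "vf r j"] by (simp add: qmean_eq)

section \<open>Covariances of truncated progenies at a given lag\<close>

lemma sq_int_V: "sq_int slots (V r j m)"
  by (rule A.sq_int_bounded[OF measurable_V V_bounds(3)])

lemma expectation_V: "(\<integral>x. V r j m x \<partial>slots) = (\<integral>\<omega>. qmean r j \<omega> \<partial>P)"
  using expectation_fam[of "vf r j", OF vf_bound, where m=m and r=r] by (simp add: V_eq_vf[symmetric] qmean_def)

lemma expectation_V_shift: "(\<integral>x. V r j m x \<partial>slots) = (\<integral>\<omega>. qmean r j (shift_by l \<omega>) \<partial>P)"
  by (simp add: expectation_V integral_shift_by[OF measurable_qmean])

text \<open>The two levels may differ; both progenies are read from histories of
  \<open>max r s\<close> generations.\<close>

lemma expectation_V_pair: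
  assumes "m \<noteq> m'"
  shows "(\<integral>x. V r j m x * V s j' m' x \<partial>slots) =
    (\<integral>\<omega>. qmean r j (shift_by (int m) \<omega>) * qmean s j' (shift_by (int m') \<omega>) \<partial>P)"
proof -
  define R where "R = max r s"
  have R: "r \<le> R" "s \<le> R" by (auto simp: R_def)
  have pair: "(\<integral>x. vf r j (fam x m R) * vf s j' (fam x m' R) \<partial>slots) =
    (\<integral>\<omega>. (\<integral>x. vf r j (fam x 0 R) \<partial>quenched q p (shift_by (int m) \<omega>)) *
      (\<integral>x. vf s j' (fam x 0 R) \<partial>quenched q p (shift_by (int m') \<omega>)) \<partial>P)"
    by (rule expectation_fam_pair[OF vf_bound vf_bound assms])
  show ?thesis
    unfolding V_eq_vf[OF R(1)] V_eq_vf[OF R(2)] pair by (simp add: qmean_eq R)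
qed

text \<open>The windows of the two families leave \<open>j - 1 - r\<close> sites between them.
  Mixing over this gap has to pay for the two heights \<open>(1 / t) ^ r\<close> and
  \<open>(1 / t) ^ s\<close>.\<close>

lemma cov_V_short:
  assumes j: "j \<ge> 1" "r \<le> j div 2" "s \<le> j div 2"
  shows "\<bar>cov slots (V r i m) (V s i' (m + j))\<bar> \<le> 4 * c\<^sub>0 / t ^ 4 * t ^ j"
proof -
  define n where "n = j - 1 - r"
  define h where "h = j div 2"
  have h: "r \<le> h" "s \<le> h" "2 * h \<le> j" using j by (auto simp: h_def)
  define G where "G \<omega> = qmean r i (shift_by (int m) \<omega>)" for \<omega>
  define H where "H \<omega> = qmean s i' (shift_by (int (m + j)) \<omega>)" for \<omega>
  have "r \<le> j - 1" using j by linarith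
  then have n: "int m + int r + int n = int (m + j) - 1" using j(1) by (simp add: n_def)
  have G: "depends_on {..<int m + int r} G"
    unfolding G_def by (rule depends_on_mono[OF depends_on_qmean]) auto
  have H: "depends_on {int m + int r + int n..} H"
    unfolding H_def n by (rule depends_on_mono[OF depends_on_qmean]) auto
  have "\<bar>(\<integral>\<omega>. G \<omega> * H \<omega> \<partial>P) - (\<integral>\<omega>. G \<omega> \<partial>P) * (\<integral>\<omega>. H \<omega> \<partial>P)\<bar> \<le> 4 * (1 / t) ^ r * (1 / t) ^ s * (c\<^sub>0 * (t ^ 4) ^ n)"
    by (rule covariance_real[OF G H _ _ _ _ mixing]) (use t c\<^sub>0 in \<open>auto simp: G_def H_def intro: qmean_bound\<close>)
  moreover have "cov slots (V r i m) (V s i' (m + j)) = (\<integral>\<omega>. G \<omega> * H \<omega> \<partial>P) - (\<integral>\<omega>. G \<omega> \<partial>P) * (\<integral>\<omega>. H \<omega> \<partial>P)"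
    unfolding cov_def G_def H_def expectation_V_shift[where l="int m" and r=r] expectation_V_shift[where l="int (m + j)" and r=s]
    using j(1) by (simp add: expectation_V_pair)
  moreover have "4 * (1 / t) ^ r * (1 / t) ^ s * (c\<^sub>0 * (t ^ 4) ^ n) \<le> 4 * c\<^sub>0 / t ^ 4 * t ^ j"
  proof -
    have "(1 / t) ^ r * (1 / t) ^ s * (t ^ 4) ^ n = t ^ (4 * n) / t ^ (r + s)"
      by (simp add: power_divide power_add power_mult)
    also have "\<dots> \<le> t ^ j / t ^ 4"
    proof -
      \<comment> \<open>Amounts to \<open>5 * r + s \<le> 3 * j\<close>, which holds because both
        levels are at most half the lag. Equality is possible: the fourth power in the rate is used
        up here.\<close>
      have "j + (r + s) \<le> 4 * n + 4" using h j(1) by (simp add: n_def)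
      then have "t ^ (4 * n + 4) \<le> t ^ (j + (r + s))" using t by (intro power_decreasing) auto
      then show ?thesis using t by (simp add: field_simps power_add)
    qed
    finally have "4 * c\<^sub>0 * ((1 / t) ^ r * (1 / t) ^ s * (t ^ 4) ^ n) \<le> 4 * c\<^sub>0 * (t ^ j / t ^ 4)"
      using c\<^sub>0 by (intro mult_left_mono) auto
    then show ?thesis by (simp add: mult_ac)
  qed
  ultimately show ?thesis by linarith
qed

text \<open>The first term bounds the covariance at lag \<open>j\<close> of families cut at
  \<open>j div 2\<close> generations, the second the mean-square cost of cutting the two families
  there.\<close>

definition cj :: "nat \<Rightarrow> real" where
  "cj j = 4 * c\<^sub>0 / t ^ 4 * t ^ j + 2 * (sqrt (err 0) * sqrt (err (j div 2)))"

lemma cj_nonneg: "0 \<le> cj j"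
  using c\<^sub>0 t err_pos[THEN less_imp_le] by (auto simp: cj_def intro!: add_nonneg_nonneg mult_nonneg_nonneg)

text \<open>With \<open>z\<close> the fourth root of \<open>\<rho>'\<close>, the root of the error
  at level \<open>j div 2\<close> is of order \<open>z ^ (2 * (j div 2))\<close>; an odd lag costs
  one factor \<open>1 / z\<close>.\<close>

lemma summable_cj: "summable cj"
proof -
  define z where "z = sqrt (sqrt \<rho>')"
  have z: "0 < z" "z < 1" using \<rho>' by (auto simp: z_def)
  have z4: "\<rho>' = z ^ 4"
  proof -
    have "z ^ 4 = (z\<^sup>2)\<^sup>2" by simp
    also have "\<dots> = \<rho>'" using \<rho>' by (simp add: z_def)
    finally show ?thesis ..
  qed
  have le: "sqrt (err (j div 2)) \<le> sqrt c\<^sub>4 / z * z ^ j" for j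
  proof -
    have "sqrt (err (j div 2)) = sqrt c\<^sub>4 * sqrt ((z ^ (2 * (j div 2)))\<^sup>2)"
      by (simp add: err_def z4 real_sqrt_mult flip: power_mult)
    also have "sqrt ((z ^ (2 * (j div 2)))\<^sup>2) = z ^ (2 * (j div 2))" using z by simp
    also have "z ^ (2 * (j div 2)) \<le> z ^ j / z"
    proof -
      have "z ^ Suc (2 * (j div 2)) \<le> z ^ j" using z by (intro power_decreasing) auto
      then show ?thesis using z by (simp add: field_simps)
    qed
    finally show ?thesis using c\<^sub>4 by (simp add: mult_left_mono)
  qed
  have "summable (\<lambda>j. 4 * c\<^sub>0 / t ^ 4 * t ^ j + 2 * (sqrt (err 0) * (sqrt c\<^sub>4 / z * z ^ j)))"
    using t z by (intro summable_add summable_mult summable_geometric) auto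
  then show ?thesis
  proof (rule summable_comparison_test'[where N=0])
    show "norm (cj j) \<le> 4 * c\<^sub>0 / t ^ 4 * t ^ j + 2 * (sqrt (err 0) * (sqrt c\<^sub>4 / z * z ^ j))" for j
    proof -
      have "sqrt (err 0) * sqrt (err (j div 2)) \<le> sqrt (err 0) * (sqrt c\<^sub>4 / z * z ^ j)"
        using err_pos[of 0] by (intro mult_left_mono le) auto
      then have "cj j \<le> 4 * c\<^sub>0 / t ^ 4 * t ^ j + 2 * (sqrt (err 0) * (sqrt c\<^sub>4 / z * z ^ j))"
        unfolding cj_def by linarith
      then show ?thesis using cj_nonneg[of j] by simp
    qed
  qed
qed

lemma l2_V: "l2 slots (V r j m) \<le> sqrt (err 0)"
  by (rule l2_le_sqrt) (rule V_square)

lemma l2_V_diff: "r \<le> s \<Longrightarrow> l2 slots (\<lambda>x. V s j m x - V r j m x) \<le> sqrt (err r)"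
  by (rule l2_le_sqrt) (rule V_diff)

text \<open>Levels above half the lag are lowered to it by \<open>cov_replace\<close>, smaller ones
  are kept. The bound depends on neither level, and the limit in the truncation rests on this
  uniformity.\<close>

lemma cov_V: "\<bar>cov slots (V r i m) (V s i' (m + j))\<bar> \<le> cj j"
proof (cases "j = 0")
  case True
  have "\<bar>cov slots (V r i m) (V s i' (m + j))\<bar> \<le> l2 slots (V r i m) * l2 slots (V s i' (m + j))"
    by (intro A.abs_cov_le sq_int_V)
  also have "\<dots> \<le> sqrt (err 0) * sqrt (err 0)" by (intro mult_mono l2_V) (use err_pos[of 0] in auto)
  also have "\<dots> \<le> cj j" using True c\<^sub>0 t err_pos[of 0] by (simp add: cj_def)
  finally show ?thesis .
next
  case False
  define h where "h = j div 2"
  have d: "l2 slots (\<lambda>x. V r i m x - V (min r h) i m x) \<le> sqrt (err h)" for r i m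
  proof (cases "r \<le> h")
    case True
    then show ?thesis using err_pos[of h] by (simp add: A.l2_const min_def)
  next
    case False
    then show ?thesis by (simp add: min_def l2_V_diff)
  qed
  have "\<bar>cov slots (V r i m) (V s i' (m + j))\<bar> \<le> \<bar>cov slots (V (min r h) i m) (V (min s h) i' (m + j))\<bar> +
      l2 slots (\<lambda>x. V r i m x - V (min r h) i m x) * l2 slots (V s i' (m + j)) +
      l2 slots (V (min r h) i m) * l2 slots (\<lambda>x. V s i' (m + j) x - V (min s h) i' (m + j) x)"
    by (intro A.cov_replace sq_int_V)
  also have "\<dots> \<le> 4 * c\<^sub>0 / t ^ 4 * t ^ j + sqrt (err h) * sqrt (err 0) + sqrt (err 0) * sqrt (err h)"
    by (intro add_mono mult_mono d l2_V cov_V_short) (use False err_pos less_imp_le in \<open>auto simp: h_def\<close>)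
  also have "\<dots> = cj j" by (simp add: cj_def h_def)
  finally show ?thesis .
qed

text \<open>Bounds the variance per unit time of the difference between two truncated sums. At lag
  \<open>j\<close> the differences have covariance at most \<open>4 * cj j\<close>, by expanding
  into four covariances, and at most \<open>err r\<close>, by Cauchy-Schwarz.\<close>

definition \<delta> :: "nat \<Rightarrow> real" where
  "\<delta> r = 2 * (\<Sum>j. min (4 * cj j) (err r))"

lemma min_cj: "0 \<le> min (4 * cj j) (err r)" "min (4 * cj j) (err r) \<le> 4 * cj j"
  using cj_nonneg[of j] err_pos[of r] by auto

lemma summable_min_cj: "summable (\<lambda>j. \<bar>min (4 * cj j) (err r)\<bar>)"
  by (rule summable_comparison_test'[OF summable_mult[OF summable_cj, of 4], where N=0])
    (use min_cj in auto)

lemma \<delta>_nonneg: "0 \<le> \<delta> r"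
  unfolding \<delta>_def using summable_min_cj[of r] min_cj by (simp add: suminf_nonneg)

text \<open>Dominated convergence for series: every term is at most \<open>err r\<close>, which
  tends to 0, and \<open>4 * cj j\<close> is a summable majorant.\<close>

lemma \<delta>_tendsto_0: "\<delta> \<longlonglongrightarrow> 0"
proof -
  have "(\<lambda>r. \<Sum>j. min (4 * cj j) (err r)) \<longlonglongrightarrow> (\<Sum>j. 0)"
  proof (rule tannerys_theorem[where M="\<lambda>j. 4 * cj j", THEN conjunct2, THEN conjunct2])
    show "(\<lambda>r. min (4 * cj j) (err r)) \<longlonglongrightarrow> 0" for j
    proof (rule tendsto_sandwich[OF _ _ tendsto_const err_tendsto_0])
      show "eventually (\<lambda>r. 0 \<le> min (4 * cj j) (err r)) sequentially"
        using min_cj by (intro always_eventually) auto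
      show "eventually (\<lambda>r. min (4 * cj j) (err r) \<le> err r) sequentially"
        by (intro always_eventually) auto
    qed
    show "eventually (\<lambda>(k, n). norm (min (4 * cj k) (err n)) \<le> 4 * cj k) (at_top \<times>\<^sub>F sequentially)"
      using min_cj by (intro always_eventually) auto
    show "summable (\<lambda>j. 4 * cj j)" by (intro summable_mult summable_cj)
  qed auto
  then have "(\<lambda>r. 2 * (\<Sum>j. min (4 * cj j) (err r))) \<longlonglongrightarrow> 2 * 0" by (intro tendsto_mult_left) simp
  then show ?thesis by (simp add: \<delta>_def[abs_def])
qed

section \<open>Sums of truncated progenies\<close>

definition T :: "nat \<Rightarrow> 'd \<Rightarrow> nat \<Rightarrow> ('d slot \<Rightarrow> nat^'d) \<Rightarrow> real" where
  "T r i n x = (\<Sum>m<n. V r i m x - (\<integral>x. V r i m x \<partial>slots))"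

lemma sq_int_T: "sq_int slots (T r i n)"
  unfolding T_def[abs_def] by (intro sq_int_sum sq_int_diff sq_int_V A.sq_int_const)

text \<open>The bound does not involve the higher level \<open>s\<close>, so it survives the limit
  in \<open>s\<close> taken in \<open>l2_N_T\<close>.\<close>

lemma l2_T_diff:
  assumes rs: "r \<le> s"
  shows "l2 slots (\<lambda>x. T s i n x - T r i n x) \<le> sqrt (real n) * sqrt (\<delta> r)"
proof -
  define D where "D m x = V s i m x - V r i m x" for m x
  have D: "sq_int slots (D m)" for m unfolding D_def[abs_def] by (intro sq_int_diff sq_int_V)
  have eD: "(\<integral>x. D m x \<partial>slots) = (\<integral>x. V s i m x \<partial>slots) - (\<integral>x. V r i m x \<partial>slots)" for m
    unfolding D_def by (rule Bochner_Integration.integral_diff) (intro A.sq_int_integrable sq_int_V)+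
  have TD: "T s i n x - T r i n x = (\<Sum>m<n. D m x - (\<integral>x. D m x \<partial>slots))" for x
    by (simp add: T_def eD sum_subtractf) (simp add: D_def sum_subtractf)
  have cD: "\<bar>cov slots (D m) (D (m + j))\<bar> \<le> min (4 * cj j) (err r)" for m j
  proof -
    have "cov slots (D m) (D (m + j)) = cov slots (V s i m) (V s i (m + j)) - cov slots (V r i m) (V s i (m + j))
        - (cov slots (V s i m) (V r i (m + j)) - cov slots (V r i m) (V r i (m + j)))"
      unfolding D_def[abs_def] by (simp add: A.cov_diff_left A.cov_diff_right sq_int_V sq_int_diff)
    then have "\<bar>cov slots (D m) (D (m + j))\<bar> \<le> 4 * cj j"
      using cov_V[of s i m s i j] cov_V[of r i m s i j] cov_V[of s i m r i j] cov_V[of r i m r i j] by linarith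
    moreover have "\<bar>cov slots (D m) (D (m + j))\<bar> \<le> sqrt (err r) * sqrt (err r)"
      by (rule order_trans[OF A.abs_cov_le[OF D D] mult_mono])
        (use l2_V_diff[OF rs] err_pos[of r] in \<open>auto simp: D_def[abs_def]\<close>)
    ultimately show ?thesis using err_pos[of r] by simp
  qed
  have cD': "cov slots (D m) (D k) \<le> min (4 * cj (ndist m k)) (err r)" for m k
    using cD[of m "k - m"] cD[of k "m - k"]
    by (cases "m \<le> k") (simp_all add: ndist_def A.cov_commute[of "D m" "D k"] abs_le_iff)
  have "(l2 slots (\<lambda>x. T s i n x - T r i n x))\<^sup>2 = (\<Sum>m<n. \<Sum>k<n. cov slots (D m) (D k))"
    unfolding TD by (rule A.l2_centered_sum_square) (rule D)
  also have "\<dots> \<le> (\<Sum>m<n. \<Sum>k<n. min (4 * cj (ndist m k)) (err r))"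
    by (intro sum_mono cD')
  also have "\<dots> \<le> real (card {..<n}) * (2 * (\<Sum>j. \<bar>min (4 * cj j) (err r)\<bar>))"
    by (rule double_sum_ndist_le[OF summable_min_cj]) simp
  also have "(\<lambda>j. \<bar>min (4 * cj j) (err r)\<bar>) = (\<lambda>j. min (4 * cj j) (err r))"
    using min_cj by (auto simp: fun_eq_iff)
  finally have "(l2 slots (\<lambda>x. T s i n x - T r i n x))\<^sup>2 \<le> real n * \<delta> r" by (simp add: \<delta>_def)
  then have "sqrt ((l2 slots (\<lambda>x. T s i n x - T r i n x))\<^sup>2) \<le> sqrt (real n * \<delta> r)" by (rule real_sqrt_le_mono)
  then show ?thesis by (simp add: real_sqrt_mult)
qed

text \<open>A linear combination over the types is again one bounded function of the family history,
  so the scalar theorem \<open>clt_fam\<close> applies; its covariances at lag \<open>j\<close> are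
  at most a multiple of \<open>cj j\<close>.\<close>

lemma clt_T:
  fixes u :: "real^'d"
  obtains \<sigma> where "(\<lambda>n. (l2 slots (\<lambda>x. \<Sum>i\<in>UNIV. u $ i * T r i n x))\<^sup>2 / n) \<longlonglongrightarrow> \<sigma>"
    "\<And>y. (\<lambda>n. \<integral>x. iexp (y / sqrt n * (\<Sum>i\<in>UNIV. u $ i * T r i n x)) \<partial>slots) \<longlonglongrightarrow> of_real (exp (- (y\<^sup>2 * \<sigma> / 2)))"
proof -
  define \<mu> where "\<mu> i = (\<integral>x. V r i 0 x \<partial>slots)" for i
  have \<mu>: "(\<integral>x. V r i m x \<partial>slots) = \<mu> i" for i m by (simp add: \<mu>_def expectation_V)
  define \<xi> where "\<xi> as = (\<Sum>i\<in>UNIV. u $ i * (vf r i as - \<mu> i))" for as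
  have \<xi>V: "\<xi> (fam x m r) = (\<Sum>i\<in>UNIV. u $ i * (V r i m x - \<mu> i))" for x m
    by (simp add: \<xi>_def V_eq_vf[of r r])
  have \<xi>T: "(\<Sum>m<n. \<xi> (fam x m r)) = (\<Sum>i\<in>UNIV. u $ i * T r i n x)" for n x
    unfolding \<xi>V T_def \<mu> by (subst sum.swap) (simp add: sum_distrib_left)
  define B where "B = (\<Sum>i\<in>UNIV. \<bar>u $ i\<bar> * ((1 / t) ^ r + \<bar>\<mu> i\<bar>))"
  have \<xi>B: "\<bar>\<xi> as\<bar> \<le> B" for as
    unfolding \<xi>_def B_def
  proof (intro order_trans[OF sum_abs] sum_mono)
    fix i
    have "\<bar>vf r i as - \<mu> i\<bar> \<le> (1 / t) ^ r + \<bar>\<mu> i\<bar>" using vf_bound[of r i as] by linarith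
    then show "\<bar>u $ i * (vf r i as - \<mu> i)\<bar> \<le> \<bar>u $ i\<bar> * ((1 / t) ^ r + \<bar>\<mu> i\<bar>)"
      unfolding abs_mult by (intro mult_left_mono) auto
  qed
  have intV: "integrable slots (V r i m)" for i m by (intro A.sq_int_integrable sq_int_V)
  have mean: "(\<integral>x. \<xi> (fam x 0 r) \<partial>slots) = 0"
    unfolding \<xi>V using intV by (simp add: \<mu> A.prob_space[simplified])
  have sV: "sq_int slots (\<lambda>x. u $ i * (V r i m x - \<mu> i))" for i m
    by (intro sq_int_cmult sq_int_diff sq_int_V A.sq_int_const)
  have pair: "(\<integral>x. \<xi> (fam x 0 r) * \<xi> (fam x j r) \<partial>slots) =
      (\<Sum>i\<in>UNIV. \<Sum>i'\<in>UNIV. u $ i * u $ i' * cov slots (V r i 0) (V r i' j))" for j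
  proof -
    have "(\<integral>x. \<xi> (fam x 0 r) * \<xi> (fam x j r) \<partial>slots) =
        (\<integral>x. (\<Sum>i\<in>UNIV. \<Sum>i'\<in>UNIV. (u $ i * (V r i 0 x - \<mu> i)) * (u $ i' * (V r i' j x - \<mu> i'))) \<partial>slots)"
      by (simp only: \<xi>V sum_product)
    also have "\<dots> = (\<Sum>i\<in>UNIV. \<Sum>i'\<in>UNIV. \<integral>x. (u $ i * (V r i 0 x - \<mu> i)) * (u $ i' * (V r i' j x - \<mu> i')) \<partial>slots)"
      using sq_int_mult[OF sV sV] by (simp only: Bochner_Integration.integral_sum Bochner_Integration.integrable_sum)
    also have "\<dots> = (\<Sum>i\<in>UNIV. \<Sum>i'\<in>UNIV. u $ i * u $ i' * cov slots (V r i 0) (V r i' j))"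
    proof (intro sum.cong refl)
      fix i i'
      have "(\<integral>x. (u $ i * (V r i 0 x - \<mu> i)) * (u $ i' * (V r i' j x - \<mu> i')) \<partial>slots) =
          (\<integral>x. (u $ i * u $ i') * ((V r i 0 x - \<mu> i) * (V r i' j x - \<mu> i')) \<partial>slots)"
        by (intro Bochner_Integration.integral_cong refl) (simp add: mult_ac)
      then show "(\<integral>x. (u $ i * (V r i 0 x - \<mu> i)) * (u $ i' * (V r i' j x - \<mu> i')) \<partial>slots) =
          u $ i * u $ i' * cov slots (V r i 0) (V r i' j)"
        by (simp add: A.cov_eq_centered[OF sq_int_V sq_int_V] \<mu>)
    qed
    finally show ?thesis .
  qed
  define L where "L = (\<Sum>i\<in>UNIV. \<Sum>i'\<in>UNIV. \<bar>u $ i * u $ i'\<bar>)"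
  have "summable (\<lambda>j. \<bar>\<integral>x. \<xi> (fam x 0 r) * \<xi> (fam x j r) \<partial>slots\<bar>)"
  proof (rule summable_comparison_test'[OF summable_mult[OF summable_cj, of L], where N=0])
    fix j
    have "\<bar>\<integral>x. \<xi> (fam x 0 r) * \<xi> (fam x j r) \<partial>slots\<bar> \<le> (\<Sum>i\<in>UNIV. \<Sum>i'\<in>UNIV. \<bar>u $ i * u $ i'\<bar> * cj j)"
      unfolding pair
    proof (intro order_trans[OF sum_abs] sum_mono)
      fix i i'
      show "\<bar>u $ i * u $ i' * cov slots (V r i 0) (V r i' j)\<bar> \<le> \<bar>u $ i * u $ i'\<bar> * cj j"
        unfolding abs_mult[of "u $ i * u $ i'"] using cov_V[of r i 0 r i' j] by (intro mult_left_mono) auto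
    qed
    also have "\<dots> = L * cj j" by (simp add: L_def sum_distrib_right)
    finally show "norm \<bar>\<integral>x. \<xi> (fam x 0 r) * \<xi> (fam x j r) \<partial>slots\<bar> \<le> L * cj j" by simp
  qed
  then show ?thesis
    by (rule clt_fam[OF \<xi>B mean, unfolded \<xi>T]) (rule that)
qed

text \<open>Decomposition of variance: given the environment the progenies are independent, so
  covariances of distinct families are those of the quenched means, and the expected quenched
  variance appears on the diagonal only. The rest is the variance of a sum of quenched means, which
  is nonnegative.\<close>

lemma l2_T_ge:
  "real n * ((\<integral>x. (V r i 0 x)\<^sup>2 \<partial>slots) - (\<integral>\<omega>. (qmean r i \<omega>)\<^sup>2 \<partial>P)) \<le> (l2 slots (T r i n))\<^sup>2"
proof -
  define g where "g m \<omega> = qmean r i (shift_by (int m) \<omega>)" for m :: nat and \<omega>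
  have [measurable]: "g m \<in> borel_measurable P" for m
    unfolding g_def by (rule measurable_compose[OF measurable_shift_by measurable_qmean])
  have g: "sq_int P (g m)" for m
    by (rule EP.sq_int_bounded[where B="(1 / t) ^ r"]) (auto simp: g_def intro: qmean_bound)
  define v where "v = (\<integral>x. (V r i 0 x)\<^sup>2 \<partial>slots) - (\<integral>\<omega>. (qmean r i \<omega>)\<^sup>2 \<partial>P)"
  have Eg: "(\<integral>x. V r i m x \<partial>slots) = (\<integral>\<omega>. g m \<omega> \<partial>P)" for m
    unfolding g_def by (rule expectation_V_shift)
  have off: "cov slots (V r i m) (V r i k) = cov P (g m) (g k)" if "m \<noteq> k" for m k
    using that unfolding cov_def Eg by (simp add: expectation_V_pair g_def)
  have diag: "cov slots (V r i m) (V r i m) = cov P (g m) (g m) + v" for m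
  proof -
    have bd2: "\<bar>vf r i as * vf r i as\<bar> \<le> (1 / t) ^ r * (1 / t) ^ r" for as
      using mult_mono[OF vf_bound[of r i as] vf_bound[of r i as]] t by (simp add: abs_mult)
    have "(\<integral>x. V r i m x * V r i m x \<partial>slots) = (\<integral>x. (V r i 0 x)\<^sup>2 \<partial>slots)"
      using expectation_fam[of "\<lambda>as. vf r i as * vf r i as", OF bd2, where m=m and r=r]
        expectation_fam[of "\<lambda>as. vf r i as * vf r i as", OF bd2, where m=0 and r=r]
      by (simp add: V_eq_vf[symmetric] power2_eq_square)
    moreover have "(\<integral>\<omega>. g m \<omega> * g m \<omega> \<partial>P) = (\<integral>\<omega>. (qmean r i \<omega>)\<^sup>2 \<partial>P)"
      using integral_shift_by[of "\<lambda>\<omega>. (qmean r i \<omega>)\<^sup>2" "int m"] by (simp add: g_def power2_eq_square)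
    ultimately show ?thesis unfolding cov_def Eg by (simp add: v_def)
  qed
  have "(l2 slots (T r i n))\<^sup>2 = (\<Sum>m<n. \<Sum>k<n. cov slots (V r i m) (V r i k))"
    unfolding T_def[abs_def] by (rule A.l2_centered_sum_square) (rule sq_int_V)
  also have "\<dots> = (\<Sum>m<n. \<Sum>k<n. cov P (g m) (g k) + (if k = m then v else 0))"
    by (intro sum.cong refl) (auto simp: off diag)
  also have "\<dots> = (\<Sum>m<n. \<Sum>k<n. cov P (g m) (g k)) + real n * v"
    by (simp add: sum.distrib)
  also have "(\<Sum>m<n. \<Sum>k<n. cov P (g m) (g k)) = (l2 P (\<lambda>\<omega>. \<Sum>m<n. g m \<omega> - (\<integral>\<omega>. g m \<omega> \<partial>P)))\<^sup>2"
    by (rule EP.l2_centered_sum_square[symmetric]) (rule g)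
  finally show ?thesis by (simp add: v_def)
qed

end

section \<open>Removal of the truncation\<close>

text \<open>The error separates into a part vanishing in \<open>n\<close> and one vanishing in
  \<open>r\<close>, which makes \<open>c\<close> a Cauchy sequence. The explicit distance
  \<open>d r\<close> from the limit is kept for the degenerate case, where it bounds the variances
  at level \<open>r\<close>.\<close>

lemma double_limit:
  fixes a :: "nat \<Rightarrow> 'b::banach"
  assumes b: "\<And>r. b r \<longlonglongrightarrow> c r" and le: "\<And>r n. norm (a n - b r n) \<le> e n + d r"
    and e: "e \<longlonglongrightarrow> 0" and d: "d \<longlonglongrightarrow> (0::real)"
  obtains z where "a \<longlonglongrightarrow> z" "c \<longlonglongrightarrow> z" "\<And>r. norm (z - c r) \<le> d r"
proof -
  have cc: "norm (c r - c r') \<le> d r + d r'" for r r'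
  proof (rule LIMSEQ_le)
    show "(\<lambda>n. norm (b r n - b r' n)) \<longlonglongrightarrow> norm (c r - c r')" by (intro tendsto_intros b)
    show "(\<lambda>n. e n + d r + (e n + d r')) \<longlonglongrightarrow> d r + d r'"
      using tendsto_add[OF tendsto_add[OF e tendsto_const[of "d r"]] tendsto_add[OF e tendsto_const[of "d r'"]]] by simp
    have "norm (b r n - b r' n) \<le> e n + d r + (e n + d r')" for n
      using le[of n r] le[of n r'] norm_triangle_ineq4[of "a n - b r' n" "a n - b r n"] by simp
    then show "\<exists>N. \<forall>n\<ge>N. norm (b r n - b r' n) \<le> e n + d r + (e n + d r')" by blast
  qed
  have "Cauchy c"
  proof (rule CauchyI)
    fix \<epsilon> :: real assume "0 < \<epsilon>"
    then obtain N where N: "\<And>r. r \<ge> N \<Longrightarrow> \<bar>d r\<bar> < \<epsilon> / 2"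
      using LIMSEQ_D[OF d, of "\<epsilon> / 2"] by auto
    show "\<exists>M. \<forall>m\<ge>M. \<forall>n\<ge>M. norm (c m - c n) < \<epsilon>"
    proof (intro exI allI impI)
      fix m n assume "N \<le> m" "N \<le> n"
      then show "norm (c m - c n) < \<epsilon>" using cc[of m n] N[of m] N[of n] by linarith
    qed
  qed
  then obtain z where z: "c \<longlonglongrightarrow> z" using Cauchy_convergent[of c] unfolding convergent_def by blast
  have zc: "norm (z - c r) \<le> d r" for r
  proof (rule LIMSEQ_le)
    show "(\<lambda>r'. norm (c r' - c r)) \<longlonglongrightarrow> norm (z - c r)" by (intro tendsto_intros z)
    show "(\<lambda>r'. d r' + d r) \<longlonglongrightarrow> d r" using tendsto_add[OF d tendsto_const[of "d r"]] by simp
  qed (use cc in blast)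
  have "a \<longlonglongrightarrow> z"
  proof (rule LIMSEQ_I)
    fix \<epsilon> :: real assume \<epsilon>: "0 < \<epsilon>"
    then obtain r where r: "\<bar>d r\<bar> < \<epsilon> / 4"
      using LIMSEQ_D[OF d, of "\<epsilon> / 4"] by auto
    obtain N where N: "\<And>n. n \<ge> N \<Longrightarrow> \<bar>e n\<bar> < \<epsilon> / 4"
      using LIMSEQ_D[OF e, of "\<epsilon> / 4"] \<epsilon> by auto
    obtain N' where N': "\<And>n. n \<ge> N' \<Longrightarrow> norm (b r n - c r) < \<epsilon> / 4"
      using LIMSEQ_D[OF b[of r], of "\<epsilon> / 4"] \<epsilon> by auto
    show "\<exists>no. \<forall>n\<ge>no. norm (a n - z) < \<epsilon>"
    proof (intro exI allI impI)
      fix n assume n: "max N N' \<le> n"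
      have "a n - z = (a n - b r n) + (b r n - c r) - (z - c r)" by simp
      then have "norm (a n - z) \<le> norm (a n - b r n) + norm (b r n - c r) + norm (z - c r)"
        using norm_triangle_ineq4[of "(a n - b r n) + (b r n - c r)" "z - c r"]
          norm_triangle_ineq[of "a n - b r n" "b r n - c r"] by simp
      then show "norm (a n - z) < \<epsilon>" using le[of n r] N[of n] N'[of n] zc[of r] r n by linarith
    qed
  qed
  with z zc that show ?thesis by blast
qed

text \<open>Summation by arrival time: up to time \<open>n - 1\<close> the family of time
  \<open>m\<close> is counted in its first \<open>n - m - 1\<close> generations after the
  arrival.\<close>

lemma S_sum_eq_families:
  fixes x :: "'d::finite slot \<Rightarrow> nat^'d"
  shows "S_sum x n $ i = (\<Sum>m<n. \<Sum>k = 1..n - m - 1. U x (m + k) m $ i)"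
proof -
  have "S_sum x n $ i = (\<Sum>k<n. \<Sum>m<k. U x k m $ i)"
    by (simp add: S_sum_def Z_eq_sum_U)
  also have "\<dots> = (\<Sum>k<n. \<Sum>m<n. if m < k then U x k m $ i else 0)"
  proof (rule sum.cong[OF refl])
    fix k assume "k \<in> {..<n}"
    then have "{..<n} \<inter> {m. m < k} = {..<k}" by auto
    then show "(\<Sum>m<k. U x k m $ i) = (\<Sum>m<n. if m < k then U x k m $ i else 0)"
      by (simp add: sum.If_cases)
  qed
  also have "\<dots> = (\<Sum>m<n. \<Sum>k<n. if m < k then U x k m $ i else 0)" by (rule sum.swap)
  also have "\<dots> = (\<Sum>m<n. \<Sum>k = 1..n - m - 1. U x (m + k) m $ i)"
  proof (rule sum.cong[OF refl])
    fix m
    have "(\<Sum>k<n. if m < k then U x k m $ i else 0) = (\<Sum>k\<in>{..<n} \<inter> {k. m < k}. U x k m $ i)"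
      by (simp add: sum.If_cases)
    also have "\<dots> = (\<Sum>k = 1..n - m - 1. U x (m + k) m $ i)"
      by (rule sum.reindex_bij_witness[of _ "\<lambda>k. m + k" "\<lambda>k. k - m"]) auto
    finally show "(\<Sum>k<n. if m < k then U x k m $ i else 0) = (\<Sum>k = 1..n - m - 1. U x (m + k) m $ i)" .
  qed
  finally show ?thesis .
qed

context mixing_branching
begin

lemma S_sum_eq_W: "real (S_sum x n $ i) = (\<Sum>m<n. real (W (n - m - 1) i m x))"
  by (simp add: S_sum_eq_families W_def)

lemma sq_int_W: "sq_int slots (\<lambda>x. real (W r i m x))"
proof -
  have "sq_int slots (\<lambda>x. real (W r i m x) - V r i m x)"
    unfolding sq_int_def using W_V_diff(1)[of r i m] by (auto intro: borel_measurable_diff measurable_W measurable_V)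
  from sq_int_add[OF this sq_int_V[of r i m]] show ?thesis by simp
qed

lemma l2_W_V: "l2 slots (\<lambda>x. real (W r i m x) - V r i m x) \<le> sqrt (err r)"
  by (rule l2_le_sqrt) (rule W_V_diff)

text \<open>Uniform in \<open>r\<close>. It makes the mean of \<open>Y\<close> finite, and likewise
  the series in \<open>rho\<close>, for which \<open>enn2real\<close> would otherwise return the
  default 0.\<close>

lemma expectation_W_le: "(\<integral>x. real (W r i m x) \<partial>slots) \<le> 2 * sqrt (err 0)"
proof -
  have "(\<integral>x. real (W r i m x) \<partial>slots) \<le> l2 slots (\<lambda>x. (real (W r i m x) - V r i m x) + V r i m x)"
    using A.abs_expectation_le_l2[OF sq_int_W[of r i m]] by simp
  also have "\<dots> \<le> sqrt (err r) + sqrt (err 0)"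
    by (intro order_trans[OF l2_add] add_mono l2_W_V l2_V sq_int_diff sq_int_W sq_int_V)
  also have "err r \<le> err 0" unfolding err_def using c\<^sub>4 \<rho>' by (simp add: power_le_one)
  finally show ?thesis by simp
qed

text \<open>The mean of \<open>W\<close> is exactly a partial sum of the series in
  \<open>rho\<close>; truncation in height changes it by at most
  \<open>sqrt (err r)\<close>.\<close>

lemma expectation_V_tendsto: "(\<lambda>r. \<integral>x. V r i m x \<partial>slots) \<longlonglongrightarrow> rho P q p $ i"
proof -
  define a where "a k = (\<integral>\<^sup>+\<omega>. (M_prod q p 1 \<omega> (Suc k) *v I_vec q p 1 \<omega> 0) $ i \<partial>P)" for k
  have a: "a k = (\<integral>\<^sup>+x. of_nat (U x (m + Suc k) m $ i) \<partial>slots)" for k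
  proof -
    have "(\<integral>\<^sup>+x. of_nat (U x (m + Suc k) m $ i) \<partial>slots) = (\<integral>\<^sup>+x. (\<lambda>as. of_nat (as ! Suc k $ i)) (fam x m (Suc k)) \<partial>slots)"
      by (simp add: fam_nth del: U.simps)
    also have "\<dots> = (\<integral>\<^sup>+\<omega>. (\<integral>\<^sup>+x. (\<lambda>as. of_nat (as ! Suc k $ i)) (fam x 0 (Suc k)) \<partial>quenched q p \<omega>) \<partial>P)"
      by (rule nn_integral_fam)
    also have "\<dots> = a k"
      unfolding a_def nn_integral_U[symmetric] by (simp add: fam_nth del: U.simps)
    finally show ?thesis ..
  qed
  have Wa: "ennreal (\<integral>x. real (W r i m x) \<partial>slots) = (\<Sum>k<r. a k)" for r
  proof -
    have "ennreal (\<integral>x. real (W r i m x) \<partial>slots) = (\<integral>\<^sup>+x. ennreal (real (W r i m x)) \<partial>slots)"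
      by (rule nn_integral_eq_integral[symmetric]) (auto intro: A.sq_int_integrable sq_int_W)
    also have "\<dots> = (\<integral>\<^sup>+x. (\<Sum>k<r. of_nat (U x (m + Suc k) m $ i)) \<partial>slots)"
    proof (intro nn_integral_cong)
      fix x
      have "W r i m x = (\<Sum>k<r. U x (m + Suc k) m $ i)"
        unfolding W_def by (rule sum.reindex_bij_witness[of _ Suc "\<lambda>k. k - 1"]) auto
      then show "ennreal (real (W r i m x)) = (\<Sum>k<r. of_nat (U x (m + Suc k) m $ i))"
        by (subst ennreal_of_nat_eq_real_of_nat[symmetric]) (simp only: of_nat_sum)
    qed
    also have "\<dots> = (\<Sum>k<r. a k)"
      unfolding a by (rule nn_integral_sum) (rule measurable_U_slots)
    finally show ?thesis .
  qed

  have lim: "(\<lambda>r. \<Sum>k<r. a k) \<longlonglongrightarrow> (\<Sum>k. a k)" by (intro summable_LIMSEQ summableI)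
  have "(\<Sum>k. a k) \<le> ennreal (2 * sqrt (err 0))"
    by (rule LIMSEQ_le_const2[OF lim]) (auto simp: Wa[symmetric] intro!: ennreal_leI expectation_W_le)
  then have fin: "(\<Sum>k. a k) \<noteq> \<infinity>" by (auto simp: top_unique)
  have "(\<lambda>r. enn2real (ennreal (\<integral>x. real (W r i m x) \<partial>slots))) \<longlonglongrightarrow> enn2real (\<Sum>k. a k)"
    unfolding Wa by (rule tendsto_enn2real) (use lim fin in \<open>simp_all add: less_top[symmetric]\<close>)
  then have EW: "(\<lambda>r. \<integral>x. real (W r i m x) \<partial>slots) \<longlonglongrightarrow> rho P q p $ i"
    by (simp add: rho_def a_def)
  have "(\<lambda>r. (\<integral>x. real (W r i m x) \<partial>slots) - (\<integral>x. V r i m x \<partial>slots)) \<longlonglongrightarrow> 0"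
  proof (rule Lim_null_comparison[OF always_eventually])
    show "\<forall>r. norm ((\<integral>x. real (W r i m x) \<partial>slots) - (\<integral>x. V r i m x \<partial>slots)) \<le> sqrt (err r)"
    proof
      fix r
      have "(\<integral>x. real (W r i m x) \<partial>slots) - (\<integral>x. V r i m x \<partial>slots) = (\<integral>x. real (W r i m x) - V r i m x \<partial>slots)"
        by (rule Bochner_Integration.integral_diff[symmetric]) (intro A.sq_int_integrable sq_int_W sq_int_V)+
      also have "\<bar>\<dots>\<bar> \<le> l2 slots (\<lambda>x. real (W r i m x) - V r i m x)"
        by (intro A.abs_expectation_le_l2 sq_int_diff sq_int_W sq_int_V)
      finally show "norm ((\<integral>x. real (W r i m x) \<partial>slots) - (\<integral>x. V r i m x \<partial>slots)) \<le> sqrt (err r)"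
        using l2_W_V[of r i m] by simp
    qed
    show "(\<lambda>r. sqrt (err r)) \<longlonglongrightarrow> 0" using tendsto_real_sqrt[OF err_tendsto_0] by simp
  qed
  from tendsto_diff[OF EW this] show ?thesis by simp
qed

section \<open>The centred sum and its distance from the truncated sums\<close>

definition N :: "'d \<Rightarrow> nat \<Rightarrow> ('d slot \<Rightarrow> nat^'d) \<Rightarrow> real" where
  "N i n x = real (S_sum x n $ i) - real n * rho P q p $ i"

lemma N_eq: "N i n x = (\<Sum>m<n. real (W (n - m - 1) i m x) - rho P q p $ i)"
  by (simp add: N_def S_sum_eq_W sum_subtractf)

lemma sq_int_N: "sq_int slots (N i n)"
  unfolding N_eq[abs_def] by (intro sq_int_sum sq_int_diff sq_int_W A.sq_int_const)

text \<open>Total of the boundary errors: in \<open>N\<close> the family of time \<open>m\<close> is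
  cut after \<open>n - m - 1\<close> generations, and the costs of these cuts sum to a bound
  independent of \<open>n\<close>.\<close>

definition c\<^sub>5 :: real where "c\<^sub>5 = (\<Sum>k. 2 * sqrt (err k))"

lemma summable_sqrt_err: "summable (\<lambda>k. 2 * sqrt (err k))"
proof -
  have "sqrt (err k) = sqrt c\<^sub>4 * sqrt \<rho>' ^ k" for k
    using \<rho>' by (simp add: err_def real_sqrt_mult real_sqrt_power)
  then show ?thesis using \<rho>' by (simp add: summable_geometric)
qed

text \<open>\<open>N\<close> is centred by \<open>rho\<close>, which is the limit of the truncated
  means and not one of them. The comparison therefore passes through a level \<open>s\<close>, where
  a bias of at most \<open>n * b s\<close> remains, and lets \<open>s\<close> tend to
  infinity.\<close>

lemma l2_N_T: "l2 slots (\<lambda>x. N i n x - T r i n x) \<le> c\<^sub>5 + sqrt (real n) * sqrt (\<delta> r)"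
proof (rule LIMSEQ_le_const)
  define b where "b s = \<bar>(\<integral>x. V s i 0 x \<partial>slots) - rho P q p $ i\<bar>" for s
  show "(\<lambda>s. c\<^sub>5 + real n * b s + sqrt (real n) * sqrt (\<delta> r)) \<longlonglongrightarrow> c\<^sub>5 + sqrt (real n) * sqrt (\<delta> r)"
  proof -
    have "b \<longlonglongrightarrow> 0" unfolding b_def
      using expectation_V_tendsto[of i 0] by (intro tendsto_rabs_zero LIM_zero)
    then have "(\<lambda>s. c\<^sub>5 + real n * b s + sqrt (real n) * sqrt (\<delta> r)) \<longlonglongrightarrow> c\<^sub>5 + real n * 0 + sqrt (real n) * sqrt (\<delta> r)"
      by (intro tendsto_intros)
    then show ?thesis by simp
  qed
  show "\<exists>k. \<forall>s\<ge>k. l2 slots (\<lambda>x. N i n x - T r i n x) \<le> c\<^sub>5 + real n * b s + sqrt (real n) * sqrt (\<delta> r)"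
  proof (intro exI allI impI)
    \<comment> \<open>The level is at least \<open>n\<close>, so that every count
      \<open>W (n - m - 1)\<close> occurring in \<open>N\<close> belongs to a lower level.\<close>
    fix s assume s: "max r n \<le> s"
    have ms: "l2 slots (\<lambda>x. real (W k i m x) - V s i m x) \<le> 2 * sqrt (err k)" if "k \<le> s" for k m
    proof -
      have "l2 slots (\<lambda>x. real (W k i m x) - V s i m x) \<le>
          l2 slots (\<lambda>x. real (W k i m x) - V k i m x) + l2 slots (\<lambda>x. V k i m x - V s i m x)"
        by (intro l2_triangle3 sq_int_W sq_int_V)
      also have "\<dots> \<le> sqrt (err k) + sqrt (err k)"
        using l2_W_V l2_V_diff[OF that, of i m] by (intro add_mono) (auto simp: l2_minus_commute[of slots "V k i m"])
      finally show ?thesis by simp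
    qed
    define e where "e = (\<integral>x. V s i 0 x \<partial>slots) - rho P q p $ i"
    have NT: "N i n x - T s i n x = (\<Sum>m<n. (real (W (n - m - 1) i m x) - V s i m x) + e)" for x
      by (simp add: N_eq T_def e_def sum_subtractf[symmetric] expectation_V[where m="_"] algebra_simps)
    have "l2 slots (\<lambda>x. N i n x - T s i n x) \<le> (\<Sum>m<n. l2 slots (\<lambda>x. (real (W (n - m - 1) i m x) - V s i m x) + e))"
      unfolding NT by (intro l2_sum sq_int_add sq_int_diff sq_int_W sq_int_V A.sq_int_const)
    also have "\<dots> \<le> (\<Sum>m<n. 2 * sqrt (err (n - m - 1)) + \<bar>e\<bar>)"
    proof (rule sum_mono)
      fix m assume "m \<in> {..<n}"
      have "l2 slots (\<lambda>x. (real (W (n - m - 1) i m x) - V s i m x) + e) \<le>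
          l2 slots (\<lambda>x. real (W (n - m - 1) i m x) - V s i m x) + l2 slots (\<lambda>x. e)"
        by (intro l2_add sq_int_diff sq_int_W sq_int_V A.sq_int_const)
      also have "\<dots> \<le> 2 * sqrt (err (n - m - 1)) + \<bar>e\<bar>"
        using s by (intro add_mono ms) (auto simp: A.l2_const)
      finally show "l2 slots (\<lambda>x. (real (W (n - m - 1) i m x) - V s i m x) + e) \<le> 2 * sqrt (err (n - m - 1)) + \<bar>e\<bar>" .
    qed
    also have "\<dots> = (\<Sum>m<n. 2 * sqrt (err (n - Suc m))) + real n * b s"
      by (simp add: sum.distrib b_def e_def)
    also have "(\<Sum>m<n. 2 * sqrt (err (n - Suc m))) = (\<Sum>k<n. 2 * sqrt (err k))"
      by (rule sum.nat_diff_reindex)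
    also have "\<dots> \<le> c\<^sub>5"
      unfolding c\<^sub>5_def using summable_sqrt_err err_pos less_imp_le by (intro sum_le_suminf) auto
    finally have "l2 slots (\<lambda>x. N i n x - T s i n x) \<le> c\<^sub>5 + real n * b s" by simp
    moreover have "l2 slots (\<lambda>x. N i n x - T r i n x) \<le>
        l2 slots (\<lambda>x. N i n x - T s i n x) + l2 slots (\<lambda>x. T s i n x - T r i n x)"
      by (intro l2_triangle3 sq_int_N sq_int_T)
    moreover have "l2 slots (\<lambda>x. T s i n x - T r i n x) \<le> sqrt (real n) * sqrt (\<delta> r)"
      using s by (intro l2_T_diff) auto
    ultimately show "l2 slots (\<lambda>x. N i n x - T r i n x) \<le> c\<^sub>5 + real n * b s + sqrt (real n) * sqrt (\<delta> r)"
      by linarith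
  qed
qed

definition lin :: "real^'d \<Rightarrow> ('d \<Rightarrow> 'a \<Rightarrow> real) \<Rightarrow> 'a \<Rightarrow> real" where
  "lin u f x = (\<Sum>i\<in>UNIV. u $ i * f i x)"

definition norm1 :: "real^'d \<Rightarrow> real" where
  "norm1 u = (\<Sum>i\<in>UNIV. \<bar>u $ i\<bar>)"

lemma sq_int_lin: "(\<And>i. sq_int M (f i)) \<Longrightarrow> sq_int M (lin u f)"
  unfolding lin_def[abs_def] by (intro sq_int_sum sq_int_cmult) auto

lemma l2_lin_N_T:
  "l2 slots (\<lambda>x. lin u (\<lambda>i. N i n) x - lin u (\<lambda>i. T r i n) x) \<le> norm1 u * (c\<^sub>5 + sqrt (real n) * sqrt (\<delta> r))"
proof -
  have "l2 slots (\<lambda>x. lin u (\<lambda>i. N i n) x - lin u (\<lambda>i. T r i n) x) =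
      l2 slots (\<lambda>x. \<Sum>i\<in>UNIV. u $ i * (N i n x - T r i n x))"
    by (simp add: lin_def sum_subtractf[symmetric] right_diff_distrib)
  also have "\<dots> \<le> (\<Sum>i\<in>UNIV. l2 slots (\<lambda>x. u $ i * (N i n x - T r i n x)))"
    by (intro l2_sum sq_int_cmult sq_int_diff sq_int_N sq_int_T)
  also have "\<dots> \<le> (\<Sum>i\<in>UNIV. \<bar>u $ i\<bar> * (c\<^sub>5 + sqrt (real n) * sqrt (\<delta> r)))"
    unfolding l2_cmult by (intro sum_mono mult_left_mono l2_N_T) auto
  also have "\<dots> = norm1 u * (c\<^sub>5 + sqrt (real n) * sqrt (\<delta> r))" by (simp add: norm1_def sum_distrib_right)
  finally show ?thesis .
qed

text \<open>The error at a truncation level is uniform in \<open>n\<close>, so the limits in \<open>n\<close> and \<open>r\<close> may be exchanged.\<close>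

lemma clt_N:
  obtains s where "s \<ge> 0"
    "(\<lambda>n. (l2 slots (lin u (\<lambda>i. N i n)))\<^sup>2 / n) \<longlonglongrightarrow> s\<^sup>2"
    "(\<lambda>n. \<integral>x. iexp (lin u (\<lambda>i. N i n) x / sqrt n) \<partial>slots) \<longlonglongrightarrow> of_real (exp (- (s\<^sup>2 / 2)))"
    "\<And>r. s = 0 \<Longrightarrow> \<exists>y. (\<lambda>n. (l2 slots (lin u (\<lambda>i. T r i n)))\<^sup>2 / n) \<longlonglongrightarrow> y \<and> y \<le> (norm1 u)\<^sup>2 * \<delta> r"
proof -
  have "\<exists>\<sigma>. ((\<lambda>n. (l2 slots (lin u (\<lambda>i. T r i n)))\<^sup>2 / n) \<longlonglongrightarrow> \<sigma>) \<and>
    ((\<lambda>n. \<integral>x. iexp (1 / sqrt n * lin u (\<lambda>i. T r i n) x) \<partial>slots) \<longlonglongrightarrow> of_real (exp (- (1\<^sup>2 * \<sigma> / 2))))" for r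
  proof (rule clt_T[of u r], intro exI conjI)
    fix \<sigma>
    assume 1: "(\<lambda>n. (l2 slots (\<lambda>x. \<Sum>i\<in>UNIV. u $ i * T r i n x))\<^sup>2 / n) \<longlonglongrightarrow> \<sigma>"
      and 2: "\<And>y. (\<lambda>n. \<integral>x. iexp (y / sqrt n * (\<Sum>i\<in>UNIV. u $ i * T r i n x)) \<partial>slots) \<longlonglongrightarrow> of_real (exp (- (y\<^sup>2 * \<sigma> / 2)))"
    show "(\<lambda>n. (l2 slots (lin u (\<lambda>i. T r i n)))\<^sup>2 / n) \<longlonglongrightarrow> \<sigma>" unfolding lin_def[abs_def] by (rule 1)
    show "(\<lambda>n. \<integral>x. iexp (1 / sqrt n * lin u (\<lambda>i. T r i n) x) \<partial>slots) \<longlonglongrightarrow> of_real (exp (- (1\<^sup>2 * \<sigma> / 2)))"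
      unfolding lin_def[abs_def] by (rule 2)
  qed
  then have "\<forall>r. \<exists>\<sigma>. ((\<lambda>n. (l2 slots (lin u (\<lambda>i. T r i n)))\<^sup>2 / n) \<longlonglongrightarrow> \<sigma>) \<and>
    ((\<lambda>n. \<integral>x. iexp (1 / sqrt n * lin u (\<lambda>i. T r i n) x) \<partial>slots) \<longlonglongrightarrow> of_real (exp (- (1\<^sup>2 * \<sigma> / 2))))"
    by (rule allI)
  from choice[OF this] obtain \<sigma> where \<sigma>: "\<And>r. (\<lambda>n. (l2 slots (lin u (\<lambda>i. T r i n)))\<^sup>2 / n) \<longlonglongrightarrow> \<sigma> r"
    "\<And>r. (\<lambda>n. \<integral>x. iexp (1 / sqrt n * lin u (\<lambda>i. T r i n) x) \<partial>slots) \<longlonglongrightarrow> of_real (exp (- (1\<^sup>2 * \<sigma> r / 2)))"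
    by blast
  have \<sigma>0: "\<sigma> r \<ge> 0" for r by (rule LIMSEQ_le_const[OF \<sigma>(1)]) auto
  define en where "en n = (if n = 0 then 0 else norm1 u * c\<^sub>5 / sqrt (real n))" for n :: nat
  define dr where "dr r = norm1 u * sqrt (\<delta> r)" for r
  have n1: "norm1 u \<ge> 0" by (simp add: norm1_def sum_nonneg)
  have en: "en \<longlonglongrightarrow> 0"
  proof -
    have "(\<lambda>n. norm1 u * c\<^sub>5 / sqrt (real n)) \<longlonglongrightarrow> 0" by real_asymp
    then show ?thesis
      by (rule Lim_transform_eventually) (auto simp: en_def eventually_sequentially intro!: exI[of _ 1])
  qed
  have dr: "dr \<longlonglongrightarrow> 0"
    unfolding dr_def using tendsto_mult_left[OF tendsto_real_sqrt[OF \<delta>_tendsto_0], of "norm1 u"] by simp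
  have dr0: "dr r \<ge> 0" for r using n1 \<delta>_nonneg by (simp add: dr_def)
  have close: "l2 slots (\<lambda>x. lin u (\<lambda>i. N i n) x - lin u (\<lambda>i. T r i n) x) / sqrt n \<le> en n + dr r" for n r
  proof (cases "n = 0")
    case False
    then have "l2 slots (\<lambda>x. lin u (\<lambda>i. N i n) x - lin u (\<lambda>i. T r i n) x) / sqrt n \<le>
        norm1 u * (c\<^sub>5 + sqrt (real n) * sqrt (\<delta> r)) / sqrt n"
      by (intro divide_right_mono l2_lin_N_T) auto
    also have "\<dots> = en n + dr r" using False by (simp add: en_def dr_def field_simps)
    finally show ?thesis .
  qed (use dr0 in \<open>simp add: en_def\<close>)
  have sN: "sq_int slots (lin u (\<lambda>i. N i n))" for n by (intro sq_int_lin sq_int_N)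
  have sT: "sq_int slots (lin u (\<lambda>i. T r i n))" for r n by (intro sq_int_lin sq_int_T)
  \<comment> \<open>The limits are exchanged for standard deviations and not for variances, because
    the former satisfy the triangle inequality.\<close>
  obtain s where s: "(\<lambda>n. l2 slots (lin u (\<lambda>i. N i n)) / sqrt n) \<longlonglongrightarrow> s" "(\<lambda>r. sqrt (\<sigma> r)) \<longlonglongrightarrow> s"
    "\<And>r. norm (s - sqrt (\<sigma> r)) \<le> dr r"
  proof (rule double_limit[OF _ _ en dr])
    show "(\<lambda>n. l2 slots (lin u (\<lambda>i. T r i n)) / sqrt n) \<longlonglongrightarrow> sqrt (\<sigma> r)" for r
      using tendsto_real_sqrt[OF \<sigma>(1)[of r]] by (simp add: real_sqrt_divide)
    show "norm (l2 slots (lin u (\<lambda>i. N i n)) / sqrt n - l2 slots (lin u (\<lambda>i. T r i n)) / sqrt n) \<le> en n + dr r" for r n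
    proof -
      have "\<bar>l2 slots (lin u (\<lambda>i. N i n)) - l2 slots (lin u (\<lambda>i. T r i n))\<bar> / sqrt n \<le>
          l2 slots (\<lambda>x. lin u (\<lambda>i. N i n) x - lin u (\<lambda>i. T r i n) x) / sqrt n"
        by (intro divide_right_mono l2_triangle sN sT) auto
      then show ?thesis using close[of n r] by (simp add: diff_divide_distrib[symmetric] abs_divide)
    qed
  qed blast
  \<comment> \<open>The same error bound serves the characteristic functions, whose distance is at
    most the mean-square distance.\<close>
  obtain z where z: "(\<lambda>n. \<integral>x. iexp (lin u (\<lambda>i. N i n) x / sqrt n) \<partial>slots) \<longlonglongrightarrow> z"
    "(\<lambda>r. complex_of_real (exp (- (1\<^sup>2 * \<sigma> r / 2)))) \<longlonglongrightarrow> z"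
  proof (rule double_limit[OF \<sigma>(2) _ en dr])
    fix n r
    let ?f = "\<lambda>x. lin u (\<lambda>i. N i n) x / sqrt n" and ?g = "\<lambda>x. 1 / sqrt n * lin u (\<lambda>i. T r i n) x"
    have d: "?f x - ?g x = 1 / sqrt n * (lin u (\<lambda>i. N i n) x - lin u (\<lambda>i. T r i n) x)" for x
      by (simp add: diff_divide_distrib)
    have sd: "sq_int slots (\<lambda>x. ?f x - ?g x)" unfolding d by (intro sq_int_cmult sq_int_diff sN sT)
    have "cmod ((\<integral>x. iexp (?f x) \<partial>slots) - (\<integral>x. iexp (?g x) \<partial>slots)) \<le> sqrt (\<integral>x. (?f x - ?g x)\<^sup>2 \<partial>slots)"
      by (rule A.norm_char_diff_le) (use sN[of n] sT[of r n] sd in \<open>auto simp: sq_int_def\<close>)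
    also have "\<dots> = l2 slots (\<lambda>x. ?f x - ?g x)" by (simp add: l2_def)
    also have "\<dots> = l2 slots (\<lambda>x. lin u (\<lambda>i. N i n) x - lin u (\<lambda>i. T r i n) x) / sqrt n"
      unfolding d l2_cmult by simp
    finally show "cmod ((\<integral>x. iexp (?f x) \<partial>slots) - (\<integral>x. iexp (?g x) \<partial>slots)) \<le> en n + dr r"
      using close[of n r] by linarith
  qed blast
  have s0: "s \<ge> 0" by (rule LIMSEQ_le_const[OF s(2)]) (use \<sigma>0 in auto)
  have s2: "\<sigma> \<longlonglongrightarrow> s\<^sup>2"
    using tendsto_power[OF s(2), of 2] \<sigma>0 by simp
  have "(\<lambda>r. complex_of_real (exp (- (1\<^sup>2 * \<sigma> r / 2)))) \<longlonglongrightarrow> of_real (exp (- (1\<^sup>2 * s\<^sup>2 / 2)))"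
    by (intro tendsto_intros s2) auto
  then have zz: "z = of_real (exp (- (s\<^sup>2 / 2)))" using LIMSEQ_unique[OF z(2)] by simp
  show ?thesis
  proof (rule that[OF s0])
    show "(\<lambda>n. (l2 slots (lin u (\<lambda>i. N i n)))\<^sup>2 / n) \<longlonglongrightarrow> s\<^sup>2"
      using tendsto_power[OF s(1), of 2] by (simp add: power_divide)
    show "(\<lambda>n. \<integral>x. iexp (lin u (\<lambda>i. N i n) x / sqrt n) \<partial>slots) \<longlonglongrightarrow> of_real (exp (- (s\<^sup>2 / 2)))"
      using z(1) zz by simp
    fix r :: nat assume "s = 0"
    then have "sqrt (\<sigma> r) \<le> dr r" using s(3)[of r] \<sigma>0[of r] by simp
    then have "(sqrt (\<sigma> r))\<^sup>2 \<le> (dr r)\<^sup>2" using \<sigma>0 by (intro power_mono) auto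
    then have "\<sigma> r \<le> (norm1 u)\<^sup>2 * \<delta> r" using \<sigma>0 \<delta>_nonneg by (simp add: dr_def power_mult_distrib)
    then show "\<exists>y. (\<lambda>n. (l2 slots (lin u (\<lambda>i. T r i n)))\<^sup>2 / n) \<longlonglongrightarrow> y \<and> y \<le> (norm1 u)\<^sup>2 * \<delta> r"
      using \<sigma>(1)[of r] by blast
  qed
qed

end

section \<open>The limit law\<close>

lemma measurable_Y [measurable]: "(\<lambda>x. Y x n $ i) \<in> borel_measurable slot_space"
proof -
  have "(\<lambda>x. of_nat (U x (Suc (n + k)) n $ i) :: ennreal) \<in> borel_measurable slot_space" for k
    by (rule measurable_compose[OF measurable_U]) simp
  then show ?thesis by (simp add: Y_def del: U.simps)
qed

text \<open>Partial sums are nondecreasing, integral and bounded, hence eventually constant.\<close>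

lemma suminf_of_nat_finite:
  fixes u :: "nat \<Rightarrow> nat"
  assumes fin: "(\<Sum>k. of_nat (u k) :: ennreal) < \<infinity>"
  obtains n r0 where "(\<Sum>k. of_nat (u k) :: ennreal) = of_nat n" "\<And>r. r \<ge> r0 \<Longrightarrow> (\<Sum>k<r. u k) = n"
proof -
  define s where "s r = (\<Sum>k<r. u k)" for r
  obtain B where B: "(\<Sum>k. of_nat (u k) :: ennreal) < of_nat B"
    using ennreal_Ex_less_of_nat[of "\<Sum>k. of_nat (u k)"] fin by auto
  have "s r < B" for r
  proof -
    have "(of_nat (s r) :: ennreal) \<le> (\<Sum>k. of_nat (u k))"
      unfolding s_def of_nat_sum by (rule sum_le_suminf) auto
    also note B
    finally show ?thesis by simp
  qed
  then have "range s \<subseteq> {..<B}" by blast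
  then have fs: "finite (range s)" by (rule finite_subset) simp
  have "Max (range s) \<in> range s" using fs by (intro Max_in) simp_all
  then obtain r0 where r0: "Max (range s) = s r0" ..
  have s: "s r = s r0" if "r \<ge> r0" for r
  proof (rule antisym)
    show "s r \<le> s r0" unfolding r0[symmetric] using fs by (intro Max_ge) auto
    show "s r0 \<le> s r" unfolding s_def using that by (intro sum_mono2) auto
  qed
  have "(\<lambda>r. of_nat (s r) :: ennreal) \<longlonglongrightarrow> (\<Sum>k. of_nat (u k))"
    unfolding s_def of_nat_sum by (intro summable_LIMSEQ summableI)
  moreover have "(\<lambda>r. of_nat (s r) :: ennreal) \<longlonglongrightarrow> of_nat (s r0)"
  proof (rule tendsto_eventually, rule eventually_sequentiallyI)
    fix r assume "r0 \<le> r"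
    then have "s r = s r0" by (rule s)
    then show "(of_nat (s r) :: ennreal) = of_nat (s r0)" by simp
  qed
  ultimately have "(\<Sum>k. of_nat (u k) :: ennreal) = of_nat (s r0)" by (rule LIMSEQ_unique)
  then show ?thesis
  proof (rule that)
    show "(\<Sum>k<r. u k) = s r0" if "r0 \<le> r" for r using s[OF that] unfolding s_def .
  qed
qed

context branching_environment
begin

lemma measurable_snd_annealed [measurable]: "snd \<in> measurable (annealed P q p) slot_space"
  unfolding measurable_annealed by (rule measurable_snd)

lemma
  fixes f :: "_ \<Rightarrow> 'b::{banach, second_countable_topology}"
  assumes [measurable]: "f \<in> borel_measurable slot_space"
  shows integral_annealed_snd: "(\<integral>z. f (snd z) \<partial>annealed P q p) = (\<integral>x. f x \<partial>slots)"
    and integrable_annealed_snd: "integrable (annealed P q p) (\<lambda>z. f (snd z)) \<longleftrightarrow> integrable slots f"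
  by (simp_all add: distr_annealed[symmetric] integral_distr integrable_distr_eq)

end

context mixing_branching
begin

section \<open>The covariance matrix of the limit\<close>

lemma lin_axis:
  "lin (axis i 1) f = f i"
  "lin (axis i 1 + axis j 1) f x = f i x + f j x"
  "lin (axis i 1 - axis j 1) f x = f i x - f j x"
  by (auto simp: lin_def axis_def distrib_right left_diff_distrib sum.distrib sum_subtractf
      if_distrib[of "\<lambda>z. z * _"] cong: if_cong)

lemma l2_lin_N_square:
  "(l2 slots (lin u (\<lambda>i. N i n)))\<^sup>2 = (\<Sum>i\<in>UNIV. \<Sum>j\<in>UNIV. u $ i * u $ j * (\<integral>x. N i n x * N j n x \<partial>slots))"
proof -
  have s: "integrable slots (\<lambda>x. u $ i * u $ j * (N i n x * N j n x))" for i j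
    by (intro integrable_mult_right sq_int_mult sq_int_N)
  have "(l2 slots (lin u (\<lambda>i. N i n)))\<^sup>2 = (\<integral>x. (\<Sum>i\<in>UNIV. \<Sum>j\<in>UNIV. u $ i * u $ j * (N i n x * N j n x)) \<partial>slots)"
    unfolding l2_square
    by (intro Bochner_Integration.integral_cong refl) (simp add: lin_def power2_eq_square sum_product mult_ac)
  also have "\<dots> = (\<Sum>i\<in>UNIV. \<Sum>j\<in>UNIV. \<integral>x. u $ i * u $ j * (N i n x * N j n x) \<partial>slots)"
    using s by (simp only: Bochner_Integration.integral_sum Bochner_Integration.integrable_sum)
  finally show ?thesis by simp
qed

text \<open>Polarisation: a mixed moment is a quarter of the difference between the second moments
  of sum and difference, whose limits are supplied by \<open>clt_N\<close>.\<close>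

lemma covariance_limit:
  obtains K where "\<And>i j. (\<lambda>n. (\<integral>x. N i n x * N j n x \<partial>slots) / n) \<longlonglongrightarrow> K i j"
proof -
  have "\<exists>k. (\<lambda>n. (\<integral>x. N i n x * N j n x \<partial>slots) / n) \<longlonglongrightarrow> k" for i j
  proof -
    obtain a where a: "(\<lambda>n. (l2 slots (lin (axis i 1 + axis j 1) (\<lambda>i. N i n)))\<^sup>2 / n) \<longlonglongrightarrow> a"
      using clt_N by blast
    obtain b where b: "(\<lambda>n. (l2 slots (lin (axis i 1 - axis j 1) (\<lambda>i. N i n)))\<^sup>2 / n) \<longlonglongrightarrow> b"
      using clt_N by blast
    have eq: "(\<integral>x. N i n x * N j n x \<partial>slots) / n =
        ((l2 slots (lin (axis i 1 + axis j 1) (\<lambda>i. N i n)))\<^sup>2 / n - (l2 slots (lin (axis i 1 - axis j 1) (\<lambda>i. N i n)))\<^sup>2 / n) / 4" for n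
    proof -
      have "(\<integral>x. (N i n x + N j n x)\<^sup>2 \<partial>slots) - (\<integral>x. (N i n x - N j n x)\<^sup>2 \<partial>slots) =
          (\<integral>x. (N i n x + N j n x)\<^sup>2 - (N i n x - N j n x)\<^sup>2 \<partial>slots)"
        by (rule Bochner_Integration.integral_diff[symmetric])
          (use sq_int_add[OF sq_int_N[of i n] sq_int_N[of j n]] sq_int_diff[OF sq_int_N[of i n] sq_int_N[of j n]]
            in \<open>auto simp: sq_int_def\<close>)
      also have "\<dots> = (\<integral>x. 4 * (N i n x * N j n x) \<partial>slots)"
        by (intro Bochner_Integration.integral_cong refl) (simp add: power2_eq_square algebra_simps)
      finally show ?thesis by (simp add: l2_square lin_axis diff_divide_distrib[symmetric])
    qed
    have "(\<lambda>n. (\<integral>x. N i n x * N j n x \<partial>slots) / n) \<longlonglongrightarrow> (a - b) / 4"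
      unfolding eq by (intro tendsto_divide tendsto_diff a b tendsto_const) simp
    then show ?thesis by blast
  qed
  then have "\<forall>ij. \<exists>k. (\<lambda>n. (\<integral>x. N (fst ij) n x * N (snd ij) n x \<partial>slots) / n) \<longlonglongrightarrow> k" by blast
  from choice[OF this] obtain K where K: "\<And>ij. (\<lambda>n. (\<integral>x. N (fst ij) n x * N (snd ij) n x \<partial>slots) / n) \<longlonglongrightarrow> K ij"
    by blast
  show ?thesis
  proof (rule that)
    show "(\<lambda>n. (\<integral>x. N i n x * N j n x \<partial>slots) / n) \<longlonglongrightarrow> K (i, j)" for i j using K[of "(i, j)"] by simp
  qed
qed

text \<open>The limits of second moments determine a positive semidefinite form and with it the
  Gaussian law; uniqueness of limits identifies the exponent in \<open>clt_N\<close> with this form.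
  Convergence of the second moments also bounds them, as \<open>cramer_wold_conv\<close> requires.
  The last conclusion is what the nondegeneracy is derived from.\<close>

lemma clt_S_sum:
  obtains \<nu> :: "(real^'d) measure" where "gaussian_law \<nu>" "\<And>i. (\<integral>x. x $ i \<partial>\<nu>) = 0"
    "conv_in_distr (annealed P q p)
      (\<lambda>n (\<omega>, x). \<chi> i. (real (S_sum x n $ i) - real n * rho P q p $ i) / sqrt (real n)) \<nu>"
    "\<And>i. (\<lambda>n. (l2 slots (N i n))\<^sup>2 / n) \<longlonglongrightarrow> (\<integral>x. (x $ i)\<^sup>2 \<partial>\<nu>)"
proof -
  obtain K where K: "\<And>i j. (\<lambda>n. (\<integral>x. N i n x * N j n x \<partial>slots) / n) \<longlonglongrightarrow> K i j"
    by (rule covariance_limit) (rule that)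
  have sym: "K i j = K j i" for i j
    by (rule LIMSEQ_unique[OF K[of i j]]) (use K[of j i] in \<open>simp add: mult.commute\<close>)
  have lim: "(\<lambda>n. (l2 slots (lin u (\<lambda>i. N i n)))\<^sup>2 / n) \<longlonglongrightarrow> qform K (($) u)" for u
  proof -
    have "(\<lambda>n. \<Sum>i\<in>UNIV. \<Sum>j\<in>UNIV. u $ i * u $ j * ((\<integral>x. N i n x * N j n x \<partial>slots) / n)) \<longlonglongrightarrow> qform K (($) u)"
      unfolding qform_def by (intro tendsto_sum tendsto_mult_left K)
    then show ?thesis by (simp add: l2_lin_N_square sum_divide_distrib)
  qed
  have psd: "qform K u \<ge> 0" for u
  proof -
    have "qform K (($) (\<chi> i. u i)) \<ge> 0" by (rule LIMSEQ_le_const[OF lim]) auto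
    then show ?thesis by (simp add: qform_def)
  qed
  obtain \<nu> :: "(real^'d) measure" where \<nu>: "gaussian_law \<nu>" "\<And>i. (\<integral>x. x $ i \<partial>\<nu>) = 0"
    "\<And>i. (\<integral>x. (x $ i)\<^sup>2 \<partial>\<nu>) = K i i" "integrable \<nu> (\<lambda>x. (norm x)\<^sup>2)"
    "\<And>u. (\<integral>x. iexp (u \<bullet> x) \<partial>\<nu>) = exp (- (qform K (($) u) / 2))"
    by (rule gaussian_law_exists[OF sym psd]) (rule that)
  define G where "G n x = (\<chi> i. N i n x / sqrt (real n))" for n x
  have N_meas: "N i n \<in> borel_measurable slot_space" for i n
    using sq_int_N[of i n] by (simp add: sq_int_def measurable_slots_iff)
  have G_meas [measurable]: "G n \<in> borel_measurable slot_space" for n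
    unfolding borel_measurable_euclidean_space[of "G n"]
    by (auto simp: Basis_vec_def inner_axis G_def intro!: borel_measurable_divide N_meas)
  have uG: "u \<bullet> G n x = lin u (\<lambda>i. N i n) x / sqrt n" for u n x
    by (simp add: G_def lin_def inner_vec_def sum_divide_distrib)
  have normG: "(norm (G n x))\<^sup>2 = (\<Sum>i\<in>UNIV. (N i n x)\<^sup>2 / n)" for n x
    by (simp add: power2_norm_eq_inner inner_vec_def G_def power2_eq_square[symmetric] power_divide)
  have intN: "integrable slots (\<lambda>x. (N i n x)\<^sup>2 / n)" for i n
    using sq_int_N[of i n] by (simp add: sq_int_def)
  have EG: "(\<integral>x. (norm (G n x))\<^sup>2 \<partial>slots) = (\<Sum>i\<in>UNIV. (l2 slots (N i n))\<^sup>2 / n)" for n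
    unfolding normG using intN by (simp add: l2_square)
  have var: "(\<lambda>n. (l2 slots (N i n))\<^sup>2 / n) \<longlonglongrightarrow> K i i" for i
    using K[of i i] unfolding l2_square unfolding power2_eq_square .
  have "(\<lambda>n. \<Sum>i\<in>UNIV. (l2 slots (N i n))\<^sup>2 / n) \<longlonglongrightarrow> (\<Sum>i\<in>UNIV. K i i)"
    by (intro tendsto_sum var)
  then obtain C where C: "\<And>n. norm (\<Sum>i\<in>UNIV. (l2 slots (N i n))\<^sup>2 / n) \<le> C"
    using convergent_imp_Bseq[THEN BseqD] convergentI by blast
  have char: "(\<lambda>n. \<integral>x. iexp (u \<bullet> G n x) \<partial>slots) \<longlonglongrightarrow> (\<integral>x. iexp (u \<bullet> x) \<partial>\<nu>)" for u
  proof -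
    obtain s where s: "(\<lambda>n. (l2 slots (lin u (\<lambda>i. N i n)))\<^sup>2 / n) \<longlonglongrightarrow> s\<^sup>2"
      "(\<lambda>n. \<integral>x. iexp (lin u (\<lambda>i. N i n) x / sqrt n) \<partial>slots) \<longlonglongrightarrow> of_real (exp (- (s\<^sup>2 / 2)))"
      using clt_N[of u] by blast
    have "s\<^sup>2 = qform K (($) u)" by (rule LIMSEQ_unique[OF s(1) lim])
    then show ?thesis using s(2) unfolding uG \<nu>(5) by simp
  qed
  have "conv_in_distr (annealed P q p) (\<lambda>n z. G n (snd z)) \<nu>"
  proof (rule cramer_wold_conv[where C="max C (\<integral>x. (norm x)\<^sup>2 \<partial>\<nu>)"])
    show "prob_space (annealed P q p)" by (rule prob_space_annealed)
    show "prob_space \<nu>" "sets \<nu> = sets borel" using \<nu>(1) by (auto simp: gaussian_law_def)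
    show "(\<lambda>z. G n (snd z)) \<in> borel_measurable (annealed P q p)" for n
      by (rule measurable_compose[OF measurable_snd_annealed G_meas])
    show "(\<lambda>n. \<integral>z. iexp (u \<bullet> G n (snd z)) \<partial>annealed P q p) \<longlonglongrightarrow> (\<integral>x. iexp (u \<bullet> x) \<partial>\<nu>)" for u
      using char[of u] by (subst integral_annealed_snd) auto
    show "integrable (annealed P q p) (\<lambda>z. (norm (G n (snd z)))\<^sup>2)" for n
      using intN by (subst integrable_annealed_snd) (auto simp: normG)
    show "(\<integral>z. (norm (G n (snd z)))\<^sup>2 \<partial>annealed P q p) \<le> max C (\<integral>x. (norm x)\<^sup>2 \<partial>\<nu>)" for n
      using C[of n] by (subst integral_annealed_snd) (auto simp: EG)
    show "integrable \<nu> (\<lambda>x. (norm x)\<^sup>2)" by (rule \<nu>)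
  qed simp
  also have "(\<lambda>n z. G n (snd z)) =
      (\<lambda>n (\<omega>, x). \<chi> i. (real (S_sum x n $ i) - real n * rho P q p $ i) / sqrt (real n))"
    by (auto simp: fun_eq_iff G_def N_def)
  finally show ?thesis
  proof (rule that[OF \<nu>(1,2)])
    show "(\<lambda>n. (l2 slots (N i n))\<^sup>2 / n) \<longlonglongrightarrow> (\<integral>x. (x $ i)\<^sup>2 \<partial>\<nu>)" for i unfolding \<nu>(3) by (rule var)
  qed
qed

section \<open>Degeneracy of the limit variance\<close>

lemma W_eq_sum: "W r i m x = (\<Sum>k<r. U x (Suc (m + k)) m $ i)"
  unfolding W_def by (rule sum.reindex_bij_witness[of _ Suc "\<lambda>k. k - 1"]) (auto simp del: U.simps)

lemma W_le_Y: "of_nat (W r i m x) \<le> Y x m $ i"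
  unfolding W_eq_sum Y_def of_nat_sum by (simp del: U.simps) (rule sum_le_suminf, auto)

lemma nn_integral_Y_finite: "(\<integral>\<^sup>+x. Y x m $ i \<partial>slots) < \<infinity>"
proof -
  have [measurable]: "(\<lambda>x. of_nat (U x (Suc (m + k)) m $ i) :: ennreal) \<in> borel_measurable slots" for k
    by (rule measurable_U_slots)
  have "(\<lambda>r. \<Sum>k<r. \<integral>\<^sup>+x. of_nat (U x (Suc (m + k)) m $ i) \<partial>slots) \<longlonglongrightarrow>
      (\<Sum>k. \<integral>\<^sup>+x. of_nat (U x (Suc (m + k)) m $ i) \<partial>slots)"
    by (intro summable_LIMSEQ summableI)
  moreover have "(\<Sum>k<r. \<integral>\<^sup>+x. of_nat (U x (Suc (m + k)) m $ i) \<partial>slots) \<le> ennreal (2 * sqrt (err 0))" for r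
  proof -
    have "(\<Sum>k<r. \<integral>\<^sup>+x. of_nat (U x (Suc (m + k)) m $ i) \<partial>slots) = (\<integral>\<^sup>+x. of_nat (W r i m x) \<partial>slots)"
      unfolding W_eq_sum of_nat_sum by (rule nn_integral_sum[symmetric]) measurable
    also have "\<dots> = ennreal (\<integral>x. real (W r i m x) \<partial>slots)"
      unfolding ennreal_of_nat_eq_real_of_nat
      by (rule nn_integral_eq_integral) (auto intro: A.sq_int_integrable sq_int_W)
    finally show ?thesis by (simp add: ennreal_leI expectation_W_le)
  qed
  ultimately have "(\<Sum>k. \<integral>\<^sup>+x. of_nat (U x (Suc (m + k)) m $ i) \<partial>slots) \<le> ennreal (2 * sqrt (err 0))"
    by (intro LIMSEQ_le_const2) auto
  moreover have "(\<integral>\<^sup>+x. Y x m $ i \<partial>slots) = (\<Sum>k. \<integral>\<^sup>+x. of_nat (U x (Suc (m + k)) m $ i) \<partial>slots)"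
    unfolding Y_def by (simp add: nn_integral_suminf del: U.simps)
  ultimately show ?thesis by (simp add: order_le_less_trans[OF _ ennreal_less_top])
qed

definition qvar :: "nat \<Rightarrow> 'd \<Rightarrow> (int \<Rightarrow> 's) \<Rightarrow> real" where
  "qvar r i \<omega> = (\<integral>x. (V r i 0 x)\<^sup>2 \<partial>quenched q p \<omega>) - (qmean r i \<omega>)\<^sup>2"

lemma nn_integral_qvar:
  shows "(\<integral>\<^sup>+x. ennreal ((V r i 0 x - qmean r i \<omega>)\<^sup>2) \<partial>quenched q p \<omega>) = ennreal (qvar r i \<omega>)"
    and "0 \<le> qvar r i \<omega>"
proof -
  interpret Q: prob_space "quenched q p \<omega>" by (rule prob_space_quenched)
  have V: "integrable (quenched q p \<omega>) (V r i 0)"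
    by (rule quenched_bounded[where B="(1 / t) ^ r"]) (auto simp: V_bounds)
  have V2: "integrable (quenched q p \<omega>) (\<lambda>x. (V r i 0 x)\<^sup>2)"
    by (rule quenched_bounded[where B="((1 / t) ^ r)\<^sup>2"]) (auto simp: V_bounds intro!: power_mono)
  have eq: "(\<integral>x. (V r i 0 x - qmean r i \<omega>)\<^sup>2 \<partial>quenched q p \<omega>) = qvar r i \<omega>"
    using Q.variance_eq[OF V V2] by (simp add: qvar_def qmean_def)
  have int: "integrable (quenched q p \<omega>) (\<lambda>x. (V r i 0 x - qmean r i \<omega>)\<^sup>2)"
    using V V2 by (simp add: power2_diff)
  show "(\<integral>\<^sup>+x. ennreal ((V r i 0 x - qmean r i \<omega>)\<^sup>2) \<partial>quenched q p \<omega>) = ennreal (qvar r i \<omega>)"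
    unfolding eq[symmetric] by (rule nn_integral_eq_integral[OF int]) simp
  show "0 \<le> qvar r i \<omega>" unfolding eq[symmetric] by simp
qed

lemma measurable_qvar [measurable]: "qvar r i \<in> borel_measurable P"
proof -
  have "(\<lambda>x. (V r i 0 x)\<^sup>2) \<in> borel_measurable slot_space" by measurable
  from measurable_integral_quenched[OF this] show ?thesis unfolding qvar_def[abs_def] by measurable
qed

lemma expectation_qvar:
  "(\<integral>\<^sup>+\<omega>. ennreal (qvar r i \<omega>) \<partial>P) = ennreal ((\<integral>x. (V r i 0 x)\<^sup>2 \<partial>slots) - (\<integral>\<omega>. (qmean r i \<omega>)\<^sup>2 \<partial>P))"
proof -
  have b: "\<bar>(V r i 0 x)\<^sup>2\<bar> \<le> ((1 / t) ^ r)\<^sup>2" for x by (auto simp: V_bounds intro!: power_mono)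
  have m: "(\<lambda>x. (V r i 0 x)\<^sup>2) \<in> borel_measurable slot_space" by measurable
  have b': "\<bar>\<integral>x. (V r i 0 x)\<^sup>2 \<partial>quenched q p \<omega>\<bar> \<le> ((1 / t) ^ r)\<^sup>2" for \<omega>
    using quenched_bounded(2)[of "\<lambda>x. (V r i 0 x)\<^sup>2" "((1 / t) ^ r)\<^sup>2" \<omega>] m b by simp
  have i1: "integrable P (\<lambda>\<omega>. \<integral>x. (V r i 0 x)\<^sup>2 \<partial>quenched q p \<omega>)"
    by (rule EP.integrable_const_bound[where B="((1 / t) ^ r)\<^sup>2"])
      (use b' measurable_integral_quenched[OF m] in auto)
  have i2: "integrable P (\<lambda>\<omega>. (qmean r i \<omega>)\<^sup>2)"
    using EP.sq_int_bounded[OF measurable_qmean qmean_bound] by (simp add: sq_int_def)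
  have "(\<integral>\<^sup>+\<omega>. ennreal (qvar r i \<omega>) \<partial>P) = ennreal (\<integral>\<omega>. qvar r i \<omega> \<partial>P)"
    by (rule nn_integral_eq_integral) (use i1 i2 nn_integral_qvar(2) in \<open>auto simp: qvar_def[abs_def]\<close>)
  also have "(\<integral>\<omega>. qvar r i \<omega> \<partial>P) = (\<integral>x. (V r i 0 x)\<^sup>2 \<partial>slots) - (\<integral>\<omega>. (qmean r i \<omega>)\<^sup>2 \<partial>P)"
    unfolding qvar_def using i1 i2 by (simp add: integral_slots_real[OF m b])
  finally show ?thesis .
qed

text \<open>A vanishing limit variance makes the expected quenched variances of the truncations of
  \<open>Y\<^sub>0\<close> tend to zero; by Fatou's lemma \<open>Y\<^sub>0\<close> then has quenched variance zero.\<close>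

lemma degenerate_imp_constant:
  assumes zero: "(\<lambda>n. (l2 slots (N i n))\<^sup>2 / n) \<longlonglongrightarrow> 0"
  shows "\<exists>f :: (int \<Rightarrow> 's) \<Rightarrow> nat. AE \<omega> in P. measure (quenched q p \<omega>)
           {x \<in> space (quenched q p \<omega>). Y x 0 $ i = of_nat (f \<omega>)} = 1"
proof -
  obtain s where s: "(\<lambda>n. (l2 slots (lin (axis i 1) (\<lambda>i. N i n)))\<^sup>2 / n) \<longlonglongrightarrow> s\<^sup>2"
    "\<And>r. s = 0 \<Longrightarrow> \<exists>y. (\<lambda>n. (l2 slots (lin (axis i 1) (\<lambda>i. T r i n)))\<^sup>2 / n) \<longlonglongrightarrow> y \<and> y \<le> (norm1 (axis i 1 :: real^'d))\<^sup>2 * \<delta> r"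
    using clt_N[of "axis i 1"] by blast
  have "s\<^sup>2 = 0" using LIMSEQ_unique[OF s(1)] zero by (simp add: lin_axis)
  then have s0: "s = 0" by simp
  have norm1: "norm1 (axis i 1 :: real^'d) = 1"
    by (simp add: norm1_def axis_def if_distrib[of abs] cong: if_cong)
  \<comment> \<open>In the degenerate case the variance rate at level \<open>r\<close> is at most
    \<open>\<delta> r\<close>, and by \<open>l2_T_ge\<close> it dominates the expected quenched
    variance.\<close>
  have v: "(\<integral>x. (V r i 0 x)\<^sup>2 \<partial>slots) - (\<integral>\<omega>. (qmean r i \<omega>)\<^sup>2 \<partial>P) \<le> \<delta> r" (is "?v r \<le> _") for r
  proof -
    obtain y where y: "(\<lambda>n. (l2 slots (T r i n))\<^sup>2 / n) \<longlonglongrightarrow> y" "y \<le> \<delta> r"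
      using s(2)[OF s0, of r] by (auto simp: lin_axis norm1)
    have "?v r \<le> (l2 slots (T r i n))\<^sup>2 / n" if "n \<ge> 1" for n
      using l2_T_ge[of n r i] that by (simp add: field_simps)
    then have "?v r \<le> y" by (intro LIMSEQ_le_const[OF y(1)]) blast
    with y(2) show ?thesis by simp
  qed
  have "(\<integral>\<^sup>+\<omega>. liminf (\<lambda>r. ennreal (qvar r i \<omega>)) \<partial>P) \<le> liminf (\<lambda>r. \<integral>\<^sup>+\<omega>. ennreal (qvar r i \<omega>) \<partial>P)"
    by (rule nn_integral_liminf) measurable
  also have "\<dots> \<le> liminf (\<lambda>r. ennreal (\<delta> r))"
    unfolding expectation_qvar by (intro Liminf_mono always_eventually allI ennreal_leI v)
  also have "(\<lambda>r. ennreal (\<delta> r)) \<longlonglongrightarrow> ennreal 0" by (intro tendsto_ennrealI \<delta>_tendsto_0)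
  then have "liminf (\<lambda>r. ennreal (\<delta> r)) = 0" by (simp add: lim_imp_Liminf)
  finally have "(\<integral>\<^sup>+\<omega>. liminf (\<lambda>r. ennreal (qvar r i \<omega>)) \<partial>P) = 0" by simp
  then have AE1: "AE \<omega> in P. liminf (\<lambda>r. ennreal (qvar r i \<omega>)) = 0"
    by (subst (asm) nn_integral_0_iff_AE) measurable
  have "AE \<omega> in P. (\<integral>\<^sup>+x. Y x 0 $ i \<partial>quenched q p \<omega>) \<noteq> \<infinity>"
  proof (rule nn_integral_PInf_AE[OF measurable_nn_integral_quenched[OF measurable_Y]])
    show "(\<integral>\<^sup>+\<omega>. (\<integral>\<^sup>+x. Y x 0 $ i \<partial>quenched q p \<omega>) \<partial>P) \<noteq> \<infinity>"
      using nn_integral_Y_finite[of 0 i] unfolding nn_integral_slots[OF measurable_Y] by simp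
  qed
  \<comment> \<open>The constant is the limit of the quenched means; the floor only turns it into a
    natural number, the limit itself proving to be integral.\<close>
  with AE1 have "AE \<omega> in P. measure (quenched q p \<omega>)
      {x \<in> space (quenched q p \<omega>). Y x 0 $ i = of_nat (nat \<lfloor>lim (\<lambda>r. qmean r i \<omega>)\<rfloor>)} = 1"
  proof eventually_elim
    case (elim \<omega>)
    interpret Q: prob_space "quenched q p \<omega>" by (rule prob_space_quenched)
    have V: "integrable (quenched q p \<omega>) (V r i 0)" for r
      by (rule quenched_bounded[where B="(1 / t) ^ r"]) (auto simp: V_bounds)
    have V_meas [measurable]: "V r i 0 \<in> borel_measurable (quenched q p \<omega>)" for r
      using V by blast
    \<comment> \<open>The quenched means increase with the level and are bounded by the quenched
      mean of \<open>Y x 0 $ i\<close>, which is finite for almost every environment.\<close>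
    have "convergent (\<lambda>r. qmean r i \<omega>)"
    proof (rule Bseq_monoseq_convergent)
      have le: "qmean r i \<omega> \<le> enn2real (\<integral>\<^sup>+x. Y x 0 $ i \<partial>quenched q p \<omega>)" for r
      proof -
        have "ennreal (V r i 0 x) \<le> Y x 0 $ i" for x
          using order_trans[OF ennreal_leI[OF V_bounds(4)] W_le_Y[of r i 0 x, unfolded ennreal_of_nat_eq_real_of_nat]] .
        then have "(\<integral>\<^sup>+x. ennreal (V r i 0 x) \<partial>quenched q p \<omega>) \<le> (\<integral>\<^sup>+x. Y x 0 $ i \<partial>quenched q p \<omega>)"
          by (intro nn_integral_mono)
        moreover have "(\<integral>\<^sup>+x. ennreal (V r i 0 x) \<partial>quenched q p \<omega>) = ennreal (qmean r i \<omega>)"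
          unfolding qmean_def by (rule nn_integral_eq_integral[OF V]) (simp add: V_bounds)
        ultimately have "ennreal (qmean r i \<omega>) \<le> (\<integral>\<^sup>+x. Y x 0 $ i \<partial>quenched q p \<omega>)" by simp
        then have "enn2real (ennreal (qmean r i \<omega>)) \<le> enn2real (\<integral>\<^sup>+x. Y x 0 $ i \<partial>quenched q p \<omega>)"
          using elim(2) by (intro enn2real_mono) (auto simp: less_top[symmetric])
        then show ?thesis by (simp add: qmean_def V_bounds)
      qed
      have "0 \<le> qmean r i \<omega>" for r by (simp add: qmean_def V_bounds)
      then show "Bseq (\<lambda>r. qmean r i \<omega>)"
        using le by (intro BseqI'[where K="enn2real (\<integral>\<^sup>+x. Y x 0 $ i \<partial>quenched q p \<omega>)"]) auto
      show "monoseq (\<lambda>r. qmean r i \<omega>)"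
        unfolding qmean_def by (intro monoI1) (auto intro!: integral_mono V V_mono)
    qed
    then have m: "(\<lambda>r. qmean r i \<omega>) \<longlonglongrightarrow> lim (\<lambda>r. qmean r i \<omega>)" by (simp add: convergent_LIMSEQ_iff)
    have "(\<integral>\<^sup>+x. liminf (\<lambda>r. ennreal ((V r i 0 x - qmean r i \<omega>)\<^sup>2)) \<partial>quenched q p \<omega>) \<le>
        liminf (\<lambda>r. \<integral>\<^sup>+x. ennreal ((V r i 0 x - qmean r i \<omega>)\<^sup>2) \<partial>quenched q p \<omega>)"
      by (rule nn_integral_liminf) measurable
    also have "\<dots> = 0" unfolding nn_integral_qvar(1) by (rule elim(1))
    finally have "(\<integral>\<^sup>+x. liminf (\<lambda>r. ennreal ((V r i 0 x - qmean r i \<omega>)\<^sup>2)) \<partial>quenched q p \<omega>) = 0" by simp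
    then have AE2: "AE x in quenched q p \<omega>. liminf (\<lambda>r. ennreal ((V r i 0 x - qmean r i \<omega>)\<^sup>2)) = 0"
      by (subst (asm) nn_integral_0_iff_AE) measurable
    have "AE x in quenched q p \<omega>. Y x 0 $ i \<noteq> \<infinity>"
      using elim(2) by (intro nn_integral_PInf_AE) auto
    with AE2 have "AE x in quenched q p \<omega>. Y x 0 $ i = of_nat (nat \<lfloor>lim (\<lambda>r. qmean r i \<omega>)\<rfloor>)"
    proof eventually_elim
      case (elim x)
      define u where "u k = U x (Suc (0 + k)) 0 $ i" for k
      have Yu: "Y x 0 $ i = (\<Sum>k. of_nat (u k))" unfolding Y_def u_def by (rule vec_lambda_beta)
      have Wu: "W r i 0 x = (\<Sum>k<r. u k)" for r unfolding u_def by (rule W_eq_sum)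
      have "(\<Sum>k. of_nat (u k) :: ennreal) < \<infinity>"
        using elim(2) unfolding Yu by (simp add: less_top)
      then obtain n r0 where n: "Y x 0 $ i = of_nat n" and r0: "\<And>r. r \<ge> r0 \<Longrightarrow> W r i 0 x = n"
        unfolding Yu Wu using suminf_of_nat_finite[of u] by blast
      \<comment> \<open>From \<open>max r0 r1\<close> on both truncations are inactive: the count
        has reached its final value \<open>n\<close>, which lies below the cap.\<close>
      obtain r1 where r1: "real n < (1 / t) ^ r1" using real_arch_pow[of "1 / t" "real n"] t by auto
      have "V r i 0 x = real n" if r: "r \<ge> max r0 r1" for r
      proof -
        have "(1 / t) ^ r1 \<le> (1 / t) ^ r" using r t by (intro power_increasing) auto
        moreover have "W r i 0 x = n" using r by (intro r0) simp
        ultimately show ?thesis using r1 by (simp only: V_def min_def) simp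
      qed
      then have "(\<lambda>r. V r i 0 x) \<longlonglongrightarrow> real n"
        by (intro tendsto_eventually eventually_sequentiallyI)
      then have "(\<lambda>r. ennreal ((V r i 0 x - qmean r i \<omega>)\<^sup>2)) \<longlonglongrightarrow> ennreal ((real n - lim (\<lambda>r. qmean r i \<omega>))\<^sup>2)"
        by (intro tendsto_ennrealI tendsto_intros m)
      then have "liminf (\<lambda>r. ennreal ((V r i 0 x - qmean r i \<omega>)\<^sup>2)) = ennreal ((real n - lim (\<lambda>r. qmean r i \<omega>))\<^sup>2)"
        by (intro lim_imp_Liminf sequentially_bot)
      with elim(1) have "real n = lim (\<lambda>r. qmean r i \<omega>)" by simp
      then show ?case using n by (metis floor_of_nat nat_int)
    qed
    moreover have "{x \<in> space (quenched q p \<omega>). Y x 0 $ i = of_nat (nat \<lfloor>lim (\<lambda>r. qmean r i \<omega>)\<rfloor>)} \<in> Q.events"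
    proof -
      have "(\<lambda>x. Y x 0 $ i) \<in> borel_measurable (quenched q p \<omega>)" by measurable
      from measurable_sets[OF this, of "{of_nat (nat \<lfloor>lim (\<lambda>r. qmean r i \<omega>)\<rfloor>)}"] show ?thesis
        by (simp add: vimage_def)
    qed
    ultimately show ?case by (simp only: Q.prob_Collect_eq_1)
  qed
  then show ?thesis by (intro exI[of _ "\<lambda>\<omega>. nat \<lfloor>lim (\<lambda>r. qmean r i \<omega>)\<rfloor>"])
qed

end

theorem theorem1p3:
  fixes S :: "'s measure"
    and P :: "(int \<Rightarrow> 's) measure"
    and q :: "'s \<Rightarrow> (nat^'d::finite) pmf"
    and p :: "'d \<Rightarrow> 's \<Rightarrow> (nat^'d) pmf"
  assumes env: "stationary_ergodic S P"
    and q_meas: "(\<lambda>s. measure_pmf (q s)) \<in> measurable S (subprob_algebra (count_space UNIV))"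
    and p_meas: "\<And>i. (\<lambda>s. measure_pmf (p i s)) \<in> measurable S (subprob_algebra (count_space UNIV))"
    and A1: "(\<integral>\<^sup>+\<omega>. e2ennreal (max 0 (elog (vec_norm 1 (I_vec q p 1 \<omega> 0)))) \<partial>P) < \<infinity>"
    and A2: "(\<integral>\<^sup>+\<omega>. e2ennreal (max 0 (elog (mat_norm 1 (M_mat q p 1 \<omega> 0)))) \<partial>P) < \<infinity>"
    and A3: "\<exists>\<gamma><0. (\<lambda>n. ext_expectation P (\<lambda>\<omega>. elog (mat_norm 1 (M_prod q p 1 \<omega> n))) / ereal (real n))
               \<longlonglongrightarrow> \<gamma>"
    and B1: "\<exists>\<kappa>>2.
        (\<forall>n\<ge>1. (\<integral>\<^sup>+\<omega>. epow (vec_norm \<kappa> (M_prod q p \<kappa> \<omega> n *v I_vec q p \<kappa> \<omega> 0)) \<kappa> \<partial>P) < \<infinity>) \<and>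
        limsup (\<lambda>n. elog (\<integral>\<^sup>+\<omega>. epow (vec_norm \<kappa> (M_prod q p \<kappa> \<omega> n *v I_vec q p \<kappa> \<omega> 0)) \<kappa> \<partial>P)
                      / ereal (real n)) < 0"
    and B2: "limsup (\<lambda>n. elog (mixing_coeff S P n) / ereal (real n)) < 0"
  shows "\<exists>\<nu> :: (real^'d) measure.
      gaussian_law \<nu> \<and> (\<forall>i. (\<integral>x. x $ i \<partial>\<nu>) = 0) \<and>
      conv_in_distr (annealed P q p)
        (\<lambda>n (\<omega>, x). \<chi> i. (real (S_sum x n $ i) - real n * rho P q p $ i) / sqrt (real n)) \<nu> \<and>
      (\<forall>i. \<not> (\<exists>f :: (int \<Rightarrow> 's) \<Rightarrow> nat.
              AE \<omega> in P. measure (quenched q p \<omega>)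
                 {x \<in> space (quenched q p \<omega>). Y x 0 $ i = of_nat (f \<omega>)} = 1)
           \<longrightarrow> (\<integral>x. (x $ i)\<^sup>2 \<partial>\<nu>) > 0)"
proof -
  interpret branching_environment S P q p
    using env q_meas p_meas by unfold_locales
  obtain \<kappa> where \<kappa>: "\<kappa> > 2"
    and fin: "\<And>n. n \<ge> 1 \<Longrightarrow> (\<integral>\<^sup>+\<omega>. epow (vec_norm \<kappa> (M_prod q p \<kappa> \<omega> n *v I_vec q p \<kappa> \<omega> 0)) \<kappa> \<partial>P) < \<infinity>"
    and ls: "limsup (\<lambda>n. elog (\<integral>\<^sup>+\<omega>. epow (vec_norm \<kappa> (M_prod q p \<kappa> \<omega> n *v I_vec q p \<kappa> \<omega> 0)) \<kappa> \<partial>P)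
                      / ereal (real n)) < 0"
    using B1 by blast
  obtain C \<theta> where C: "0 < \<theta>" "\<theta> < 1"
    "\<And>n. n \<ge> 1 \<Longrightarrow> (\<integral>\<^sup>+\<omega>. epow (vec_norm \<kappa> (M_prod q p \<kappa> \<omega> n *v I_vec q p \<kappa> \<omega> 0)) \<kappa> \<partial>P) \<le> ennreal (C * \<theta> ^ n)"
    using limsup_elog_imp_exp_decay[OF ls fin] by blast
  have "mixing_coeff S P n < \<infinity>" for n
    using mixing_coeff_le_1[of n] by (rule order_le_less_trans) simp
  from limsup_elog_imp_exp_decay[OF B2 this] obtain C' \<theta>' where C': "0 < \<theta>'" "\<theta>' < 1"
    "\<And>n. n \<ge> 1 \<Longrightarrow> mixing_coeff S P n \<le> ennreal (C' * \<theta>' ^ n)"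
    by blast
  \<comment> \<open>A common constant and rate for both decays. The fourth root matches the form of
    the locale, and the lower bound 1 for \<open>c\<close> covers index 0, where the trivial bound
    \<open>mixing_coeff_le_1\<close> is used.\<close>
  define c t where "c = max 1 (max C C')" and "t = sqrt (sqrt (max \<theta> \<theta>'))"
  have t4: "t ^ 4 = max \<theta> \<theta>'"
  proof -
    have "t ^ 4 = (t\<^sup>2)\<^sup>2" by (simp flip: power_mult)
    then show ?thesis using C(1) by (simp add: t_def)
  qed
  have le: "C * \<theta> ^ n \<le> c * (t ^ 4) ^ n" "C' * \<theta>' ^ n \<le> c * (t ^ 4) ^ n" for n
    unfolding t4 c_def using C(1) C'(1) by (auto intro!: mult_mono power_mono)
  interpret mixing_branching S P q p \<kappa> c t
  proof unfold_locales
    show "\<kappa> > 2" by (rule \<kappa>)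
    show "c > 0" by (simp add: c_def)
    show "0 < t" "t < 1" using C C' by (auto simp: t_def less_max_iff_disj)
    show "(\<integral>\<^sup>+\<omega>. epow (vec_norm \<kappa> (M_prod q p \<kappa> \<omega> k *v I_vec q p \<kappa> \<omega> 0)) \<kappa> \<partial>P) \<le> ennreal (c * (t ^ 4) ^ k)"
      if "k \<ge> 1" for k
      by (rule order_trans[OF C(3)[OF that] ennreal_leI[OF le(1)]])
    show "mixing_coeff S P n \<le> ennreal (c * (t ^ 4) ^ n)" for n
    proof (cases "n = 0")
      case True
      have "(1 :: ennreal) \<le> ennreal c" by (simp add: c_def)
      then show ?thesis using order_trans[OF mixing_coeff_le_1[of n]] True by simp
    next
      case False
      then show ?thesis using order_trans[OF C'(3)[of n] ennreal_leI[OF le(2)]] by simp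
    qed
  qed
  obtain \<nu> :: "(real^'d) measure" where \<nu>: "gaussian_law \<nu>" "\<And>i. (\<integral>x. x $ i \<partial>\<nu>) = 0"
    "conv_in_distr (annealed P q p)
      (\<lambda>n (\<omega>, x). \<chi> i. (real (S_sum x n $ i) - real n * rho P q p $ i) / sqrt (real n)) \<nu>"
    "\<And>i. (\<lambda>n. (l2 slots (N i n))\<^sup>2 / n) \<longlonglongrightarrow> (\<integral>x. (x $ i)\<^sup>2 \<partial>\<nu>)"
    by (rule clt_S_sum) (rule that)
  have pos: "(\<integral>x. (x $ i)\<^sup>2 \<partial>\<nu>) > 0"
    if nc: "\<not> (\<exists>f :: (int \<Rightarrow> 's) \<Rightarrow> nat. AE \<omega> in P. measure (quenched q p \<omega>)
                 {x \<in> space (quenched q p \<omega>). Y x 0 $ i = of_nat (f \<omega>)} = 1)" for i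
  proof (rule ccontr)
    assume "\<not> ?thesis"
    moreover have "(\<integral>x. (x $ i)\<^sup>2 \<partial>\<nu>) \<ge> 0" by simp
    ultimately have "(\<integral>x. (x $ i)\<^sup>2 \<partial>\<nu>) = 0" by linarith
    with \<nu>(4)[of i] have "(\<lambda>n. (l2 slots (N i n))\<^sup>2 / n) \<longlonglongrightarrow> 0" by simp
    from degenerate_imp_constant[OF this] nc show False by contradiction
  qed
  show ?thesis
    by (intro exI[of _ \<nu>] conjI allI impI \<nu>(1-3) pos)
qed

end
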